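(* Consider the Riemannian manifold $(\mathrm{SL}(2,\mathbb R), g(c_1,c_2,c_3))$ and suppose that its isometry group is $3$-dimensional, with the parameters chosen (as one may assume) so that $c_1>c_2>0>c_3$. Let $\{e_1,e_2,e_3\}$ be the left-invariant orthonormal frame with $[e_1,e_2]=c_3e_3$, $[e_2,e_3]=c_1e_1$, $[e_3,e_1]=c_2e_2$. If $f:M^2\to \mathrm{SL}(2,\mathbb R)$ is a constant mean curvature (CMC) surface with vertically harmonic Gauss map, then $c_2=c_1+c_3$ (equivalently, $K_{12}=K_{23}$), and $e_2$ is tangent to $f(M^2)$. Moreover, the surface is minimal and its Gauss map is harmonic.
   Context: **Metrics on $\mathrm{SL}(2,\mathbb R)$.** Identify $\mathrm{SL}(2,\mathbb R)$ with the isomorphic group $\mathrm{SU}(1,1)=\left\{\begin{pmatrix}\alpha&\beta\\ \overline\beta&\overline\alpha\end{pmatrix}: |\alpha|^2-|\beta|^2=1\right\}$ via $A\mapsto \frac12\begin{pmatrix}i&1\\1&i\end{pmatrix}A\begin{pmatrix}-i&1\\1&-i\end{pmatrix}$. Let $\mathbf i=\begin{pmatrix}i&0\\0&-i\end{pmatrix}$, $\mathbf j'=\begin{pmatrix}0&-i\\ i&0\end{pmatrix}$, $\mathbf k'=\begin{pmatrix}0&1\\1&0\end{pmatrix}$ be a basis of $\mathfrak{su}(1,1)$, and let $E_1,E_2,E_3$ be the left-invariant vector fields corresponding to $\mathbf j',\mathbf k',\mathbf i$, respectively. For $\lambda_1,\lambda_2,\lambda_3>0$ put $e_1=\frac{1}{\lambda_2\lambda_3}E_1$,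 $e_2=\frac{1}{\lambda_3\lambda_1}E_2$, $e_3=\frac{1}{\lambda_1\lambda_2}E_3$. Then $[e_1,e_2]=c_3e_3$, $[e_2,e_3]=c_1e_1$, $[e_3,e_1]=c_2e_2$ with $c_1=2/\lambda_1^2$, $c_2=2/\lambda_2^2$, $c_3=-2/\lambda_3^2$. The left-invariant metric $g(c_1,c_2,c_3)$ is the one for which $\{e_1,e_2,e_3\}$ is orthonormal. $K_{ij}$ denotes the sectional curvature of the plane spanned by $e_i,e_j$. **CMC surfaces.** A surface $f:M^2\to Q^3$ in a Riemannian $3$-manifold is an isometric immersion (so $M^2$ carries the induced metric) with unit normal $N$. Its second fundamental form $h$ is defined by $\nabla^Q_{\mathrm df(X)}\mathrm df(Y)=\mathrm df(\nabla^M_XY)+h(X,Y)N$, and the mean curvature is $H=\mathrm{tr}\,h$. The surface is CMC if $H$ is constant and minimal if $H\equiv 0$ (so a minimal surface is CMC). **Gauss map.** For a Riemannian $3$-manifold $(Q^3,g_Q)$, let $\pi:\mathrm{Gr}_2(TQ^3)\to Q^3$ be the Grassmannian bundle whose fibre over $q$ is the Grassmannian of $2$-planes in $T_qQ^3$. It carries the natural invariant metric induced by the canonical $1$-form of the orthonormal frame bundle and the Levi-Civita connection: the horizontal distribution determined by the Levi-Civita connection is orthogonal to the fibres and is mapped isometrically by $\mathrm d\pi$, and each fibre has the standard $\mathrm O(3)$-invariant metric (with a fixed normalization). Then $\pi$ is a Riemannian submersion with totally geodesic fibres. The (tangential) Gauss map of $f$ is $\psi:M^2\to \mathrm{Gr}_2(TQ^3)$,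 $\psi(p)=\mathrm df_p(T_pM^2)$. **(Vertical) harmonicity.** For a smooth map $\phi:(M,g_M)\to(P,g_P)$, the tension field is $\tau(\phi)=\mathrm{tr}_{g_M}(\nabla\mathrm d\phi)$, where $\nabla\mathrm d\phi(X,Y)=\nabla^P_{\mathrm d\phi(X)}\mathrm d\phi(Y)-\mathrm d\phi(\nabla^M_XY)$; $\phi$ is harmonic if and only if $\tau(\phi)=0$. If $\pi:P\to Q$ is a Riemannian submersion, $\phi$ is vertically harmonic if the component of $\tau(\phi)$ in $\ker \mathrm d\pi$ (the vertical component with respect to the orthogonal splitting of $TP$) vanishes. *)

theory Defs
  imports "HOL-Analysis.Analysis"
begin

section \<open>Smooth maps and embedded submanifolds\<close>

text \<open>
  Manifolds are embedded submanifolds of Euclidean spaces. By Whitney's theorem this covers every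
  (Hausdorff, second countable) manifold up to diffeomorphism; the ambient type is arbitrary and
  its inner product plays no role: metrics are given separately.
\<close>

primrec Ck_on :: "nat \<Rightarrow> ('a::euclidean_space \<Rightarrow> 'b::real_normed_vector) \<Rightarrow> 'a set \<Rightarrow> bool" where
  "Ck_on 0 f U \<longleftrightarrow> continuous_on U f"
| "Ck_on (Suc k) f U \<longleftrightarrow> (\<forall>x\<in>U. f differentiable (at x)) \<and>
     (\<forall>v. Ck_on k (\<lambda>x. frechet_derivative f (at x) v) U)"

definition smooth_on :: "'a::euclidean_space set \<Rightarrow> ('a \<Rightarrow> 'b::real_normed_vector) \<Rightarrow> bool" where
  "smooth_on U f \<longleftrightarrow> (\<forall>k. Ck_on k f U)"

definition smooth_at :: "'a::euclidean_space set \<Rightarrow> ('a \<Rightarrow> 'b::real_normed_vector) \<Rightarrow> 'a \<Rightarrow> bool" where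
  "smooth_at M f p \<longleftrightarrow>
     (\<exists>U F. open U \<and> p \<in> U \<and> smooth_on U F \<and> (\<forall>x\<in>M \<inter> U. f x = F x))"

definition smooth_map :: "'a::euclidean_space set \<Rightarrow> 'b::euclidean_space set \<Rightarrow> ('a \<Rightarrow> 'b) \<Rightarrow> bool" where
  "smooth_map M P f \<longleftrightarrow> f ` M \<subseteq> P \<and> (\<forall>p\<in>M. smooth_at M f p)"

definition submanifold :: "nat \<Rightarrow> 'a::euclidean_space set \<Rightarrow> bool" where
  "submanifold d M \<longleftrightarrow>
     (\<forall>p\<in>M. \<exists>U V \<Phi> \<Psi> S. open U \<and> p \<in> U \<and> open V \<and> homeomorphism U V \<Phi> \<Psi> \<and>
        smooth_on U \<Phi> \<and> smooth_on V \<Psi> \<and>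
        subspace (S :: 'a set) \<and> dim S = d \<and> \<Phi> ` (M \<inter> U) = V \<inter> S)"

definition tangent_space :: "'a::euclidean_space set \<Rightarrow> 'a \<Rightarrow> 'a set" where
  "tangent_space M p =
     {u. \<exists>\<epsilon>>0. \<exists>c :: real \<Rightarrow> 'a. smooth_on {-\<epsilon><..<\<epsilon>} c \<and> c ` {-\<epsilon><..<\<epsilon>} \<subseteq> M \<and> c 0 = p \<and>
        (c has_vector_derivative u) (at 0)}"

text \<open>
  The derivative within \<open>M\<close> is not unique on the ambient space, but for a map that is smooth at
  \<open>p\<close> its value on tangent vectors is (it is the velocity of the image curve). It is used on
  tangent vectors only.
\<close>

definition dmap :: "'a::euclidean_space set \<Rightarrow> ('a \<Rightarrow> 'b::real_normed_vector) \<Rightarrow> 'a \<Rightarrow> 'a \<Rightarrow> 'b" where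
  "dmap M f p u = frechet_derivative f (at p within M) u"

definition vec_field_at :: "'a::euclidean_space set \<Rightarrow> 'a \<Rightarrow> ('a \<Rightarrow> 'a) \<Rightarrow> bool" where
  "vec_field_at M p X \<longleftrightarrow> smooth_at M X p \<and>
     (\<forall>\<^sub>F x in nhds p. x \<in> M \<longrightarrow> X x \<in> tangent_space M x)"

definition lie_bracket ::
    "'a::euclidean_space set \<Rightarrow> ('a \<Rightarrow> 'a) \<Rightarrow> ('a \<Rightarrow> 'a) \<Rightarrow> 'a \<Rightarrow> 'a" where
  "lie_bracket M X Y p = dmap M Y p (X p) - dmap M X p (Y p)"


section \<open>Riemannian geometry\<close>

text \<open>A Riemannian metric assigns to each point \<open>p\<close> a bilinear form, relevant on the tangent space
  at \<open>p\<close> only.\<close>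

type_synonym 'a metric = "'a \<Rightarrow> 'a \<Rightarrow> 'a \<Rightarrow> real"

text \<open>
  \<open>nabla p u Y\<close> is the derivative at \<open>p\<close> of the vector field \<open>Y\<close> (given near \<open>p\<close>) in the tangent
  direction \<open>u\<close>. The last two clauses (compatibility with the metric, vanishing torsion) force the
  Koszul formula, so the connection is unique on these arguments, and smoothness of the covariant
  derivative of smooth fields is automatic.
\<close>

definition is_levi_civita ::
    "'a::euclidean_space set \<Rightarrow> 'a metric \<Rightarrow> ('a \<Rightarrow> 'a \<Rightarrow> ('a \<Rightarrow> 'a) \<Rightarrow> 'a) \<Rightarrow> bool" where
  "is_levi_civita M g nabla \<longleftrightarrow> (\<forall>p\<in>M.
     (\<forall>u Y. u \<in> tangent_space M p \<and> vec_field_at M p Y \<longrightarrow> nabla p u Y \<in> tangent_space M p) \<and>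
     (\<forall>u v a b Y. u \<in> tangent_space M p \<and> v \<in> tangent_space M p \<and> vec_field_at M p Y \<longrightarrow>
        nabla p (a *\<^sub>R u + b *\<^sub>R v) Y = a *\<^sub>R nabla p u Y + b *\<^sub>R nabla p v Y) \<and>
     (\<forall>u Y Z. u \<in> tangent_space M p \<and> vec_field_at M p Y \<and> vec_field_at M p Z \<longrightarrow>
        nabla p u (\<lambda>x. Y x + Z x) = nabla p u Y + nabla p u Z) \<and>
     (\<forall>u s Y. u \<in> tangent_space M p \<and> smooth_at M s p \<and> vec_field_at M p Y \<longrightarrow>
        nabla p u (\<lambda>x. s x *\<^sub>R Y x) = dmap M s p u *\<^sub>R Y p + s p *\<^sub>R nabla p u Y) \<and>
     (\<forall>u Y Z. u \<in> tangent_space M p \<and> vec_field_at M p Y \<and> vec_field_at M p Z \<longrightarrow>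
        dmap M (\<lambda>x. g x (Y x) (Z x)) p u = g p (nabla p u Y) (Z p) + g p (Y p) (nabla p u Z)) \<and>
     (\<forall>X Y. vec_field_at M p X \<and> vec_field_at M p Y \<longrightarrow>
        nabla p (X p) Y - nabla p (Y p) X = lie_bracket M X Y p))"

definition levi_civita ::
    "'a::euclidean_space set \<Rightarrow> 'a metric \<Rightarrow> 'a \<Rightarrow> 'a \<Rightarrow> ('a \<Rightarrow> 'a) \<Rightarrow> 'a" where
  "levi_civita M g = (SOME nabla. is_levi_civita M g nabla)"

definition curvature ::
    "'a::euclidean_space set \<Rightarrow> 'a metric \<Rightarrow> ('a \<Rightarrow> 'a) \<Rightarrow> ('a \<Rightarrow> 'a) \<Rightarrow> ('a \<Rightarrow> 'a) \<Rightarrow> 'a \<Rightarrow> 'a" where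
  "curvature M g X Y Z p =
     levi_civita M g p (X p) (\<lambda>x. levi_civita M g x (Y x) Z)
     - levi_civita M g p (Y p) (\<lambda>x. levi_civita M g x (X x) Z)
     - levi_civita M g p (lie_bracket M X Y p) Z"

definition sectional_curvature ::
    "'a::euclidean_space set \<Rightarrow> 'a metric \<Rightarrow> ('a \<Rightarrow> 'a) \<Rightarrow> ('a \<Rightarrow> 'a) \<Rightarrow> 'a \<Rightarrow> real" where
  "sectional_curvature M g X Y p =
     g p (curvature M g X Y Y p) (X p) /
     (g p (X p) (X p) * g p (Y p) (Y p) - (g p (X p) (Y p))\<^sup>2)"

definition orthonormal_basis ::
    "'a::euclidean_space set \<Rightarrow> 'a metric \<Rightarrow> 'a \<Rightarrow> 'a set \<Rightarrow> bool" where
  "orthonormal_basis M g p B \<longleftrightarrow> finite B \<and> B \<subseteq> tangent_space M p \<and> span B = tangent_space M p \<and>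
     (\<forall>b\<in>B. \<forall>c\<in>B. g p b c = (if b = c then 1 else 0))"

definition metric_trace ::
    "'a::euclidean_space set \<Rightarrow> 'a metric \<Rightarrow> 'a \<Rightarrow> ('a \<Rightarrow> 'a \<Rightarrow> 'b::real_vector) \<Rightarrow> 'b" where
  "metric_trace M g p \<beta> = (THE t. \<forall>B. orthonormal_basis M g p B \<longrightarrow> t = (\<Sum>b\<in>B. \<beta> b b))"

text \<open>
  The connection induced on vector fields \<open>V\<close> along \<open>\<phi> : M \<rightarrow> P\<close>. It is determined by the Leibniz rule
  and by its value on \<open>F \<circ> \<phi>\<close>, \<open>F\<close> a vector field on \<open>P\<close>; near \<open>p\<close> every smooth \<open>V\<close> is a
  combination of such fields with smooth coefficients.
\<close>

definition pullback_connection ::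
    "'a::euclidean_space set \<Rightarrow> 'b::euclidean_space set \<Rightarrow> 'b metric \<Rightarrow> ('a \<Rightarrow> 'b) \<Rightarrow>
     'a \<Rightarrow> 'a \<Rightarrow> ('a \<Rightarrow> 'b) \<Rightarrow> 'b" where
  "pullback_connection M P gP \<phi> p u V =
     (THE w. \<forall>(n::nat) v F.
        (\<forall>a<n. smooth_at M (v a) p \<and> vec_field_at P (\<phi> p) (F a)) \<and>
        (\<forall>\<^sub>F x in nhds p. x \<in> M \<longrightarrow> V x = (\<Sum>a<n. v a x *\<^sub>R F a (\<phi> x))) \<longrightarrow>
        w = (\<Sum>a<n. dmap M (v a) p u *\<^sub>R F a (\<phi> p)
                   + v a p *\<^sub>R levi_civita P gP (\<phi> p) (dmap M \<phi> p u) (F a)))"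

text \<open>\<open>nabla_d M gM P gP \<phi> p\<close> is the bilinear map \<open>\<nabla>d\<phi>\<close> on the tangent space at \<open>p\<close>; the
  second argument is extended to a vector field, on which the value does not depend.\<close>

definition nabla_d ::
    "'a::euclidean_space set \<Rightarrow> 'a metric \<Rightarrow> 'b::euclidean_space set \<Rightarrow> 'b metric \<Rightarrow> ('a \<Rightarrow> 'b) \<Rightarrow>
     'a \<Rightarrow> 'a \<Rightarrow> 'a \<Rightarrow> 'b" where
  "nabla_d M gM P gP \<phi> p u v =
     (THE w. \<forall>Y. vec_field_at M p Y \<and> Y p = v \<longrightarrow>
        w = pullback_connection M P gP \<phi> p u (\<lambda>x. dmap M \<phi> x (Y x))
            - dmap M \<phi> p (levi_civita M gM p u Y))"

definition tension_field ::
    "'a::euclidean_space set \<Rightarrow> 'a metric \<Rightarrow> 'b::euclidean_space set \<Rightarrow> 'b metric \<Rightarrow> ('a \<Rightarrow> 'b) \<Rightarrow>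
     'a \<Rightarrow> 'b" where
  "tension_field M gM P gP \<phi> p = metric_trace M gM p (nabla_d M gM P gP \<phi> p)"

definition harmonic_map ::
    "'a::euclidean_space set \<Rightarrow> 'a metric \<Rightarrow> 'b::euclidean_space set \<Rightarrow> 'b metric \<Rightarrow> ('a \<Rightarrow> 'b) \<Rightarrow>
     bool" where
  "harmonic_map M gM P gP \<phi> \<longleftrightarrow> (\<forall>p\<in>M. tension_field M gM P gP \<phi> p = 0)"

definition vertical_space ::
    "'b::euclidean_space set \<Rightarrow> ('b \<Rightarrow> 'c::real_normed_vector) \<Rightarrow> 'b \<Rightarrow> 'b set" where
  "vertical_space P \<pi> y = {v \<in> tangent_space P y. dmap P \<pi> y v = 0}"

definition vertical_part ::
    "'b::euclidean_space set \<Rightarrow> 'b metric \<Rightarrow> ('b \<Rightarrow> 'c::real_normed_vector) \<Rightarrow> 'b \<Rightarrow> 'b \<Rightarrow> 'b" where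
  "vertical_part P gP \<pi> y w =
     (THE v. v \<in> vertical_space P \<pi> y \<and> (\<forall>z\<in>vertical_space P \<pi> y. gP y (w - v) z = 0))"

definition vertically_harmonic_map ::
    "'a::euclidean_space set \<Rightarrow> 'a metric \<Rightarrow> 'b::euclidean_space set \<Rightarrow> 'b metric \<Rightarrow>
     ('b \<Rightarrow> 'c::real_normed_vector) \<Rightarrow> ('a \<Rightarrow> 'b) \<Rightarrow> bool" where
  "vertically_harmonic_map M gM P gP \<pi> \<phi> \<longleftrightarrow>
     (\<forall>p\<in>M. vertical_part P gP \<pi> (\<phi> p) (tension_field M gM P gP \<phi> p) = 0)"


section \<open>The isometry group and its dimension\<close>

definition isometry_group :: "'a::euclidean_space set \<Rightarrow> 'a metric \<Rightarrow> ('a \<Rightarrow> 'a) set" where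
  "isometry_group Q g = {\<phi> \<in> extensional Q. bij_betw \<phi> Q Q \<and>
     smooth_map Q Q \<phi> \<and> smooth_map Q Q (the_inv_into Q \<phi>) \<and>
     (\<forall>p\<in>Q. \<forall>u\<in>tangent_space Q p. \<forall>v\<in>tangent_space Q p.
        g (\<phi> p) (dmap Q \<phi> p u) (dmap Q \<phi> p v) = g p u v)}"

text \<open>On isometries of a connected manifold the topology of pointwise convergence is the
  compact-open topology, i.e. the Lie group topology; the dimension of a Lie group is its dimension
  as a topological manifold.\<close>

definition isometry_group_topology :: "'a::euclidean_space set \<Rightarrow> 'a metric \<Rightarrow> ('a \<Rightarrow> 'a) topology" where
  "isometry_group_topology Q g =
     subtopology (product_topology (\<lambda>_. top_of_set Q) Q) (isometry_group Q g)"

definition locally_Euclidean_dim :: "nat \<Rightarrow> 'b topology \<Rightarrow> bool" where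
  "locally_Euclidean_dim n T \<longleftrightarrow>
     (\<forall>x\<in>topspace T. \<exists>U. openin T U \<and> x \<in> U \<and> subtopology T U homeomorphic_space Euclidean_space n)"


section \<open>Surfaces in a Riemannian 3-manifold\<close>

definition induced_metric ::
    "'a::euclidean_space set \<Rightarrow> 'b::euclidean_space metric \<Rightarrow> ('a \<Rightarrow> 'b) \<Rightarrow> 'a metric" where
  "induced_metric M g f = (\<lambda>p u v. g (f p) (dmap M f p u) (dmap M f p v))"

definition immersed_surface ::
    "'a::euclidean_space set \<Rightarrow> 'b::euclidean_space set \<Rightarrow> 'b metric \<Rightarrow> ('a \<Rightarrow> 'b) \<Rightarrow> ('a \<Rightarrow> 'b) \<Rightarrow>
     bool" where
  "immersed_surface M Q g f N \<longleftrightarrow>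
     M \<noteq> {} \<and> submanifold 2 M \<and> smooth_map M Q f \<and>
     (\<forall>p\<in>M. inj_on (dmap M f p) (tangent_space M p)) \<and>
     (\<forall>p\<in>M. smooth_at M N p \<and> N p \<in> tangent_space Q (f p) \<and> g (f p) (N p) (N p) = 1 \<and>
        (\<forall>u\<in>tangent_space M p. g (f p) (N p) (dmap M f p u) = 0))"

definition second_fundamental_form ::
    "'a::euclidean_space set \<Rightarrow> 'b::euclidean_space set \<Rightarrow> 'b metric \<Rightarrow> ('a \<Rightarrow> 'b) \<Rightarrow> ('a \<Rightarrow> 'b) \<Rightarrow>
     'a \<Rightarrow> 'a \<Rightarrow> 'a \<Rightarrow> real" where
  "second_fundamental_form M Q g f N p u v =
     (THE h. nabla_d M (induced_metric M g f) Q g f p u v = h *\<^sub>R N p)"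

definition mean_curvature ::
    "'a::euclidean_space set \<Rightarrow> 'b::euclidean_space set \<Rightarrow> 'b metric \<Rightarrow> ('a \<Rightarrow> 'b) \<Rightarrow> ('a \<Rightarrow> 'b) \<Rightarrow>
     'a \<Rightarrow> real" where
  "mean_curvature M Q g f N p =
     metric_trace M (induced_metric M g f) p (second_fundamental_form M Q g f N p)"

definition cmc ::
    "'a::euclidean_space set \<Rightarrow> 'b::euclidean_space set \<Rightarrow> 'b metric \<Rightarrow> ('a \<Rightarrow> 'b) \<Rightarrow> ('a \<Rightarrow> 'b) \<Rightarrow>
     bool" where
  "cmc M Q g f N \<longleftrightarrow> (\<exists>H. \<forall>p\<in>M. mean_curvature M Q g f N p = H)"

definition minimal ::
    "'a::euclidean_space set \<Rightarrow> 'b::euclidean_space set \<Rightarrow> 'b metric \<Rightarrow> ('a \<Rightarrow> 'b) \<Rightarrow> ('a \<Rightarrow> 'b) \<Rightarrow>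
     bool" where
  "minimal M Q g f N \<longleftrightarrow> (\<forall>p\<in>M. mean_curvature M Q g f N p = 0)"


section \<open>The Grassmannian bundle of 2-planes and the Gauss map\<close>

text \<open>
  \<open>Q\<close> is a 3-manifold with a global frame \<open>e\<close>, and \<open>frame_metric e\<close> is the metric making \<open>e\<close>
  orthonormal. A 2-plane in the tangent space at \<open>q\<close> is encoded by the matrix, with respect to the
  orthonormal basis \<open>e 1 q, e 2 q, e 3 q\<close>, of the orthogonal projection onto it.
\<close>

definition frame_coords :: "(3 \<Rightarrow> 'a::euclidean_space \<Rightarrow> 'a) \<Rightarrow> 'a \<Rightarrow> 'a \<Rightarrow> real^3" where
  "frame_coords e q u = (THE x. u = (\<Sum>i\<in>UNIV. x $ i *\<^sub>R e i q))"

definition frame_metric :: "(3 \<Rightarrow> 'a::euclidean_space \<Rightarrow> 'a) \<Rightarrow> 'a metric" where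
  "frame_metric e q u v = (\<Sum>i\<in>UNIV. frame_coords e q u $ i * frame_coords e q v $ i)"

definition Gr2 :: "'a::euclidean_space set \<Rightarrow> ('a \<times> (real^3^3)) set" where
  "Gr2 Q = {(q, A). q \<in> Q \<and> transpose A = A \<and> A ** A = A \<and> rank A = 2}"

definition plane_of :: "(3 \<Rightarrow> 'a::euclidean_space \<Rightarrow> 'a) \<Rightarrow> 'a \<times> (real^3^3) \<Rightarrow> 'a set" where
  "plane_of e x = {\<Sum>i\<in>UNIV. v $ i *\<^sub>R e i (fst x) | v. v \<in> range ((*v) (snd x))}"

definition connection_matrix ::
    "'a::euclidean_space set \<Rightarrow> (3 \<Rightarrow> 'a \<Rightarrow> 'a) \<Rightarrow> 'a \<Rightarrow> 'a \<Rightarrow> real^3^3" where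
  "connection_matrix Q e q u =
     (\<chi> i j. frame_metric e q (e i q) (levi_civita Q (frame_metric e) q u (e j)))"

text \<open>
  A tangent vector of \<open>Gr2 Q\<close> is the velocity \<open>(u, B)\<close> of a curve \<open>(q t, A t)\<close>, that is, of a field of
  planes along \<open>q t\<close>. The matrix below is the covariant derivative of the corresponding projection
  endomorphism: it vanishes exactly for parallel fields of planes, so its kernel is the horizontal
  distribution, and it restricts to the identity \<open>(0, B) \<mapsto> B\<close> on the vertical vectors.
\<close>

definition Gr2_vertical ::
    "'a::euclidean_space set \<Rightarrow> (3 \<Rightarrow> 'a \<Rightarrow> 'a) \<Rightarrow> 'a \<times> (real^3^3) \<Rightarrow> 'a \<times> (real^3^3) \<Rightarrow> real^3^3" where
  "Gr2_vertical Q e x \<xi> =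
     snd \<xi> + connection_matrix Q e (fst x) (fst \<xi>) ** snd x
           - snd x ** connection_matrix Q e (fst x) (fst \<xi>)"

text \<open>
  The inner product of \<open>real^3^3\<close> is \<open>tr (transpose B ** C)\<close>. Restricted to projection matrices it is,
  up to a factor, the only \<open>O(3)\<close>-invariant metric on the fibre; \<open>\<kappa> > 0\<close> is the normalization.
\<close>

definition Gr2_metric ::
    "real \<Rightarrow> 'a::euclidean_space set \<Rightarrow> (3 \<Rightarrow> 'a \<Rightarrow> 'a) \<Rightarrow> ('a \<times> (real^3^3)) metric" where
  "Gr2_metric \<kappa> Q e x \<xi> \<eta> =
     frame_metric e (fst x) (fst \<xi>) (fst \<eta>)
     + \<kappa> * (Gr2_vertical Q e x \<xi> \<bullet> Gr2_vertical Q e x \<eta>)"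

definition gauss_map ::
    "'a::euclidean_space set \<Rightarrow> 'b::euclidean_space set \<Rightarrow> (3 \<Rightarrow> 'b \<Rightarrow> 'b) \<Rightarrow> ('a \<Rightarrow> 'b) \<Rightarrow>
     'a \<Rightarrow> 'b \<times> (real^3^3)" where
  "gauss_map M Q e f p =
     (THE x. x \<in> Gr2 Q \<and> fst x = f p \<and> plane_of e x = dmap M f p ` tangent_space M p)"


section \<open>\<open>SL(2,\<real>)\<close> and its left-invariant frames\<close>

definition SL2R :: "(real^2^2) set" where
  "SL2R = {A. det A = 1}"

definition mat22 :: "'a \<Rightarrow> 'a \<Rightarrow> 'a \<Rightarrow> 'a \<Rightarrow> ('a::zero)^2^2" where
  "mat22 a b c d = vector [vector [a, b], vector [c, d]]"

definition su11_basis :: "3 \<Rightarrow> complex^2^2" where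
  "su11_basis i =
     (if i = 1 then mat22 0 (-\<i>) \<i> 0 else if i = 2 then mat22 0 1 1 0 else mat22 \<i> 0 0 (-\<i>))"

text \<open>The images of \<open>su11_basis\<close> under the isomorphism from \<open>SU(1,1)\<close> to \<open>SL(2,\<real>)\<close>, see
  \<open>cayley_sl2_basis\<close> below.\<close>

definition sl2_basis :: "3 \<Rightarrow> real^2^2" where
  "sl2_basis i =
     (if i = 1 then mat22 (-1) 0 0 1 else if i = 2 then mat22 0 1 1 0 else mat22 0 1 (-1) 0)"

definition cayley :: "real^2^2 \<Rightarrow> complex^2^2" where
  "cayley A = (1/2) *\<^sub>R (mat22 \<i> 1 1 \<i> ** (\<chi> i j. complex_of_real (A $ i $ j)) ** mat22 (-\<i>) 1 1 (-\<i>))"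

lemma cayley_sl2_basis: "cayley (sl2_basis i) = su11_basis i"
  using exhaust_3[of i]
  by (auto simp: cayley_def sl2_basis_def su11_basis_def mat22_def vec_eq_iff forall_2
      matrix_matrix_mult_def sum_2 vector_2 scaleR_conv_of_real[where 'a=complex])

lemma sl2_basis_commutators:
  "sl2_basis 1 ** sl2_basis 2 - sl2_basis 2 ** sl2_basis 1 = (-2) *\<^sub>R sl2_basis 3"
  "sl2_basis 2 ** sl2_basis 3 - sl2_basis 3 ** sl2_basis 2 = 2 *\<^sub>R sl2_basis 1"
  "sl2_basis 3 ** sl2_basis 1 - sl2_basis 1 ** sl2_basis 3 = 2 *\<^sub>R sl2_basis 2"
  by (auto simp: sl2_basis_def mat22_def vec_eq_iff forall_2 matrix_matrix_mult_def sum_2 vector_2)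

definition sl2_frame :: "real \<Rightarrow> real \<Rightarrow> real \<Rightarrow> 3 \<Rightarrow> real^2^2 \<Rightarrow> real^2^2" where
  "sl2_frame l1 l2 l3 i q =
     (if i = 1 then 1 / (l2 * l3) else if i = 2 then 1 / (l3 * l1) else 1 / (l1 * l2))
       *\<^sub>R (q ** sl2_basis i)"

end

theory Submission
  imports Defs
begin

text \<open>
  In the left-invariant frame the Levi-Civita connection of \<open>SL(2,\<real>)\<close> is \<open>d + \<mu> \<theta> \<times> _\<close>, where
  \<open>\<theta>\<close> is the Maurer-Cartan form with values in \<open>real^3\<close>, \<open>\<times>\<close> the cross product and \<open>\<mu>\<close> the diagonal
  matrix with entries \<open>(c1 + c2 + c3) / 2 - c i\<close>; the curvature operator is diagonal with entries
  \<open>K23, K13, K12\<close>. Let \<open>\<nu>\<close> be the unit normal of the surface in frame coordinates. The vertical part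
  of the tension field of the Gauss map is the tangential part of the rough Laplacian of \<open>\<nu>\<close>, which by
  the Codazzi equation is, for constant mean curvature, a Ricci term. Hence \<open>\<nu>\<close> is everywhere an
  eigenvector of the curvature operator. It cannot be a frame vector on an open set, because no two
  frame fields span an integrable distribution; so two eigenvalues coincide, necessarily \<open>K12 = K23\<close>,
  and \<open>\<nu>\<close> is orthogonal to \<open>e 2\<close>. Then \<open>\<nu>\<close> is given by an angle whose differential is expressed
  through \<open>\<nu>\<close> and the mean curvature \<open>H\<close>; closedness of that differential gives \<open>H = 0\<close>, and the
  horizontal part of the tension field, which consists of \<open>H \<nu>\<close> and an O'Neill curvature term, vanishes.
\<close>

section \<open>Calculus of smooth maps\<close>

text \<open>Connections, traces, tension fields and second fundamental forms are given by
  \<open>SOME\<close> and \<open>THE\<close>, so nothing can be computed before existence and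
  uniqueness are known. The locale \<open>framed\<close> settles this once for three manifolds: the
  group, its Grassmannian bundle and the surface. The bundle is the obstacle. It is not orientable
  and hence has no global frame, so its tangent spaces, of dimension 5, are embedded in a trivial
  bundle of rank 6, where torsion is allowed as long as it is normal to the image.

  That only K12 and K23 can coincide has this reason: the difference of two eigenvalues of the
  curvature operator is twice an entry of \<mu> times a difference of the other two entries. For c1
  > c2 > 0 > c3 the entries of \<mu> are distinct, the first is negative and the third is positive,
  so only the second, (c1 + c3 - c2) / 2, can vanish. The same zero makes the connection form
  independent of the direction \<open>e 2\<close>, and this is why the turning of the normal can be
  described by a single angle.\<close>

lemma Ck_on_cong:
  assumes "open U" "\<And>x. x \<in> U \<Longrightarrow> f x = g x" "Ck_on k f U"
  shows "Ck_on k g U"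
  using assms(2,3)
proof (induction k arbitrary: f g)
  case 0
  show ?case using continuous_on_eq[of U f g] 0 unfolding Ck_on.simps by blast
next
  case (Suc k)
  have d: "(g has_derivative frechet_derivative f (at x)) (at x)" if "x \<in> U" for x
  proof (rule has_derivative_transform_within_open[OF _ \<open>open U\<close> that])
    show "(f has_derivative frechet_derivative f (at x)) (at x)"
      using Suc.prems(2) that by (simp add: frechet_derivative_works)
  qed (use Suc.prems(1) in blast)
  then have e: "frechet_derivative g (at x) = frechet_derivative f (at x)" if "x \<in> U" for x
    using that frechet_derivative_at by metis
  show ?case
    using d Suc.prems(2) Suc.IH[of "\<lambda>x. frechet_derivative f (at x) v" "\<lambda>x. frechet_derivative g (at x) v" for v]
    by (auto simp: e differentiable_def)
qed

lemma Ck_on_subset: "Ck_on k f U \<Longrightarrow> V \<subseteq> U \<Longrightarrow> Ck_on k f V"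
  by (induction k arbitrary: f) (auto intro: continuous_on_subset)

lemma Ck_on_SucI:
  assumes "open U" "\<And>x. x \<in> U \<Longrightarrow> (f has_derivative f' x) (at x)" "\<And>v. Ck_on k (\<lambda>x. f' x v) U"
  shows "Ck_on (Suc k) f U"
proof -
  have e: "frechet_derivative f (at x) = f' x" if "x \<in> U" for x
    using that assms(2) frechet_derivative_at by metis
  have "Ck_on k (\<lambda>x. frechet_derivative f (at x) v) U" for v
    by (rule Ck_on_cong[OF assms(1) _ assms(3)[of v]]) (simp add: e)
  then show ?thesis using assms(2) by (auto simp: differentiable_def)
qed

lemma Ck_on_has_derivative:
  "Ck_on (Suc k) f U \<Longrightarrow> x \<in> U \<Longrightarrow> (f has_derivative frechet_derivative f (at x)) (at x)"
  by (simp add: frechet_derivative_works)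

lemma Ck_on_decr: "Ck_on (Suc k) f U \<Longrightarrow> Ck_on k f U"
proof (induction k arbitrary: f)
  case 0
  then show ?case
    by (auto intro!: continuous_at_imp_continuous_on differentiable_imp_continuous_within)
next
  case (Suc k)
  then show ?case by auto
qed

lemma Ck_on_const: "open U \<Longrightarrow> Ck_on k (\<lambda>x. c) U"
  by (induction k arbitrary: c) auto

lemma Ck_on_linear:
  assumes "open U" "bounded_linear L" "Ck_on k f U"
  shows "Ck_on k (\<lambda>x. L (f x)) U"
  using assms(3)
proof (induction k arbitrary: f)
  case 0
  then show ?case using bounded_linear.continuous_on[OF assms(2)] by simp
next
  case (Suc k)
  show ?case
  proof (rule Ck_on_SucI[OF assms(1), where f'="\<lambda>x v. L (frechet_derivative f (at x) v)"])
    show "((\<lambda>x. L (f x)) has_derivative (\<lambda>v. L (frechet_derivative f (at x) v))) (at x)" if "x \<in> U" for x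
      by (rule bounded_linear.has_derivative[OF assms(2) Ck_on_has_derivative[OF Suc.prems that]])
    show "Ck_on k (\<lambda>x. L (frechet_derivative f (at x) v)) U" for v
      by (rule Suc.IH) (use Suc.prems in simp)
  qed
qed

lemma Ck_on_add:
  assumes "open U" "Ck_on k f U" "Ck_on k g U"
  shows "Ck_on k (\<lambda>x. f x + g x) U"
  using assms(2,3)
proof (induction k arbitrary: f g)
  case 0
  then show ?case by (auto intro!: continuous_intros)
next
  case (Suc k)
  show ?case
  proof (rule Ck_on_SucI[OF assms(1), where f'="\<lambda>x v. frechet_derivative f (at x) v + frechet_derivative g (at x) v"])
    show "((\<lambda>x. f x + g x) has_derivative (\<lambda>v. frechet_derivative f (at x) v + frechet_derivative g (at x) v)) (at x)"
      if "x \<in> U" for x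
      using Suc.prems that by (intro has_derivative_add Ck_on_has_derivative)
    show "Ck_on k (\<lambda>x. frechet_derivative f (at x) v + frechet_derivative g (at x) v) U" for v
      by (rule Suc.IH) (use Suc.prems in simp_all)
  qed
qed

lemma Ck_on_bilinear:
  assumes "open U" "bounded_bilinear B" "Ck_on k f U" "Ck_on k g U"
  shows "Ck_on k (\<lambda>x. B (f x) (g x)) U"
  using assms(3,4)
proof (induction k arbitrary: f g)
  case 0
  then show ?case using bounded_bilinear.continuous_on[OF assms(2)] by simp
next
  case (Suc k)
  show ?case
  proof (rule Ck_on_SucI[OF assms(1), where f'="\<lambda>x v. B (f x) (frechet_derivative g (at x) v)
      + B (frechet_derivative f (at x) v) (g x)"])
    show "((\<lambda>x. B (f x) (g x)) has_derivative (\<lambda>v. B (f x) (frechet_derivative g (at x) v)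
      + B (frechet_derivative f (at x) v) (g x))) (at x)" if "x \<in> U" for x
      using that Suc.prems by (intro bounded_bilinear.FDERIV[OF assms(2)] Ck_on_has_derivative)
    show "Ck_on k (\<lambda>x. B (f x) (frechet_derivative g (at x) v)
      + B (frechet_derivative f (at x) v) (g x)) U" for v
      using Suc.prems Ck_on_decr[OF Suc.prems(1)] Ck_on_decr[OF Suc.prems(2)]
      by (intro Ck_on_add[OF assms(1)] Suc.IH) auto
  qed
qed

lemma Ck_on_sum:
  assumes "open U" "\<And>a. a \<in> A \<Longrightarrow> Ck_on k (f a) U"
  shows "Ck_on k (\<lambda>x. \<Sum>a\<in>A. f a x) U"
  using assms(2)
proof (induction A rule: infinite_finite_induct)
  case (insert a A)
  then have "Ck_on k (\<lambda>x. f a x + (\<Sum>a\<in>A. f a x)) U"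
    by (intro Ck_on_add[OF assms(1)]) simp_all
  then show ?case using insert(1,2) by simp
qed (simp_all add: Ck_on_const[OF assms(1)])

text \<open>\<open>Ck_on\<close> speaks of derivatives in fixed directions only. A derivative in a
  moving direction is therefore written over the fixed basis directions, with the coordinates of the
  moving vector as coefficients.\<close>

lemma bounded_linear_Basis_sum:
  fixes L :: "'a::euclidean_space \<Rightarrow> 'b::real_normed_vector"
  assumes "bounded_linear L"
  shows "(\<Sum>b\<in>Basis. (w \<bullet> b) *\<^sub>R L b) = L w"
proof -
  interpret bounded_linear L by (rule assms)
  have "L w = L (\<Sum>b\<in>Basis. (w \<bullet> b) *\<^sub>R b)" by (simp only: euclidean_representation)
  also have "\<dots> = (\<Sum>b\<in>Basis. (w \<bullet> b) *\<^sub>R L b)" by (simp only: sum scaleR)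
  finally show ?thesis by simp
qed

text \<open>The chain rule differentiates \<open>g\<close> in a moving direction, which is split
  over the basis. The induction generalises over \<open>g\<close> alone: at each order
  \<open>g\<close> is replaced by its derivative in a basis direction, while \<open>f\<close> stays
  the same and only loses one order.\<close>

lemma Ck_on_compose:
  fixes f :: "'a::euclidean_space \<Rightarrow> 'b::euclidean_space"
  assumes "open U" "open V" "f ` U \<subseteq> V" "Ck_on k f U" "Ck_on k g V"
  shows "Ck_on k (\<lambda>x. g (f x)) U"
  using assms(4,5)
proof (induction k arbitrary: g)
  case 0
  then show ?case using assms(3) by (auto intro: continuous_on_compose2)
next
  case (Suc k)
  have bl: "bounded_linear (frechet_derivative g (at y))" if "y \<in> V" for y
    using Ck_on_has_derivative[OF Suc.prems(2) that] has_derivative_bounded_linear by blast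
  have e: "frechet_derivative g (at y) w = (\<Sum>b\<in>Basis. (w \<bullet> b) *\<^sub>R frechet_derivative g (at y) b)"
    if "y \<in> V" for y w
    by (rule bounded_linear_Basis_sum[OF bl[OF that], symmetric])
  show ?case
  proof (rule Ck_on_SucI[OF assms(1), where f'="\<lambda>x v. \<Sum>b\<in>Basis. (frechet_derivative f (at x) v \<bullet> b)
     *\<^sub>R frechet_derivative g (at (f x)) b"])
    show "((\<lambda>x. g (f x)) has_derivative (\<lambda>v. \<Sum>b\<in>Basis. (frechet_derivative f (at x) v \<bullet> b)
     *\<^sub>R frechet_derivative g (at (f x)) b)) (at x)" if "x \<in> U" for x
    proof -
      have "f x \<in> V" using that assms(3) by auto
      show ?thesis
        unfolding e[OF \<open>f x \<in> V\<close>, symmetric]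
        by (rule has_derivative_compose[OF Ck_on_has_derivative[OF Suc.prems(1) that]
              Ck_on_has_derivative[OF Suc.prems(2) \<open>f x \<in> V\<close>]])
    qed
    show "Ck_on k (\<lambda>x. \<Sum>b\<in>Basis. (frechet_derivative f (at x) v \<bullet> b)
     *\<^sub>R frechet_derivative g (at (f x)) b) U" for v
    proof (intro Ck_on_sum[OF assms(1)] Ck_on_bilinear[OF assms(1) bounded_bilinear_scaleR])
      show "Ck_on k (\<lambda>x. frechet_derivative f (at x) v \<bullet> b) U" for b
        using Suc.prems by (intro Ck_on_linear[OF assms(1) bounded_linear_inner_left]) auto
      show "Ck_on k (\<lambda>x. frechet_derivative g (at (f x)) b) U" for b
        using Suc.prems Ck_on_decr[OF Suc.prems(1)] by (intro Suc.IH) auto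
    qed
  qed
qed

text \<open>The derivative contains \<open>inverse (f x)\<close> itself, but at one order less,
  where the induction hypothesis for the same \<open>f\<close> supplies it.\<close>

lemma Ck_on_inverse:
  fixes f :: "'a::euclidean_space \<Rightarrow> real"
  assumes "open U" "\<And>x. x \<in> U \<Longrightarrow> f x \<noteq> 0" "Ck_on k f U"
  shows "Ck_on k (\<lambda>x. inverse (f x)) U"
  using assms(3)
proof (induction k)
  case 0
  then show ?case using assms(2) by (simp add: continuous_on_inverse)
next
  case (Suc k)
  note k = Suc.IH[OF Ck_on_decr[OF Suc.prems]]
  show ?case
  proof (rule Ck_on_SucI[OF assms(1), where f'="\<lambda>x v. - (inverse (f x) * frechet_derivative f (at x) v * inverse (f x))"])
    show "((\<lambda>x. inverse (f x)) has_derivative (\<lambda>v. - (inverse (f x) * frechet_derivative f (at x) v * inverse (f x)))) (at x)"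
      if "x \<in> U" for x
      using assms(2)[OF that] Ck_on_has_derivative[OF Suc.prems that] by (rule Deriv.has_derivative_inverse)
    show "Ck_on k (\<lambda>x. - (inverse (f x) * frechet_derivative f (at x) v * inverse (f x))) U" for v
      using Suc.prems k
      by (intro Ck_on_linear[OF assms(1) bounded_linear_minus[OF bounded_linear_ident]]
          Ck_on_bilinear[OF assms(1) bounded_bilinear_mult]) auto
  qed
qed

section \<open>Smooth maps on open sets\<close>

lemma smooth_on_subset: "smooth_on U f \<Longrightarrow> V \<subseteq> U \<Longrightarrow> smooth_on V f"
  by (auto simp: smooth_on_def intro: Ck_on_subset)

lemma smooth_on_cong:
  "open U \<Longrightarrow> (\<And>x. x \<in> U \<Longrightarrow> f x = g x) \<Longrightarrow> smooth_on U f \<Longrightarrow> smooth_on U g"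
  unfolding smooth_on_def by (blast intro: Ck_on_cong)

lemma smooth_on_const: "open U \<Longrightarrow> smooth_on U (\<lambda>x. c)"
  by (simp add: smooth_on_def Ck_on_const)

lemma smooth_on_linear:
  "open U \<Longrightarrow> bounded_linear L \<Longrightarrow> smooth_on U f \<Longrightarrow> smooth_on U (\<lambda>x. L (f x))"
  by (simp add: smooth_on_def Ck_on_linear)

lemma smooth_on_add:
  "open U \<Longrightarrow> smooth_on U f \<Longrightarrow> smooth_on U g \<Longrightarrow> smooth_on U (\<lambda>x. f x + g x)"
  by (simp add: smooth_on_def Ck_on_add)

lemma smooth_on_bilinear:
  "open U \<Longrightarrow> bounded_bilinear B \<Longrightarrow> smooth_on U f \<Longrightarrow> smooth_on U g \<Longrightarrow> smooth_on U (\<lambda>x. B (f x) (g x))"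
  by (simp add: smooth_on_def Ck_on_bilinear)

lemma smooth_on_sum:
  "open U \<Longrightarrow> (\<And>a. a \<in> A \<Longrightarrow> smooth_on U (f a)) \<Longrightarrow> smooth_on U (\<lambda>x. \<Sum>a\<in>A. f a x)"
  by (simp add: smooth_on_def Ck_on_sum)

lemma smooth_on_inverse:
  fixes f :: "'a::euclidean_space \<Rightarrow> real"
  shows "open U \<Longrightarrow> (\<And>x. x \<in> U \<Longrightarrow> f x \<noteq> 0) \<Longrightarrow> smooth_on U f \<Longrightarrow> smooth_on U (\<lambda>x. inverse (f x))"
  by (simp add: smooth_on_def Ck_on_inverse)

lemma smooth_on_compose:
  fixes f :: "'a::euclidean_space \<Rightarrow> 'b::euclidean_space"
  shows "open U \<Longrightarrow> open V \<Longrightarrow> f ` U \<subseteq> V \<Longrightarrow> smooth_on U f \<Longrightarrow> smooth_on V g \<Longrightarrow>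
    smooth_on U (\<lambda>x. g (f x))"
  unfolding smooth_on_def using Ck_on_compose by blast

lemma smooth_on_bounded_linear:
  assumes "open U" "bounded_linear L"
  shows "smooth_on U L"
  unfolding smooth_on_def
proof
  fix k
  show "Ck_on k L U"
  proof (cases k)
    case 0
    then show ?thesis using assms(2) by (simp add: linear_continuous_on)
  next
    case (Suc n)
    show ?thesis unfolding Suc
      by (rule Ck_on_SucI[OF assms(1), where f'="\<lambda>x. L"])
        (simp_all add: bounded_linear_imp_has_derivative assms Ck_on_const)
  qed
qed

lemma smooth_on_has_derivative:
  assumes "smooth_on U f" "x \<in> U"
  shows "(f has_derivative frechet_derivative f (at x)) (at x)"
proof -
  have "Ck_on (Suc 0) f U" using assms(1) unfolding smooth_on_def by blast
  then show ?thesis using assms(2) by (rule Ck_on_has_derivative)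
qed

lemma smooth_on_continuous: "smooth_on U f \<Longrightarrow> continuous_on U f"
  unfolding smooth_on_def using Ck_on.simps(1) by blast

lemma smooth_on_frechet_const: "smooth_on U f \<Longrightarrow> smooth_on U (\<lambda>x. frechet_derivative f (at x) v)"
  unfolding smooth_on_def using Ck_on.simps(2) by blast

lemma smooth_on_frechet:
  fixes f :: "'a::euclidean_space \<Rightarrow> 'b::real_normed_vector"
  assumes "open U" "smooth_on U f" "smooth_on U Y"
  shows "smooth_on U (\<lambda>x. frechet_derivative f (at x) (Y x))"
proof -
  have "smooth_on U (\<lambda>x. \<Sum>b\<in>Basis. (Y x \<bullet> b) *\<^sub>R frechet_derivative f (at x) b)"
    using assms
    by (intro smooth_on_sum smooth_on_bilinear[OF _ bounded_bilinear_scaleR]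
        smooth_on_linear[OF _ bounded_linear_inner_left] smooth_on_frechet_const)
  moreover have "(\<Sum>b\<in>Basis. (Y x \<bullet> b) *\<^sub>R frechet_derivative f (at x) b) = frechet_derivative f (at x) (Y x)"
    if "x \<in> U" for x
    using smooth_on_has_derivative[OF assms(2) that] has_derivative_bounded_linear bounded_linear_Basis_sum by blast
  ultimately show ?thesis by (rule smooth_on_cong[OF assms(1), rotated])
qed

section \<open>Second derivatives and their symmetry\<close>

definition D2 :: "('a::euclidean_space \<Rightarrow> 'b::real_normed_vector) \<Rightarrow> 'a \<Rightarrow> 'a \<Rightarrow> 'a \<Rightarrow> 'b" where
  "D2 f x u v = frechet_derivative (\<lambda>y. frechet_derivative f (at y) v) (at x) u"

text \<open>Over the basis, each term is a product of a coordinate of \<open>Y\<close> and a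
  derivative of \<open>f\<close> in a fixed direction, so the product rule applies. The set
  \<open>T\<close> is arbitrary in order that the rule can be used along submanifolds.\<close>

lemma has_derivative_frechet:
  fixes f :: "'a::euclidean_space \<Rightarrow> 'b::real_normed_vector"
  assumes "open U" "smooth_on U f" "x \<in> U" "(Y has_derivative Y') (at x within T)"
  shows "((\<lambda>y. frechet_derivative f (at y) (Y y)) has_derivative
    (\<lambda>u. D2 f x u (Y x) + frechet_derivative f (at x) (Y' u))) (at x within T)"
proof -
  have lin: "bounded_linear (frechet_derivative f (at y))" if "y \<in> U" for y
    using smooth_on_has_derivative[OF assms(2) that] has_derivative_bounded_linear by blast
  have rep: "(\<Sum>b\<in>Basis. (w \<bullet> b) *\<^sub>R frechet_derivative f (at y) b) = frechet_derivative f (at y) w"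
    if "y \<in> U" for y w
    by (rule bounded_linear_Basis_sum[OF lin[OF that]])
  have d: "((\<lambda>y. frechet_derivative f (at y) b) has_derivative (\<lambda>u. D2 f x u b)) (at x within T)" for b
    unfolding D2_def
    by (rule has_derivative_at_withinI, rule smooth_on_has_derivative[OF smooth_on_frechet_const[OF assms(2)] assms(3)])
  have dU: "((\<lambda>y. frechet_derivative f (at y) b) has_derivative (\<lambda>u. D2 f x u b)) (at x)" for b
    unfolding D2_def
    by (rule smooth_on_has_derivative[OF smooth_on_frechet_const[OF assms(2)] assms(3)])
  have "((\<lambda>y. \<Sum>b\<in>Basis. (w \<bullet> b) *\<^sub>R frechet_derivative f (at y) b) has_derivative
     (\<lambda>u. \<Sum>b\<in>Basis. (w \<bullet> b) *\<^sub>R D2 f x u b)) (at x)" for w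
    by (intro has_derivative_sum has_derivative_scaleR_right dU)
  then have "((\<lambda>y. frechet_derivative f (at y) w) has_derivative
     (\<lambda>u. \<Sum>b\<in>Basis. (w \<bullet> b) *\<^sub>R D2 f x u b)) (at x)" for w
    by (rule has_derivative_transform_within_open[OF _ assms(1,3)]) (simp add: rep)
  then have D2rep: "D2 f x u w = (\<Sum>b\<in>Basis. (w \<bullet> b) *\<^sub>R D2 f x u b)" for u w
    using dU has_derivative_unique by metis
  have "((\<lambda>y. \<Sum>b\<in>Basis. (Y y \<bullet> b) *\<^sub>R frechet_derivative f (at y) b) has_derivative
     (\<lambda>u. \<Sum>b\<in>Basis. (Y x \<bullet> b) *\<^sub>R D2 f x u b + (Y' u \<bullet> b) *\<^sub>R frechet_derivative f (at x) b)) (at x within T)"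
    by (intro has_derivative_sum has_derivative_scaleR d has_derivative_inner_left assms(4))
  then have "((\<lambda>y. \<Sum>b\<in>Basis. (Y y \<bullet> b) *\<^sub>R frechet_derivative f (at y) b) has_derivative
     (\<lambda>u. D2 f x u (Y x) + frechet_derivative f (at x) (Y' u))) (at x within T)"
    by (simp add: sum.distrib D2rep[symmetric] rep[OF assms(3)])
  \<comment> \<open>The expansion equals \<open>frechet_derivative f (at y) (Y y)\<close> only for
    \<open>y\<close> in \<open>U\<close>, and \<open>x\<close> need not belong to \<open>T\<close>;
    so the two difference quotients are compared under the limit.\<close>
  then show ?thesis
    unfolding has_derivative_within
  proof (elim conjE, intro conjI)
    assume l: "((\<lambda>y. (1 / norm (y - x)) *\<^sub>R ((\<Sum>b\<in>Basis. (Y y \<bullet> b) *\<^sub>R frechet_derivative f (at y) b) -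
       ((\<Sum>b\<in>Basis. (Y x \<bullet> b) *\<^sub>R frechet_derivative f (at x) b) + (D2 f x (y - x) (Y x) +
           frechet_derivative f (at x) (Y' (y - x)))))) \<longlongrightarrow> 0) (at x within T)"
    show "((\<lambda>y. (1 / norm (y - x)) *\<^sub>R (frechet_derivative f (at y) (Y y) -
       (frechet_derivative f (at x) (Y x) + (D2 f x (y - x) (Y x) +
           frechet_derivative f (at x) (Y' (y - x)))))) \<longlongrightarrow> 0) (at x within T)"
    proof (rule Lim_transform_eventually[OF l])
      show "\<forall>\<^sub>F y in at x within T. (1 / norm (y - x)) *\<^sub>R ((\<Sum>b\<in>Basis. (Y y \<bullet> b) *\<^sub>R frechet_derivative f (at y) b) -
       ((\<Sum>b\<in>Basis. (Y x \<bullet> b) *\<^sub>R frechet_derivative f (at x) b) + (D2 f x (y - x) (Y x) +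
           frechet_derivative f (at x) (Y' (y - x))))) = (1 / norm (y - x)) *\<^sub>R (frechet_derivative f (at y) (Y y) -
       (frechet_derivative f (at x) (Y x) + (D2 f x (y - x) (Y x) +
           frechet_derivative f (at x) (Y' (y - x)))))"
        using assms(1,3) by (auto simp: eventually_at_topological rep intro!: exI[of _ U])
    qed
  qed
qed

text \<open>Both mixed partials are limits of the same second difference quotient, by applying the mean
  value theorem in the two possible orders.\<close>

lemma second_difference:
  fixes f :: "'a::euclidean_space \<Rightarrow> real"
  assumes U: "open U" "smooth_on U f"
    and h: "h > 0" and sub: "\<And>s t. 0 \<le> s \<Longrightarrow> s \<le> h \<Longrightarrow> 0 \<le> t \<Longrightarrow> t \<le> h \<Longrightarrow> p + s *\<^sub>R u + t *\<^sub>R v \<in> U"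
  shows "\<exists>s t. 0 < s \<and> s < h \<and> 0 < t \<and> t < h \<and>
    f (p + h *\<^sub>R u + h *\<^sub>R v) - f (p + h *\<^sub>R u) - f (p + h *\<^sub>R v) + f p = h * h * D2 f (p + s *\<^sub>R u + t *\<^sub>R v) v u"
proof -
  have d1: "((\<lambda>s. f (p + s *\<^sub>R u + t *\<^sub>R v)) has_real_derivative
      frechet_derivative f (at (p + s *\<^sub>R u + t *\<^sub>R v)) u) (at s)"
    if "p + s *\<^sub>R u + t *\<^sub>R v \<in> U" for s t
  proof -
    have "((\<lambda>s. p + s *\<^sub>R u + t *\<^sub>R v) has_derivative (\<lambda>s. s *\<^sub>R u)) (at s)"
      by (auto intro!: derivative_eq_intros)
    from has_derivative_compose[OF this smooth_on_has_derivative[OF U(2) that]]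
    have "((\<lambda>s. f (p + s *\<^sub>R u + t *\<^sub>R v)) has_derivative
      (\<lambda>x. frechet_derivative f (at (p + s *\<^sub>R u + t *\<^sub>R v)) (x *\<^sub>R u))) (at s)" .
    moreover have "linear (frechet_derivative f (at (p + s *\<^sub>R u + t *\<^sub>R v)))"
      using smooth_on_has_derivative[OF U(2) that] has_derivative_linear by blast
    ultimately show ?thesis
      by (simp add: has_field_derivative_def linear_scale mult_commute_abs)
  qed
  have d2: "((\<lambda>t. frechet_derivative f (at (p + s *\<^sub>R u + t *\<^sub>R v)) u) has_real_derivative
      D2 f (p + s *\<^sub>R u + t *\<^sub>R v) v u) (at t)"
    if "p + s *\<^sub>R u + t *\<^sub>R v \<in> U" for s t
  proof -
    have "((\<lambda>t. p + s *\<^sub>R u + t *\<^sub>R v) has_derivative (\<lambda>t. t *\<^sub>R v)) (at t)"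
      by (auto intro!: derivative_eq_intros)
    from has_derivative_compose[OF this smooth_on_has_derivative[OF smooth_on_frechet_const[OF U(2)] that]]
    have "((\<lambda>t. frechet_derivative f (at (p + s *\<^sub>R u + t *\<^sub>R v)) u) has_derivative
      (\<lambda>x. D2 f (p + s *\<^sub>R u + t *\<^sub>R v) (x *\<^sub>R v) u)) (at t)" unfolding D2_def .
    moreover have "linear (\<lambda>w. D2 f (p + s *\<^sub>R u + t *\<^sub>R v) w u)"
      unfolding D2_def
      using smooth_on_has_derivative[OF smooth_on_frechet_const[OF U(2)] that] has_derivative_linear by blast
    then have "D2 f (p + s *\<^sub>R u + t *\<^sub>R v) (x *\<^sub>R v) u = x * D2 f (p + s *\<^sub>R u + t *\<^sub>R v) v u" for x
      by (rule linear_scale[where f="\<lambda>w. D2 f (p + s *\<^sub>R u + t *\<^sub>R v) w u", unfolded real_scaleR_def])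
    ultimately show ?thesis
      by (simp add: has_field_derivative_def mult_commute_abs)
  qed
  \<comment> \<open>Difference across the strip in direction \<open>v\<close>, as a function of the
    position along \<open>u\<close>. The vanishing term \<open>0 *\<^sub>R v\<close> is kept so that
    both summands are instances of \<open>d1\<close>.\<close>
  define G where "G s = f (p + s *\<^sub>R u + h *\<^sub>R v) - f (p + s *\<^sub>R u + 0 *\<^sub>R v)" for s
  have "(G has_real_derivative frechet_derivative f (at (p + s *\<^sub>R u + h *\<^sub>R v)) u
      - frechet_derivative f (at (p + s *\<^sub>R u + 0 *\<^sub>R v)) u) (at s)" if "0 \<le> s" "s \<le> h" for s
    unfolding G_def by (intro DERIV_diff d1 sub) (use that h in auto)
  from MVT2[OF h this] obtain s where s: "0 < s" "s < h" and
    s2: "G h - G 0 = (h - 0) * (frechet_derivative f (at (p + s *\<^sub>R u + h *\<^sub>R v)) u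
      - frechet_derivative f (at (p + s *\<^sub>R u + 0 *\<^sub>R v)) u)" by blast
  have "((\<lambda>t. frechet_derivative f (at (p + s *\<^sub>R u + t *\<^sub>R v)) u) has_real_derivative
      D2 f (p + s *\<^sub>R u + t *\<^sub>R v) v u) (at t)" if "0 \<le> t" "t \<le> h" for t
    by (intro d2 sub) (use that h s in auto)
  from MVT2[OF h this] obtain t where t: "0 < t" "t < h"
    "frechet_derivative f (at (p + s *\<^sub>R u + h *\<^sub>R v)) u - frechet_derivative f (at (p + s *\<^sub>R u + 0 *\<^sub>R v)) u
      = (h - 0) * D2 f (p + s *\<^sub>R u + t *\<^sub>R v) v u" by blast
  have "G h - G 0 = f (p + h *\<^sub>R u + h *\<^sub>R v) - f (p + h *\<^sub>R u) - f (p + h *\<^sub>R v) + f p"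
    by (simp add: G_def)
  with s2 t s show ?thesis by auto
qed

lemma D2_symmetric_real:
  fixes f :: "'a::euclidean_space \<Rightarrow> real"
  assumes U: "open U" "smooth_on U f" "p \<in> U"
  shows "D2 f p u v = D2 f p v u"
proof (rule ccontr)
  assume ne: "D2 f p u v \<noteq> D2 f p v u"
  \<comment> \<open>Half of the supposed gap: the two second derivatives, taken at suitable points
    near \<open>p\<close>, are equal, yet each lies within \<open>\<epsilon>\<close> of its own
    value at \<open>p\<close>.\<close>
  define \<epsilon> where "\<epsilon> = \<bar>D2 f p u v - D2 f p v u\<bar> / 2"
  have \<epsilon>: "\<epsilon> > 0" using ne by (simp add: \<epsilon>_def)
  have cont: "isCont (\<lambda>x. D2 f x a b) p" for a b
    using smooth_on_continuous[OF smooth_on_frechet_const[OF smooth_on_frechet_const[OF U(2)]]] U(1,3)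
    by (auto simp: D2_def continuous_on_eq_continuous_at)
  obtain r1 where r1: "r1 > 0" "\<And>x. dist x p < r1 \<Longrightarrow> \<bar>D2 f x u v - D2 f p u v\<bar> < \<epsilon>"
    using cont[of u v] \<epsilon> unfolding continuous_at_eps_delta by (auto simp: dist_real_def)
  obtain r2 where r2: "r2 > 0" "\<And>x. dist x p < r2 \<Longrightarrow> \<bar>D2 f x v u - D2 f p v u\<bar> < \<epsilon>"
    using cont[of v u] \<epsilon> unfolding continuous_at_eps_delta by (auto simp: dist_real_def)
  obtain r3 where r3: "r3 > 0" "ball p r3 \<subseteq> U" using U openE by blast
  define r where "r = min r1 (min r2 r3)"
  have r: "r > 0" using r1 r2 r3 by (simp add: r_def)
  \<comment> \<open>With this side the whole parallelogram stays within \<open>r / 2\<close> of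
    \<open>p\<close>; the added 1 keeps the denominator positive when \<open>u\<close> and
    \<open>v\<close> vanish.\<close>
  define h where "h = r / (2 * (norm u + norm v + 1))"
  have np: "norm u + norm v + 1 > 0" by (smt (verit) norm_ge_zero)
  have h: "h > 0" using r np by (auto simp: h_def intro!: divide_pos_pos)
  have close: "dist (p + s *\<^sub>R u + t *\<^sub>R v) p < r" if "0 \<le> s" "s \<le> h" "0 \<le> t" "t \<le> h" for s t
  proof -
    have "dist (p + s *\<^sub>R u + t *\<^sub>R v) p \<le> s * norm u + t * norm v"
      using that norm_triangle_ineq[of "s *\<^sub>R u" "t *\<^sub>R v"] by (simp add: dist_norm)
    also have "\<dots> \<le> h * norm u + h * norm v" using that by (intro add_mono mult_right_mono) auto
    also have "\<dots> \<le> h * (norm u + norm v + 1)" using h by (simp add: algebra_simps)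
    also have "\<dots> = r / 2" using np unfolding h_def by (simp add: divide_simps del: distrib_left_numeral)
    finally show ?thesis using r by simp
  qed
  have inU: "p + s *\<^sub>R u + t *\<^sub>R v \<in> U" if "0 \<le> s" "s \<le> h" "0 \<le> t" "t \<le> h" for s t
    using close[OF that] r3 by (auto simp: r_def dist_commute subset_eq)
  have inU': "p + s *\<^sub>R v + t *\<^sub>R u \<in> U" if "0 \<le> s" "s \<le> h" "0 \<le> t" "t \<le> h" for s t
    using inU[of t s] that by (simp add: algebra_simps)
  from second_difference[OF U(1,2) h inU] obtain s t where st: "0 < s" "s < h" "0 < t" "t < h"
    "f (p + h *\<^sub>R u + h *\<^sub>R v) - f (p + h *\<^sub>R u) - f (p + h *\<^sub>R v) + f p = h * h * D2 f (p + s *\<^sub>R u + t *\<^sub>R v) v u"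
    by blast
  from second_difference[OF U(1,2) h inU'] obtain s' t' where st': "0 < s'" "s' < h" "0 < t'" "t' < h"
    "f (p + h *\<^sub>R v + h *\<^sub>R u) - f (p + h *\<^sub>R v) - f (p + h *\<^sub>R u) + f p = h * h * D2 f (p + s' *\<^sub>R v + t' *\<^sub>R u) u v"
    by blast
  have "h * h * D2 f (p + s *\<^sub>R u + t *\<^sub>R v) v u = h * h * D2 f (p + s' *\<^sub>R v + t' *\<^sub>R u) u v"
    using st(5) st'(5) by (simp add: algebra_simps)
  then have eq: "D2 f (p + s *\<^sub>R u + t *\<^sub>R v) v u = D2 f (p + s' *\<^sub>R v + t' *\<^sub>R u) u v"
    using h by simp
  have "\<bar>D2 f (p + s *\<^sub>R u + t *\<^sub>R v) v u - D2 f p v u\<bar> < \<epsilon>"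
    using close[of s t] st by (intro r2) (auto simp: r_def)
  moreover have "\<bar>D2 f (p + s' *\<^sub>R v + t' *\<^sub>R u) u v - D2 f p u v\<bar> < \<epsilon>"
    using close[of t' s'] st' by (intro r1) (auto simp: r_def algebra_simps)
  ultimately show False unfolding eq \<epsilon>_def by (simp add: abs_if field_simps split: if_splits)
qed

lemma D2_symmetric:
  fixes f :: "'a::euclidean_space \<Rightarrow> 'b::euclidean_space"
  assumes U: "open U" "smooth_on U f" "p \<in> U"
  shows "D2 f p u v = D2 f p v u"
proof (rule euclidean_eqI)
  fix b :: 'b assume "b \<in> Basis"
  define fb where "fb x = f x \<bullet> b" for x
  have smb: "smooth_on U fb"
    unfolding fb_def by (rule smooth_on_linear[OF U(1) bounded_linear_inner_left U(2)])
  have e: "frechet_derivative fb (at x) w = frechet_derivative f (at x) w \<bullet> b" if "x \<in> U" for x w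
  proof -
    have "(fb has_derivative (\<lambda>w. frechet_derivative f (at x) w \<bullet> b)) (at x)"
      unfolding fb_def by (intro has_derivative_inner_left smooth_on_has_derivative[OF U(2) that])
    then show ?thesis using frechet_derivative_at by metis
  qed
  have "D2 fb p w z = D2 f p w z \<bullet> b" for w z
  proof -
    have "((\<lambda>x. frechet_derivative f (at x) z \<bullet> b) has_derivative (\<lambda>w. D2 f p w z \<bullet> b)) (at p)"
      unfolding D2_def
      by (intro has_derivative_inner_left smooth_on_has_derivative[OF smooth_on_frechet_const[OF U(2)] U(3)])
    then have "((\<lambda>x. frechet_derivative fb (at x) z) has_derivative (\<lambda>w. D2 f p w z \<bullet> b)) (at p)"
      by (rule has_derivative_transform_within_open[OF _ U(1,3)]) (simp add: e)
    then show ?thesis unfolding D2_def using frechet_derivative_at by metis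
  qed
  then show "D2 f p u v \<bullet> b = D2 f p v u \<bullet> b"
    using D2_symmetric_real[OF U(1) smb U(3)] by metis
qed

text \<open>Linearity of \<open>D2\<close> is at hand in the slot of the outer derivative; symmetry
  moves the zero vector there.\<close>

lemma D2_zero_right:
  fixes f :: "'a::euclidean_space \<Rightarrow> 'b::euclidean_space"
  assumes U: "open U" "smooth_on U f" "p \<in> U"
  shows "D2 f p u 0 = 0"
proof -
  have "D2 f p 0 u = 0"
    unfolding D2_def
    by (rule linear_0[OF has_derivative_linear[OF smooth_on_has_derivative[OF smooth_on_frechet_const[OF U(2)] U(3)]]])
  then show ?thesis using D2_symmetric[OF U] by metis
qed

section \<open>Derivatives along submanifolds\<close>

lemma has_derivative_eq_on:
  assumes "(F has_derivative F') (at p within M)" "p \<in> M" "\<forall>\<^sub>F x in nhds p. x \<in> M \<longrightarrow> f x = F x"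
  shows "(f has_derivative F') (at p within M)"
proof (rule has_derivative_transform_eventually[OF assms(1)])
  show "\<forall>\<^sub>F x in at p within M. F x = f x"
    using assms(3) unfolding eventually_at_filter by (auto elim: eventually_mono)
  show "F p = f p" using eventually_nhds_x_imp_x[OF assms(3)] assms(2) by simp
qed (rule assms(2))

lemma smooth_at_differentiable:
  assumes "smooth_at M f p" "p \<in> M"
  shows "f differentiable (at p within M)"
proof -
  obtain U F where U: "open U" "p \<in> U" "smooth_on U F" "\<forall>x\<in>M \<inter> U. f x = F x"
    using assms(1) unfolding smooth_at_def by blast
  have "(f has_derivative frechet_derivative F (at p)) (at p within M)"
  proof (rule has_derivative_eq_on[OF _ assms(2)])
    show "(F has_derivative frechet_derivative F (at p)) (at p within M)"
      by (rule has_derivative_at_withinI[OF smooth_on_has_derivative[OF U(3,2)]])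
    show "\<forall>\<^sub>F x in nhds p. x \<in> M \<longrightarrow> f x = F x"
      unfolding eventually_nhds using U by blast
  qed
  then show ?thesis unfolding differentiable_def by blast
qed

lemma dmap_has_derivative:
  "smooth_at M f p \<Longrightarrow> p \<in> M \<Longrightarrow> (f has_derivative dmap M f p) (at p within M)"
  using smooth_at_differentiable unfolding dmap_def frechet_derivative_works by blast

lemma derivative_along_curve:
  assumes "(f has_derivative f') (at p within M)" "open I" "t \<in> I" "c ` I \<subseteq> M" "c t = p"
    "(c has_vector_derivative u) (at t)"
  shows "((\<lambda>t. f (c t)) has_vector_derivative f' u) (at t)"
proof -
  have 1: "(c has_derivative (\<lambda>t. t *\<^sub>R u)) (at t within I)"
    using assms(6) unfolding has_vector_derivative_def by (rule has_derivative_at_withinI)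
  have 2: "(f has_derivative f') (at (c t) within c ` I)"
    using has_derivative_subset[OF assms(1,4)] assms(5) by simp
  have "(f \<circ> c has_derivative f' \<circ> (\<lambda>t. t *\<^sub>R u)) (at t within I)"
    by (rule diff_chain_within[OF 1 2])
  then have "(f \<circ> c has_derivative f' \<circ> (\<lambda>t. t *\<^sub>R u)) (at t)"
    by (simp only: at_within_open[OF assms(3,2)])
  moreover have "f' (x *\<^sub>R u) = x *\<^sub>R f' u" for x
    by (rule linear_scale[OF has_derivative_linear[OF assms(1)]])
  ultimately show ?thesis unfolding has_vector_derivative_def by (simp add: comp_def)
qed

text \<open>Each value is the velocity of \<open>f\<close> along a curve in \<open>M\<close> that
  represents \<open>u\<close>, and velocities are unique.\<close>

lemma tangent_derivative_unique:
  assumes "u \<in> tangent_space M p" "(f has_derivative f1) (at p within M)" "(f has_derivative f2) (at p within M)"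
  shows "f1 u = f2 u"
proof -
  obtain \<epsilon> c where c: "\<epsilon> > (0::real)" "c ` {-\<epsilon><..<\<epsilon>} \<subseteq> M" "c 0 = p" "(c has_vector_derivative u) (at 0)"
    using assms(1) unfolding tangent_space_def by blast
  have "((\<lambda>t. f (c t)) has_vector_derivative f1 u) (at 0)" "((\<lambda>t. f (c t)) has_vector_derivative f2 u) (at 0)"
    by (rule derivative_along_curve[OF assms(2) open_greaterThanLessThan _ c(2,3,4)]
        derivative_along_curve[OF assms(3) open_greaterThanLessThan _ c(2,3,4)], use c in simp)+
  then show ?thesis by (rule vector_derivative_unique_at)
qed

text \<open>\<open>dmap\<close> picks one of possibly many derivatives within \<open>M\<close>; on
  tangent vectors any derivative found by the calculus rules gives the same value. Most values of
  \<open>dmap\<close> below are computed in this way.\<close>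

lemma dmap_eq:
  assumes "u \<in> tangent_space M p" "(f has_derivative f') (at p within M)"
  shows "dmap M f p u = f' u"
proof -
  have "(f has_derivative dmap M f p) (at p within M)"
    unfolding dmap_def using assms(2) by (metis differentiable_def frechet_derivative_works)
  then show ?thesis using tangent_derivative_unique assms by blast
qed

lemma tangent_spaceI:
  assumes "\<epsilon> > 0" "smooth_on {-\<epsilon><..<\<epsilon>} c" "c ` {-\<epsilon><..<\<epsilon>} \<subseteq> M" "c 0 = p" "(c has_vector_derivative u) (at 0)"
  shows "u \<in> tangent_space M p"
  unfolding tangent_space_def using assms by blast

lemma tangent_space_in: "u \<in> tangent_space M p \<Longrightarrow> p \<in> M"
  unfolding tangent_space_def by force

lemma tangent_map:
  assumes "smooth_at M \<phi> p" "\<phi> ` M \<subseteq> P" "u \<in> tangent_space M p"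
  shows "dmap M \<phi> p u \<in> tangent_space P (\<phi> p)"
proof -
  have pM: "p \<in> M" using assms(3) by (rule tangent_space_in)
  obtain U F where U: "open U" "p \<in> U" "smooth_on U F" "\<forall>x\<in>M \<inter> U. \<phi> x = F x"
    using assms(1) unfolding smooth_at_def by blast
  obtain \<epsilon> c where c: "\<epsilon> > (0::real)" "smooth_on {-\<epsilon><..<\<epsilon>} c" "c ` {-\<epsilon><..<\<epsilon>} \<subseteq> M" "c 0 = p"
    "(c has_vector_derivative u) (at 0)"
    using assms(3) unfolding tangent_space_def by blast
  have "continuous_on {-\<epsilon><..<\<epsilon>} c" using c(2) by (rule smooth_on_continuous)
  then have "open ({-\<epsilon><..<\<epsilon>} \<inter> c -` U)"
    using U(1) by (intro continuous_open_preimage) auto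
  moreover have "0 \<in> {-\<epsilon><..<\<epsilon>} \<inter> c -` U" using c U by auto
  ultimately obtain \<delta> where \<delta>: "\<delta> > 0" "ball 0 \<delta> \<subseteq> {-\<epsilon><..<\<epsilon>} \<inter> c -` U" using openE by blast
  have sub: "{-\<delta><..<\<delta>} \<subseteq> {-\<epsilon><..<\<epsilon>} \<inter> c -` U" using \<delta>(2) by (auto simp: subset_eq dist_real_def)
  have eq: "F (c t) = \<phi> (c t)" if "t \<in> {-\<delta><..<\<delta>}" for t
  proof -
    have "c t \<in> M" "c t \<in> U" using sub that c(3) by blast+
    then show ?thesis using U(4) by simp
  qed
  show ?thesis
  proof (rule tangent_spaceI[OF \<delta>(1), of "\<lambda>t. \<phi> (c t)"])
    show "smooth_on {-\<delta><..<\<delta>} (\<lambda>t. \<phi> (c t))"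
    proof (rule smooth_on_cong)
      show "smooth_on {-\<delta><..<\<delta>} (\<lambda>t. F (c t))"
        by (rule smooth_on_compose[OF _ U(1) _ smooth_on_subset[OF c(2)] U(3)]) (use sub in auto)
    qed (use eq in auto)
    have "c ` {-\<delta><..<\<delta>} \<subseteq> M" using sub c(3) by blast
    then show "(\<lambda>t. \<phi> (c t)) ` {-\<delta><..<\<delta>} \<subseteq> P" using assms(2) by blast
    show "\<phi> (c 0) = \<phi> p" using c by simp
    show "((\<lambda>t. \<phi> (c t)) has_vector_derivative dmap M \<phi> p u) (at 0)"
      by (rule derivative_along_curve[OF dmap_has_derivative[OF assms(1) pM] _ _ c(3,4,5)]) (use c in auto)
  qed
qed

text \<open>Let \<open>z\<close> be the component of \<open>h' u\<close> orthogonal to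
  \<open>S\<close>. The function \<open>h x \<bullet> z\<close> vanishes on \<open>M\<close> near
  \<open>p\<close>, so its derivative along \<open>u\<close>, which is the squared length of
  \<open>z\<close>, is zero.\<close>

lemma derivative_in_subspace:
  fixes S :: "'b::euclidean_space set"
  assumes "(h has_derivative h') (at p within M)" "u \<in> tangent_space M p"
    "\<forall>\<^sub>F x in nhds p. x \<in> M \<longrightarrow> h x \<in> S" "subspace S"
  shows "h' u \<in> S"
proof -
  obtain y z where yz: "y \<in> span S" "\<And>w. w \<in> span S \<Longrightarrow> orthogonal z w" "h' u = y + z"
    using orthogonal_subspace_decomp_exists[of S "h' u"] by metis
  have sp: "span S = S" using assms(4) by simp
  have pM: "p \<in> M" using assms(2) by (rule tangent_space_in)
  have "((\<lambda>x. h x \<bullet> z) has_derivative (\<lambda>u. h' u \<bullet> z)) (at p within M)"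
    by (intro has_derivative_inner_left assms(1))
  moreover have "((\<lambda>x. h x \<bullet> z) has_derivative (\<lambda>u. 0)) (at p within M)"
  proof (rule has_derivative_eq_on[OF has_derivative_const pM])
    show "\<forall>\<^sub>F x in nhds p. x \<in> M \<longrightarrow> h x \<bullet> z = 0"
      using assms(3) by eventually_elim (use yz(2) sp in \<open>auto simp: orthogonal_def inner_commute[of _ z]\<close>)
  qed
  ultimately have "h' u \<bullet> z = 0" by (rule tangent_derivative_unique[OF assms(2)])
  moreover have "y \<bullet> z = 0" using yz(1,2) by (simp add: orthogonal_def inner_commute)
  ultimately have "z = 0" by (simp add: yz(3) inner_add_left)
  then show ?thesis using yz sp by simp
qed

section \<open>Smoothness relative to a subset, and vector fields\<close>

lemma smooth_at_smooth_on: "open U \<Longrightarrow> p \<in> U \<Longrightarrow> smooth_on U F \<Longrightarrow> smooth_at M F p"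
  unfolding smooth_at_def by blast

lemma smooth_at_const: "smooth_at M (\<lambda>x. c) p"
  by (rule smooth_at_smooth_on[of UNIV]) (auto intro: smooth_on_const)

lemma smooth_at_bounded_linear: "bounded_linear L \<Longrightarrow> smooth_at M L p"
  by (rule smooth_at_smooth_on[of UNIV]) (auto intro: smooth_on_bounded_linear)

lemma smooth_at_cong:
  assumes "smooth_at M f p" "\<forall>\<^sub>F x in nhds p. x \<in> M \<longrightarrow> g x = f x"
  shows "smooth_at M g p"
proof -
  obtain U F where U: "open U" "p \<in> U" "smooth_on U F" "\<forall>x\<in>M \<inter> U. f x = F x"
    using assms(1) unfolding smooth_at_def by blast
  obtain V where V: "open V" "p \<in> V" "\<forall>x\<in>V. x \<in> M \<longrightarrow> g x = f x"
    using assms(2) unfolding eventually_nhds by blast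
  show ?thesis unfolding smooth_at_def
    by (rule exI[of _ "U \<inter> V"], rule exI[of _ F]) (use U V in \<open>auto intro: smooth_on_subset\<close>)
qed

lemma smooth_at_bilinear:
  assumes "bounded_bilinear B" "smooth_at M f p" "smooth_at M g p"
  shows "smooth_at M (\<lambda>x. B (f x) (g x)) p"
proof -
  obtain U F where U: "open U" "p \<in> U" "smooth_on U F" "\<forall>x\<in>M \<inter> U. f x = F x"
    using assms(2) unfolding smooth_at_def by blast
  obtain V G where V: "open V" "p \<in> V" "smooth_on V G" "\<forall>x\<in>M \<inter> V. g x = G x"
    using assms(3) unfolding smooth_at_def by blast
  have "smooth_on (U \<inter> V) (\<lambda>x. B (F x) (G x))"
    using U V by (intro smooth_on_bilinear[OF _ assms(1)]) (auto intro: smooth_on_subset)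
  then show ?thesis unfolding smooth_at_def
    by (intro exI[of _ "U \<inter> V"] exI[of _ "\<lambda>x. B (F x) (G x)"]) (use U V in auto)
qed

lemma smooth_at_linear:
  assumes "bounded_linear L" "smooth_at M f p"
  shows "smooth_at M (\<lambda>x. L (f x)) p"
proof -
  obtain U F where U: "open U" "p \<in> U" "smooth_on U F" "\<forall>x\<in>M \<inter> U. f x = F x"
    using assms(2) unfolding smooth_at_def by blast
  then show ?thesis unfolding smooth_at_def
    by (intro exI[of _ U] exI[of _ "\<lambda>x. L (F x)"]) (auto intro: smooth_on_linear[OF _ assms(1)])
qed

lemma smooth_at_add:
  assumes "smooth_at M f p" "smooth_at M g p"
  shows "smooth_at M (\<lambda>x. f x + g x) p"
proof -
  obtain U F where U: "open U" "p \<in> U" "smooth_on U F" "\<forall>x\<in>M \<inter> U. f x = F x"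
    using assms(1) unfolding smooth_at_def by blast
  obtain V G where V: "open V" "p \<in> V" "smooth_on V G" "\<forall>x\<in>M \<inter> V. g x = G x"
    using assms(2) unfolding smooth_at_def by blast
  have "smooth_on (U \<inter> V) (\<lambda>x. F x + G x)"
    using U V by (intro smooth_on_add) (auto intro: smooth_on_subset)
  then show ?thesis unfolding smooth_at_def
    by (intro exI[of _ "U \<inter> V"] exI[of _ "\<lambda>x. F x + G x"]) (use U V in auto)
qed

lemma smooth_at_compose:
  fixes \<phi> :: "'a::euclidean_space \<Rightarrow> 'b::euclidean_space"
  assumes "smooth_at M \<phi> p" "p \<in> M" "\<phi> ` M \<subseteq> P" "smooth_at P G (\<phi> p)"
  shows "smooth_at M (\<lambda>x. G (\<phi> x)) p"
proof -
  obtain U F where U: "open U" "p \<in> U" "smooth_on U F" "\<forall>x\<in>M \<inter> U. \<phi> x = F x"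
    using assms(1) unfolding smooth_at_def by blast
  obtain V H where V: "open V" "\<phi> p \<in> V" "smooth_on V H" "\<forall>x\<in>P \<inter> V. G x = H x"
    using assms(4) unfolding smooth_at_def by blast
  have o: "open (U \<inter> F -` V)"
    using U V by (intro continuous_open_preimage smooth_on_continuous)
  have "smooth_on (U \<inter> F -` V) (\<lambda>x. H (F x))"
    by (rule smooth_on_compose[OF o V(1) _ smooth_on_subset[OF U(3)] V(3)]) auto
  then show ?thesis unfolding smooth_at_def
    by (intro exI[of _ "U \<inter> F -` V"] exI[of _ "\<lambda>x. H (F x)"]) (use U V o assms in auto)
qed

text \<open>On tangent vectors \<open>dmap\<close> agrees with the ambient derivative of a smooth
  extension of \<phi>. Since \<open>Y\<close> is tangent at all points of \<open>M\<close> near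
  \<open>p\<close>, that ambient derivative, applied to an extension of \<open>Y\<close>, extends
  the whole expression smoothly.\<close>

lemma smooth_at_dmap:
  fixes \<phi> :: "'a::euclidean_space \<Rightarrow> 'b::real_normed_vector"
  assumes "smooth_at M \<phi> p" "vec_field_at M p Y"
  shows "smooth_at M (\<lambda>x. dmap M \<phi> x (Y x)) p"
proof -
  obtain U F where U: "open U" "p \<in> U" "smooth_on U F" "\<forall>x\<in>M \<inter> U. \<phi> x = F x"
    using assms(1) unfolding smooth_at_def by blast
  have smY: "smooth_at M Y p" and tY: "\<forall>\<^sub>F x in nhds p. x \<in> M \<longrightarrow> Y x \<in> tangent_space M x"
    using assms(2) by (auto simp: vec_field_at_def)
  obtain V G where V: "open V" "p \<in> V" "smooth_on V G" "\<forall>x\<in>M \<inter> V. Y x = G x"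
    using smY unfolding smooth_at_def by blast
  have "smooth_on (U \<inter> V) (\<lambda>x. frechet_derivative F (at x) (G x))"
    using U V by (intro smooth_on_frechet) (auto intro: smooth_on_subset)
  then have "smooth_at M (\<lambda>x. frechet_derivative F (at x) (G x)) p"
    using U V by (intro smooth_at_smooth_on[of "U \<inter> V"]) auto
  then show ?thesis
  proof (rule smooth_at_cong)
    have "\<forall>\<^sub>F x in nhds p. x \<in> U \<inter> V" using U V by (intro eventually_nhds_in_open) auto
    with tY show "\<forall>\<^sub>F x in nhds p. x \<in> M \<longrightarrow> dmap M \<phi> x (Y x) = frechet_derivative F (at x) (G x)"
    proof eventually_elim
      case (elim x)
      show ?case
      proof
        assume x: "x \<in> M"
        have "(\<phi> has_derivative frechet_derivative F (at x)) (at x within M)"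
        proof (rule has_derivative_eq_on[OF _ x])
          show "(F has_derivative frechet_derivative F (at x)) (at x within M)"
            by (rule has_derivative_at_withinI[OF smooth_on_has_derivative[OF U(3)]]) (use elim in simp)
          show "\<forall>\<^sub>F y in nhds x. y \<in> M \<longrightarrow> \<phi> y = F y"
            unfolding eventually_nhds using U elim by blast
        qed
        then show "dmap M \<phi> x (Y x) = frechet_derivative F (at x) (G x)"
          using dmap_eq elim x V(4) by fastforce
      qed
    qed
  qed
qed

lemma vec_field_at_tangent: "vec_field_at M p Y \<Longrightarrow> p \<in> M \<Longrightarrow> Y p \<in> tangent_space M p"
  unfolding vec_field_at_def by (blast dest: eventually_nhds_x_imp_x)

lemma vec_field_at_add:
  assumes "vec_field_at M p X" "vec_field_at M p Y" "\<And>x. x \<in> M \<Longrightarrow> subspace (tangent_space M x)"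
  shows "vec_field_at M p (\<lambda>x. X x + Y x)"
  unfolding vec_field_at_def
proof
  show "smooth_at M (\<lambda>x. X x + Y x) p" using assms by (intro smooth_at_add) (auto simp: vec_field_at_def)
  have "\<forall>\<^sub>F x in nhds p. x \<in> M \<longrightarrow> X x \<in> tangent_space M x" "\<forall>\<^sub>F x in nhds p. x \<in> M \<longrightarrow> Y x \<in> tangent_space M x"
    using assms(1,2) by (auto simp: vec_field_at_def)
  then show "\<forall>\<^sub>F x in nhds p. x \<in> M \<longrightarrow> X x + Y x \<in> tangent_space M x"
    by eventually_elim (use assms(3) in \<open>auto intro: subspace_add\<close>)
qed

lemma vec_field_at_scale:
  assumes "vec_field_at M p X" "smooth_at M s p" "\<And>x. x \<in> M \<Longrightarrow> subspace (tangent_space M x)"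
  shows "vec_field_at M p (\<lambda>x. s x *\<^sub>R X x)"
  unfolding vec_field_at_def
proof
  show "smooth_at M (\<lambda>x. s x *\<^sub>R X x) p"
    using assms by (intro smooth_at_bilinear[OF bounded_bilinear_scaleR]) (auto simp: vec_field_at_def)
  have "\<forall>\<^sub>F x in nhds p. x \<in> M \<longrightarrow> X x \<in> tangent_space M x"
    using assms(1) by (auto simp: vec_field_at_def)
  then show "\<forall>\<^sub>F x in nhds p. x \<in> M \<longrightarrow> s x *\<^sub>R X x \<in> tangent_space M x"
    by eventually_elim (use assms(3) in \<open>auto intro: subspace_scale\<close>)
qed

text \<open>One notion for a defining equation, with \<open>S = {0}\<close>, and for a chart, with
  \<open>S\<close> the model subspace: nearby tangent spaces are preimages of one fixed subspace
  under the derivative of one smooth map.\<close>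

definition regular_at :: "'a::euclidean_space set \<Rightarrow> 'a \<Rightarrow> ('a \<Rightarrow> 'b::euclidean_space) \<Rightarrow> 'b set \<Rightarrow> 'a set \<Rightarrow> bool" where
  "regular_at P p G S U \<longleftrightarrow> open U \<and> p \<in> U \<and> smooth_on U G \<and> subspace S \<and>
     (\<forall>x\<in>P \<inter> U. tangent_space P x = {v. frechet_derivative G (at x) v \<in> S})"

lemma regular_at_subspace:
  assumes "regular_at P p G S U" "p \<in> P"
  shows "subspace (tangent_space P p)"
proof -
  have "linear (frechet_derivative G (at p))" "subspace S"
    "tangent_space P p = {v. frechet_derivative G (at p) v \<in> S}"
    using assms smooth_on_has_derivative has_derivative_linear unfolding regular_at_def by blast+
  then show ?thesis by (auto simp: subspace_def linear_0 linear_add linear_scale)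
qed

text \<open>For a tangent field, the derivative of \<open>G\<close> applied to it takes values in
  \<open>S\<close> along \<open>P\<close>, hence so does the derivative of this expression along a
  tangent vector. In the antisymmetrised expression the second derivatives of \<open>G\<close>
  cancel, and the derivative of \<open>G\<close> on the bracket remains.\<close>

lemma regular_at_bracket:
  assumes "regular_at P p G S U" "p \<in> P" "vec_field_at P p X" "vec_field_at P p Y"
  shows "lie_bracket P X Y p \<in> tangent_space P p"
proof -
  have U: "open U" "p \<in> U" "smooth_on U G" "subspace S"
    and T: "\<And>x. x \<in> P \<inter> U \<Longrightarrow> tangent_space P x = {v. frechet_derivative G (at x) v \<in> S}"
    using assms(1) by (auto simp: regular_at_def)
  have key: "D2 G p u (Z p) + frechet_derivative G (at p) (dmap P Z p u) \<in> S"
    if Z: "vec_field_at P p Z" and u: "u \<in> tangent_space P p" for Z u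
  proof (rule derivative_in_subspace[OF _ u _ U(4)])
    show "((\<lambda>y. frechet_derivative G (at y) (Z y)) has_derivative
      (\<lambda>u. D2 G p u (Z p) + frechet_derivative G (at p) (dmap P Z p u))) (at p within P)"
      using Z assms(2) by (intro has_derivative_frechet[OF U(1,3,2)] dmap_has_derivative) (auto simp: vec_field_at_def)
    have "\<forall>\<^sub>F x in nhds p. x \<in> U" using U by (intro eventually_nhds_in_open)
    moreover have "\<forall>\<^sub>F x in nhds p. x \<in> P \<longrightarrow> Z x \<in> tangent_space P x" using Z by (auto simp: vec_field_at_def)
    ultimately show "\<forall>\<^sub>F x in nhds p. x \<in> P \<longrightarrow> frechet_derivative G (at x) (Z x) \<in> S"
      by eventually_elim (use T in auto)
  qed
  have lin: "linear (frechet_derivative G (at p))"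
    using smooth_on_has_derivative[OF U(3,2)] has_derivative_linear by blast
  have "frechet_derivative G (at p) (lie_bracket P X Y p) =
      (D2 G p (X p) (Y p) + frechet_derivative G (at p) (dmap P Y p (X p)))
      - (D2 G p (Y p) (X p) + frechet_derivative G (at p) (dmap P X p (Y p)))"
    unfolding lie_bracket_def using D2_symmetric[OF U(1,3,2), of "X p" "Y p"] by (simp add: linear_diff[OF lin])
  also have "\<dots> \<in> S"
    by (intro subspace_diff[OF U(4)] key assms vec_field_at_tangent)
  finally show ?thesis using T U(2) assms(2) by auto
qed

section \<open>Connections from a coframe\<close>

text \<open>Linearity is asked on a tangent space only, since coframes and covariant derivatives are
  not controlled on other vectors.\<close>

definition linear_on_sub :: "'a::real_vector set \<Rightarrow> ('a \<Rightarrow> 'b::real_vector) \<Rightarrow> bool" where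
  "linear_on_sub T f \<longleftrightarrow> (\<forall>u\<in>T. \<forall>v\<in>T. \<forall>a b. f (a *\<^sub>R u + b *\<^sub>R v) = a *\<^sub>R f u + b *\<^sub>R f v)"

lemma linear_on_subD:
  "linear_on_sub T f \<Longrightarrow> u \<in> T \<Longrightarrow> v \<in> T \<Longrightarrow> f (a *\<^sub>R u + b *\<^sub>R v) = a *\<^sub>R f u + b *\<^sub>R f v"
  by (simp add: linear_on_sub_def)

lemma linear_on_sub_add: "linear_on_sub T f \<Longrightarrow> u \<in> T \<Longrightarrow> v \<in> T \<Longrightarrow> f (u + v) = f u + f v"
  using linear_on_subD[of T f u v 1 1] by simp

lemma linear_on_sub_scale: "linear_on_sub T f \<Longrightarrow> u \<in> T \<Longrightarrow> f (a *\<^sub>R u) = a *\<^sub>R f u"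
  using linear_on_subD[of T f u u a 0] by simp

lemma linear_on_sub_diff: "linear_on_sub T f \<Longrightarrow> u \<in> T \<Longrightarrow> v \<in> T \<Longrightarrow> f (u - v) = f u - f v"
  using linear_on_subD[of T f u v 1 "-1"] by simp

lemma linear_on_sub_0: "linear_on_sub T f \<Longrightarrow> subspace T \<Longrightarrow> f 0 = 0"
  using linear_on_sub_scale[of T f 0 0] subspace_0 by fastforce

lemma linear_on_sub_sum:
  assumes "linear_on_sub T f" "subspace T" "\<And>i. i \<in> I \<Longrightarrow> x i \<in> T"
  shows "f (\<Sum>i\<in>I. c i *\<^sub>R x i) = (\<Sum>i\<in>I. c i *\<^sub>R f (x i))"
  using assms(3)
proof (induction I rule: infinite_finite_induct)
  case (insert i I)
  have "(\<Sum>i\<in>I. c i *\<^sub>R x i) \<in> T" using insert assms(2) by (intro subspace_sum subspace_scale) auto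
  then have "f (c i *\<^sub>R x i + (\<Sum>i\<in>I. c i *\<^sub>R x i)) = c i *\<^sub>R f (x i) + f (\<Sum>i\<in>I. c i *\<^sub>R x i)"
    using insert assms by (simp add: linear_on_sub_add linear_on_sub_scale subspace_scale)
  then show ?case using insert by simp
qed (simp_all add: linear_on_sub_0[OF assms(1,2)])

lemma linear_imp_linear_on_sub: "linear f \<Longrightarrow> linear_on_sub T f"
  by (simp add: linear_on_sub_def linear_add linear_scale)

lemma dmap_linear_on: "smooth_at M f p \<Longrightarrow> p \<in> M \<Longrightarrow> linear_on_sub T (dmap M f p)"
  by (rule linear_imp_linear_on_sub[OF has_derivative_linear[OF dmap_has_derivative]])

text \<open>
  The tangent bundle of \<open>P\<close> is embedded isometrically by \<open>\<Theta>\<close> into the trivial bundle with fibre \<open>'e\<close>,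
  and \<open>d + \<Omega> (\<Theta> _)\<close> is a metric connection of that bundle whose torsion is normal to
  the image. Its tangential part is therefore the Levi-Civita connection.
\<close>

locale framed =
  fixes P :: "'a::euclidean_space set" and g :: "'a metric"
    and \<Theta> :: "'a \<Rightarrow> 'a \<Rightarrow> 'e::euclidean_space" and \<Omega> :: "'e \<Rightarrow> 'e \<Rightarrow> 'e"
  assumes metric: "\<And>p u v. u \<in> tangent_space P p \<Longrightarrow> v \<in> tangent_space P p \<Longrightarrow> g p u v = \<Theta> p u \<bullet> \<Theta> p v"
    and inj: "\<And>p u. u \<in> tangent_space P p \<Longrightarrow> \<Theta> p u = 0 \<Longrightarrow> u = 0"
    and sub: "\<And>p. p \<in> P \<Longrightarrow> subspace (tangent_space P p)"
    and ext: "\<And>p v. v \<in> tangent_space P p \<Longrightarrow> \<exists>Y. vec_field_at P p Y \<and> Y p = v"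
    and bracket: "\<And>p X Y. p \<in> P \<Longrightarrow> vec_field_at P p X \<Longrightarrow> vec_field_at P p Y \<Longrightarrow>
      lie_bracket P X Y p \<in> tangent_space P p"
    and bil: "bilinear \<Omega>"
    and skew: "\<And>x y z. \<Omega> x y \<bullet> z = - (y \<bullet> \<Omega> x z)"
    and coframe: "\<And>p. p \<in> P \<Longrightarrow> \<exists>H \<Theta>'.
      (\<forall>\<^sub>F x in nhds p. x \<in> P \<longrightarrow> (\<forall>u\<in>tangent_space P x. \<Theta> x u = H x u)) \<and>
      linear (H p) \<and> (\<forall>u. \<Theta>' u 0 = 0) \<and>
      (\<forall>v. ((\<lambda>(x, v). H x v) has_derivative (\<lambda>(u, w). \<Theta>' u v + H p w)) (at (p, v))) \<and>
      (\<forall>u\<in>tangent_space P p. \<forall>v\<in>tangent_space P p. \<forall>z\<in>tangent_space P p.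
        (\<Theta>' u v - \<Theta>' v u + \<Omega> (\<Theta> p u) (\<Theta> p v) - \<Omega> (\<Theta> p v) (\<Theta> p u)) \<bullet> \<Theta> p z = 0)"
begin

abbreviation T where "T \<equiv> tangent_space P"

lemma lin: "p \<in> P \<Longrightarrow> linear_on_sub (T p) (\<Theta> p)"
proof -
  assume p: "p \<in> P"
  obtain H where H: "\<forall>\<^sub>F x in nhds p. x \<in> P \<longrightarrow> (\<forall>u\<in>T x. \<Theta> x u = H x u)" "linear (H p)"
    using coframe[OF p] by blast
  have e: "\<Theta> p u = H p u" if "u \<in> T p" for u
    using eventually_nhds_x_imp_x[OF H(1)] p that by blast
  show ?thesis
    using sub[OF p] linear_imp_linear_on_sub[OF H(2), of "T p"]
    by (simp add: linear_on_sub_def e subspace_add subspace_scale)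
qed

text \<open>Covariant derivatives are known only through inner products with the image of the
  coframe, because the normal part is discarded. Equalities between them are obtained from this
  test.\<close>

lemma eq_of_inner:
  assumes "w1 \<in> T p" "w2 \<in> T p" "\<And>z. z \<in> T p \<Longrightarrow> \<Theta> p w1 \<bullet> \<Theta> p z = \<Theta> p w2 \<bullet> \<Theta> p z"
  shows "w1 = w2"
proof -
  have p: "p \<in> P" using assms(1) tangent_space_in by blast
  have d: "w1 - w2 \<in> T p" using assms sub[OF p] by (simp add: subspace_diff)
  have "\<Theta> p (w1 - w2) \<bullet> \<Theta> p (w1 - w2) = 0"
    using assms(3)[OF d] linear_on_sub_diff[OF lin[OF p] assms(1,2)] by (simp add: inner_diff_left)
  then show ?thesis using inj[OF d] by simp
qed

text \<open>\<open>w\<close> is the preimage of the orthogonal projection of \<open>e\<close> to the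
  image of the tangent space.\<close>

lemma represent:
  assumes "p \<in> P"
  shows "\<exists>w\<in>T p. \<forall>z\<in>T p. \<Theta> p w \<bullet> \<Theta> p z = e \<bullet> \<Theta> p z"
proof -
  have V: "subspace (\<Theta> p ` T p)"
    unfolding subspace_def
  proof (intro conjI ballI allI)
    show "0 \<in> \<Theta> p ` T p"
      by (rule image_eqI[of _ _ 0]) (simp_all add: linear_on_sub_0[OF lin[OF assms] sub[OF assms]] subspace_0[OF sub[OF assms]])
    show "x + y \<in> \<Theta> p ` T p" if "x \<in> \<Theta> p ` T p" "y \<in> \<Theta> p ` T p" for x y
      using that linear_on_sub_add[OF lin[OF assms], symmetric] subspace_add[OF sub[OF assms]] by blast
    show "c *\<^sub>R x \<in> \<Theta> p ` T p" if "x \<in> \<Theta> p ` T p" for c x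
      using that linear_on_sub_scale[OF lin[OF assms], symmetric] subspace_scale[OF sub[OF assms]] by blast
  qed
  obtain y n where yn: "y \<in> span (\<Theta> p ` T p)" "\<And>w. w \<in> span (\<Theta> p ` T p) \<Longrightarrow> orthogonal n w" "e = y + n"
    using orthogonal_subspace_decomp_exists[of "\<Theta> p ` T p" e] by metis
  have sp: "span (\<Theta> p ` T p) = \<Theta> p ` T p" using V by (simp only: span_eq_iff)
  obtain w where w: "w \<in> T p" "y = \<Theta> p w" using yn(1) unfolding sp by blast
  show ?thesis
  proof (rule bexI[OF _ w(1)], rule ballI)
    fix z assume "z \<in> T p"
    then have "n \<bullet> \<Theta> p z = 0" using yn(2) unfolding sp orthogonal_def by blast
    then show "\<Theta> p w \<bullet> \<Theta> p z = e \<bullet> \<Theta> p z" by (simp add: yn(3) w(2)[symmetric] inner_add_left)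
  qed
qed

text \<open>The local extension \<open>H\<close> is differentiated in place of \<Theta>. One term
  comes from the motion of the base point and vanishes with \<open>V p\<close>; the other is the
  coframe of the derivative of \<open>V\<close>. At a zero of \<open>V\<close> only the latter is
  left.\<close>

lemma coframe_along:
  assumes "p \<in> M" "\<phi> ` M \<subseteq> P"
    "(\<phi> has_derivative \<phi>') (at p within M)" "(V has_derivative V') (at p within M)"
    "\<forall>\<^sub>F x in nhds p. x \<in> M \<longrightarrow> V x \<in> T (\<phi> x)"
  shows "\<exists>D. ((\<lambda>x. \<Theta> (\<phi> x) (V x)) has_derivative D) (at p within M) \<and>
     (\<forall>u. V p = 0 \<longrightarrow> V' u \<in> T (\<phi> p) \<longrightarrow> D u = \<Theta> (\<phi> p) (V' u))"
proof -
  have q: "\<phi> p \<in> P" using assms by blast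
  obtain H \<Theta>' where H: "\<forall>\<^sub>F x in nhds (\<phi> p). x \<in> P \<longrightarrow> (\<forall>u\<in>T x. \<Theta> x u = H x u)" "linear (H (\<phi> p))"
    "\<forall>u. \<Theta>' u 0 = 0"
    "\<And>v. ((\<lambda>(x, v). H x v) has_derivative (\<lambda>(u, w). \<Theta>' u v + H (\<phi> p) w)) (at (\<phi> p, v))"
    using coframe[OF q] by blast
  have ev: "\<forall>\<^sub>F x in nhds p. x \<in> M \<longrightarrow> (\<forall>u\<in>T (\<phi> x). \<Theta> (\<phi> x) u = H (\<phi> x) u)"
  proof -
    have "continuous (at p within M) \<phi>" using assms(3) has_derivative_continuous by blast
    then have "(\<phi> \<longlongrightarrow> \<phi> p) (at p within M)" by (simp add: continuous_within)
    then have "\<forall>\<^sub>F x in at p within M. \<phi> x \<in> P \<longrightarrow> (\<forall>u\<in>T (\<phi> x). \<Theta> (\<phi> x) u = H (\<phi> x) u)"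
      using H(1) by (rule filterlim_iff[THEN iffD1, rule_format])
    then show ?thesis
      unfolding eventually_at_filter
      by (rule eventually_mono) (use assms(2) eventually_nhds_x_imp_x[OF H(1)] q in blast)
  qed
  have "((\<lambda>x. case (\<phi> x, V x) of (x, v) \<Rightarrow> H x v) has_derivative
      (\<lambda>u. case (\<phi>' u, V' u) of (u, w) \<Rightarrow> \<Theta>' u (V p) + H (\<phi> p) w)) (at p within M)"
    by (rule has_derivative_compose[OF has_derivative_Pair[OF assms(3,4)] H(4)])
  then have "((\<lambda>x. H (\<phi> x) (V x)) has_derivative (\<lambda>u. \<Theta>' (\<phi>' u) (V p) + H (\<phi> p) (V' u))) (at p within M)"
    by simp
  then have "((\<lambda>x. \<Theta> (\<phi> x) (V x)) has_derivative (\<lambda>u. \<Theta>' (\<phi>' u) (V p) + H (\<phi> p) (V' u))) (at p within M)"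
  proof (rule has_derivative_eq_on[OF _ assms(1)])
    show "\<forall>\<^sub>F x in nhds p. x \<in> M \<longrightarrow> \<Theta> (\<phi> x) (V x) = H (\<phi> x) (V x)"
      using ev assms(5) by eventually_elim blast
  qed
  moreover have "H (\<phi> p) w = \<Theta> (\<phi> p) w" if "w \<in> T (\<phi> p)" for w
    using eventually_nhds_x_imp_x[OF H(1)] q that by auto
  ultimately show ?thesis using H(3) by fastforce
qed

lemma frame_has_derivative:
  assumes "p \<in> P" "vec_field_at P p Y"
  shows "((\<lambda>x. \<Theta> x (Y x)) has_derivative dmap P (\<lambda>x. \<Theta> x (Y x)) p) (at p within P)"
proof -
  have "\<exists>D. ((\<lambda>x. \<Theta> x (Y x)) has_derivative D) (at p within P)"
    using coframe_along[of p P "\<lambda>x. x" "\<lambda>u. u" Y "dmap P Y p"] assms dmap_has_derivative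
    by (fastforce simp: vec_field_at_def)
  then show ?thesis unfolding dmap_def using frechet_derivative_works differentiable_def by metis
qed

section \<open>Existence and uniqueness of the Levi-Civita connection\<close>

definition conn :: "'a \<Rightarrow> 'a \<Rightarrow> ('a \<Rightarrow> 'a) \<Rightarrow> 'a" where
  "conn p u Y = (SOME w. w \<in> T p \<and> (\<forall>z\<in>T p. \<Theta> p w \<bullet> \<Theta> p z =
     (dmap P (\<lambda>x. \<Theta> x (Y x)) p u + \<Omega> (\<Theta> p u) (\<Theta> p (Y p))) \<bullet> \<Theta> p z))"

lemma conn:
  assumes "p \<in> P"
  shows "conn p u Y \<in> T p" "\<And>z. z \<in> T p \<Longrightarrow> \<Theta> p (conn p u Y) \<bullet> \<Theta> p z =
     (dmap P (\<lambda>x. \<Theta> x (Y x)) p u + \<Omega> (\<Theta> p u) (\<Theta> p (Y p))) \<bullet> \<Theta> p z"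
proof -
  have "\<exists>w. w \<in> T p \<and> (\<forall>z\<in>T p. \<Theta> p w \<bullet> \<Theta> p z =
     (dmap P (\<lambda>x. \<Theta> x (Y x)) p u + \<Omega> (\<Theta> p u) (\<Theta> p (Y p))) \<bullet> \<Theta> p z)"
    using represent[OF assms] by blast
  from someI_ex[OF this] show "conn p u Y \<in> T p" "\<And>z. z \<in> T p \<Longrightarrow> \<Theta> p (conn p u Y) \<bullet> \<Theta> p z =
     (dmap P (\<lambda>x. \<Theta> x (Y x)) p u + \<Omega> (\<Theta> p u) (\<Theta> p (Y p))) \<bullet> \<Theta> p z"
    unfolding conn_def by auto
qed

lemmas bil_simps = bilinear_ladd[OF bil] bilinear_radd[OF bil] bilinear_lmul[OF bil] bilinear_rmul[OF bil]
  bilinear_lsub[OF bil] bilinear_rsub[OF bil] bilinear_lzero[OF bil] bilinear_rzero[OF bil]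

lemma vec_field_tangent_near:
  "vec_field_at P p Y \<Longrightarrow> \<forall>\<^sub>F x in nhds p. x \<in> P \<longrightarrow> Y x \<in> T x"
  by (simp add: vec_field_at_def)

text \<open>In the difference, the terms with derivatives of the two fields combine to the coframe
  of the bracket. The remaining terms are the torsion expression of \<open>coframe\<close>, which is
  orthogonal to the image.\<close>

lemma torsion_free:
  assumes "p \<in> P" "vec_field_at P p X" "vec_field_at P p Y"
  shows "conn p (X p) Y - conn p (Y p) X = lie_bracket P X Y p"
proof (rule eq_of_inner)
  show "conn p (X p) Y - conn p (Y p) X \<in> T p"
    using conn(1)[OF assms(1)] sub[OF assms(1)] by (simp add: subspace_diff)
  show br: "lie_bracket P X Y p \<in> T p" by (rule bracket[OF assms])
  fix z assume z: "z \<in> T p"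
  have XT: "X p \<in> T p" "Y p \<in> T p" using vec_field_at_tangent assms by blast+
  obtain H \<Theta>' where H: "\<forall>\<^sub>F x in nhds p. x \<in> P \<longrightarrow> (\<forall>u\<in>T x. \<Theta> x u = H x u)" "linear (H p)"
    "\<And>v. ((\<lambda>(x, v). H x v) has_derivative (\<lambda>(u, w). \<Theta>' u v + H p w)) (at (p, v))"
    "\<And>u v z. u \<in> T p \<Longrightarrow> v \<in> T p \<Longrightarrow> z \<in> T p \<Longrightarrow>
       (\<Theta>' u v - \<Theta>' v u + \<Omega> (\<Theta> p u) (\<Theta> p v) - \<Omega> (\<Theta> p v) (\<Theta> p u)) \<bullet> \<Theta> p z = 0"
    using coframe[OF assms(1)] by blast
  have d: "dmap P (\<lambda>x. \<Theta> x (Z x)) p u = \<Theta>' u (Z p) + H p (dmap P Z p u)"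
    if Z: "vec_field_at P p Z" and u: "u \<in> T p" for Z u
  proof (rule dmap_eq[OF u])
    have "((\<lambda>x. case (x, Z x) of (x, v) \<Rightarrow> H x v) has_derivative
      (\<lambda>u. case (u, dmap P Z p u) of (u, w) \<Rightarrow> \<Theta>' u (Z p) + H p w)) (at p within P)"
      using Z assms(1) by (intro has_derivative_compose[OF has_derivative_Pair[OF has_derivative_ident
            dmap_has_derivative] H(3)]) (auto simp: vec_field_at_def)
    then have h: "((\<lambda>x. H x (Z x)) has_derivative (\<lambda>u. \<Theta>' u (Z p) + H p (dmap P Z p u))) (at p within P)"
      by simp
    show "((\<lambda>x. \<Theta> x (Z x)) has_derivative (\<lambda>u. \<Theta>' u (Z p) + H p (dmap P Z p u))) (at p within P)"
    proof (rule has_derivative_eq_on[OF h assms(1)])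
      show "\<forall>\<^sub>F x in nhds p. x \<in> P \<longrightarrow> \<Theta> x (Z x) = H x (Z x)"
        using vec_field_tangent_near[OF Z] H(1) by eventually_elim blast
    qed
  qed
  have "H p (lie_bracket P X Y p) = \<Theta> p (lie_bracket P X Y p)"
    using eventually_nhds_x_imp_x[OF H(1)] assms(1) br by auto
  then have b: "\<Theta> p (lie_bracket P X Y p) = H p (dmap P Y p (X p)) - H p (dmap P X p (Y p))"
    unfolding lie_bracket_def by (simp add: linear_diff[OF H(2)])
  have "\<Theta> p (conn p (X p) Y - conn p (Y p) X) \<bullet> \<Theta> p z =
      (dmap P (\<lambda>x. \<Theta> x (Y x)) p (X p) + \<Omega> (\<Theta> p (X p)) (\<Theta> p (Y p))) \<bullet> \<Theta> p z -
      (dmap P (\<lambda>x. \<Theta> x (X x)) p (Y p) + \<Omega> (\<Theta> p (Y p)) (\<Theta> p (X p))) \<bullet> \<Theta> p z"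
    using conn[OF assms(1)] z by (simp add: linear_on_sub_diff[OF lin[OF assms(1)]] inner_diff_left)
  also have "\<dots> = \<Theta> p (lie_bracket P X Y p) \<bullet> \<Theta> p z"
    using H(4)[OF XT z] by (simp add: d[OF assms(3) XT(1)] d[OF assms(2) XT(2)] b inner_add_left inner_diff_left)
  finally show "\<Theta> p (conn p (X p) Y - conn p (Y p) X) \<bullet> \<Theta> p z = \<Theta> p (lie_bracket P X Y p) \<bullet> \<Theta> p z" .
qed

text \<open>One rule for two clauses of \<open>is_levi_civita\<close>: both coefficients equal to 1
  give additivity, a zero second coefficient gives the Leibniz rule.\<close>

lemma dmap_frame_scale_add:
  assumes "u \<in> T p" "vec_field_at P p Y" "vec_field_at P p Z" "smooth_at P s p" "smooth_at P t p"
  shows "dmap P (\<lambda>x. \<Theta> x (s x *\<^sub>R Y x + t x *\<^sub>R Z x)) p u =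
    dmap P s p u *\<^sub>R \<Theta> p (Y p) + s p *\<^sub>R dmap P (\<lambda>x. \<Theta> x (Y x)) p u
    + (dmap P t p u *\<^sub>R \<Theta> p (Z p) + t p *\<^sub>R dmap P (\<lambda>x. \<Theta> x (Z x)) p u)"
proof (rule dmap_eq[OF assms(1)])
  have p: "p \<in> P" using assms(1) tangent_space_in by blast
  have "((\<lambda>x. s x *\<^sub>R \<Theta> x (Y x) + t x *\<^sub>R \<Theta> x (Z x)) has_derivative
      (\<lambda>u. (s p *\<^sub>R dmap P (\<lambda>x. \<Theta> x (Y x)) p u + dmap P s p u *\<^sub>R \<Theta> p (Y p))
        + (t p *\<^sub>R dmap P (\<lambda>x. \<Theta> x (Z x)) p u + dmap P t p u *\<^sub>R \<Theta> p (Z p)))) (at p within P)"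
    using assms p by (intro has_derivative_add has_derivative_scaleR dmap_has_derivative frame_has_derivative)
  then have "((\<lambda>x. \<Theta> x (s x *\<^sub>R Y x + t x *\<^sub>R Z x)) has_derivative
      (\<lambda>u. (s p *\<^sub>R dmap P (\<lambda>x. \<Theta> x (Y x)) p u + dmap P s p u *\<^sub>R \<Theta> p (Y p))
        + (t p *\<^sub>R dmap P (\<lambda>x. \<Theta> x (Z x)) p u + dmap P t p u *\<^sub>R \<Theta> p (Z p)))) (at p within P)"
  proof (rule has_derivative_eq_on[OF _ p])
    show "\<forall>\<^sub>F x in nhds p. x \<in> P \<longrightarrow> \<Theta> x (s x *\<^sub>R Y x + t x *\<^sub>R Z x) = s x *\<^sub>R \<Theta> x (Y x) + t x *\<^sub>R \<Theta> x (Z x)"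
      using vec_field_tangent_near[OF assms(2)] vec_field_tangent_near[OF assms(3)]
      by eventually_elim (auto simp: linear_on_subD[OF lin])
  qed
  then show "((\<lambda>x. \<Theta> x (s x *\<^sub>R Y x + t x *\<^sub>R Z x)) has_derivative
      (\<lambda>u. dmap P s p u *\<^sub>R \<Theta> p (Y p) + s p *\<^sub>R dmap P (\<lambda>x. \<Theta> x (Y x)) p u
    + (dmap P t p u *\<^sub>R \<Theta> p (Z p) + t p *\<^sub>R dmap P (\<lambda>x. \<Theta> x (Z x)) p u))) (at p within P)"
    by (simp add: add.commute)
qed

lemma dmap_const: "u \<in> tangent_space M p \<Longrightarrow> dmap M (\<lambda>x. c) p u = 0"
  by (rule dmap_eq[of u M p "\<lambda>x. c" "\<lambda>u. 0"]) simp_all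

text \<open>Compatibility with the metric holds because the \<Omega> terms cancel by
  \<open>skew\<close>; the algebraic clauses are tested against the image of the coframe.\<close>

lemma is_levi_civita_conn: "is_levi_civita P g conn"
  unfolding is_levi_civita_def
proof (intro ballI conjI allI impI; (elim conjE)?)
  fix p assume p: "p \<in> P"
  note c = conn[OF p] and l = lin[OF p] and s = sub[OF p]
  show "conn p u Y \<in> T p" for u Y by (rule c)
  show "conn p (X p) Y - conn p (Y p) X = lie_bracket P X Y p"
    if "vec_field_at P p X" "vec_field_at P p Y" for X Y
    by (rule torsion_free[OF p that])
  show "conn p (a *\<^sub>R u + b *\<^sub>R v) Y = a *\<^sub>R conn p u Y + b *\<^sub>R conn p v Y"
    if uv: "u \<in> T p" "v \<in> T p" and Y: "vec_field_at P p Y" for u v a b Y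
  proof (rule eq_of_inner)
    show "conn p (a *\<^sub>R u + b *\<^sub>R v) Y \<in> T p" "a *\<^sub>R conn p u Y + b *\<^sub>R conn p v Y \<in> T p"
      using c s by (auto intro: subspace_add subspace_scale)
    have d: "dmap P (\<lambda>x. \<Theta> x (Y x)) p (a *\<^sub>R u + b *\<^sub>R v) =
       a *\<^sub>R dmap P (\<lambda>x. \<Theta> x (Y x)) p u + b *\<^sub>R dmap P (\<lambda>x. \<Theta> x (Y x)) p v"
      using has_derivative_linear[OF frame_has_derivative[OF p Y]] by (simp add: linear_add linear_scale)
    show "\<Theta> p (conn p (a *\<^sub>R u + b *\<^sub>R v) Y) \<bullet> \<Theta> p z = \<Theta> p (a *\<^sub>R conn p u Y + b *\<^sub>R conn p v Y) \<bullet> \<Theta> p z"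
      if z: "z \<in> T p" for z
      using c z uv by (simp add: linear_on_subD[OF l] d bil_simps inner_add_left algebra_simps)
  qed
  show "conn p u (\<lambda>x. Y x + Z x) = conn p u Y + conn p u Z"
    if u: "u \<in> T p" and YZ: "vec_field_at P p Y" "vec_field_at P p Z" for u Y Z
  proof (rule eq_of_inner)
    show "conn p u (\<lambda>x. Y x + Z x) \<in> T p" "conn p u Y + conn p u Z \<in> T p"
      using c s by (auto intro: subspace_add)
    have "dmap P (\<lambda>x. \<Theta> x (Y x + Z x)) p u = dmap P (\<lambda>x. \<Theta> x (Y x)) p u + dmap P (\<lambda>x. \<Theta> x (Z x)) p u"
      using dmap_frame_scale_add[OF u YZ smooth_at_const[of P 1] smooth_at_const[of P 1]]
      by (simp add: dmap_const[OF u])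
    then show "\<Theta> p (conn p u (\<lambda>x. Y x + Z x)) \<bullet> \<Theta> p z = \<Theta> p (conn p u Y + conn p u Z) \<bullet> \<Theta> p z"
      if z: "z \<in> T p" for z
      using c z u vec_field_at_tangent[OF _ p] YZ
      by (simp add: linear_on_sub_add[OF l] bil_simps inner_add_left)
  qed
  show "conn p u (\<lambda>x. h x *\<^sub>R Y x) = dmap P h p u *\<^sub>R Y p + h p *\<^sub>R conn p u Y"
    if u: "u \<in> T p" and h: "smooth_at P h p" and Y: "vec_field_at P p Y" for u h Y
  proof (rule eq_of_inner)
    note Yp = vec_field_at_tangent[OF Y p]
    show "conn p u (\<lambda>x. h x *\<^sub>R Y x) \<in> T p" "dmap P h p u *\<^sub>R Y p + h p *\<^sub>R conn p u Y \<in> T p"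
      using c s Yp by (auto intro: subspace_add subspace_scale)
    have "dmap P (\<lambda>x. \<Theta> x (h x *\<^sub>R Y x)) p u = dmap P h p u *\<^sub>R \<Theta> p (Y p) + h p *\<^sub>R dmap P (\<lambda>x. \<Theta> x (Y x)) p u"
      using dmap_frame_scale_add[OF u Y Y h smooth_at_const[of P 0]] by (simp add: dmap_const[OF u])
    then show "\<Theta> p (conn p u (\<lambda>x. h x *\<^sub>R Y x)) \<bullet> \<Theta> p z = \<Theta> p (dmap P h p u *\<^sub>R Y p + h p *\<^sub>R conn p u Y) \<bullet> \<Theta> p z"
      if z: "z \<in> T p" for z
      using c z u Yp
      by (simp add: linear_on_subD[OF l] linear_on_sub_scale[OF l] bil_simps inner_add_left algebra_simps)
  qed
  show "dmap P (\<lambda>x. g x (Y x) (Z x)) p u = g p (conn p u Y) (Z p) + g p (Y p) (conn p u Z)"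
    if u: "u \<in> T p" and YZ: "vec_field_at P p Y" "vec_field_at P p Z" for u Y Z
  proof -
    note t = vec_field_at_tangent[OF YZ(1) p] vec_field_at_tangent[OF YZ(2) p]
    have "((\<lambda>x. \<Theta> x (Y x) \<bullet> \<Theta> x (Z x)) has_derivative
      (\<lambda>u. \<Theta> p (Y p) \<bullet> dmap P (\<lambda>x. \<Theta> x (Z x)) p u + dmap P (\<lambda>x. \<Theta> x (Y x)) p u \<bullet> \<Theta> p (Z p))) (at p within P)"
      using YZ by (intro has_derivative_inner frame_has_derivative[OF p])
    then have "((\<lambda>x. g x (Y x) (Z x)) has_derivative
      (\<lambda>u. \<Theta> p (Y p) \<bullet> dmap P (\<lambda>x. \<Theta> x (Z x)) p u + dmap P (\<lambda>x. \<Theta> x (Y x)) p u \<bullet> \<Theta> p (Z p))) (at p within P)"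
    proof (rule has_derivative_eq_on[OF _ p])
      show "\<forall>\<^sub>F x in nhds p. x \<in> P \<longrightarrow> g x (Y x) (Z x) = \<Theta> x (Y x) \<bullet> \<Theta> x (Z x)"
        using vec_field_tangent_near[OF YZ(1)] vec_field_tangent_near[OF YZ(2)]
        by eventually_elim (auto simp: metric)
    qed
    from dmap_eq[OF u this]
    show ?thesis
      using c(2)[OF t(2), of u Y] c(2)[OF t(1), of u Z] skew[of "\<Theta> p u" "\<Theta> p (Y p)" "\<Theta> p (Z p)"]
      by (simp add: metric t c(1) inner_add_left inner_add_right inner_commute)
  qed
qed

text \<open>Uniqueness is the Koszul argument: the difference of two Levi-Civita connections is
  symmetric in its first two slots and skew in its last two.\<close>

lemma levi_civita_unique:
  assumes "is_levi_civita P g n1" "is_levi_civita P g n2" "u \<in> T p" "vec_field_at P p Y"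
  shows "n1 p u Y = n2 p u Y"
proof -
  have p: "p \<in> P" using assms(3) tangent_space_in by blast
  define B where "B X Y Z = g p (n1 p (X p) Y - n2 p (X p) Y) (Z p)" for X Y Z :: "'a \<Rightarrow> 'a"
  have n: "n p (X p) Y \<in> T p" if "is_levi_civita P g n" "vec_field_at P p X" "vec_field_at P p Y" for n X Y
    using that p vec_field_at_tangent[OF that(2) p] unfolding is_levi_civita_def by blast
  have gd: "g p (a - b) z = g p a z - g p b z" if "a \<in> T p" "b \<in> T p" "z \<in> T p" for a b z
    using that sub[OF p] by (simp add: metric subspace_diff linear_on_sub_diff[OF lin[OF p]] inner_diff_left)
  have gs: "g p a b = g p b a" if "a \<in> T p" "b \<in> T p" for a b
    using that by (simp add: metric inner_commute)
  have skewB: "B X Y Z = - B X Z Y"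
    if v: "vec_field_at P p X" "vec_field_at P p Y" "vec_field_at P p Z" for X Y Z
  proof -
    note t = vec_field_at_tangent[OF v(1) p] vec_field_at_tangent[OF v(2) p] vec_field_at_tangent[OF v(3) p]
    have "dmap P (\<lambda>x. g x (Y x) (Z x)) p (X p) = g p (n p (X p) Y) (Z p) + g p (Y p) (n p (X p) Z)"
      if "is_levi_civita P g n" for n
      using that p v t unfolding is_levi_civita_def by blast
    from this[OF assms(1)] this[OF assms(2)]
    have "g p (n1 p (X p) Y) (Z p) + g p (Y p) (n1 p (X p) Z) = g p (n2 p (X p) Y) (Z p) + g p (Y p) (n2 p (X p) Z)"
      by simp
    then show ?thesis
      unfolding B_def using n[OF assms(1)] n[OF assms(2)] v t gs by (simp add: gd)
  qed
  have symB: "B X Y Z = B Y X Z"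
    if v: "vec_field_at P p X" "vec_field_at P p Y" "vec_field_at P p Z" for X Y Z
  proof -
    have "n p (X p) Y - n p (Y p) X = lie_bracket P X Y p" if "is_levi_civita P g n" for n
      using that p v unfolding is_levi_civita_def by blast
    from this[OF assms(1)] this[OF assms(2)]
    have "n1 p (X p) Y - n2 p (X p) Y = n1 p (Y p) X - n2 p (Y p) X" by (simp add: algebra_simps)
    then show ?thesis by (simp add: B_def)
  qed
  \<comment> \<open>Six swaps of neighbouring slots, alternately of the last two and of the first
    two, lead back to the start; three of them change the sign.\<close>
  have B0: "B X Y Z = 0" if "vec_field_at P p X" "vec_field_at P p Y" "vec_field_at P p Z" for X Y Z
    using skewB[of X Y Z] symB[of X Z Y] skewB[of Z X Y] symB[of Z Y X] skewB[of Y Z X] symB[of X Y Z] that by linarith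
  obtain X where X: "vec_field_at P p X" "X p = u" using ext[OF assms(3)] by blast
  have d: "n1 p u Y - n2 p u Y \<in> T p"
    using n[OF assms(1) X(1) assms(4)] n[OF assms(2) X(1) assms(4)] X(2) sub[OF p] by (simp add: subspace_diff)
  then obtain Z where Z: "vec_field_at P p Z" "Z p = n1 p u Y - n2 p u Y" using ext by blast
  have "g p (n1 p u Y - n2 p u Y) (n1 p u Y - n2 p u Y) = 0"
    using B0[OF X(1) assms(4) Z(1)] X(2) Z(2) by (simp add: B_def)
  then show ?thesis using inj[OF d] by (simp add: metric d)
qed

lemma is_levi_civita_levi_civita: "is_levi_civita P g (levi_civita P g)"
  unfolding levi_civita_def using someI[of "is_levi_civita P g", OF is_levi_civita_conn] .

lemma levi_civita_conn: "u \<in> T p \<Longrightarrow> vec_field_at P p Y \<Longrightarrow> levi_civita P g p u Y = conn p u Y"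
  by (rule levi_civita_unique[OF is_levi_civita_levi_civita is_levi_civita_conn])

lemma levi_civita_tangent: "u \<in> T p \<Longrightarrow> vec_field_at P p Y \<Longrightarrow> levi_civita P g p u Y \<in> T p"
  using levi_civita_conn conn(1) tangent_space_in by metis

lemma levi_civita_inner:
  "u \<in> T p \<Longrightarrow> vec_field_at P p Y \<Longrightarrow> z \<in> T p \<Longrightarrow> \<Theta> p (levi_civita P g p u Y) \<bullet> \<Theta> p z =
     (dmap P (\<lambda>x. \<Theta> x (Y x)) p u + \<Omega> (\<Theta> p u) (\<Theta> p (Y p))) \<bullet> \<Theta> p z"
  using levi_civita_conn conn(2) tangent_space_in by metis

lemma levi_civita_add:
  "u \<in> T p \<Longrightarrow> vec_field_at P p Y \<Longrightarrow> vec_field_at P p Z \<Longrightarrow>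
     levi_civita P g p u (\<lambda>x. a *\<^sub>R Y x + b *\<^sub>R Z x) = a *\<^sub>R levi_civita P g p u Y + b *\<^sub>R levi_civita P g p u Z"
proof -
  assume h: "u \<in> T p" "vec_field_at P p Y" "vec_field_at P p Z"
  have p: "p \<in> P" using h(1) tangent_space_in by blast
  note L = is_levi_civita_levi_civita[unfolded is_levi_civita_def, rule_format, OF p]
  have "vec_field_at P p (\<lambda>x. a *\<^sub>R Y x)" "vec_field_at P p (\<lambda>x. b *\<^sub>R Z x)"
    using vec_field_at_scale[OF _ smooth_at_const sub] h by blast+
  then have "levi_civita P g p u (\<lambda>x. a *\<^sub>R Y x + b *\<^sub>R Z x)
     = levi_civita P g p u (\<lambda>x. a *\<^sub>R Y x) + levi_civita P g p u (\<lambda>x. b *\<^sub>R Z x)"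
    using L h(1) by blast
  moreover have "levi_civita P g p u (\<lambda>x. c *\<^sub>R W x) = c *\<^sub>R levi_civita P g p u W"
    if "vec_field_at P p W" for c W
  proof -
    have "levi_civita P g p u (\<lambda>x. c *\<^sub>R W x) = dmap P (\<lambda>x. c) p u *\<^sub>R W p + c *\<^sub>R levi_civita P g p u W"
      using L h(1) that smooth_at_const[of P c p] by blast
    then show ?thesis by (simp add: dmap_const[OF h(1)])
  qed
  ultimately show ?thesis using h by simp
qed

text \<open>The bracket of an extension of \<open>u\<close> with \<open>Y\<close> is the plain
  derivative of \<open>Y\<close>, as the other term is linear in \<open>Y p\<close>; so this
  derivative is tangent. The connection form contributes nothing at a zero of \<open>Y\<close>. This
  is what makes \<open>nabla_d\<close> independent of the extension of its second argument.\<close>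

lemma levi_civita_vanishing:
  assumes "u \<in> T p" "vec_field_at P p Y" "Y p = 0"
  shows "levi_civita P g p u Y = dmap P Y p u" "dmap P Y p u \<in> T p"
proof -
  have p: "p \<in> P" using assms(1) tangent_space_in by blast
  obtain X where X: "vec_field_at P p X" "X p = u" using ext[OF assms(1)] by blast
  have sX: "smooth_at P X p" and sY: "smooth_at P Y p" using X assms by (auto simp: vec_field_at_def)
  have "lie_bracket P X Y p = dmap P Y p u"
    unfolding lie_bracket_def
    using X(2) assms(3) linear_0[OF has_derivative_linear[OF dmap_has_derivative[OF sX p]]] by simp
  then show t: "dmap P Y p u \<in> T p" using bracket[OF p X(1) assms(2)] by simp
  obtain D where D: "((\<lambda>x. \<Theta> x (Y x)) has_derivative D) (at p within P)"
     "dmap P Y p u \<in> T p \<Longrightarrow> D u = \<Theta> p (dmap P Y p u)"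
    using coframe_along[of p P "\<lambda>x. x" "\<lambda>u. u" Y "dmap P Y p"] p assms(2,3) dmap_has_derivative[OF sY p]
    by (fastforce simp: vec_field_at_def)
  have "dmap P (\<lambda>x. \<Theta> x (Y x)) p u = \<Theta> p (dmap P Y p u)" using dmap_eq[OF assms(1) D(1)] D(2) t by simp
  then show "levi_civita P g p u Y = dmap P Y p u"
    using assms levi_civita_inner[OF assms(1,2)] linear_on_sub_0[OF lin[OF p] sub[OF p]]
    by (intro eq_of_inner[OF levi_civita_tangent[OF assms(1,2)] t]) (simp add: bil_simps)
qed

section \<open>Traces over orthonormal bases\<close>

lemma orthonormal_expand:
  assumes "orthonormal_basis P g p B" "x \<in> T p" "p \<in> P"
  shows "x = (\<Sum>b\<in>B. (\<Theta> p x \<bullet> \<Theta> p b) *\<^sub>R b)"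
proof -
  have B: "finite B" "B \<subseteq> T p" "span B = T p" "\<And>b c. b \<in> B \<Longrightarrow> c \<in> B \<Longrightarrow> \<Theta> p b \<bullet> \<Theta> p c = (if b = c then 1 else 0)"
    using assms(1) metric unfolding orthonormal_basis_def by (auto simp: subset_eq)
  obtain r where r: "x = (\<Sum>b\<in>B. r b *\<^sub>R b)"
    using assms(2) B(1,3) span_finite[OF B(1)] by auto
  have "\<Theta> p x \<bullet> \<Theta> p c = r c" if c: "c \<in> B" for c
  proof -
    have "\<Theta> p x = (\<Sum>b\<in>B. r b *\<^sub>R \<Theta> p b)"
      unfolding r using B by (intro linear_on_sub_sum[OF lin sub] assms) auto
    then have "\<Theta> p x \<bullet> \<Theta> p c = (\<Sum>b\<in>B. r b * (\<Theta> p b \<bullet> \<Theta> p c))" by (simp add: inner_sum_left)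
    also have "\<dots> = (\<Sum>b\<in>B. if b = c then r b else 0)" using c B(4) by (intro sum.cong) auto
    also have "\<dots> = r c" using c B(1) by simp
    finally show ?thesis .
  qed
  then show ?thesis by (subst r) (auto intro: sum.cong)
qed

text \<open>Both slots of \<beta> are expanded over \<open>C\<close>. The matrix \<open>G\<close> of
  inner products between two orthonormal bases has orthonormal columns, which is the identity
  \<open>f\<close>. The lemma is needed since \<open>metric_trace\<close> asks for one value that
  serves all bases.\<close>

lemma trace_independent:
  fixes \<beta> :: "'a \<Rightarrow> 'a \<Rightarrow> 'b::real_vector"
  assumes "p \<in> P" "orthonormal_basis P g p B" "orthonormal_basis P g p C"
    "\<And>u. u \<in> T p \<Longrightarrow> linear_on_sub (T p) (\<beta> u)" "\<And>u. u \<in> T p \<Longrightarrow> linear_on_sub (T p) (\<lambda>v. \<beta> v u)"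
  shows "(\<Sum>b\<in>B. \<beta> b b) = (\<Sum>c\<in>C. \<beta> c c)"
proof -
  have B: "finite B" "B \<subseteq> T p" and C: "finite C" "C \<subseteq> T p"
    using assms unfolding orthonormal_basis_def by auto
  have C2: "\<And>b c. b \<in> C \<Longrightarrow> c \<in> C \<Longrightarrow> \<Theta> p b \<bullet> \<Theta> p c = (if b = c then 1 else 0)"
    using assms(3) metric unfolding orthonormal_basis_def by (auto simp: subset_eq)
  define G where "G b c = \<Theta> p b \<bullet> \<Theta> p c" for b c
  have e: "\<beta> b b = (\<Sum>c\<in>C. \<Sum>d\<in>C. (G b c * G b d) *\<^sub>R \<beta> c d)" if "b \<in> B" for b
  proof -
    have bT: "b \<in> T p" using that B by auto
    have bb: "b = (\<Sum>c\<in>C. G b c *\<^sub>R c)" unfolding G_def by (rule orthonormal_expand[OF assms(3) bT assms(1)])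
    have "\<beta> b b = (\<lambda>v. \<beta> v b) (\<Sum>c\<in>C. G b c *\<^sub>R c)" using bb by simp
    also have "\<dots> = (\<Sum>c\<in>C. G b c *\<^sub>R \<beta> c b)"
      using C bT by (intro linear_on_sub_sum[OF assms(5) sub[OF assms(1)]]) auto
    also have "\<dots> = (\<Sum>c\<in>C. G b c *\<^sub>R (\<Sum>d\<in>C. G b d *\<^sub>R \<beta> c d))"
    proof (intro sum.cong refl arg_cong[where f="scaleR _"])
      fix c assume "c \<in> C"
      then have "\<beta> c (\<Sum>d\<in>C. G b d *\<^sub>R d) = (\<Sum>d\<in>C. G b d *\<^sub>R \<beta> c d)"
        using C by (intro linear_on_sub_sum[OF assms(4) sub[OF assms(1)]]) auto
      then show "\<beta> c b = (\<Sum>d\<in>C. G b d *\<^sub>R \<beta> c d)" using bb by simp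
    qed
    finally show ?thesis by (simp add: scaleR_right.sum)
  qed
  have f: "(\<Sum>b\<in>B. G b c * G b d) = G c d" if "c \<in> C" "d \<in> C" for c d
  proof -
    have cT: "c \<in> T p" "d \<in> T p" using that C by auto
    have "\<Theta> p c = (\<Sum>b\<in>B. G c b *\<^sub>R \<Theta> p b)"
      using linear_on_sub_sum[OF lin sub, OF assms(1) assms(1), of B "\<lambda>b. b" "G c"] B
        orthonormal_expand[OF assms(2) cT(1) assms(1)] unfolding G_def by auto
    from arg_cong[OF this, of "\<lambda>x. x \<bullet> \<Theta> p d"] have "G c d = (\<Sum>b\<in>B. G c b * G b d)"
      unfolding G_def by (simp only: inner_sum_left inner_scaleR_left)
    then show ?thesis by (simp add: G_def inner_commute)
  qed
  have "(\<Sum>b\<in>B. \<beta> b b) = (\<Sum>b\<in>B. \<Sum>c\<in>C. \<Sum>d\<in>C. (G b c * G b d) *\<^sub>R \<beta> c d)" using e by simp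
  also have "\<dots> = (\<Sum>c\<in>C. \<Sum>b\<in>B. \<Sum>d\<in>C. (G b c * G b d) *\<^sub>R \<beta> c d)" by (rule sum.swap)
  also have "\<dots> = (\<Sum>c\<in>C. \<Sum>d\<in>C. \<Sum>b\<in>B. (G b c * G b d) *\<^sub>R \<beta> c d)" by (intro sum.cong refl sum.swap)
  also have "\<dots> = (\<Sum>c\<in>C. \<Sum>d\<in>C. G c d *\<^sub>R \<beta> c d)" using f by (simp add: scaleR_left.sum[symmetric])
  also have "\<dots> = (\<Sum>c\<in>C. \<Sum>d\<in>C. if c = d then \<beta> c d else 0)"
    using C2 by (intro sum.cong refl) (simp add: G_def)
  also have "\<dots> = (\<Sum>c\<in>C. \<beta> c c)" using C(1) by simp
  finally show ?thesis .
qed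

lemma metric_trace_eq:
  fixes \<beta> :: "'a \<Rightarrow> 'a \<Rightarrow> 'b::real_vector"
  assumes "p \<in> P" "orthonormal_basis P g p B"
    "\<And>u. u \<in> T p \<Longrightarrow> linear_on_sub (T p) (\<beta> u)" "\<And>u. u \<in> T p \<Longrightarrow> linear_on_sub (T p) (\<lambda>v. \<beta> v u)"
  shows "metric_trace P g p \<beta> = (\<Sum>b\<in>B. \<beta> b b)"
  unfolding metric_trace_def
proof (rule the_equality)
  show "\<forall>C. orthonormal_basis P g p C \<longrightarrow> (\<Sum>b\<in>B. \<beta> b b) = (\<Sum>c\<in>C. \<beta> c c)"
    using trace_independent[OF assms(1,2) _ assms(3,4)] by blast
qed (use assms(2) in blast)

end

section \<open>The second fundamental form of a map\<close>

text \<open>Continuity of \<phi> within \<open>M\<close> gives the claim away from \<open>p\<close>;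
  at \<open>p\<close> itself, which the filter \<open>at p within M\<close> omits, the hypothesis
  applies directly.\<close>

lemma eventually_pullback:
  assumes "smooth_at M \<phi> p" "p \<in> M" "\<phi> ` M \<subseteq> P" "\<forall>\<^sub>F y in nhds (\<phi> p). y \<in> P \<longrightarrow> Q y"
  shows "\<forall>\<^sub>F x in nhds p. x \<in> M \<longrightarrow> Q (\<phi> x)"
proof -
  have "continuous (at p within M) \<phi>"
    using dmap_has_derivative[OF assms(1,2)] has_derivative_continuous by blast
  then have "(\<phi> \<longlongrightarrow> \<phi> p) (at p within M)" by (simp add: continuous_within)
  then have "\<forall>\<^sub>F x in at p within M. \<phi> x \<in> P \<longrightarrow> Q (\<phi> x)"
    using assms(4) by (rule filterlim_iff[THEN iffD1, rule_format])
  then show ?thesis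
    unfolding eventually_at_filter
    by (rule eventually_mono) (use assms(2,3) eventually_nhds_x_imp_x[OF assms(4)] in blast)
qed

text \<open>\<open>pullback_connection\<close> quantifies over all ways of writing a field along
  \<phi> by fields of \<open>P\<close>. The clause \<open>rep\<close> provides one such way: its
  coefficients depend smoothly on foot point and vector together, so they can be composed with a
  smooth field along a smooth map.\<close>

locale framed_target = framed P g \<Theta> \<Omega>
  for P :: "'a::euclidean_space set" and g and \<Theta> :: "'a \<Rightarrow> 'a \<Rightarrow> 'e::euclidean_space" and \<Omega> +
  assumes rep: "\<And>p. p \<in> P \<Longrightarrow> \<exists>(n::nat) F C. (\<forall>a<n. vec_field_at P p (F a) \<and> smooth_on UNIV (C a :: 'a \<times> 'a \<Rightarrow> real)) \<and>
      (\<forall>\<^sub>F y in nhds p. y \<in> P \<longrightarrow> (\<forall>u\<in>tangent_space P y. u = (\<Sum>a<n. C a (y, u) *\<^sub>R F a y)))"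
begin

text \<open>Every admissible representation of \<open>V\<close> yields a tangent vector whose inner
  products with the coframe are given by an expression free of the representation. Hence all of them
  agree, and the one built from \<open>rep\<close> shows that the definite description has a
  value.\<close>

lemma pullback_along:
  fixes M :: "'c::euclidean_space set"
  assumes \<phi>: "\<phi> ` M \<subseteq> P" "smooth_at M \<phi> p" and p: "p \<in> M" and u: "u \<in> tangent_space M p"
    and V: "smooth_at M V p" "\<forall>\<^sub>F x in nhds p. x \<in> M \<longrightarrow> V x \<in> T (\<phi> x)"
  shows "pullback_connection M P g \<phi> p u V \<in> T (\<phi> p)"
    and "z \<in> T (\<phi> p) \<Longrightarrow> \<Theta> (\<phi> p) (pullback_connection M P g \<phi> p u V) \<bullet> \<Theta> (\<phi> p) z =
      (dmap M (\<lambda>x. \<Theta> (\<phi> x) (V x)) p u + \<Omega> (\<Theta> (\<phi> p) (dmap M \<phi> p u)) (\<Theta> (\<phi> p) (V p))) \<bullet> \<Theta> (\<phi> p) z"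
proof -
  have q: "\<phi> p \<in> P" using \<phi> p by blast
  let ?w = "\<lambda>n v F. (\<Sum>a<(n::nat). dmap M (v a) p u *\<^sub>R F a (\<phi> p)
                   + v a p *\<^sub>R levi_civita P g (\<phi> p) (dmap M \<phi> p u) (F a))"
  let ?rep = "\<lambda>(n::nat) v F. (\<forall>a<n. smooth_at M (v a) p \<and> vec_field_at P (\<phi> p) (F a)) \<and>
        (\<forall>\<^sub>F x in nhds p. x \<in> M \<longrightarrow> V x = (\<Sum>a<n. v a x *\<^sub>R F a (\<phi> x)))"
  have du: "dmap M \<phi> p u \<in> T (\<phi> p)" by (rule tangent_map[OF \<phi>(2,1) u])
  have char: "?w n v F \<in> T (\<phi> p) \<and> (\<forall>z\<in>T (\<phi> p). \<Theta> (\<phi> p) (?w n v F) \<bullet> \<Theta> (\<phi> p) z =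
      (dmap M (\<lambda>x. \<Theta> (\<phi> x) (V x)) p u + \<Omega> (\<Theta> (\<phi> p) (dmap M \<phi> p u)) (\<Theta> (\<phi> p) (V p))) \<bullet> \<Theta> (\<phi> p) z)"
    if r: "?rep n v F" for n v F
  proof (intro conjI ballI)
    have sv: "smooth_at M (v a) p" and Fa: "vec_field_at P (\<phi> p) (F a)" if "a < n" for a using r that by auto
    have Ft: "F a (\<phi> p) \<in> T (\<phi> p)" if "a < n" for a using vec_field_at_tangent[OF Fa[OF that] q] .
    have Lt: "levi_civita P g (\<phi> p) (dmap M \<phi> p u) (F a) \<in> T (\<phi> p)" if "a < n" for a
      by (rule levi_civita_tangent[OF du Fa[OF that]])
    show "?w n v F \<in> T (\<phi> p)"
      by (intro subspace_sum[OF sub[OF q]] subspace_add[OF sub[OF q]] subspace_scale[OF sub[OF q]]) (auto intro: Ft Lt)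
    have ev: "\<forall>\<^sub>F x in nhds p. x \<in> M \<longrightarrow> (\<forall>a<n. F a (\<phi> x) \<in> T (\<phi> x))"
    proof (rule eventually_pullback[OF \<phi>(2) p \<phi>(1)])
      have "\<forall>\<^sub>F y in nhds (\<phi> p). \<forall>a\<in>{..<n}. y \<in> P \<longrightarrow> F a y \<in> T y"
        by (intro eventually_ball_finite) (use Fa in \<open>auto simp: vec_field_at_def\<close>)
      then show "\<forall>\<^sub>F y in nhds (\<phi> p). y \<in> P \<longrightarrow> (\<forall>a<n. F a y \<in> T y)"
        by (rule eventually_mono) auto
    qed
    have Vp: "V p = (\<Sum>a<n. v a p *\<^sub>R F a (\<phi> p))"
      using r eventually_nhds_x_imp_x[of _ p] p by blast
    have cF: "((\<lambda>x. \<Theta> (\<phi> x) (F a (\<phi> x))) has_derivative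
        (\<lambda>w. dmap P (\<lambda>y. \<Theta> y (F a y)) (\<phi> p) (dmap M \<phi> p w))) (at p within M)" if "a < n" for a
      using diff_chain_within[OF dmap_has_derivative[OF \<phi>(2) p]
          has_derivative_subset[OF frame_has_derivative[OF q Fa[OF that]] \<phi>(1)]] by (simp add: comp_def)
    have "((\<lambda>x. \<Sum>a<n. v a x *\<^sub>R \<Theta> (\<phi> x) (F a (\<phi> x))) has_derivative
        (\<lambda>w. \<Sum>a<n. v a p *\<^sub>R dmap P (\<lambda>y. \<Theta> y (F a y)) (\<phi> p) (dmap M \<phi> p w)
            + dmap M (v a) p w *\<^sub>R \<Theta> (\<phi> p) (F a (\<phi> p)))) (at p within M)"
      by (intro has_derivative_sum has_derivative_scaleR cF dmap_has_derivative sv p) auto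
    then have "((\<lambda>x. \<Theta> (\<phi> x) (V x)) has_derivative
        (\<lambda>w. \<Sum>a<n. v a p *\<^sub>R dmap P (\<lambda>y. \<Theta> y (F a y)) (\<phi> p) (dmap M \<phi> p w)
            + dmap M (v a) p w *\<^sub>R \<Theta> (\<phi> p) (F a (\<phi> p)))) (at p within M)"
    proof (rule has_derivative_eq_on[OF _ p])
      have "\<forall>\<^sub>F x in nhds p. x \<in> M \<longrightarrow> V x = (\<Sum>a<n. v a x *\<^sub>R F a (\<phi> x))" using r by blast
      with ev show "\<forall>\<^sub>F x in nhds p. x \<in> M \<longrightarrow> \<Theta> (\<phi> x) (V x) = (\<Sum>a<n. v a x *\<^sub>R \<Theta> (\<phi> x) (F a (\<phi> x)))"
      proof eventually_elim
        case (elim x)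
        show ?case
        proof
          assume x: "x \<in> M"
          then have "\<phi> x \<in> P" using \<phi> by blast
          from linear_on_sub_sum[OF lin[OF this] sub[OF this], of "{..<n}" "\<lambda>a. F a (\<phi> x)" "\<lambda>a. v a x"]
          show "\<Theta> (\<phi> x) (V x) = (\<Sum>a<n. v a x *\<^sub>R \<Theta> (\<phi> x) (F a (\<phi> x)))" using elim x by simp
        qed
      qed
    qed
    from dmap_eq[OF u this] have d: "dmap M (\<lambda>x. \<Theta> (\<phi> x) (V x)) p u =
       (\<Sum>a<n. v a p *\<^sub>R dmap P (\<lambda>y. \<Theta> y (F a y)) (\<phi> p) (dmap M \<phi> p u)
            + dmap M (v a) p u *\<^sub>R \<Theta> (\<phi> p) (F a (\<phi> p)))" .
    have \<Theta>V: "\<Theta> (\<phi> p) (V p) = (\<Sum>a<n. v a p *\<^sub>R \<Theta> (\<phi> p) (F a (\<phi> p)))"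
      unfolding Vp by (intro linear_on_sub_sum[OF lin[OF q] sub[OF q]]) (auto intro: Ft)
    have bs: "\<Omega> x (\<Sum>a<n. c a *\<^sub>R y a) = (\<Sum>a<n. c a *\<^sub>R \<Omega> x (y a))" for x c y
    proof -
      have "linear (\<Omega> x)" using bil by (simp add: bilinear_def)
      then show ?thesis by (simp add: linear_sum linear_scale)
    qed
    fix z assume z: "z \<in> T (\<phi> p)"
    have "\<Theta> (\<phi> p) (?w n v F) = (\<Sum>a<n. 1 *\<^sub>R \<Theta> (\<phi> p) (dmap M (v a) p u *\<^sub>R F a (\<phi> p)
                   + v a p *\<^sub>R levi_civita P g (\<phi> p) (dmap M \<phi> p u) (F a)))"
      using linear_on_sub_sum[OF lin[OF q] sub[OF q], of "{..<n}" "\<lambda>a. dmap M (v a) p u *\<^sub>R F a (\<phi> p)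
                   + v a p *\<^sub>R levi_civita P g (\<phi> p) (dmap M \<phi> p u) (F a)" "\<lambda>_. 1"]
      by (simp add: Ft Lt subspace_add[OF sub[OF q]] subspace_scale[OF sub[OF q]])
    also have "\<dots> = (\<Sum>a<n. dmap M (v a) p u *\<^sub>R \<Theta> (\<phi> p) (F a (\<phi> p))
                   + v a p *\<^sub>R \<Theta> (\<phi> p) (levi_civita P g (\<phi> p) (dmap M \<phi> p u) (F a)))"
      by (intro sum.cong refl) (simp add: linear_on_subD[OF lin[OF q]] Ft Lt)
    finally have "\<Theta> (\<phi> p) (?w n v F) \<bullet> \<Theta> (\<phi> p) z = (\<Sum>a<n. dmap M (v a) p u * (\<Theta> (\<phi> p) (F a (\<phi> p)) \<bullet> \<Theta> (\<phi> p) z)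
         + v a p * (\<Theta> (\<phi> p) (levi_civita P g (\<phi> p) (dmap M \<phi> p u) (F a)) \<bullet> \<Theta> (\<phi> p) z))"
      by (simp add: inner_sum_left inner_add_left)
    also have "\<dots> = (\<Sum>a<n. dmap M (v a) p u * (\<Theta> (\<phi> p) (F a (\<phi> p)) \<bullet> \<Theta> (\<phi> p) z)
         + v a p * ((dmap P (\<lambda>y. \<Theta> y (F a y)) (\<phi> p) (dmap M \<phi> p u) +
              \<Omega> (\<Theta> (\<phi> p) (dmap M \<phi> p u)) (\<Theta> (\<phi> p) (F a (\<phi> p)))) \<bullet> \<Theta> (\<phi> p) z))"
      using levi_civita_inner[OF du Fa z] by (intro sum.cong refl) simp
    also have "\<dots> = (dmap M (\<lambda>x. \<Theta> (\<phi> x) (V x)) p u + \<Omega> (\<Theta> (\<phi> p) (dmap M \<phi> p u)) (\<Theta> (\<phi> p) (V p))) \<bullet> \<Theta> (\<phi> p) z"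
      unfolding d \<Theta>V bs by (simp add: inner_sum_left inner_add_left sum.distrib[symmetric] algebra_simps)
    finally show "\<Theta> (\<phi> p) (?w n v F) \<bullet> \<Theta> (\<phi> p) z = (dmap M (\<lambda>x. \<Theta> (\<phi> x) (V x)) p u
        + \<Omega> (\<Theta> (\<phi> p) (dmap M \<phi> p u)) (\<Theta> (\<phi> p) (V p))) \<bullet> \<Theta> (\<phi> p) z" .
  qed
  obtain n :: nat and F C where rC: "\<And>a. a < n \<Longrightarrow> vec_field_at P (\<phi> p) (F a)" "\<And>a. a < n \<Longrightarrow> smooth_on UNIV (C a)"
     "\<forall>\<^sub>F y in nhds (\<phi> p). y \<in> P \<longrightarrow> (\<forall>u\<in>T y. u = (\<Sum>a<n. C a (y, u) *\<^sub>R F a y))"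
    using rep[OF q] by auto
  define v where "v a x = C a (\<phi> x, V x)" for a x
  have rep0: "?rep n v F"
  proof (intro conjI allI impI)
    show "vec_field_at P (\<phi> p) (F a)" if "a < n" for a by (rule rC(1)[OF that])
    have "smooth_at M (\<lambda>x. (\<phi> x, 0::'a) + (0::'a, V x)) p"
      by (intro smooth_at_add smooth_at_linear[of "\<lambda>x. (x, 0)"] smooth_at_linear[of "\<lambda>x. (0, x)"] \<phi> V
          bounded_linear_Pair bounded_linear_ident bounded_linear_zero)
    then have "smooth_at M (\<lambda>x. (\<phi> x, V x)) p" by simp
    then show "smooth_at M (v a) p" if "a < n" for a
      unfolding v_def
      by (rule smooth_at_compose[OF _ p, of _ UNIV]) (use rC(2)[OF that] in \<open>auto intro: smooth_at_smooth_on\<close>)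
    show "\<forall>\<^sub>F x in nhds p. x \<in> M \<longrightarrow> V x = (\<Sum>a<n. v a x *\<^sub>R F a (\<phi> x))"
      using eventually_pullback[OF \<phi>(2) p \<phi>(1) rC(3)] V(2)
      unfolding v_def by eventually_elim blast
  qed
  have eq: "pullback_connection M P g \<phi> p u V = ?w n v F"
    unfolding pullback_connection_def
  proof (rule the_equality)
    show "\<forall>m v' F'. ?rep m v' F' \<longrightarrow> ?w n v F = ?w m v' F'"
    proof (intro allI impI)
      fix m v' F' assume r': "?rep m v' F'"
      show "?w n v F = ?w m v' F'"
        using char[OF rep0] char[OF r'] by (intro eq_of_inner[of _ "\<phi> p"]) auto
    qed
    show "w = ?w n v F" if "\<forall>m v' F'. ?rep m v' F' \<longrightarrow> w = ?w m v' F'" for w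
      using that rep0 by blast
  qed
  show "pullback_connection M P g \<phi> p u V \<in> T (\<phi> p)" "z \<in> T (\<phi> p) \<Longrightarrow> \<Theta> (\<phi> p) (pullback_connection M P g \<phi> p u V) \<bullet> \<Theta> (\<phi> p) z =
      (dmap M (\<lambda>x. \<Theta> (\<phi> x) (V x)) p u + \<Omega> (\<Theta> (\<phi> p) (dmap M \<phi> p u)) (\<Theta> (\<phi> p) (V p))) \<bullet> \<Theta> (\<phi> p) z"
    unfolding eq using char[OF rep0] by auto
qed

end

locale framed_map = M: framed M gM \<Theta>M \<Omega>M + P: framed_target P gP \<Theta> \<Omega>
  for M :: "'c::euclidean_space set" and gM and \<Theta>M :: "'c \<Rightarrow> 'c \<Rightarrow> 'd::euclidean_space" and \<Omega>M
    and P :: "'a::euclidean_space set" and gP and \<Theta> :: "'a \<Rightarrow> 'a \<Rightarrow> 'e::euclidean_space" and \<Omega> +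
  fixes \<phi> :: "'c \<Rightarrow> 'a"
  assumes image: "\<phi> ` M \<subseteq> P" and smooth: "\<And>p. p \<in> M \<Longrightarrow> smooth_at M \<phi> p"
begin

lemma in_P: "p \<in> M \<Longrightarrow> \<phi> p \<in> P" using image by blast

lemma d_tangent: "u \<in> tangent_space M p \<Longrightarrow> dmap M \<phi> p u \<in> tangent_space P (\<phi> p)"
  by (rule tangent_map[OF smooth image]) (auto dest: tangent_space_in)

lemma d_lin: "p \<in> M \<Longrightarrow> linear_on_sub T (dmap M \<phi> p)"
  by (rule dmap_linear_on[OF smooth])

lemma d_field_smooth: "p \<in> M \<Longrightarrow> vec_field_at M p Y \<Longrightarrow> smooth_at M (\<lambda>x. dmap M \<phi> x (Y x)) p"
  by (rule smooth_at_dmap[OF smooth])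

lemma d_field_tangent:
  "vec_field_at M p Y \<Longrightarrow> \<forall>\<^sub>F x in nhds p. x \<in> M \<longrightarrow> dmap M \<phi> x (Y x) \<in> tangent_space P (\<phi> x)"
  unfolding vec_field_at_def by (auto elim!: eventually_mono intro: d_tangent)

lemma d_field_has_derivative:
  assumes "p \<in> M" "vec_field_at M p Y"
  shows "((\<lambda>x. \<Theta> (\<phi> x) (dmap M \<phi> x (Y x))) has_derivative dmap M (\<lambda>x. \<Theta> (\<phi> x) (dmap M \<phi> x (Y x))) p) (at p within M)"
proof -
  have "\<exists>D. ((\<lambda>x. \<Theta> (\<phi> x) (dmap M \<phi> x (Y x))) has_derivative D) (at p within M)"
    using P.coframe_along[OF assms(1) image dmap_has_derivative[OF smooth[OF assms(1)] assms(1)]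
        dmap_has_derivative[OF d_field_smooth[OF assms] assms(1)] d_field_tangent[OF assms(2)]] by blast
  then show ?thesis unfolding dmap_def using frechet_derivative_works differentiable_def by metis
qed

text \<open>The part of \<open>nabla_d\<close>, in the coframe, that differentiates. The rest, the
  \<Omega> term, sees only the value \<open>Y p\<close>, so independence of the extension is a
  question about this part alone.\<close>

definition second_part :: "'c \<Rightarrow> 'c \<Rightarrow> ('c \<Rightarrow> 'c) \<Rightarrow> 'e" where
  "second_part p u Y = dmap M (\<lambda>x. \<Theta> (\<phi> x) (dmap M \<phi> x (Y x))) p u - \<Theta> (\<phi> p) (dmap M \<phi> p (levi_civita M gM p u Y))"

lemma second_part_comb:
  assumes u: "u \<in> tangent_space M p" and Y: "vec_field_at M p Y" "vec_field_at M p Z"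
  shows "second_part p u (\<lambda>x. a *\<^sub>R Y x + b *\<^sub>R Z x) = a *\<^sub>R second_part p u Y + b *\<^sub>R second_part p u Z"
proof -
  have p: "p \<in> M" using u tangent_space_in by blast
  have "((\<lambda>x. a *\<^sub>R \<Theta> (\<phi> x) (dmap M \<phi> x (Y x)) + b *\<^sub>R \<Theta> (\<phi> x) (dmap M \<phi> x (Z x))) has_derivative
     (\<lambda>u. a *\<^sub>R dmap M (\<lambda>x. \<Theta> (\<phi> x) (dmap M \<phi> x (Y x))) p u + b *\<^sub>R dmap M (\<lambda>x. \<Theta> (\<phi> x) (dmap M \<phi> x (Z x))) p u)) (at p within M)"
    by (intro has_derivative_add has_derivative_scaleR_right d_field_has_derivative p Y)
  then have "((\<lambda>x. \<Theta> (\<phi> x) (dmap M \<phi> x (a *\<^sub>R Y x + b *\<^sub>R Z x))) has_derivative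
     (\<lambda>u. a *\<^sub>R dmap M (\<lambda>x. \<Theta> (\<phi> x) (dmap M \<phi> x (Y x))) p u + b *\<^sub>R dmap M (\<lambda>x. \<Theta> (\<phi> x) (dmap M \<phi> x (Z x))) p u)) (at p within M)"
  proof (rule has_derivative_eq_on[OF _ p])
    show "\<forall>\<^sub>F x in nhds p. x \<in> M \<longrightarrow> \<Theta> (\<phi> x) (dmap M \<phi> x (a *\<^sub>R Y x + b *\<^sub>R Z x)) =
       a *\<^sub>R \<Theta> (\<phi> x) (dmap M \<phi> x (Y x)) + b *\<^sub>R \<Theta> (\<phi> x) (dmap M \<phi> x (Z x))"
      using M.vec_field_tangent_near[OF Y(1)] M.vec_field_tangent_near[OF Y(2)]
      by eventually_elim
        (auto simp: linear_on_subD[OF d_lin[of _ "tangent_space M _"]] linear_on_subD[OF P.lin] d_tangent in_P)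
  qed
  from dmap_eq[OF u this] show ?thesis
    unfolding second_part_def M.levi_civita_add[OF u Y]
    using M.levi_civita_tangent[OF u] Y d_lin[OF p, of "tangent_space M p"]
    by (simp add: linear_on_subD linear_on_subD[OF P.lin] d_tangent in_P[OF p] algebra_simps)
qed

text \<open>Both terms become the coframe of the differential of \<phi> on the derivative of
  \<open>Y\<close>. In the first, the second derivative of \<phi> is paired with
  \<open>Y p = 0\<close>; for the second, the Levi-Civita derivative at a zero is the plain
  one.\<close>

lemma second_part_vanishing:
  assumes u: "u \<in> tangent_space M p" and Y: "vec_field_at M p Y" "Y p = 0"
  shows "second_part p u Y = 0"
proof -
  have p: "p \<in> M" using u tangent_space_in by blast
  note lc = M.levi_civita_vanishing[OF u Y]
  obtain U F where U: "open U" "p \<in> U" "smooth_on U F" "\<forall>x\<in>M \<inter> U. \<phi> x = F x"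
    using smooth[OF p] unfolding smooth_at_def by blast
  have dF: "dmap M \<phi> x v = frechet_derivative F (at x) v" if "x \<in> M \<inter> U" "v \<in> tangent_space M x" for x v
  proof (rule dmap_eq[OF that(2)], rule has_derivative_eq_on)
    show "(F has_derivative frechet_derivative F (at x)) (at x within M)"
      by (rule has_derivative_at_withinI[OF smooth_on_has_derivative[OF U(3)]]) (use that in auto)
    show "\<forall>\<^sub>F y in nhds x. y \<in> M \<longrightarrow> \<phi> y = F y"
      unfolding eventually_nhds using U that by blast
  qed (use that in auto)
  have "((\<lambda>x. frechet_derivative F (at x) (Y x)) has_derivative
      (\<lambda>u. D2 F p u (Y p) + frechet_derivative F (at p) (dmap M Y p u))) (at p within M)"
    by (rule has_derivative_frechet[OF U(1,3,2) dmap_has_derivative[OF _ p]]) (use Y in \<open>simp add: vec_field_at_def\<close>)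
  then have "((\<lambda>x. dmap M \<phi> x (Y x)) has_derivative
      (\<lambda>u. D2 F p u (Y p) + frechet_derivative F (at p) (dmap M Y p u))) (at p within M)"
  proof (rule has_derivative_eq_on[OF _ p])
    have "\<forall>\<^sub>F x in nhds p. x \<in> U" using U by (intro eventually_nhds_in_open)
    with M.vec_field_tangent_near[OF Y(1)]
    show "\<forall>\<^sub>F x in nhds p. x \<in> M \<longrightarrow> dmap M \<phi> x (Y x) = frechet_derivative F (at x) (Y x)"
      by eventually_elim (use dF in auto)
  qed
  then have W: "dmap M (\<lambda>x. dmap M \<phi> x (Y x)) p u = D2 F p u 0 + frechet_derivative F (at p) (dmap M Y p u)"
    using dmap_eq[OF u] Y(2) by fastforce
  have W': "dmap M (\<lambda>x. dmap M \<phi> x (Y x)) p u = dmap M \<phi> p (dmap M Y p u)"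
    using W D2_zero_right[OF U(1,3,2)] dF[of p] p U(2) lc(2) by simp
  obtain D where D: "((\<lambda>x. \<Theta> (\<phi> x) (dmap M \<phi> x (Y x))) has_derivative D) (at p within M)"
    "dmap M \<phi> p (Y p) = 0 \<Longrightarrow> dmap M (\<lambda>x. dmap M \<phi> x (Y x)) p u \<in> tangent_space P (\<phi> p) \<Longrightarrow>
      D u = \<Theta> (\<phi> p) (dmap M (\<lambda>x. dmap M \<phi> x (Y x)) p u)"
    using P.coframe_along[OF p image dmap_has_derivative[OF smooth[OF p] p]
        dmap_has_derivative[OF d_field_smooth[OF p Y(1)] p] d_field_tangent[OF Y(1)]] by blast
  have "dmap M \<phi> p (Y p) = 0"
    using Y(2) linear_0[OF has_derivative_linear[OF dmap_has_derivative[OF smooth[OF p] p]]] by simp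
  then have "D u = \<Theta> (\<phi> p) (dmap M \<phi> p (dmap M Y p u))"
    using D(2) W' d_tangent[OF lc(2)] by simp
  then show ?thesis unfolding second_part_def using dmap_eq[OF u D(1)] lc(1) by simp
qed

lemma second_part_eq:
  assumes u: "u \<in> tangent_space M p" and Y: "vec_field_at M p Y" "vec_field_at M p Z" "Y p = Z p"
  shows "second_part p u Y = second_part p u Z"
proof -
  have "vec_field_at M p (\<lambda>x. 1 *\<^sub>R Y x + (-1) *\<^sub>R Z x)"
    using Y by (intro vec_field_at_add vec_field_at_scale smooth_at_const M.sub)
  then have "second_part p u (\<lambda>x. 1 *\<^sub>R Y x + (-1) *\<^sub>R Z x) = 0"
    by (rule second_part_vanishing[OF u]) (simp add: Y(3))
  then show ?thesis unfolding second_part_comb[OF u Y(1,2)] by simp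
qed

text \<open>By \<open>second_part_eq\<close> the defining expression is the same for all extensions
  of \<open>Y p\<close>, so the definite description has a value; it is then determined by its inner
  products with the coframe.\<close>

lemma nabla_d:
  assumes u: "u \<in> tangent_space M p" and Y: "vec_field_at M p Y"
  shows "nabla_d M gM P gP \<phi> p u (Y p) \<in> tangent_space P (\<phi> p)"
    and "z \<in> tangent_space P (\<phi> p) \<Longrightarrow> \<Theta> (\<phi> p) (nabla_d M gM P gP \<phi> p u (Y p)) \<bullet> \<Theta> (\<phi> p) z =
      (second_part p u Y + \<Omega> (\<Theta> (\<phi> p) (dmap M \<phi> p u)) (\<Theta> (\<phi> p) (dmap M \<phi> p (Y p)))) \<bullet> \<Theta> (\<phi> p) z"
proof -
  have p: "p \<in> M" using u tangent_space_in by blast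
  let ?w = "\<lambda>Y. pullback_connection M P gP \<phi> p u (\<lambda>x. dmap M \<phi> x (Y x)) - dmap M \<phi> p (levi_civita M gM p u Y)"
  have char: "?w Z \<in> tangent_space P (\<phi> p) \<and> (\<forall>z\<in>tangent_space P (\<phi> p). \<Theta> (\<phi> p) (?w Z) \<bullet> \<Theta> (\<phi> p) z =
      (second_part p u Z + \<Omega> (\<Theta> (\<phi> p) (dmap M \<phi> p u)) (\<Theta> (\<phi> p) (dmap M \<phi> p (Z p)))) \<bullet> \<Theta> (\<phi> p) z)"
    if Z: "vec_field_at M p Z" for Z
  proof -
    note pb = P.pullback_along[OF image smooth[OF p] p u d_field_smooth[OF p Z] d_field_tangent[OF Z]]
    note t = d_tangent[OF M.levi_civita_tangent[OF u Z]]
    show ?thesis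
      using pb t by (auto simp: second_part_def subspace_diff[OF P.sub[OF in_P[OF p]]]
          linear_on_sub_diff[OF P.lin[OF in_P[OF p]]] inner_diff_left inner_add_left)
  qed
  have eq: "nabla_d M gM P gP \<phi> p u (Y p) = ?w Y"
    unfolding nabla_d_def
  proof (rule the_equality)
    show "\<forall>Z. vec_field_at M p Z \<and> Z p = Y p \<longrightarrow> ?w Y = ?w Z"
    proof (intro allI impI)
      fix Z assume Z: "vec_field_at M p Z \<and> Z p = Y p"
      then have "second_part p u Z = second_part p u Y" using second_part_eq[OF u _ Y] by blast
      then show "?w Y = ?w Z"
        using char[of Z] char[OF Y] Z by (intro P.eq_of_inner[of _ "\<phi> p"]) auto
    qed
    show "w = ?w Y" if "\<forall>Z. vec_field_at M p Z \<and> Z p = Y p \<longrightarrow> w = ?w Z" for w using that Y by blast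
  qed
  show "nabla_d M gM P gP \<phi> p u (Y p) \<in> tangent_space P (\<phi> p)"
    "z \<in> tangent_space P (\<phi> p) \<Longrightarrow> \<Theta> (\<phi> p) (nabla_d M gM P gP \<phi> p u (Y p)) \<bullet> \<Theta> (\<phi> p) z =
      (second_part p u Y + \<Omega> (\<Theta> (\<phi> p) (dmap M \<phi> p u)) (\<Theta> (\<phi> p) (dmap M \<phi> p (Y p)))) \<bullet> \<Theta> (\<phi> p) z"
    unfolding eq using char[OF Y] by auto
qed

lemma nabla_d_tangent:
  "u \<in> tangent_space M p \<Longrightarrow> v \<in> tangent_space M p \<Longrightarrow> nabla_d M gM P gP \<phi> p u v \<in> tangent_space P (\<phi> p)"
  using M.ext nabla_d(1) by metis

lemma nabla_d_lin_left:
  assumes v: "v \<in> tangent_space M p"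
  shows "linear_on_sub (tangent_space M p) (\<lambda>u. nabla_d M gM P gP \<phi> p u v)"
  unfolding linear_on_sub_def
proof (intro ballI allI)
  fix u u' a b assume u: "u \<in> tangent_space M p" "u' \<in> tangent_space M p"
  have p: "p \<in> M" using v tangent_space_in by blast
  obtain Y where Y: "vec_field_at M p Y" "Y p = v" using M.ext[OF v] by blast
  have w: "a *\<^sub>R u + b *\<^sub>R u' \<in> tangent_space M p"
    using u M.sub[OF p] by (simp add: subspace_add subspace_scale)
  have L: "levi_civita M gM p (a *\<^sub>R u + b *\<^sub>R u') Y = a *\<^sub>R levi_civita M gM p u Y + b *\<^sub>R levi_civita M gM p u' Y"
    using M.is_levi_civita_levi_civita p u Y(1) unfolding is_levi_civita_def by blast
  have sp: "second_part p (a *\<^sub>R u + b *\<^sub>R u') Y = a *\<^sub>R second_part p u Y + b *\<^sub>R second_part p u' Y"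
    unfolding second_part_def L
    using has_derivative_linear[OF d_field_has_derivative[OF p Y(1)]]
      M.levi_civita_tangent[OF u(1) Y(1)] M.levi_civita_tangent[OF u(2) Y(1)] d_lin[OF p, of "tangent_space M p"]
    by (simp add: linear_add linear_scale linear_on_subD linear_on_subD[OF P.lin] d_tangent in_P[OF p] algebra_simps)
  show "nabla_d M gM P gP \<phi> p (a *\<^sub>R u + b *\<^sub>R u') v = a *\<^sub>R nabla_d M gM P gP \<phi> p u v + b *\<^sub>R nabla_d M gM P gP \<phi> p u' v"
  proof (rule P.eq_of_inner[of _ "\<phi> p"])
    note t = nabla_d_tangent[OF u(1) v] nabla_d_tangent[OF u(2) v]
    show "nabla_d M gM P gP \<phi> p (a *\<^sub>R u + b *\<^sub>R u') v \<in> tangent_space P (\<phi> p)" by (rule nabla_d_tangent[OF w v])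
    show "a *\<^sub>R nabla_d M gM P gP \<phi> p u v + b *\<^sub>R nabla_d M gM P gP \<phi> p u' v \<in> tangent_space P (\<phi> p)"
      using t P.sub[OF in_P[OF p]] by (simp add: subspace_add subspace_scale)
    fix z assume z: "z \<in> tangent_space P (\<phi> p)"
    show "\<Theta> (\<phi> p) (nabla_d M gM P gP \<phi> p (a *\<^sub>R u + b *\<^sub>R u') v) \<bullet> \<Theta> (\<phi> p) z =
      \<Theta> (\<phi> p) (a *\<^sub>R nabla_d M gM P gP \<phi> p u v + b *\<^sub>R nabla_d M gM P gP \<phi> p u' v) \<bullet> \<Theta> (\<phi> p) z"
      using nabla_d(2)[OF w Y(1) z] nabla_d(2)[OF u(1) Y(1) z] nabla_d(2)[OF u(2) Y(1) z] t
      by (simp add: Y(2) sp linear_on_subD[OF d_lin[OF p] u] linear_on_subD[OF P.lin[OF in_P[OF p]]] d_tangent u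
          P.bil_simps inner_add_left algebra_simps)
  qed
qed

lemma nabla_d_lin_right:
  assumes u: "u \<in> tangent_space M p"
  shows "linear_on_sub (tangent_space M p) (nabla_d M gM P gP \<phi> p u)"
  unfolding linear_on_sub_def
proof (intro ballI allI)
  fix v v' a b assume v: "v \<in> tangent_space M p" "v' \<in> tangent_space M p"
  have p: "p \<in> M" using u tangent_space_in by blast
  obtain Y where Y: "vec_field_at M p Y" "Y p = v" using M.ext[OF v(1)] by blast
  obtain Y' where Y': "vec_field_at M p Y'" "Y' p = v'" using M.ext[OF v(2)] by blast
  have S: "vec_field_at M p (\<lambda>x. a *\<^sub>R Y x + b *\<^sub>R Y' x)"
    using Y Y' by (intro vec_field_at_add vec_field_at_scale smooth_at_const M.sub)
  show "nabla_d M gM P gP \<phi> p u (a *\<^sub>R v + b *\<^sub>R v') = a *\<^sub>R nabla_d M gM P gP \<phi> p u v + b *\<^sub>R nabla_d M gM P gP \<phi> p u v'"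
  proof (rule P.eq_of_inner[of _ "\<phi> p"])
    note t = nabla_d_tangent[OF u v(1)] nabla_d_tangent[OF u v(2)]
    show "nabla_d M gM P gP \<phi> p u (a *\<^sub>R v + b *\<^sub>R v') \<in> tangent_space P (\<phi> p)"
      using nabla_d(1)[OF u S] by (simp add: Y Y')
    show "a *\<^sub>R nabla_d M gM P gP \<phi> p u v + b *\<^sub>R nabla_d M gM P gP \<phi> p u v' \<in> tangent_space P (\<phi> p)"
      using t P.sub[OF in_P[OF p]] by (simp add: subspace_add subspace_scale)
    fix z assume z: "z \<in> tangent_space P (\<phi> p)"
    show "\<Theta> (\<phi> p) (nabla_d M gM P gP \<phi> p u (a *\<^sub>R v + b *\<^sub>R v')) \<bullet> \<Theta> (\<phi> p) z =
      \<Theta> (\<phi> p) (a *\<^sub>R nabla_d M gM P gP \<phi> p u v + b *\<^sub>R nabla_d M gM P gP \<phi> p u v') \<bullet> \<Theta> (\<phi> p) z"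
      using nabla_d(2)[OF u S z] nabla_d(2)[OF u Y(1) z] nabla_d(2)[OF u Y'(1) z] t
      by (simp add: Y(2) Y'(2) second_part_comb[OF u Y(1) Y'(1)] linear_on_subD[OF d_lin[OF p] v]
          linear_on_subD[OF P.lin[OF in_P[OF p]]] d_tangent v P.bil_simps inner_add_left algebra_simps)
  qed
qed

lemma tension_field_eq:
  assumes "p \<in> M" "orthonormal_basis M gM p B"
  shows "tension_field M gM P gP \<phi> p = (\<Sum>b\<in>B. nabla_d M gM P gP \<phi> p b b)"
  unfolding tension_field_def
  by (rule M.metric_trace_eq[OF assms nabla_d_lin_right nabla_d_lin_left])

end

section \<open>The left-invariant geometry of \<open>SL(2,\<real>)\<close>\<close>

unbundle cross3_syntax

lemma mat22_nth [simp]: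
  "mat22 a b c d $ 1 $ 1 = a" "mat22 a b c d $ 1 $ 2 = b" "mat22 a b c d $ 2 $ 1 = c" "mat22 a b c d $ 2 $ 2 = d"
  by (simp_all add: mat22_def)

lemma mult22_nth: "((A::real^2^2) ** B) $ i $ j = A $ i $ 1 * B $ 1 $ j + A $ i $ 2 * B $ 2 $ j"
  by (simp add: matrix_matrix_mult_def sum_2)

lemma eq22_iff: "(A::'a^2^2) = B \<longleftrightarrow> A$1$1 = B$1$1 \<and> A$1$2 = B$1$2 \<and> A$2$1 = B$2$1 \<and> A$2$2 = B$2$2"
  by (simp add: vec_eq_iff forall_2)

lemma eq3_iff: "(x::'a^3) = y \<longleftrightarrow> x$1 = y$1 \<and> x$2 = y$2 \<and> x$3 = y$3"
  by (simp add: vec_eq_iff forall_3)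

lemma inner3: "(x::real^3) \<bullet> y = x$1 * y$1 + x$2 * y$2 + x$3 * y$3"
  by (simp add: inner_vec_def sum_3)

lemma bounded_bilinear_matrix_mult: "bounded_bilinear ((**) :: real^'n^'m \<Rightarrow> real^'k^'n \<Rightarrow> real^'k^'m)"
  unfolding bilinear_conv_bounded_bilinear[symmetric] bilinear_def
  by (auto intro!: linearI simp: vec_eq_iff matrix_matrix_mult_def sum.distrib algebra_simps sum_distrib_left)

lemmas matrix_mult_add = bounded_bilinear.add_left[OF bounded_bilinear_matrix_mult]
  bounded_bilinear.add_right[OF bounded_bilinear_matrix_mult]

text \<open>The adjugate agrees with the inverse on \<open>SL2R\<close> but is linear in
  \<open>q\<close>. The Maurer-Cartan form written with it is a bilinear map on all pairs of
  matrices, which makes its derivatives immediate.\<close>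

definition adj22 :: "real^2^2 \<Rightarrow> real^2^2" where
  "adj22 q = mat22 (q$2$2) (- q$1$2) (- q$2$1) (q$1$1)"

lemma adj22_mult: "adj22 q ** q = mat (det q)" "q ** adj22 q = mat (det q)"
  by (auto simp: adj22_def eq22_iff mult22_nth det_2 mat_def)

lemma adj22_prod: "adj22 (a ** b) = adj22 b ** adj22 a"
  by (auto simp: adj22_def eq22_iff mult22_nth algebra_simps)

lemma linear_adj22: "linear adj22"
  by (rule linearI) (auto simp: adj22_def eq22_iff)

definition dg :: "real^3 \<Rightarrow> real^3 \<Rightarrow> real^3" where
  "dg m x = (\<chi> i. m $ i * x $ i)"

lemma dg_nth [simp]: "dg m x $ i = m $ i * x $ i"
  by (simp add: dg_def)

lemma linear_dg: "linear (dg m)"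
  by (rule linearI) (auto simp: vec_eq_iff algebra_simps)

lemma bounded_bilinear_cross3: "bounded_bilinear cross3"
  using bilinear_cross by (simp add: bilinear_conv_bounded_bilinear)

section \<open>The group as a level set of the determinant\<close>

definition det22 :: "real^2^2 \<Rightarrow> real" where
  "det22 q = q$1$1 * q$2$2 - q$1$2 * q$2$1"

lemma has_derivative_nth22 [derivative_intros]:
  "(f has_derivative f') F \<Longrightarrow> ((\<lambda>x. f x $ i $ j) has_derivative (\<lambda>u. f' u $ i $ j)) F"
  for f :: "'a::real_normed_vector \<Rightarrow> real^'n^'m"
  by (intro bounded_linear.has_derivative[OF bounded_linear_vec_nth])

lemma det22_has_derivative:
  "(det22 has_derivative (\<lambda>v. v$1$1 * q$2$2 + q$1$1 * v$2$2 - v$1$2 * q$2$1 - q$1$2 * v$2$1)) (at q within S)"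
  unfolding det22_def by (auto intro!: derivative_eq_intros)

lemma bounded_linear_nth22: "bounded_linear (\<lambda>q::real^'n^'m. q $ i $ j)"
  by (intro bounded_linear_compose[OF bounded_linear_vec_nth] bounded_linear_vec_nth)

lemma smooth_on_det22: "smooth_on UNIV det22"
proof -
  have "smooth_on UNIV (\<lambda>q::real^2^2. q$1$1 * q$2$2 + - (q$1$2 * q$2$1))"
    by (intro smooth_on_add smooth_on_linear[OF _ bounded_linear_minus[OF bounded_linear_ident]]
        smooth_on_bilinear[OF _ bounded_bilinear_mult] smooth_on_bounded_linear bounded_linear_nth22) simp_all
  then show ?thesis by (simp add: det22_def[abs_def])
qed

lemma SL2R_det22: "q \<in> SL2R \<longleftrightarrow> det22 q = 1"
  by (simp add: SL2R_def det_2 det22_def mult.commute)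

text \<open>A trace-free matrix is a sum of three nilpotent ones, so a polynomial curve has the
  prescribed velocity and no matrix exponential is needed.\<close>

definition unipotent_curve :: "real^2^2 \<Rightarrow> real^2^2 \<Rightarrow> real \<Rightarrow> real^2^2" where
  "unipotent_curve q s t = q ** (mat 1 + t *\<^sub>R (s$1$1 *\<^sub>R mat22 1 (-1) 1 (-1)))
     ** (mat 1 + t *\<^sub>R ((s$1$2 + s$1$1) *\<^sub>R mat22 0 1 0 0)) ** (mat 1 + t *\<^sub>R ((s$2$1 - s$1$1) *\<^sub>R mat22 0 0 1 0))"

lemma unipotent_curve_SL2R:
  assumes "q \<in> SL2R"
  shows "unipotent_curve q s t \<in> SL2R"
proof -
  have "det (mat 1 + t *\<^sub>R (a *\<^sub>R mat22 1 (-1) 1 (-1)) :: real^2^2) = 1" "det (mat 1 + t *\<^sub>R (a *\<^sub>R mat22 0 1 0 0) :: real^2^2) = 1"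
    "det (mat 1 + t *\<^sub>R (a *\<^sub>R mat22 0 0 1 0) :: real^2^2) = 1" for a
    by (simp_all add: det_2 mat_def algebra_simps)
  then show ?thesis using assms by (simp add: SL2R_def unipotent_curve_def det_mul)
qed

lemma smooth_unipotent_curve: "smooth_on UNIV (unipotent_curve q s)"
proof -
  have b: "smooth_on UNIV (\<lambda>t::real. mat 1 + t *\<^sub>R A)" for A :: "real^2^2"
    by (intro smooth_on_add smooth_on_const smooth_on_bounded_linear bounded_linear_scaleR_left) simp_all
  show ?thesis
    unfolding unipotent_curve_def[abs_def]
    by (intro smooth_on_bilinear[OF _ bounded_bilinear_matrix_mult] b smooth_on_const) simp_all
qed

lemma unipotent_curve_derivative:
  assumes "s$1$1 + s$2$2 = 0"
  shows "(unipotent_curve q s has_vector_derivative (q ** s)) (at 0)"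
proof -
  have b: "((\<lambda>t::real. mat 1 + t *\<^sub>R A) has_vector_derivative A) (at 0)" for A :: "real^2^2"
    by (auto intro!: derivative_eq_intros)
  note m = bounded_bilinear.has_vector_derivative[OF bounded_bilinear_matrix_mult]
  let ?A = "s$1$1 *\<^sub>R mat22 1 (-1) 1 (-1)" and ?B = "(s$1$2 + s$1$1) *\<^sub>R mat22 0 1 0 0"
    and ?C = "(s$2$1 - s$1$1) *\<^sub>R mat22 0 0 1 0"
  \<comment> \<open>\<open>?A\<close> carries the diagonal of \<open>s\<close>; \<open>?B\<close>
    and \<open>?C\<close> correct the two off-diagonal entries that \<open>?A\<close> brings
    along.\<close>
  have "s$2$2 = - s$1$1" using assms by simp
  then have s: "s = ?C + (?B + ?A)" by (simp add: eq22_iff)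
  let ?D = "q ** (mat 1 + 0 *\<^sub>R ?A) ** (mat 1 + 0 *\<^sub>R ?B) ** ?C +
     (q ** (mat 1 + 0 *\<^sub>R ?A) ** ?B + (q ** ?A + 0 ** (mat 1 + 0 *\<^sub>R ?A)) ** (mat 1 + 0 *\<^sub>R ?B)) ** (mat 1 + 0 *\<^sub>R ?C)"
  have "(unipotent_curve q s has_vector_derivative ?D) (at 0)"
    unfolding unipotent_curve_def[abs_def] by (intro m b has_vector_derivative_const)
  moreover have "?D = q ** (?C + (?B + ?A))"
    by (simp add: matrix_mult_add del: scaleR_right_diff_distrib)
  ultimately show ?thesis using s by simp
qed

text \<open>The determinant is constant on \<open>SL2R\<close>, so its derivative kills tangent
  vectors. Conversely a vector of the kernel is \<open>q ** s\<close> with trace-free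
  \<open>s\<close>, which is the velocity of \<open>unipotent_curve\<close>.\<close>

lemma tangent_space_SL2R:
  assumes "q \<in> SL2R"
  shows "tangent_space SL2R q = {v. frechet_derivative det22 (at q) v \<in> {0}}"
proof -
  have fd: "frechet_derivative det22 (at q) v = v$1$1 * q$2$2 + q$1$1 * v$2$2 - v$1$2 * q$2$1 - q$1$2 * v$2$1" for v
    using fun_cong[OF frechet_derivative_at[OF det22_has_derivative[of q UNIV]], of v] by simp
  show ?thesis
  proof (intro set_eqI iffI)
    fix u assume u: "u \<in> tangent_space SL2R q"
    have "(det22 has_derivative (\<lambda>u. 0)) (at q within SL2R)"
      by (rule has_derivative_eq_on[OF has_derivative_const[of 1] assms]) (simp add: SL2R_det22)
    then show "u \<in> {v. frechet_derivative det22 (at q) v \<in> {0}}"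
      using tangent_derivative_unique[OF u det22_has_derivative \<open>(det22 has_derivative (\<lambda>u. 0)) (at q within SL2R)\<close>]
      by (simp only: fd mem_Collect_eq singleton_iff)
  next
    fix u assume "u \<in> {v. frechet_derivative det22 (at q) v \<in> {0}}"
    then have d: "u$1$1 * q$2$2 + q$1$1 * u$2$2 - u$1$2 * q$2$1 - q$1$2 * u$2$1 = 0" by (simp add: fd)
    define s where "s = adj22 q ** u"
    have tr: "s$1$1 + s$2$2 = 0" using d by (simp add: s_def adj22_def mult22_nth algebra_simps)
    have qs: "q ** s = u"
      using assms by (simp add: s_def matrix_mul_assoc adj22_mult SL2R_def)
    show "u \<in> tangent_space SL2R q"
    proof (rule tangent_spaceI[of 1 "unipotent_curve q s"])
      show "smooth_on {-1<..<1} (unipotent_curve q s)" by (rule smooth_on_subset[OF smooth_unipotent_curve]) simp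
      show "unipotent_curve q s ` {- 1<..<1} \<subseteq> SL2R" using unipotent_curve_SL2R[OF assms] by auto
      show "unipotent_curve q s 0 = q" by (simp add: unipotent_curve_def)
      show "(unipotent_curve q s has_vector_derivative u) (at 0)" using unipotent_curve_derivative[OF tr] qs by metis
    qed simp
  qed
qed

lemma regular_SL2R: "regular_at SL2R q det22 {0} UNIV"
  by (simp add: regular_at_def smooth_on_det22 tangent_space_SL2R)

lemma SL2R_tangent_iff:
  assumes "q \<in> SL2R"
  shows "u \<in> tangent_space SL2R q \<longleftrightarrow> (adj22 q ** u)$1$1 + (adj22 q ** u)$2$2 = 0"
proof -
  have "frechet_derivative det22 (at q) u = u$1$1 * q$2$2 + q$1$1 * u$2$2 - u$1$2 * q$2$1 - q$1$2 * u$2$1"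
    using fun_cong[OF frechet_derivative_at[OF det22_has_derivative[of q UNIV]], of u] by simp
  then show ?thesis
    unfolding tangent_space_SL2R[OF assms] by (auto simp: adj22_def mult22_nth algebra_simps)
qed

section \<open>Left-invariant frame and coframe\<close>

locale sl2 =
  fixes l1 l2 l3 :: real
  assumes l_pos: "l1 > 0" "l2 > 0" "l3 > 0"
begin

definition e where "e = sl2_frame l1 l2 l3"
definition g where "g = frame_metric e"

text \<open>Frame coordinates of an element of the Lie algebra, inverse to \<open>gen\<close> on
  trace-free matrices. The formula kills the identity matrix and so is a linear extension to all
  matrices.\<close>

definition crd :: "real^2^2 \<Rightarrow> real^3" where
  "crd s = vector [l2 * l3 * (s$2$2 - s$1$1) / 2, l3 * l1 * (s$1$2 + s$2$1) / 2, l1 * l2 * (s$1$2 - s$2$1) / 2]"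

definition gen :: "real^3 \<Rightarrow> real^2^2" where
  "gen y = mat22 (- (y$1 / (l2 * l3))) (y$2 / (l3 * l1) + y$3 / (l1 * l2)) (y$2 / (l3 * l1) - y$3 / (l1 * l2)) (y$1 / (l2 * l3))"

definition E :: "real^3 \<Rightarrow> real^2^2 \<Rightarrow> real^2^2" where "E y q = q ** gen y"

definition \<theta> :: "real^2^2 \<Rightarrow> real^2^2 \<Rightarrow> real^3" where "\<theta> q u = crd (adj22 q ** u)"

definition c :: "real^3" where "c = vector [2 / l1\<^sup>2, 2 / l2\<^sup>2, - 2 / l3\<^sup>2]"
text \<open>Milnor's constants of a left-invariant metric on a unimodular group;
  \<open>dg_\<mu>_cross\<close> shows what forces these values.\<close>

definition \<mu> :: "real^3" where "\<mu> = (\<chi> i. (c$1 + c$2 + c$3) / 2 - c$i)"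

lemma linear_crd: "linear crd"
  by (rule linearI) (auto simp: crd_def eq3_iff field_simps)

lemma crd_gen: "crd (gen y) = y"
  using l_pos by (auto simp: crd_def gen_def eq3_iff field_simps)

lemma gen_crd: "s$1$1 + s$2$2 = 0 \<Longrightarrow> gen (crd s) = s"
  using l_pos by (auto simp: crd_def gen_def eq22_iff field_simps add_eq_0_iff)

lemma bounded_bilinear_\<theta>: "bounded_bilinear \<theta>"
  unfolding \<theta>_def[abs_def] bilinear_conv_bounded_bilinear[symmetric] bilinear_def
proof (intro conjI allI)
  have r: "linear (\<lambda>u. a ** u :: real^2^2)" and l: "linear (\<lambda>u. u ** a)" for a :: "real^2^2"
    using bounded_bilinear.bounded_linear_right[OF bounded_bilinear_matrix_mult]
      bounded_bilinear.bounded_linear_left[OF bounded_bilinear_matrix_mult] by (simp_all add: linear_conv_bounded_linear)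
  show "linear (\<lambda>u. crd (adj22 x ** u))" for x
    using linear_compose[OF r[of "adj22 x"] linear_crd] by (simp add: comp_def)
  show "linear (\<lambda>x. crd (adj22 x ** u))" for u
    using linear_compose[OF linear_compose[OF linear_adj22 l[of u]] linear_crd] by (simp add: comp_def)
qed

lemma E_sum: "E y q = (\<Sum>i\<in>UNIV. y $ i *\<^sub>R e i q)"
  by (simp add: E_def e_def sum_3 sl2_frame_def sl2_basis_def gen_def eq22_iff mult22_nth algebra_simps
      add_divide_distrib diff_divide_distrib)

lemma e_E: "e i q = E (axis i 1) q"
  unfolding E_sum axis_def by (simp add: if_distrib[of "\<lambda>a. a *\<^sub>R _"] cong: if_cong)

lemma linear_E_left: "linear (\<lambda>y. E y q)"
  unfolding E_sum by (rule linearI) (simp_all add: sum.distrib scaleR_add_left scaleR_sum_right)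

lemma linear_E_right: "linear (E y)"
  unfolding E_def[abs_def]
  using bounded_bilinear.bounded_linear_left[OF bounded_bilinear_matrix_mult] linear_conv_bounded_linear by blast

lemma E_tangent: "q \<in> SL2R \<Longrightarrow> E y q \<in> tangent_space SL2R q"
proof -
  assume q: "q \<in> SL2R"
  then have "adj22 q ** E y q = gen y" by (simp add: E_def matrix_mul_assoc adj22_mult SL2R_def)
  then show ?thesis using SL2R_tangent_iff[OF q] by (simp add: gen_def)
qed

lemma \<theta>_E: "q \<in> SL2R \<Longrightarrow> \<theta> q (E y q) = y"
  by (simp add: \<theta>_def E_def matrix_mul_assoc adj22_mult SL2R_def crd_gen)

lemma E_\<theta>: "u \<in> tangent_space SL2R q \<Longrightarrow> E (\<theta> q u) q = u"
proof -
  assume u: "u \<in> tangent_space SL2R q"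
  have q: "q \<in> SL2R" using u tangent_space_in by blast
  have "gen (crd (adj22 q ** u)) = adj22 q ** u" using u SL2R_tangent_iff[OF q] gen_crd by blast
  then show ?thesis using q by (simp add: E_def \<theta>_def matrix_mul_assoc adj22_mult SL2R_def)
qed

lemma frame_coords_\<theta>: "u \<in> tangent_space SL2R q \<Longrightarrow> frame_coords e q u = \<theta> q u"
  unfolding frame_coords_def E_sum[symmetric]
proof (rule the_equality)
  assume u: "u \<in> tangent_space SL2R q"
  show "u = E (\<theta> q u) q" using E_\<theta>[OF u] by simp
  show "x = \<theta> q u" if "u = E x q" for x using \<theta>_E[OF tangent_space_in[OF u], of x] that by simp
qed

lemma g_\<theta>: "u \<in> tangent_space SL2R q \<Longrightarrow> v \<in> tangent_space SL2R q \<Longrightarrow> g q u v = \<theta> q u \<bullet> \<theta> q v"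
  by (simp add: g_def frame_metric_def frame_coords_\<theta> inner_vec_def)

text \<open>Vanishing torsion in frame coordinates. In components it says that any two entries of
  \<mu> add up to the remaining entry of \<open>c\<close>, and these three equations determine
  \<mu>.\<close>

lemma dg_\<mu>_cross: "dg \<mu> y \<times> z - dg \<mu> z \<times> y = dg c (y \<times> z)"
  by (simp add: eq3_iff cross_components \<mu>_def field_simps)

text \<open>Maurer-Cartan equation. As \<theta> is bilinear, \<open>\<theta> u v\<close> is its
  derivative in the base point along \<open>u\<close>, so the left side is the exterior derivative
  on \<open>u\<close> and \<open>v\<close>. Left invariance, in the form of \<open>m\<close>,
  reduces the claim to a computation in the Lie algebra.\<close>

lemma \<theta>_structure:
  assumes "u \<in> tangent_space SL2R q" "v \<in> tangent_space SL2R q"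
  shows "\<theta> u v - \<theta> v u = - dg c (\<theta> q u \<times> \<theta> q v)"
proof -
  have q: "q \<in> SL2R" using assms(1) tangent_space_in by blast
  define y z where "y = \<theta> q u" and "z = \<theta> q v"
  have uv: "u = q ** gen y" "v = q ** gen z"
    using E_\<theta>[OF assms(1)] E_\<theta>[OF assms(2)] by (simp_all add: y_def z_def E_def)
  have m: "adj22 (q ** a) ** (q ** b) = adj22 a ** b" for a b
  proof -
    have "adj22 (q ** a) ** (q ** b) = adj22 a ** (adj22 q ** q) ** b" by (simp add: adj22_prod matrix_mul_assoc)
    then show ?thesis using q by (simp add: adj22_mult SL2R_def)
  qed
  have "\<theta> u v - \<theta> v u = crd (adj22 (gen y) ** gen z) - crd (adj22 (gen z) ** gen y)"
    unfolding uv \<theta>_def m ..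
  also have "\<dots> = - dg c (y \<times> z)"
    using l_pos by (simp add: eq3_iff cross_components c_def crd_def gen_def adj22_def mult22_nth field_simps power2_eq_square)
  finally show ?thesis by (simp add: y_def z_def)
qed

definition \<Omega> :: "real^3 \<Rightarrow> real^3 \<Rightarrow> real^3" where "\<Omega> x w = dg \<mu> x \<times> w"

lemma bilinear_\<Omega>: "bilinear \<Omega>"
proof -
  have "bounded_bilinear (\<lambda>x w. dg \<mu> x \<times> w)"
    by (rule bounded_bilinear.comp1[OF bounded_bilinear_cross3 linear_dg[unfolded linear_conv_bounded_linear]])
  then show ?thesis by (simp add: bilinear_conv_bounded_bilinear \<Omega>_def[abs_def])
qed

lemma \<Omega>_skew: "\<Omega> x y \<bullet> z = - (y \<bullet> \<Omega> x z)"
  by (simp add: \<Omega>_def inner3 cross_components algebra_simps)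

lemma E_field: "q \<in> SL2R \<Longrightarrow> vec_field_at SL2R q (E y)"
  unfolding vec_field_at_def
  using smooth_at_bounded_linear[OF linear_E_right[unfolded linear_conv_bounded_linear]]
  by (auto intro: always_eventually simp: E_tangent)

sublocale SL: framed_target SL2R g \<theta> \<Omega>
proof
  show "g p u v = \<theta> p u \<bullet> \<theta> p v" if "u \<in> tangent_space SL2R p" "v \<in> tangent_space SL2R p" for p u v
    by (rule g_\<theta>[OF that])
  show "u = 0" if "u \<in> tangent_space SL2R p" "\<theta> p u = 0" for p u
    using E_\<theta>[OF that(1)] that(2) linear_0[OF linear_E_left] by simp
  show "subspace (tangent_space SL2R p)" if "p \<in> SL2R" for p
    by (rule regular_at_subspace[OF regular_SL2R that])
  show "\<exists>Y. vec_field_at SL2R p Y \<and> Y p = v" if "v \<in> tangent_space SL2R p" for p v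
    using E_field E_\<theta>[OF that] tangent_space_in[OF that] by blast
  show "lie_bracket SL2R X Y p \<in> tangent_space SL2R p"
    if "p \<in> SL2R" "vec_field_at SL2R p X" "vec_field_at SL2R p Y" for p X Y
    by (rule regular_at_bracket[OF regular_SL2R that])
  show "bilinear \<Omega>" by (rule bilinear_\<Omega>)
  show "\<Omega> x y \<bullet> z = - (y \<bullet> \<Omega> x z)" for x y z by (rule \<Omega>_skew)
  show "\<exists>H \<Theta>'. (\<forall>\<^sub>F x in nhds p. x \<in> SL2R \<longrightarrow> (\<forall>u\<in>tangent_space SL2R x. \<theta> x u = H x u)) \<and>
      linear (H p) \<and> (\<forall>u. \<Theta>' u 0 = 0) \<and>
      (\<forall>v. ((\<lambda>(x, v). H x v) has_derivative (\<lambda>(u, w). \<Theta>' u v + H p w)) (at (p, v))) \<and>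
      (\<forall>u\<in>tangent_space SL2R p. \<forall>v\<in>tangent_space SL2R p. \<forall>z\<in>tangent_space SL2R p.
        (\<Theta>' u v - \<Theta>' v u + \<Omega> (\<theta> p u) (\<theta> p v) - \<Omega> (\<theta> p v) (\<theta> p u)) \<bullet> \<theta> p z = 0)"
    if "p \<in> SL2R" for p
  \<comment> \<open>By bilinearity \<theta> serves as its own extension and as its own derivative in
    the base point.\<close>
  proof (intro exI[of _ \<theta>] conjI allI ballI)
    show "linear (\<theta> p)" "\<theta> u 0 = 0" for u
      using bounded_bilinear_\<theta> bounded_bilinear.bounded_linear_right linear_conv_bounded_linear
        bounded_bilinear.zero_right by blast+
    show "((\<lambda>(x, v). \<theta> x v) has_derivative (\<lambda>(u, w). \<theta> u v + \<theta> p w)) (at (p, v))" for v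
    proof -
      have "((\<lambda>y. \<theta> (fst y) (snd y)) has_derivative (\<lambda>h. \<theta> (fst (p, v)) (snd h) + \<theta> (fst h) (snd (p, v)))) (at (p, v))"
        by (rule bounded_bilinear.FDERIV[OF bounded_bilinear_\<theta>])
          (auto intro!: bounded_linear_imp_has_derivative bounded_linear_fst bounded_linear_snd)
      then show ?thesis by (simp add: case_prod_unfold add.commute)
    qed
    show "(\<theta> u v - \<theta> v u + \<Omega> (\<theta> p u) (\<theta> p v) - \<Omega> (\<theta> p v) (\<theta> p u)) \<bullet> \<theta> p z = 0"
      if "u \<in> tangent_space SL2R p" "v \<in> tangent_space SL2R p" for u v z
      by (simp only: \<theta>_structure[OF that] \<Omega>_def add_diff_eq[symmetric] dg_\<mu>_cross) simp
  qed simp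
  show "\<exists>(n::nat) F C. (\<forall>a<n. vec_field_at SL2R p (F a) \<and> smooth_on UNIV (C a :: (real^2^2) \<times> (real^2^2) \<Rightarrow> real)) \<and>
      (\<forall>\<^sub>F y in nhds p. y \<in> SL2R \<longrightarrow> (\<forall>u\<in>tangent_space SL2R y. u = (\<Sum>a<n. C a (y, u) *\<^sub>R F a y)))"
    if "p \<in> SL2R" for p
  proof -
    let ?i = "\<lambda>a::nat. if a = 0 then 1 else if a = 1 then 2 else (3::3)"
    show ?thesis
    proof (intro exI[of _ 3] exI[of _ "\<lambda>a. e (?i a)"] exI[of _ "\<lambda>a y. \<theta> (fst y) (snd y) $ ?i a"] conjI allI impI
        always_eventually ballI)
      show "vec_field_at SL2R p (e i)" for i using E_field[OF that] by (simp add: e_E[abs_def])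
      show "smooth_on UNIV (\<lambda>y. \<theta> (fst y) (snd y) $ i)" for i
        by (intro smooth_on_linear[OF _ bounded_linear_vec_nth] smooth_on_bilinear[OF _ bounded_bilinear_\<theta>]
            smooth_on_bounded_linear bounded_linear_fst bounded_linear_snd) simp_all
      show "u = (\<Sum>a<3. \<theta> (fst (y, u)) (snd (y, u)) $ ?i a *\<^sub>R e (?i a) y)" if "u \<in> tangent_space SL2R y" for y u
        using E_\<theta>[OF that] unfolding E_sum by (simp add: sum_3 numeral_3_eq_3)
    qed
  qed
qed

section \<open>Connection and curvature on left-invariant fields\<close>

text \<open>The coframe components of a left-invariant field are constant, so only the connection
  form acts. Agreement of \<open>Y\<close> with \<open>E y\<close> is asked on \<open>SL2R\<close>
  alone, because the lemma is also applied to fields that are themselves covariant derivatives and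
  are not controlled elsewhere.\<close>

lemma levi_civita_left_invariant:
  assumes u: "u \<in> tangent_space SL2R q" and Y: "vec_field_at SL2R q Y"
    and e: "\<And>x. x \<in> SL2R \<Longrightarrow> Y x = E y x"
  shows "levi_civita SL2R g q u Y = E (\<Omega> (\<theta> q u) y) q"
proof (rule SL.eq_of_inner)
  have q: "q \<in> SL2R" using u tangent_space_in by blast
  show "levi_civita SL2R g q u Y \<in> tangent_space SL2R q" by (rule SL.levi_civita_tangent[OF u Y])
  show "E (\<Omega> (\<theta> q u) y) q \<in> tangent_space SL2R q" by (rule E_tangent[OF q])
  have "((\<lambda>x. \<theta> x (Y x)) has_derivative (\<lambda>u. 0)) (at q within SL2R)"
    by (rule has_derivative_eq_on[OF has_derivative_const[of y] q]) (simp add: e \<theta>_E)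
  from dmap_eq[OF u this]
  show "\<theta> q (levi_civita SL2R g q u Y) \<bullet> \<theta> q z = \<theta> q (E (\<Omega> (\<theta> q u) y) q) \<bullet> \<theta> q z"
    if "z \<in> tangent_space SL2R q" for z
    using SL.levi_civita_inner[OF u Y that] q by (simp add: \<theta>_E e)
qed

lemma lie_bracket_left_invariant:
  assumes "q \<in> SL2R"
  shows "lie_bracket SL2R (E x) (E y) q = E (dg c (x \<times> y)) q"
proof -
  have "lie_bracket SL2R (E x) (E y) q = levi_civita SL2R g q (E x q) (E y) - levi_civita SL2R g q (E y q) (E x)"
    using SL.is_levi_civita_levi_civita assms E_field[OF assms] unfolding is_levi_civita_def by metis
  also have "\<dots> = E (\<Omega> x y) q - E (\<Omega> y x) q"
    using assms by (simp add: levi_civita_left_invariant E_tangent E_field \<theta>_E)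
  also have "\<dots> = E (\<Omega> x y - \<Omega> y x) q" by (simp add: linear_diff[OF linear_E_left])
  finally show ?thesis by (simp add: \<Omega>_def dg_\<mu>_cross)
qed

definition k :: "real^3" where
  "k = vector [c$1 * \<mu>$1 - \<mu>$2 * \<mu>$3, c$2 * \<mu>$2 - \<mu>$3 * \<mu>$1, c$3 * \<mu>$3 - \<mu>$1 * \<mu>$2]"

text \<open>By the Jacobi identity the commutator of two cross products is the cross product with
  \<open>dg \<mu> x \<times> dg \<mu> y\<close>, which is the cofactor matrix of the diagonal matrix
  \<mu> applied to \<open>x \<times> y\<close>. The bracket term subtracts the product of \<mu> and
  \<open>c\<close>, and what results is minus \<open>k\<close>.\<close>

lemma curvature_operator:
  "\<Omega> x (\<Omega> y w) - \<Omega> y (\<Omega> x w) - \<Omega> (dg c (x \<times> y)) w = - (dg k (x \<times> y) \<times> w)"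
  by (simp add: eq3_iff \<Omega>_def cross_components k_def algebra_simps)

lemma curvature_left_invariant:
  assumes q: "q \<in> SL2R"
  shows "curvature SL2R g (E x) (E y) (E w) q = - E (dg k (x \<times> y) \<times> w) q"
proof -
  \<comment> \<open>Off \<open>SL2R\<close> the inner field of the curvature is whatever the choice
    in \<open>levi_civita\<close> makes it; on \<open>SL2R\<close> it is left-invariant, and this is
    enough for it to count as a smooth vector field.\<close>
  have f: "vec_field_at SL2R q (\<lambda>p. levi_civita SL2R g p (E x p) (E w))" for x
  proof -
    have "levi_civita SL2R g p (E x p) (E w) = E (\<Omega> x w) p" if "p \<in> SL2R" for p
      using that by (simp add: levi_civita_left_invariant E_tangent E_field \<theta>_E)
    note e = this
    have "smooth_at SL2R (E (\<Omega> x w)) q" using E_field[OF q] by (simp add: vec_field_at_def)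
    then have "smooth_at SL2R (\<lambda>p. levi_civita SL2R g p (E x p) (E w)) q"
      by (rule smooth_at_cong) (simp add: e)
    then show ?thesis unfolding vec_field_at_def by (simp add: e E_tangent)
  qed
  have l: "levi_civita SL2R g q (E x q) (\<lambda>p. levi_civita SL2R g p (E y p) (E w)) = E (\<Omega> x (\<Omega> y w)) q" for x y
  proof -
    have "levi_civita SL2R g p (E y p) (E w) = E (\<Omega> y w) p" if "p \<in> SL2R" for p
      using that by (simp add: levi_civita_left_invariant E_tangent E_field \<theta>_E)
    from levi_civita_left_invariant[OF E_tangent[OF q] f this] show ?thesis using q by (simp add: \<theta>_E)
  qed
  have "curvature SL2R g (E x) (E y) (E w) q = E (\<Omega> x (\<Omega> y w)) q - E (\<Omega> y (\<Omega> x w)) q - E (\<Omega> (dg c (x \<times> y)) w) q"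
    using q unfolding curvature_def l lie_bracket_left_invariant[OF q]
    by (simp add: levi_civita_left_invariant E_tangent E_field \<theta>_E)
  also have "\<dots> = E (\<Omega> x (\<Omega> y w) - \<Omega> y (\<Omega> x w) - \<Omega> (dg c (x \<times> y)) w) q"
    by (simp add: linear_diff[OF linear_E_left])
  also have "\<dots> = - E (dg k (x \<times> y) \<times> w) q"
    unfolding curvature_operator by (simp add: linear_neg[OF linear_E_left])
  finally show ?thesis .
qed

lemma sectional_curvature_left_invariant:
  assumes q: "q \<in> SL2R" and xy: "x \<bullet> x = 1" "y \<bullet> y = 1" "x \<bullet> y = 0"
  shows "sectional_curvature SL2R g (E x) (E y) q = dg k (x \<times> y) \<bullet> (x \<times> y)"
proof -
  have "g q (curvature SL2R g (E x) (E y) (E y) q) (E x q) = - (dg k (x \<times> y) \<times> y) \<bullet> x"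
    unfolding curvature_left_invariant[OF q] linear_neg[OF linear_E_left, symmetric]
    using q by (simp add: g_\<theta> E_tangent \<theta>_E)
  also have "\<dots> = dg k (x \<times> y) \<bullet> (x \<times> y)"
    by (simp add: inner3 cross_components algebra_simps)
  finally show ?thesis
    using q xy by (simp add: sectional_curvature_def g_\<theta> E_tangent \<theta>_E)
qed

lemma sectional_curvature_frame:
  assumes "q \<in> SL2R"
  shows "sectional_curvature SL2R g (e 1) (e 2) q = k $ 3" "sectional_curvature SL2R g (e 2) (e 3) q = k $ 1"
proof -
  have e: "e i = E (axis i 1)" for i using e_E by blast
  have a: "dg k (axis i 1) \<bullet> axis i 1 = k $ i" for i by (simp add: inner_axis)
  show "sectional_curvature SL2R g (e 1) (e 2) q = k $ 3" "sectional_curvature SL2R g (e 2) (e 3) q = k $ 1"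
    unfolding e using sectional_curvature_left_invariant[OF assms, of "axis 1 1" "axis 2 1"]
      sectional_curvature_left_invariant[OF assms, of "axis 2 1" "axis 3 1"]
    by (simp_all add: cross_basis a inner_axis_axis)
qed

end

section \<open>The Grassmannian bundle\<close>

definition outer :: "real^3 \<Rightarrow> real^3 \<Rightarrow> real^3^3" where "outer a b = (\<chi> i j. a$i * b$j)"
definition hat :: "real^3 \<Rightarrow> real^3^3" where
  "hat x = vector [vector [0, - x$3, x$2], vector [x$3, 0, - x$1], vector [- x$2, x$1, 0]]"
text \<open>Axial vector of a skew matrix, inverse to \<open>hat\<close> there. Reading off three
  entries keeps it linear on all matrices.\<close>

definition vee :: "real^3^3 \<Rightarrow> real^3" where "vee K = vector [K$3$2, K$1$3, K$2$1]"

lemma eq33_iff: "(A::'a^3^3) = B \<longleftrightarrow> (A$1$1 = B$1$1 \<and> A$1$2 = B$1$2 \<and> A$1$3 = B$1$3) \<and>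
   (A$2$1 = B$2$1 \<and> A$2$2 = B$2$2 \<and> A$2$3 = B$2$3) \<and> (A$3$1 = B$3$1 \<and> A$3$2 = B$3$2 \<and> A$3$3 = B$3$3)"
  by (simp add: vec_eq_iff forall_3)

lemma mult33_nth: "((A::real^3^3) ** B) $ i $ j = A $ i $ 1 * B $ 1 $ j + A $ i $ 2 * B $ 2 $ j + A $ i $ 3 * B $ 3 $ j"
  by (simp add: matrix_matrix_mult_def sum_3)

lemma mv33_nth: "((A::real^3^3) *v x) $ i = A $ i $ 1 * x $ 1 + A $ i $ 2 * x $ 2 + A $ i $ 3 * x $ 3"
  by (simp add: matrix_vector_mult_def sum_3)

lemma hat_nth [simp]: "hat x $1$1 = 0" "hat x $1$2 = - x$3" "hat x $1$3 = x$2" "hat x $2$1 = x$3" "hat x $2$2 = 0"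
  "hat x $2$3 = - x$1" "hat x $3$1 = - x$2" "hat x $3$2 = x$1" "hat x $3$3 = 0"
  by (simp_all add: hat_def)

lemma vee_nth [simp]: "vee K $ 1 = K$3$2" "vee K $ 2 = K$1$3" "vee K $ 3 = K$2$1"
  by (simp_all add: vee_def)

lemma outer_nth [simp]: "outer a b $ i $ j = a$i * b$j" by (simp add: outer_def)

lemma bilinear_outer: "bilinear outer"
  unfolding bilinear_def by (auto intro!: linearI simp: vec_eq_iff algebra_simps)

lemma bounded_bilinear_outer: "bounded_bilinear outer"
  using bilinear_outer by (simp add: bilinear_conv_bounded_bilinear)

lemmas outer_simps = bilinear_ladd[OF bilinear_outer] bilinear_radd[OF bilinear_outer] bilinear_lmul[OF bilinear_outer]
  bilinear_rmul[OF bilinear_outer] bilinear_lneg[OF bilinear_outer] bilinear_rneg[OF bilinear_outer]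
  bilinear_lsub[OF bilinear_outer] bilinear_rsub[OF bilinear_outer]
  bilinear_lzero[OF bilinear_outer] bilinear_rzero[OF bilinear_outer]

lemma linear_vee: "linear vee" by (rule linearI) (auto simp: eq3_iff)
lemma linear_hat: "linear hat" by (rule linearI) (auto simp: eq33_iff)

lemma outer_mult: "outer a b ** outer c d = (b \<bullet> c) *\<^sub>R outer a d"
  by (simp add: vec_eq_iff matrix_matrix_mult_def inner_vec_def sum_distrib_left sum_distrib_right algebra_simps)

lemma outer_mv: "outer a b *v x = (b \<bullet> x) *\<^sub>R a"
  by (simp add: vec_eq_iff matrix_vector_mult_def inner_vec_def sum_distrib_left sum_distrib_right algebra_simps)

lemma outer_inner: "outer a b \<bullet> outer c d = (a \<bullet> c) * (b \<bullet> d)"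
  by (simp add: inner_vec_def sum_3 algebra_simps)

lemma hat_outer: "hat x ** outer a b = outer (x \<times> a) b" "outer a b ** hat x = - outer a (x \<times> b)"
  by (simp_all add: eq33_iff mult33_nth cross_components algebra_simps)

lemma vee_outer: "vee (outer w n - outer n w) = n \<times> w"
  by (simp add: eq3_iff cross_components algebra_simps)

lemma matrix_mult_diff: "(A - B) ** C = A ** C - B ** C" "C ** (A - B) = C ** A - C ** B" for A B C :: "real^3^3"
  using bounded_bilinear.diff_left[OF bounded_bilinear_matrix_mult] bounded_bilinear.diff_right[OF bounded_bilinear_matrix_mult]
  by blast+

lemma matrix_mult_minus: "(- A) ** C = - (A ** C)" "C ** (- A) = - (C ** A)" for A C :: "real^3^3"
  using bounded_bilinear.minus_left[OF bounded_bilinear_matrix_mult] bounded_bilinear.minus_right[OF bounded_bilinear_matrix_mult]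
  by blast+

definition normal_proj :: "real^3 \<Rightarrow> real^3^3" where "normal_proj n = mat 1 - outer n n"

lemma normal_proj_mv: "normal_proj n *v x = x - (n \<bullet> x) *\<^sub>R n"
  by (simp add: normal_proj_def matrix_vector_mult_diff_rdistrib outer_mv)

lemma rank_normal_proj:
  assumes "n \<bullet> n = 1"
  shows "range ((*v) (normal_proj n)) = {x. n \<bullet> x = 0}" "rank (normal_proj n) = 2"
proof -
  show r: "range ((*v) (normal_proj n)) = {x. n \<bullet> x = 0}"
  proof (intro set_eqI iffI)
    show "x \<in> {x. n \<bullet> x = 0}" if "x \<in> range ((*v) (normal_proj n))" for x
      using that assms by (auto simp: normal_proj_mv inner_diff_right)
    show "x \<in> range ((*v) (normal_proj n))" if "x \<in> {x. n \<bullet> x = 0}" for x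
      using that by (auto simp: normal_proj_mv intro!: image_eqI[of _ _ x])
  qed
  have "n \<noteq> 0" using assms by auto
  then show "rank (normal_proj n) = 2" using dim_hyperplane[of n] by (simp add: rank_dim_range r)
qed

text \<open>Let \<open>n\<close> be a unit vector orthogonal to the range, which has dimension 2.
  Symmetry gives \<open>A *v n = 0\<close>, idempotence makes \<open>A\<close> the identity on its
  range, and by dimension the range is the whole plane orthogonal to \<open>n\<close>.\<close>

lemma projection_cases:
  assumes "transpose A = A" "A ** A = (A::real^3^3)" "rank A = 2"
  obtains n where "n \<bullet> n = 1" "A = normal_proj n"
proof -
  have sub: "subspace (range ((*v) A))"
    using linear_subspace_image[of "(*v) A" UNIV] by (simp add: matrix_vector_mul_linear)
  have "dim (range ((*v) A)) = 2" using assms(3) by (simp add: rank_dim_range)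
  moreover have "span (range ((*v) A)) = range ((*v) A)" using sub by (simp only: span_eq_iff)
  ultimately have "span (range ((*v) A)) \<subset> UNIV"
  proof -
    have "range ((*v) A) \<noteq> UNIV"
    proof
      assume "range ((*v) A) = UNIV"
      then have "dim (UNIV :: (real^3) set) = 2" using \<open>dim (range ((*v) A)) = 2\<close> by simp
      then show False by simp
    qed
    then show ?thesis unfolding \<open>span (range ((*v) A)) = range ((*v) A)\<close> by blast
  qed
  then obtain a where a: "a \<noteq> 0" "\<And>x. x \<in> span (range ((*v) A)) \<Longrightarrow> orthogonal a x"
    using orthogonal_to_subspace_exists_gen[of "range ((*v) A)" UNIV] by auto
  define n where "n = (1 / norm a) *\<^sub>R a"
  have nn: "n \<bullet> n = 1" using a(1) by (simp add: n_def power2_norm_eq_inner[symmetric] power2_eq_square)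
  have nA: "n \<bullet> (A *v x) = 0" for x
    using a(2)[of "A *v x"] span_base[of "A *v x" "range ((*v) A)"] by (simp add: n_def orthogonal_def)
  have sym: "(A *v x) \<bullet> y = x \<bullet> (A *v y)" for x y
    using dot_lmul_matrix[of x A y] assms(1) by (metis transpose_matrix_vector)
  have An: "A *v n = 0"
  proof -
    have "(A *v n) \<bullet> (A *v n) = 0" using nA[of "A *v n"] sym[of n "A *v n"] by simp
    then show ?thesis by simp
  qed
  have "range ((*v) A) = {x. n \<bullet> x = 0}"
  proof (rule subspace_dim_equal[OF sub])
    have "n \<noteq> 0" using nn by auto
    then show "dim {x. n \<bullet> x = 0} \<le> dim (range ((*v) A))" using dim_hyperplane[of n] \<open>dim (range ((*v) A)) = 2\<close> by simp
  qed (use nA in \<open>auto simp: subspace_hyperplane\<close>)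
  then have fixed: "A *v x = x" if "n \<bullet> x = 0" for x
    using that assms(2) matrix_vector_mul_assoc[of A A] by force
  have "A = normal_proj n"
    unfolding matrix_eq
  proof
    fix x
    have "n \<bullet> (x - (n \<bullet> x) *\<^sub>R n) = 0" using nn by (simp add: inner_diff_right)
    from fixed[OF this] show "A *v x = normal_proj n *v x"
      using An by (simp add: normal_proj_mv matrix_vector_mult_diff_distrib matrix_vector_mult_scaleR)
  qed
  then show ?thesis using nn that by blast
qed

lemma normal_proj_sym: "transpose (normal_proj n) = normal_proj n"
  by (simp add: normal_proj_def vec_eq_iff transpose_def mat_def mult.commute)

lemma normal_proj_idem: "n \<bullet> n = 1 \<Longrightarrow> normal_proj n ** normal_proj n = normal_proj n"
  by (simp add: normal_proj_def matrix_mult_diff outer_mult)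

lemma Gr2_iff: "x \<in> Gr2 Q \<longleftrightarrow> fst x \<in> Q \<and> (\<exists>n. n \<bullet> n = 1 \<and> snd x = normal_proj n)"
proof
  assume "x \<in> Gr2 Q"
  then show "fst x \<in> Q \<and> (\<exists>n. n \<bullet> n = 1 \<and> snd x = normal_proj n)"
    unfolding Gr2_def by (auto simp: case_prod_unfold elim!: projection_cases)
next
  assume "fst x \<in> Q \<and> (\<exists>n. n \<bullet> n = 1 \<and> snd x = normal_proj n)"
  then show "x \<in> Gr2 Q"
    unfolding Gr2_def by (auto simp: case_prod_unfold normal_proj_sym normal_proj_idem rank_normal_proj)
qed

section \<open>Tangent vectors of the space of projections\<close>

text \<open>Velocity of \<open>normal_proj n\<close> when the unit vector \<open>n\<close> moves
  with velocity \<open>w\<close>. It is unchanged when both signs are reversed, in accordance with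
  planes that carry no orientation.\<close>

definition sym_pair :: "real^3 \<Rightarrow> real^3 \<Rightarrow> real^3^3" where
  "sym_pair n w = - (outer w n + outer n w)"

text \<open>The last claim explains the commutator in the coframe of the bundle: it turns the
  velocity of a projection into a vector of \<open>real^3\<close> without choosing a sign of the
  normal.\<close>

lemma sym_pair_tangent:
  assumes "n \<bullet> n = 1" "n \<bullet> w = 0"
  shows "sym_pair n w ** normal_proj n = - outer n w" "normal_proj n ** sym_pair n w = - outer w n"
    "transpose (sym_pair n w) = sym_pair n w"
    "sym_pair n w ** normal_proj n + normal_proj n ** sym_pair n w = sym_pair n w"
    "vee (sym_pair n w ** normal_proj n - normal_proj n ** sym_pair n w) = n \<times> w"
proof -
  show a: "sym_pair n w ** normal_proj n = - outer n w" "normal_proj n ** sym_pair n w = - outer w n"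
    using assms by (simp_all add: sym_pair_def normal_proj_def matrix_mult_diff matrix_mult_minus matrix_mult_add
        outer_mult inner_commute)
  show "transpose (sym_pair n w) = sym_pair n w"
    by (simp add: sym_pair_def vec_eq_iff transpose_def mult.commute)
  show "sym_pair n w ** normal_proj n + normal_proj n ** sym_pair n w = sym_pair n w"
    unfolding a by (simp add: sym_pair_def)
  show "vee (sym_pair n w ** normal_proj n - normal_proj n ** sym_pair n w) = n \<times> w"
    unfolding a using vee_outer[of w n] by simp
qed

text \<open>The third hypothesis is the derivative of \<open>A ** A = A\<close>. It expresses
  \<open>B\<close> by the single vector \<open>B *v n\<close>, and applying both sides to
  \<open>n\<close> shows that this vector is orthogonal to \<open>n\<close>.\<close>

lemma tangent_projection_cases:
  assumes "n \<bullet> n = 1" "transpose B = B" "B ** normal_proj n + normal_proj n ** B = (B::real^3^3)"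
  obtains w where "n \<bullet> w = 0" "B = sym_pair n w"
proof -
  have ob: "outer n n ** B = outer n (B *v n)" "B ** outer n n = outer (B *v n) n"
  proof -
    have t: "B $ i $ j = B $ j $ i" for i j
      using arg_cong[OF assms(2), of "\<lambda>K. K $ i $ j"] by (simp add: transpose_def)
    show "B ** outer n n = outer (B *v n) n" by (simp add: eq33_iff mult33_nth mv33_nth algebra_simps)
    show "outer n n ** B = outer n (B *v n)"
      using t[of 2 1] t[of 3 1] t[of 3 2] by (simp add: eq33_iff mult33_nth mv33_nth algebra_simps)
  qed
  have B: "B = outer (B *v n) n + outer n (B *v n)"
    using assms(3) by (simp add: normal_proj_def matrix_mult_diff ob algebra_simps)
  have "B *v n = (outer (B *v n) n + outer n (B *v n)) *v n" using B by simp
  also have "\<dots> = B *v n + ((B *v n) \<bullet> n) *\<^sub>R n"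
    using assms(1) by (simp add: matrix_vector_mult_add_rdistrib outer_mv)
  finally have "((B *v n) \<bullet> n) *\<^sub>R n = 0" by simp
  moreover have "n \<noteq> 0" using assms(1) by auto
  ultimately have "n \<bullet> (- (B *v n)) = 0" by (simp add: inner_commute)
  moreover have "B = sym_pair n (- (B *v n))"
    unfolding sym_pair_def by (subst B) (simp add: outer_simps)
  ultimately show ?thesis using that by blast
qed

text \<open>Projection along the normal \<open>n + t *\<^sub>R w\<close>. For a unit vector
  \<open>n\<close> orthogonal to \<open>w\<close> the inverted factor is the squared length of that
  normal, so the curve is rational in \<open>t\<close> and no square root has to be
  differentiated.\<close>

definition proj_curve :: "real^3 \<Rightarrow> real^3 \<Rightarrow> real \<Rightarrow> real^3^3" where
  "proj_curve n w t = mat 1 + inverse (1 + t * t * (w \<bullet> w)) *\<^sub>R - outer (n + t *\<^sub>R w) (n + t *\<^sub>R w)"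

lemma proj_curve_denominator: "1 + t * t * (w \<bullet> w) > (0::real)"
  by (intro add_pos_nonneg mult_nonneg_nonneg[OF zero_le_square]) simp_all

lemma smooth_proj_curve: "smooth_on UNIV (proj_curve n w)"
proof -
  have l: "smooth_on UNIV (\<lambda>t::real. n + t *\<^sub>R w)"
    by (intro smooth_on_add smooth_on_const smooth_on_bounded_linear bounded_linear_scaleR_left) simp_all
  have i: "smooth_on UNIV (\<lambda>t::real. t)" by (intro smooth_on_bounded_linear bounded_linear_ident) simp
  show ?thesis
    unfolding proj_curve_def[abs_def]
  proof (intro smooth_on_add smooth_on_const smooth_on_bilinear[OF _ bounded_bilinear_scaleR] smooth_on_inverse
      smooth_on_linear[OF _ bounded_linear_minus[OF bounded_linear_ident]] smooth_on_bilinear[OF _ bounded_bilinear_outer] l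
      smooth_on_bilinear[OF _ bounded_bilinear_mult] i)
    show "1 + t * t * (w \<bullet> w) \<noteq> 0" for t using proj_curve_denominator[of t w] by simp
  qed simp_all
qed

lemma proj_curve_eq:
  assumes "n \<bullet> n = 1" "n \<bullet> w = 0"
  shows "\<exists>m. m \<bullet> m = 1 \<and> proj_curve n w t = normal_proj m"
proof -
  define d where "d = 1 + t * t * (w \<bullet> w)"
  have d: "d > 0" unfolding d_def by (rule proj_curve_denominator)
  define m where "m = (1 / sqrt d) *\<^sub>R (n + t *\<^sub>R w)"
  have nw: "(n + t *\<^sub>R w) \<bullet> (n + t *\<^sub>R w) = d"
    using assms by (simp add: d_def inner_add_left inner_add_right inner_commute)
  have "m \<bullet> m = (1 / sqrt d) * ((1 / sqrt d) * d)" unfolding m_def inner_scaleR_left inner_scaleR_right nw ..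
  also have "\<dots> = 1" using d by (simp add: field_simps)
  finally have mm: "m \<bullet> m = 1" .
  have "outer m m = (1 / sqrt d * (1 / sqrt d)) *\<^sub>R outer (n + t *\<^sub>R w) (n + t *\<^sub>R w)"
    by (simp only: m_def bilinear_lmul[OF bilinear_outer] bilinear_rmul[OF bilinear_outer] scaleR_scaleR)
  also have "1 / sqrt d * (1 / sqrt d) = inverse d" using d by (simp add: field_simps)
  finally have "proj_curve n w t = normal_proj m"
    unfolding proj_curve_def normal_proj_def d_def[symmetric] by simp
  then show ?thesis using mm by blast
qed

lemma proj_curve_derivative: "(proj_curve n w has_vector_derivative sym_pair n w) (at 0)"
proof -
  have l: "((\<lambda>t::real. n + t *\<^sub>R w) has_vector_derivative w) (at 0)"
    by (auto intro!: derivative_eq_intros)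
  have o: "((\<lambda>t. outer (n + t *\<^sub>R w) (n + t *\<^sub>R w)) has_vector_derivative
      (outer (n + 0 *\<^sub>R w) w + outer w (n + 0 *\<^sub>R w))) (at 0)"
    by (rule bounded_bilinear.has_vector_derivative[OF bounded_bilinear_outer l l])
  have i: "((\<lambda>t. inverse (1 + t * t * (w \<bullet> w))) has_real_derivative 0) (at 0)"
    by (auto intro!: derivative_eq_intros)
  have "(proj_curve n w has_vector_derivative (0 + (inverse (1 + 0 * 0 * (w \<bullet> w)) *\<^sub>R (- (outer (n + 0 *\<^sub>R w) w + outer w (n + 0 *\<^sub>R w)))
      + 0 *\<^sub>R - outer (n + 0 *\<^sub>R w) (n + 0 *\<^sub>R w)))) (at 0)"
    unfolding proj_curve_def[abs_def]
    by (intro has_vector_derivative_add has_vector_derivative_const has_vector_derivative_scaleR i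
        has_vector_derivative_minus o)
  then show ?thesis by (simp add: sym_pair_def algebra_simps)
qed

text \<open>The equations are redundant, so the common value on the bundle is not a regular one; the
  tangent spaces are instead identified with the kernels of the derivative by direct
  computation.\<close>

definition Gr2_eqs :: "(real^2^2) \<times> (real^3^3) \<Rightarrow> real \<times> (real^3^3) \<times> (real^3^3)" where
  "Gr2_eqs x = (det22 (fst x), transpose (snd x) - snd x, snd x ** snd x - snd x)"

lemma linear_transpose: "linear (transpose :: real^'n^'m \<Rightarrow> real^'m^'n)"
  by (rule linearI) (simp_all add: vec_eq_iff transpose_def)

lemma Gr2_eqs_has_derivative:
  "(Gr2_eqs has_derivative (\<lambda>\<xi>. (frechet_derivative det22 (at (fst x)) (fst \<xi>), transpose (snd \<xi>) - snd \<xi>,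
      (snd x ** snd \<xi> + snd \<xi> ** snd x) - snd \<xi>))) (at x within S)"
proof -
  have f: "(fst has_derivative fst) (at x within S)" and s: "(snd has_derivative snd) (at x within S)"
    by (rule bounded_linear_imp_has_derivative[OF bounded_linear_fst],
        rule bounded_linear_imp_has_derivative[OF bounded_linear_snd])
  have d: "(det22 has_derivative frechet_derivative det22 (at (fst x))) (at (fst x))"
    by (rule smooth_on_has_derivative[OF smooth_on_det22]) simp
  have t: "bounded_linear (transpose :: real^3^3 \<Rightarrow> real^3^3)" using linear_transpose linear_conv_bounded_linear by blast
  show ?thesis
    unfolding Gr2_eqs_def[abs_def]
    by (intro has_derivative_Pair has_derivative_compose[OF f d] has_derivative_diff s
        bounded_linear.has_derivative[OF t] bounded_bilinear.FDERIV[OF bounded_bilinear_matrix_mult])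
qed

lemma smooth_Gr2_eqs: "smooth_on UNIV Gr2_eqs"
proof -
  have f: "smooth_on UNIV (fst :: (real^2^2) \<times> (real^3^3) \<Rightarrow> _)" and s: "smooth_on UNIV (snd :: (real^2^2) \<times> (real^3^3) \<Rightarrow> _)"
    by (intro smooth_on_bounded_linear bounded_linear_fst bounded_linear_snd open_UNIV)+
  have t: "bounded_linear (transpose :: real^3^3 \<Rightarrow> real^3^3)" using linear_transpose linear_conv_bounded_linear by blast
  have "smooth_on UNIV (\<lambda>x::(real^2^2) \<times> (real^3^3). (det22 (fst x), 0::(real^3^3) \<times> (real^3^3))
       + (0::real, (transpose (snd x) + - snd x, 0::real^3^3) + (0::real^3^3, snd x ** snd x + - snd x)))"
    by (intro smooth_on_add smooth_on_linear[of _ "\<lambda>y. (y, 0)"] smooth_on_linear[of _ "\<lambda>y. (0, y)"]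
        smooth_on_compose[OF _ _ _ f smooth_on_det22] smooth_on_linear[OF _ t s] s
        smooth_on_linear[OF _ bounded_linear_minus[OF bounded_linear_ident] s]
        smooth_on_bilinear[OF _ bounded_bilinear_matrix_mult s s]
        bounded_linear_Pair bounded_linear_ident bounded_linear_zero open_UNIV) simp
  then show ?thesis by (simp add: Gr2_eqs_def[abs_def])
qed

text \<open>A closed circle of inclusions: tangent vectors lie in the kernel, elements of the kernel
  have the stated form, and a vector of that form is the velocity of \<open>unipotent_curve\<close>
  paired with \<open>proj_curve\<close>.\<close>

lemma Gr2_tangent:
  assumes q: "q \<in> SL2R" and n: "n \<bullet> n = 1"
  shows "tangent_space (Gr2 SL2R) (q, normal_proj n) = {\<xi>. frechet_derivative Gr2_eqs (at (q, normal_proj n)) \<xi> \<in> {0}}"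
    and "\<xi> \<in> tangent_space (Gr2 SL2R) (q, normal_proj n) \<longleftrightarrow>
      fst \<xi> \<in> tangent_space SL2R q \<and> (\<exists>w. n \<bullet> w = 0 \<and> snd \<xi> = sym_pair n w)"
proof -
  let ?p = "(q, normal_proj n)"
  have p: "?p \<in> Gr2 SL2R" using q n by (auto simp: Gr2_iff)
  have fd: "frechet_derivative Gr2_eqs (at ?p) \<xi> = (frechet_derivative det22 (at q) (fst \<xi>), transpose (snd \<xi>) - snd \<xi>,
      (normal_proj n ** snd \<xi> + snd \<xi> ** normal_proj n) - snd \<xi>)" for \<xi>
    using fun_cong[OF frechet_derivative_at[OF Gr2_eqs_has_derivative[of ?p UNIV]], of \<xi>] by simp
  have 1: "frechet_derivative Gr2_eqs (at ?p) \<xi> \<in> {0}" if u: "\<xi> \<in> tangent_space (Gr2 SL2R) ?p" for \<xi>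
  proof -
    have "(Gr2_eqs has_derivative (\<lambda>u. 0)) (at ?p within Gr2 SL2R)"
    proof (rule has_derivative_eq_on[OF has_derivative_const[of "(1, 0, 0)"] p], rule always_eventually, intro allI impI)
      fix x assume "x \<in> Gr2 SL2R"
      then show "Gr2_eqs x = (1, 0, 0)"
        by (auto simp: Gr2_eqs_def Gr2_def SL2R_det22)
    qed
    moreover have "(Gr2_eqs has_derivative frechet_derivative Gr2_eqs (at ?p)) (at ?p within Gr2 SL2R)"
      by (rule has_derivative_at_withinI[OF smooth_on_has_derivative[OF smooth_Gr2_eqs]]) simp
    ultimately show ?thesis using tangent_derivative_unique[OF u] by (metis singletonI)
  qed
  have 2: "fst \<xi> \<in> tangent_space SL2R q \<and> (\<exists>w. n \<bullet> w = 0 \<and> snd \<xi> = sym_pair n w)"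
    if "frechet_derivative Gr2_eqs (at ?p) \<xi> \<in> {0}" for \<xi>
  proof
    have z: "frechet_derivative det22 (at q) (fst \<xi>) = 0" "transpose (snd \<xi>) = snd \<xi>"
      "snd \<xi> ** normal_proj n + normal_proj n ** snd \<xi> = snd \<xi>"
      using that unfolding fd by (auto simp: zero_prod_def add.commute)
    show "fst \<xi> \<in> tangent_space SL2R q" using z(1) tangent_space_SL2R[OF q] by simp
    show "\<exists>w. n \<bullet> w = 0 \<and> snd \<xi> = sym_pair n w" using tangent_projection_cases[OF n z(2,3)] by metis
  qed
  have 3: "\<xi> \<in> tangent_space (Gr2 SL2R) ?p"
    if h: "fst \<xi> \<in> tangent_space SL2R q \<and> (\<exists>w. n \<bullet> w = 0 \<and> snd \<xi> = sym_pair n w)" for \<xi>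
  proof -
    obtain w where w: "n \<bullet> w = 0" "snd \<xi> = sym_pair n w" using h by blast
    define s where "s = adj22 q ** fst \<xi>"
    have tr: "s$1$1 + s$2$2 = 0" using h SL2R_tangent_iff[OF q] by (simp add: s_def)
    have qs: "q ** s = fst \<xi>" using q by (simp add: s_def matrix_mul_assoc adj22_mult SL2R_def)
    let ?c = "\<lambda>t. (unipotent_curve q s t, proj_curve n w t)"
    show ?thesis
    proof (rule tangent_spaceI[of 1 ?c])
      have "smooth_on UNIV (\<lambda>t. (unipotent_curve q s t, 0::real^3^3) + (0::real^2^2, proj_curve n w t))"
        by (intro smooth_on_add smooth_on_linear[of _ "\<lambda>y. (y, 0)"] smooth_on_linear[of _ "\<lambda>y. (0, y)"]
            smooth_unipotent_curve smooth_proj_curve bounded_linear_Pair bounded_linear_ident bounded_linear_zero open_UNIV)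
      then show "smooth_on {-1<..<1} ?c" by (auto intro: smooth_on_subset)
      show "?c ` {-1<..<1} \<subseteq> Gr2 SL2R"
        using unipotent_curve_SL2R[OF q] proj_curve_eq[OF n w(1)] by (auto simp: Gr2_iff)
      show "?c 0 = ?p" by (simp add: unipotent_curve_def proj_curve_def normal_proj_def)
      have "(?c has_vector_derivative (q ** s, sym_pair n w)) (at 0)"
        using unipotent_curve_derivative[OF tr, of q] proj_curve_derivative[of n w]
        unfolding has_vector_derivative_def by (auto intro!: derivative_eq_intros)
      then show "(?c has_vector_derivative \<xi>) (at 0)" unfolding qs w(2)[symmetric] by simp
    qed simp
  qed
  show "tangent_space (Gr2 SL2R) ?p = {\<xi>. frechet_derivative Gr2_eqs (at ?p) \<xi> \<in> {0}}"
    using 1 2 3 by blast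
  show "\<xi> \<in> tangent_space (Gr2 SL2R) (q, normal_proj n) \<longleftrightarrow>
      fst \<xi> \<in> tangent_space SL2R q \<and> (\<exists>w. n \<bullet> w = 0 \<and> snd \<xi> = sym_pair n w)"
    using 1 2 3 by blast
qed

lemma regular_Gr2: "regular_at (Gr2 SL2R) x Gr2_eqs {0} UNIV"
  unfolding regular_at_def
proof (intro conjI ballI)
  fix x assume "x \<in> Gr2 SL2R \<inter> UNIV"
  then obtain n where "fst x \<in> SL2R" "n \<bullet> n = 1" "snd x = normal_proj n" by (auto simp: Gr2_iff)
  then show "tangent_space (Gr2 SL2R) x = {v. frechet_derivative Gr2_eqs (at x) v \<in> {0}}"
    using Gr2_tangent(1)[of "fst x" n] by (metis prod.collapse)
qed (simp_all add: smooth_Gr2_eqs)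

section \<open>Identities for cross products\<close>

lemma cross_cross_inner: "(Y \<times> (n \<times> c)) \<bullet> m = (Y \<bullet> c) * (n \<bullet> m) - (Y \<bullet> n) * (c \<bullet> m)"
  by (simp add: inner3 cross_components algebra_simps)

lemma cross_inner_cross: "(n \<times> a) \<bullet> (n \<times> b) = (n \<bullet> n) * (a \<bullet> b) - (n \<bullet> b) * (n \<bullet> a)"
  by (simp add: inner3 cross_components algebra_simps)

lemma triple_expand: "((b \<times> c) \<bullet> m) *\<^sub>R n = (n \<bullet> m) *\<^sub>R (b \<times> c) + (n \<bullet> b) *\<^sub>R (c \<times> m) + (n \<bullet> c) *\<^sub>R (m \<times> b)"
  by (simp add: eq3_iff inner3 cross_components algebra_simps)

text \<open>Three vectors in the plane orthogonal to \<open>n\<close> are linearly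
  dependent.\<close>

lemma triple_zero:
  assumes "n \<bullet> n = 1" "n \<bullet> b = 0" "n \<bullet> c = 0" "n \<bullet> m = 0"
  shows "(b \<times> c) \<bullet> m = 0"
  using arg_cong[OF triple_expand[of b c m n], of "\<lambda>x. x \<bullet> n"] assms by simp

lemma cross_double_inner:
  "(n \<bullet> Z) * ((Y \<times> n) \<bullet> m) - (n \<bullet> Y) * ((Z \<times> n) \<bullet> m) = (n \<bullet> n) * ((Y \<times> Z) \<bullet> m) - (n \<bullet> (Y \<times> Z)) * (n \<bullet> m)"
  by (simp add: inner3 cross_components algebra_simps)

lemma cross_double: "n \<bullet> n = 1 \<Longrightarrow> n \<times> (a \<times> n) = a - (n \<bullet> a) *\<^sub>R n"
  by (simp add: Lagrange)

text \<open>After the quarter turn \<open>n \<times> _\<close> the claim is a polynomial identity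
  modulo the hypotheses. A second quarter turn is minus the identity on the plane and restores
  \<open>v\<close>.\<close>

lemma orthonormal_expand_R3:
  assumes "n \<bullet> n = 1" "y \<bullet> y = 1" "n \<bullet> y = 0" "n \<bullet> v = 0"
  shows "v = (v \<bullet> y) *\<^sub>R y + (v \<bullet> (n \<times> y)) *\<^sub>R (n \<times> y)"
proof -
  have "n \<times> v = (v \<bullet> y) *\<^sub>R (n \<times> y) - (v \<bullet> (n \<times> y)) *\<^sub>R y"
  proof -
    have "(n \<times> v) - ((v \<bullet> y) *\<^sub>R (n \<times> y) - (v \<bullet> (n \<times> y)) *\<^sub>R y) =
        (1 - y \<bullet> y) *\<^sub>R (n \<times> v) + (n \<bullet> y) *\<^sub>R (y \<times> v) - (n \<bullet> v) *\<^sub>R 0 + 0"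
      by (simp add: eq3_iff inner3 cross_components algebra_simps)
    then show ?thesis using assms by simp
  qed
  then have "n \<times> (n \<times> v) = (v \<bullet> y) *\<^sub>R (n \<times> (n \<times> y)) - (v \<bullet> (n \<times> y)) *\<^sub>R (n \<times> y)"
    by (simp add: Cross3.right_diff_distrib cross_mult_right)
  then show ?thesis using assms by (simp add: Lagrange) (simp add: algebra_simps)
qed

lemma sym_pair_mv: "sym_pair n b *v x = - ((n \<bullet> x) *\<^sub>R b + (b \<bullet> x) *\<^sub>R n)"
  by (simp add: sym_pair_def eq3_iff mv33_nth inner3 algebra_simps)

lemma sym_pair_commutator:
  assumes "n \<bullet> n = 1" "n \<bullet> b = 0" "n \<bullet> c = 0"
  shows "vee (sym_pair n c ** sym_pair n b - sym_pair n b ** sym_pair n c) = b \<times> c"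
proof -
  have "sym_pair n c ** sym_pair n b - sym_pair n b ** sym_pair n c = outer c b - outer b c"
    using assms by (simp add: sym_pair_def matrix_mult_minus matrix_mult_add matrix_mult_diff outer_mult inner_commute)
  then show ?thesis by (simp add: vee_outer)
qed

lemma sym_pair_add: "sym_pair n a + sym_pair n b = sym_pair n (a + b)"
  by (simp add: sym_pair_def outer_simps)

lemma sym_pair_inner:
  "n \<bullet> n = 1 \<Longrightarrow> n \<bullet> a = 0 \<Longrightarrow> n \<bullet> b = 0 \<Longrightarrow> sym_pair n a \<bullet> sym_pair n b = 2 * (a \<bullet> b)"
  by (simp add: sym_pair_def inner_add_left inner_add_right inner_diff_left inner_diff_right outer_inner inner_commute)

lemma hat_normal_proj: "hat x ** normal_proj n - normal_proj n ** hat x = sym_pair n (x \<times> n)"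
  by (simp add: normal_proj_def sym_pair_def matrix_mult_diff hat_outer)

section \<open>Coframe and connection of the Grassmannian bundle\<close>

locale sl2_gr = sl2 +
  fixes \<kappa> :: real
  assumes \<kappa>_pos: "\<kappa> > 0"
begin

abbreviation "GP \<equiv> Gr2 SL2R"
definition gG where "gG = Gr2_metric \<kappa> SL2R e"
text \<open>The factor 2 is that of \<open>sym_pair_inner\<close>: the inner product of matrices
  counts a moving normal twice.\<close>

definition s where "s = sqrt (2 * \<kappa>)"

lemma s_pos: "s > 0" and s_square: "s * s = 2 * \<kappa>"
  using \<kappa>_pos by (simp_all add: s_def)

text \<open>On tangent vectors the second component is \<open>s\<close> times the cross product of
  the unit normal with its covariant derivative, see \<open>\<Theta>_eq\<close>. Written through the
  projection matrix instead of the normal, the map is polynomial on the ambient space.\<close>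

definition \<Theta> :: "(real^2^2) \<times> (real^3^3) \<Rightarrow> (real^2^2) \<times> (real^3^3) \<Rightarrow> (real^3) \<times> (real^3)" where
  "\<Theta> x \<xi> = (\<theta> (fst x) (fst \<xi>),
     s *\<^sub>R (vee (snd \<xi> ** snd x - snd x ** snd \<xi>) + snd x *v dg \<mu> (\<theta> (fst x) (fst \<xi>))))"

text \<open>The Levi-Civita form of the base plus the O'Neill terms, which carry the curvature operator \<open>k\<close>.\<close>

definition \<Omega>G :: "(real^3) \<times> (real^3) \<Rightarrow> (real^3) \<times> (real^3) \<Rightarrow> (real^3) \<times> (real^3)" where
  "\<Omega>G a b = (dg \<mu> (fst a) \<times> fst b - (s / 2) *\<^sub>R (dg k (snd a) \<times> fst b + dg k (snd b) \<times> fst a),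
     dg \<mu> (fst a) \<times> snd b + (s / 2) *\<^sub>R dg k (fst a \<times> fst b))"

lemma GP_cases:
  assumes "x \<in> GP"
  obtains q n where "x = (q, normal_proj n)" "q \<in> SL2R" "n \<bullet> n = 1"
  using assms unfolding Gr2_iff by (metis prod.collapse)

lemma GP_tangent_cases:
  assumes "\<xi> \<in> tangent_space GP x"
  obtains q n u w where "x = (q, normal_proj n)" "q \<in> SL2R" "n \<bullet> n = 1" "\<xi> = (u, sym_pair n w)"
    "u \<in> tangent_space SL2R q" "n \<bullet> w = 0"
proof -
  obtain q n where x: "x = (q, normal_proj n)" "q \<in> SL2R" "n \<bullet> n = 1"
    using GP_cases tangent_space_in[OF assms] by blast
  then show ?thesis using that[of q n "fst \<xi>"] assms Gr2_tangent(2)[OF x(2,3), of \<xi>] by (metis prod.collapse)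
qed

lemma GP_tangentI:
  "q \<in> SL2R \<Longrightarrow> n \<bullet> n = 1 \<Longrightarrow> u \<in> tangent_space SL2R q \<Longrightarrow> n \<bullet> w = 0 \<Longrightarrow>
    (u, sym_pair n w) \<in> tangent_space GP (q, normal_proj n)"
  by (auto simp: Gr2_tangent(2))

lemma GP_tangent_same:
  assumes "\<xi> \<in> tangent_space GP (q, normal_proj n)" "n \<bullet> n = 1"
  obtains u w where "\<xi> = (u, sym_pair n w)" "u \<in> tangent_space SL2R q" "n \<bullet> w = 0"
proof -
  have "q \<in> SL2R" using tangent_space_in[OF assms(1)] by (auto simp: Gr2_iff)
  then show ?thesis using that[of "fst \<xi>"] assms Gr2_tangent(2)[OF _ assms(2), of q \<xi>] by (metis prod.collapse)
qed

lemma \<Theta>_eq: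
  assumes "n \<bullet> n = 1" "n \<bullet> w = 0"
  shows "\<Theta> (q, normal_proj n) (u, sym_pair n w) = (\<theta> q u, s *\<^sub>R (n \<times> (w + dg \<mu> (\<theta> q u) \<times> n)))"
  using sym_pair_tangent(5)[OF assms] cross_double[OF assms(1)]
  by (simp add: \<Theta>_def normal_proj_mv cross_add_right)

lemma connection_matrix_SL2R:
  assumes "u \<in> tangent_space SL2R q"
  shows "connection_matrix SL2R e q u = hat (dg \<mu> (\<theta> q u))"
proof -
  have q: "q \<in> SL2R" using assms tangent_space_in by blast
  have "connection_matrix SL2R e q u $ i $ j = axis i 1 \<bullet> (dg \<mu> (\<theta> q u) \<times> axis j 1)" for i j
  proof -
    have ej: "e j = E (axis j 1)" for j using e_E by blast
    have "levi_civita SL2R (frame_metric e) q u (e j) = E (\<Omega> (\<theta> q u) (axis j 1)) q"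
      unfolding g_def[symmetric] ej by (rule levi_civita_left_invariant[OF assms E_field[OF q]]) simp
    then show ?thesis
      unfolding connection_matrix_def
      using q by (simp add: g_def[symmetric] ej g_\<theta> E_tangent \<theta>_E \<Omega>_def)
  qed
  then show ?thesis
    by (simp add: eq33_iff inner3 cross_components axis_def)
qed

text \<open>The cross product with \<open>n\<close> is an isometry of the plane orthogonal to
  \<open>n\<close>, so the vertical term of the metric becomes \<open>s * s\<close> times an inner
  product of vectors.\<close>

lemma gG_\<Theta>:
  assumes "\<xi> \<in> tangent_space GP x" "\<eta> \<in> tangent_space GP x"
  shows "gG x \<xi> \<eta> = \<Theta> x \<xi> \<bullet> \<Theta> x \<eta>"
proof -
  obtain q n u w where x: "x = (q, normal_proj n)" "q \<in> SL2R" "n \<bullet> n = 1" "\<xi> = (u, sym_pair n w)"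
    "u \<in> tangent_space SL2R q" "n \<bullet> w = 0" using GP_tangent_cases[OF assms(1)] .
  obtain v z where y: "\<eta> = (v, sym_pair n z)" "v \<in> tangent_space SL2R q" "n \<bullet> z = 0"
    using GP_tangent_same assms(2) x(1,3) by metis
  define W where "W u w = w + dg \<mu> (\<theta> q u) \<times> n" for u w
  have nW: "n \<bullet> W u w = 0" if "n \<bullet> w = 0" for u w
    using that by (simp add: W_def inner_add_right dot_cross_self)
  have V: "Gr2_vertical SL2R e x (u, sym_pair n w) = sym_pair n (W u w)" if "u \<in> tangent_space SL2R q" for u w
    using hat_normal_proj[of "dg \<mu> (\<theta> q u)" n] that
    by (simp add: Gr2_vertical_def x(1) connection_matrix_SL2R W_def sym_pair_add[symmetric] add_diff_eq[symmetric])
  have "gG x \<xi> \<eta> = \<theta> q u \<bullet> \<theta> q v + \<kappa> * (2 * (W u w \<bullet> W v z))"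
    using sym_pair_inner[OF x(3) nW[OF x(6)] nW[OF y(3)]] x y
    by (simp add: gG_def Gr2_metric_def g_def[symmetric] g_\<theta> V[unfolded x(1)])
  also have "\<dots> = \<theta> q u \<bullet> \<theta> q v + (s * s) * ((n \<times> W u w) \<bullet> (n \<times> W v z))"
    using nW x(3,6) y(3) by (simp add: cross_inner_cross s_square)
  also have "\<dots> = \<Theta> x \<xi> \<bullet> \<Theta> x \<eta>"
    unfolding x(1,4) y(1) \<Theta>_eq[OF x(3,6)] \<Theta>_eq[OF x(3) y(3)] by (simp add: W_def)
  finally show ?thesis .
qed

lemma \<Theta>_inj:
  assumes "\<xi> \<in> tangent_space GP x" "\<Theta> x \<xi> = 0"
  shows "\<xi> = 0"
proof -
  obtain q n u w where x: "x = (q, normal_proj n)" "q \<in> SL2R" "n \<bullet> n = 1" "\<xi> = (u, sym_pair n w)"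
    "u \<in> tangent_space SL2R q" "n \<bullet> w = 0" using GP_tangent_cases[OF assms(1)] .
  have "\<theta> q u = 0" "s *\<^sub>R (n \<times> (w + dg \<mu> (\<theta> q u) \<times> n)) = 0"
    using assms(2) unfolding x(1,4) \<Theta>_eq[OF x(3,6)] by (auto simp: zero_prod_def)
  then have "u = 0" "n \<times> w = 0" using SL.inj[OF x(5)] s_pos linear_0[OF linear_dg] by auto
  then have "w = 0" using cross_inner_cross[of n w w] x(3,6) by simp
  then show ?thesis using x(4) \<open>u = 0\<close> by (simp add: sym_pair_def outer_simps zero_prod_def)
qed

lemma bilinear_\<Omega>G: "bilinear \<Omega>G"
  unfolding bilinear_def \<Omega>G_def
  by (auto intro!: linearI simp: linear_add[OF linear_dg] linear_scale[OF linear_dg] cross_add_left cross_add_right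
      cross_mult_left cross_mult_right algebra_simps)

lemma \<Omega>G_skew: "\<Omega>G x y \<bullet> z = - (y \<bullet> \<Omega>G x z)"
  by (simp add: \<Omega>G_def inner_prod_def inner3 cross_components algebra_simps)

text \<open>The cofactors contained in \<open>k\<close> are rewritten as a cross product. In this
  form the O'Neill term can be compared with the derivative of the vertical coframe.\<close>

lemma k_cofactor: "dg k (y \<times> z) = dg \<mu> (dg c (y \<times> z)) - dg \<mu> y \<times> dg \<mu> z"
  by (simp add: eq3_iff k_def cross_components algebra_simps)

text \<open>Derivative of \<open>\<Theta> x \<eta>\<close> in the base point along \<xi>, with
  \<eta> held fixed.\<close>

definition \<Theta>' :: "(real^2^2) \<times> (real^3^3) \<Rightarrow> (real^2^2) \<times> (real^3^3) \<Rightarrow> (real^2^2) \<times> (real^3^3) \<Rightarrow> (real^3) \<times> (real^3)" where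
  "\<Theta>' x \<xi> \<eta> = (\<theta> (fst \<xi>) (fst \<eta>), s *\<^sub>R (vee (snd \<eta> ** snd \<xi> - snd \<xi> ** snd \<eta>)
     + snd \<xi> *v dg \<mu> (\<theta> (fst x) (fst \<eta>)) + snd x *v dg \<mu> (\<theta> (fst \<xi>) (fst \<eta>))))"

text \<open>In the first component the O'Neill terms are symmetric and drop out, and the
  Maurer-Cartan equation cancels the rest. The second component may have a part along
  \<open>n\<close>; it is tested only against \<open>m\<close>, which is orthogonal to
  \<open>n\<close>.\<close>

lemma \<Theta>_torsion:
  assumes "\<xi> \<in> tangent_space GP x" "\<eta> \<in> tangent_space GP x" "\<zeta> \<in> tangent_space GP x"
  shows "(\<Theta>' x \<xi> \<eta> - \<Theta>' x \<eta> \<xi> + \<Omega>G (\<Theta> x \<xi>) (\<Theta> x \<eta>) - \<Omega>G (\<Theta> x \<eta>) (\<Theta> x \<xi>)) \<bullet> \<Theta> x \<zeta> = 0"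
proof -
  obtain q n u b where x: "x = (q, normal_proj n)" "q \<in> SL2R" "n \<bullet> n = 1" "\<xi> = (u, sym_pair n b)"
    "u \<in> tangent_space SL2R q" "n \<bullet> b = 0" using GP_tangent_cases[OF assms(1)] .
  obtain v c' where y: "\<eta> = (v, sym_pair n c')" "v \<in> tangent_space SL2R q" "n \<bullet> c' = 0"
    using GP_tangent_same assms(2) x(1,3) by metis
  obtain t d where z: "\<zeta> = (t, sym_pair n d)" "t \<in> tangent_space SL2R q" "n \<bullet> d = 0"
    using GP_tangent_same assms(3) x(1,3) by metis
  define y1 z1 where "y1 = \<theta> q u" and "z1 = \<theta> q v"
  define Y Z where "Y = dg \<mu> y1" and "Z = dg \<mu> z1"
  define m where "m = n \<times> (d + dg \<mu> (\<theta> q t) \<times> n)"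
  have nm: "n \<bullet> m = 0" by (simp add: m_def dot_cross_self)
  have st: "\<theta> u v - \<theta> v u = - dg c (y1 \<times> z1)" unfolding y1_def z1_def by (rule \<theta>_structure[OF x(5) y(2)])
  let ?X = "\<Theta>' x \<xi> \<eta> - \<Theta>' x \<eta> \<xi> + \<Omega>G (\<Theta> x \<xi>) (\<Theta> x \<eta>) - \<Omega>G (\<Theta> x \<eta>) (\<Theta> x \<xi>)"
  note T = \<Theta>_eq[OF x(3,6), of q u, folded y1_def, folded Y_def] \<Theta>_eq[OF x(3) y(3), of q v, folded z1_def, folded Z_def]
  have sk: "dg k (z1 \<times> y1) = - dg k (y1 \<times> z1)"
    using cross_skew[of z1 y1] linear_neg[OF linear_dg, of k "y1 \<times> z1"] by simp
  have f: "fst ?X = 0"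
  proof -
    have "fst ?X = (\<theta> u v - \<theta> v u) + (Y \<times> z1 - Z \<times> y1)"
      unfolding x(1,4) y(1) T \<Theta>'_def \<Omega>G_def by (simp add: Y_def Z_def algebra_simps)
    then show ?thesis unfolding st Y_def Z_def dg_\<mu>_cross by simp
  qed
  have l: "n \<times> (b + Y \<times> n) = n \<times> b + (Y - (n \<bullet> Y) *\<^sub>R n)" "n \<times> (c' + Z \<times> n) = n \<times> c' + (Z - (n \<bullet> Z) *\<^sub>R n)"
    by (simp_all add: cross_add_right cross_double[OF x(3)])
  have v: "vee (sym_pair n c' ** sym_pair n b - sym_pair n b ** sym_pair n c') = b \<times> c'"
     "vee (sym_pair n b ** sym_pair n c' - sym_pair n c' ** sym_pair n b) = c' \<times> b"
    using sym_pair_commutator x(3,6) y(3) by blast+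
  define W where "W = dg \<mu> (dg c (y1 \<times> z1))"
  have W: "dg \<mu> (\<theta> u v) - dg \<mu> (\<theta> v u) = - W"
    unfolding linear_diff[OF linear_dg, symmetric] st W_def by (simp add: linear_neg[OF linear_dg])
  have half: "(s / 2) *\<^sub>R (2 * a) = s *\<^sub>R a" for a :: "real^3" by (simp add: vec_eq_iff)
  have "snd ?X = s *\<^sub>R (b \<times> c' - c' \<times> b + (sym_pair n b *v Z - sym_pair n c' *v Y)
      + normal_proj n *v (dg \<mu> (\<theta> u v) - dg \<mu> (\<theta> v u))
      + Y \<times> (n \<times> (c' + Z \<times> n)) - Z \<times> (n \<times> (b + Y \<times> n)) + dg k (y1 \<times> z1))"
    unfolding x(1,4) y(1) T \<Theta>'_def \<Omega>G_def
    by (simp add: Y_def Z_def y1_def[symmetric] z1_def[symmetric] v sk cross_mult_right algebra_simps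
        matrix_vector_mult_diff_distrib half)
  also have "\<dots> = s *\<^sub>R (2 *\<^sub>R (b \<times> c') + (sym_pair n b *v Z - sym_pair n c' *v Y) - normal_proj n *v W
      + Y \<times> (n \<times> (c' + Z \<times> n)) - Z \<times> (n \<times> (b + Y \<times> n)) + (W - Y \<times> Z))"
    unfolding W k_cofactor W_def[symmetric] Y_def[symmetric] Z_def[symmetric] cross_skew[of c' b]
    by (simp add: normal_proj_mv scaleR_2 algebra_simps)
  finally have S: "snd ?X = s *\<^sub>R (2 *\<^sub>R (b \<times> c') + (sym_pair n b *v Z - sym_pair n c' *v Y) - normal_proj n *v W
      + Y \<times> (n \<times> (c' + Z \<times> n)) - Z \<times> (n \<times> (b + Y \<times> n)) + (W - Y \<times> Z))" .
  have "snd ?X \<bullet> m = s * (2 * ((b \<times> c') \<bullet> m) - ((n \<bullet> Z) * (b \<bullet> m)) + (n \<bullet> Y) * (c' \<bullet> m)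
      + ((Y \<times> (n \<times> c')) \<bullet> m + ((Y \<times> Z) \<bullet> m - (n \<bullet> Z) * ((Y \<times> n) \<bullet> m)))
      - ((Z \<times> (n \<times> b)) \<bullet> m + ((Z \<times> Y) \<bullet> m - (n \<bullet> Y) * ((Z \<times> n) \<bullet> m))) - (Y \<times> Z) \<bullet> m)"
    unfolding S l inner_scaleR_left using nm
    by (simp add: sym_pair_mv normal_proj_mv cross_add_right Cross3.right_diff_distrib cross_mult_right
        inner_add_left inner_diff_left algebra_simps)
  \<comment> \<open>The term in \<open>b\<close> and \<open>c'\<close> alone is a triple product in
    a plane, the mixed terms cancel through \<open>cross_cross_inner\<close>, and those in
    \<open>Y\<close> and \<open>Z\<close> through \<open>cross_double_inner\<close>.\<close>
  also have "\<dots> = 0"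
    using triple_zero[OF x(3,6) y(3) nm] cross_double_inner[of n Z Y m] nm x(3) cross_skew[of Z Y]
      cross_cross_inner[of Y n c' m] cross_cross_inner[of Z n b m]
    by (simp add: inner_commute algebra_simps)
  finally have "snd ?X \<bullet> m = 0" .
  moreover have "\<Theta> x \<zeta> = (\<theta> q t, s *\<^sub>R m)" unfolding x(1) z(1) m_def by (rule \<Theta>_eq[OF x(3) z(3)])
  ultimately show ?thesis using f by (simp add: inner_prod_def)
qed

lemma \<Theta>_linear: "linear (\<Theta> x)"
proof -
  have \<theta>r: "linear (\<theta> q)" for q
    using bounded_bilinear.bounded_linear_right[OF bounded_bilinear_\<theta>] linear_conv_bounded_linear by blast
  show ?thesis
    unfolding \<Theta>_def
    by (rule linearI) (simp_all add: linear_add[OF \<theta>r] linear_scale[OF \<theta>r] linear_add[OF linear_vee] linear_diff[OF linear_vee]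
        linear_scale[OF linear_vee] matrix_mult_add linear_add[OF linear_dg] linear_scale[OF linear_dg]
        matrix_vector_right_distrib matrix_vector_mult_scaleR bounded_bilinear.scaleR_left[OF bounded_bilinear_matrix_mult]
        bounded_bilinear.scaleR_right[OF bounded_bilinear_matrix_mult] algebra_simps)
qed

lemma bounded_bilinear_mv: "bounded_bilinear (\<lambda>A x. (A::real^3^3) *v x)"
  unfolding bilinear_conv_bounded_bilinear[symmetric] bilinear_def
  by (auto intro!: linearI simp: eq3_iff mv33_nth algebra_simps)

lemma \<Theta>_has_derivative:
  "((\<lambda>(x, v). \<Theta> x v) has_derivative (\<lambda>(u, w). \<Theta>' p u v + \<Theta> p w)) (at (p, v))"
proof -
  note d = bounded_linear_imp_has_derivative
  have c: "bounded_linear (\<lambda>y::(((real^2^2) \<times> (real^3^3)) \<times> ((real^2^2) \<times> (real^3^3))). fst (fst y))" "bounded_linear (\<lambda>y::(((real^2^2) \<times> (real^3^3)) \<times> ((real^2^2) \<times> (real^3^3))). snd (fst y))"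
    "bounded_linear (\<lambda>y::(((real^2^2) \<times> (real^3^3)) \<times> ((real^2^2) \<times> (real^3^3))). fst (snd y))" "bounded_linear (\<lambda>y::(((real^2^2) \<times> (real^3^3)) \<times> ((real^2^2) \<times> (real^3^3))). snd (snd y))"
    by (intro bounded_linear_compose[OF bounded_linear_fst] bounded_linear_compose[OF bounded_linear_snd]
        bounded_linear_fst bounded_linear_snd)+
  note c' = c[THEN bounded_linear_imp_has_derivative]
  note t = bounded_bilinear.FDERIV[OF bounded_bilinear_\<theta> c'(1,3)]
  have bv: "bounded_linear vee" "bounded_linear (dg \<mu>)"
    using linear_vee linear_dg by (simp_all add: linear_conv_bounded_linear)
  have "((\<lambda>y. \<Theta> (fst y) (snd y)) has_derivative (\<lambda>h. (\<theta> (fst p) (fst (snd h)) + \<theta> (fst (fst h)) (fst v),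
      s *\<^sub>R (vee ((snd v ** snd (fst h) + snd (snd h) ** snd p) - (snd p ** snd (snd h) + snd (fst h) ** snd v))
        + (snd p *v dg \<mu> (\<theta> (fst p) (fst (snd h)) + \<theta> (fst (fst h)) (fst v)) + snd (fst h) *v dg \<mu> (\<theta> (fst p) (fst v))))))) (at (p, v))"
    unfolding \<Theta>_def
    using has_derivative_Pair[OF t has_derivative_scaleR_right[OF has_derivative_add[OF
        bounded_linear.has_derivative[OF bv(1) has_derivative_diff[OF
          bounded_bilinear.FDERIV[OF bounded_bilinear_matrix_mult c'(4,2)] bounded_bilinear.FDERIV[OF bounded_bilinear_matrix_mult c'(2,4)]]]
        bounded_bilinear.FDERIV[OF bounded_bilinear_mv c'(2) bounded_linear.has_derivative[OF bv(2) t]]], of s],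
        where x="(p, v)"] by simp
  moreover have "(\<theta> (fst p) (fst (snd h)) + \<theta> (fst (fst h)) (fst v),
      s *\<^sub>R (vee ((snd v ** snd (fst h) + snd (snd h) ** snd p) - (snd p ** snd (snd h) + snd (fst h) ** snd v))
        + (snd p *v dg \<mu> (\<theta> (fst p) (fst (snd h)) + \<theta> (fst (fst h)) (fst v)) + snd (fst h) *v dg \<mu> (\<theta> (fst p) (fst v)))))
     = \<Theta>' p (fst h) v + \<Theta> p (snd h)" for h
    by (simp add: \<Theta>_def \<Theta>'_def linear_add[OF linear_vee] linear_diff[OF linear_vee] linear_add[OF linear_dg]
        matrix_vector_right_distrib scaleR_add_right scaleR_diff_right)
  ultimately show ?thesis by (simp add: case_prod_unfold)
qed

section \<open>Spanning vector fields of the bundle\<close>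

text \<open>Motion along a left-invariant field with the projection matrix held fixed. This is not
  the horizontal lift, but it is linear in \<open>x\<close>, and together with
  \<open>vfield\<close>, the rotation of planes about the axis \<open>l\<close>, it spans the
  tangent spaces.\<close>

definition hfield :: "real^3 \<Rightarrow> (real^2^2) \<times> (real^3^3) \<Rightarrow> (real^2^2) \<times> (real^3^3)" where
  "hfield y x = (E y (fst x), 0)"
definition vfield :: "real^3 \<Rightarrow> (real^2^2) \<times> (real^3^3) \<Rightarrow> (real^2^2) \<times> (real^3^3)" where
  "vfield l x = (0, hat l ** snd x - snd x ** hat l)"

lemma fields:
  assumes "x \<in> GP"
  shows "vec_field_at GP x (hfield y)" "vec_field_at GP x (vfield l)"
proof -
  have "bounded_linear (hfield y)"
    unfolding hfield_def[abs_def]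
    using bounded_linear_compose[OF linear_E_right[unfolded linear_conv_bounded_linear] bounded_linear_fst]
    by (intro bounded_linear_Pair bounded_linear_zero)
  moreover have "hfield y z \<in> tangent_space GP z" if zG: "z \<in> GP" for z
  proof -
    obtain q n where z: "z = (q, normal_proj n)" "q \<in> SL2R" "n \<bullet> n = 1" using GP_cases[OF zG] .
    show ?thesis
      using GP_tangentI[OF z(2,3) E_tangent[OF z(2)], of 0 y] by (simp add: z(1) hfield_def sym_pair_def outer_simps)
  qed
  ultimately show "vec_field_at GP x (hfield y)"
    unfolding vec_field_at_def by (auto intro: smooth_at_bounded_linear always_eventually)
  have "bounded_linear (\<lambda>x::(real^2^2) \<times> (real^3^3). hat l ** snd x - snd x ** hat l)"
    by (intro bounded_linear_sub bounded_linear_compose[OF bounded_bilinear.bounded_linear_right[OF bounded_bilinear_matrix_mult]]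
        bounded_linear_compose[OF bounded_bilinear.bounded_linear_left[OF bounded_bilinear_matrix_mult]] bounded_linear_snd)
  then have "bounded_linear (vfield l)"
    unfolding vfield_def[abs_def] by (intro bounded_linear_Pair bounded_linear_zero)
  moreover have "vfield l z \<in> tangent_space GP z" if zG: "z \<in> GP" for z
  proof -
    obtain q n where z: "z = (q, normal_proj n)" "q \<in> SL2R" "n \<bullet> n = 1" using GP_cases[OF zG] .
    show ?thesis
      using GP_tangentI[OF z(2,3) subspace_0[OF SL.sub[OF z(2)]], of "l \<times> n"]
      by (simp add: z(1) vfield_def hat_normal_proj dot_cross_self)
  qed
  ultimately show "vec_field_at GP x (vfield l)"
    unfolding vec_field_at_def by (auto intro: smooth_at_bounded_linear always_eventually)
qed

text \<open>The commutator of velocity and projection is the rotation vector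
  \<open>n \<times> w\<close>, and rotating \<open>n\<close> about it gives back
  \<open>(n \<times> w) \<times> n = w\<close>.\<close>

lemma field_decomposition:
  assumes "\<xi> \<in> tangent_space GP x"
  shows "\<xi> = hfield (\<theta> (fst x) (fst \<xi>)) x + vfield (vee (snd \<xi> ** snd x - snd x ** snd \<xi>)) x"
proof -
  obtain q n u w where x: "x = (q, normal_proj n)" "q \<in> SL2R" "n \<bullet> n = 1" "\<xi> = (u, sym_pair n w)"
    "u \<in> tangent_space SL2R q" "n \<bullet> w = 0" using GP_tangent_cases[OF assms(1)] .
  have "(n \<times> w) \<times> n = w" using cross_skew[of "n \<times> w" n] Lagrange[of n n w] x(3,6) by simp
  then show ?thesis
    using sym_pair_tangent(5)[OF x(3,6)] by (simp add: x(1,4) hfield_def vfield_def E_\<theta>[OF x(5)] hat_normal_proj)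
qed

sublocale G: framed_target GP gG \<Theta> \<Omega>G
proof
  show "gG p u v = \<Theta> p u \<bullet> \<Theta> p v" if "u \<in> tangent_space GP p" "v \<in> tangent_space GP p" for p u v
    by (rule gG_\<Theta>[OF that])
  show "u = 0" if "u \<in> tangent_space GP p" "\<Theta> p u = 0" for p u by (rule \<Theta>_inj[OF that])
  show sub: "subspace (tangent_space GP p)" if "p \<in> GP" for p by (rule regular_at_subspace[OF regular_Gr2 that])
  show "\<exists>Y. vec_field_at GP p Y \<and> Y p = v" if "v \<in> tangent_space GP p" for p v
    using field_decomposition[OF that, symmetric] fields[OF tangent_space_in[OF that]]
    by (intro exI[of _ "\<lambda>x. hfield (\<theta> (fst p) (fst v)) x + vfield (vee (snd v ** snd p - snd p ** snd v)) x"])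
      (simp add: vec_field_at_add sub)
  show "lie_bracket GP X Y p \<in> tangent_space GP p"
    if "p \<in> GP" "vec_field_at GP p X" "vec_field_at GP p Y" for p X Y
    by (rule regular_at_bracket[OF regular_Gr2 that])
  show "bilinear \<Omega>G" by (rule bilinear_\<Omega>G)
  show "\<Omega>G x y \<bullet> z = - (y \<bullet> \<Omega>G x z)" for x y z by (rule \<Omega>G_skew)
  show "\<exists>H \<Theta>'. (\<forall>\<^sub>F x in nhds p. x \<in> GP \<longrightarrow> (\<forall>u\<in>tangent_space GP x. \<Theta> x u = H x u)) \<and>
      linear (H p) \<and> (\<forall>u. \<Theta>' u 0 = 0) \<and>
      (\<forall>v. ((\<lambda>(x, v). H x v) has_derivative (\<lambda>(u, w). \<Theta>' u v + H p w)) (at (p, v))) \<and>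
      (\<forall>u\<in>tangent_space GP p. \<forall>v\<in>tangent_space GP p. \<forall>z\<in>tangent_space GP p.
        (\<Theta>' u v - \<Theta>' v u + \<Omega>G (\<Theta> p u) (\<Theta> p v) - \<Omega>G (\<Theta> p v) (\<Theta> p u)) \<bullet> \<Theta> p z = 0)"
    if "p \<in> GP" for p
  proof (rule exI[of _ \<Theta>], rule exI[of _ "\<Theta>' p"], intro conjI allI ballI)
    show "\<Theta>' p u 0 = 0" for u
      by (simp add: \<Theta>'_def bounded_bilinear.zero_right[OF bounded_bilinear_\<theta>] linear_0[OF linear_dg] linear_0[OF linear_vee]
          zero_prod_def)
  qed (simp_all add: \<Theta>_linear \<Theta>_has_derivative \<Theta>_torsion)
  show "\<exists>(n::nat) F C. (\<forall>a<n. vec_field_at GP p (F a) \<and> smooth_on UNIV (C a :: _ \<times> _ \<Rightarrow> real)) \<and>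
      (\<forall>\<^sub>F y in nhds p. y \<in> GP \<longrightarrow> (\<forall>u\<in>tangent_space GP y. u = (\<Sum>a<n. C a (y, u) *\<^sub>R F a y)))"
    if "p \<in> GP" for p
  proof -
    \<comment> \<open>Six fields for five dimensions: the indices 0 to 2 move the base point along
      the frame, 3 to 5 rotate the plane about the coordinate axes, and \<open>?i\<close> is the
      axis in both cases.\<close>
    let ?i = "\<lambda>a::nat. if a = 0 \<or> a = 3 then 1 else if a = 1 \<or> a = 4 then 2 else (3::3)"
    let ?F = "\<lambda>a. if a < 3 then hfield (axis (?i a) 1) else vfield (axis (?i a) 1)"
    let ?C = "\<lambda>(a::nat) y. if a < 3 then \<theta> (fst (fst y)) (fst (snd y)) $ ?i a
        else vee (snd (snd y) ** snd (fst y) - snd (fst y) ** snd (snd y)) $ ?i a"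
    have h: "hfield y x = (\<Sum>i\<in>UNIV. y $ i *\<^sub>R hfield (axis i 1) x)" for y x
      by (simp add: hfield_def sum_prod E_sum[of y] e_E)
    have vf: "linear (\<lambda>l. vfield l x)" for x
      unfolding vfield_def
      by (rule linearI) (simp_all add: linear_add[OF linear_hat] linear_scale[OF linear_hat] matrix_mult_add
        bounded_bilinear.scaleR_left[OF bounded_bilinear_matrix_mult]
        bounded_bilinear.scaleR_right[OF bounded_bilinear_matrix_mult] algebra_simps)
    have v: "vfield l x = (\<Sum>i\<in>UNIV. l $ i *\<^sub>R vfield (axis i 1) x)" for l x
    proof -
      have "l = (\<Sum>i\<in>UNIV. l $ i *\<^sub>R axis i 1)" by (simp add: eq3_iff sum_3 axis_def)
      then have "vfield l x = vfield (\<Sum>i\<in>UNIV. l $ i *\<^sub>R axis i 1) x" by simp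
      then show ?thesis by (simp add: linear_sum[OF vf] linear_scale[OF vf])
    qed
    show ?thesis
    proof (intro exI[of _ 6] exI[of _ ?F] exI[of _ ?C] conjI allI impI always_eventually ballI)
      show "vec_field_at GP p (?F a)" for a using fields[OF that] by simp
      have "smooth_on UNIV (\<lambda>y::((real^2^2) \<times> (real^3^3)) \<times> ((real^2^2) \<times> (real^3^3)).
          \<theta> (fst (fst y)) (fst (snd y)) $ i)" for i
        by (intro smooth_on_linear[OF _ bounded_linear_vec_nth] smooth_on_bilinear[OF _ bounded_bilinear_\<theta>]
            smooth_on_linear[OF _ bounded_linear_fst] smooth_on_linear[OF _ bounded_linear_snd] smooth_on_bounded_linear
            bounded_linear_fst bounded_linear_snd open_UNIV)
      moreover have "smooth_on UNIV (\<lambda>y::((real^2^2) \<times> (real^3^3)) \<times> ((real^2^2) \<times> (real^3^3)).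
          vee (snd (snd y) ** snd (fst y) + - (snd (fst y) ** snd (snd y))) $ i)" for i
        by (intro smooth_on_linear[OF _ bounded_linear_vec_nth] smooth_on_bilinear[OF _ bounded_bilinear_matrix_mult]
            smooth_on_linear[OF _ linear_vee[unfolded linear_conv_bounded_linear]] smooth_on_add
            smooth_on_linear[OF _ bounded_linear_minus[OF bounded_linear_ident]]
            smooth_on_linear[OF _ bounded_linear_fst] smooth_on_linear[OF _ bounded_linear_snd] smooth_on_bounded_linear
            bounded_linear_fst bounded_linear_snd open_UNIV)
      ultimately show "smooth_on UNIV (?C a)" for a
        by (cases "a < 3") (simp_all del: vee_nth)
      show "u = (\<Sum>a<6. ?C a (y, u) *\<^sub>R ?F a y)" if "u \<in> tangent_space GP y" for y u
        using field_decomposition[OF that] unfolding h[of "\<theta> _ _"] v[of "vee _"]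
        by (simp add: sum_3 eval_nat_numeral add.assoc)
    qed
  qed
qed

lemma dmap_fst: "\<xi> \<in> tangent_space GP x \<Longrightarrow> dmap GP fst x \<xi> = fst \<xi>"
  by (erule dmap_eq) (rule bounded_linear_imp_has_derivative[OF bounded_linear_fst])

text \<open>Vertical vectors have first coframe component 0, and \<open>v0\<close> is the vertical
  vector with the same second component as \<tau>: its velocity \<open>w'\<close> absorbs the
  connection term of the motion of the base point. Hence \<open>v0\<close> is the orthogonal
  projection of \<tau>.\<close>

lemma vertical_part_zero:
  assumes "\<tau> \<in> tangent_space GP x" "vertical_part GP gG fst x \<tau> = 0"
  shows "snd (\<Theta> x \<tau>) = 0"
proof -
  obtain q n u w where x: "x = (q, normal_proj n)" "q \<in> SL2R" "n \<bullet> n = 1" "\<tau> = (u, sym_pair n w)"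
    "u \<in> tangent_space SL2R q" "n \<bullet> w = 0" using GP_tangent_cases[OF assms(1)] .
  define w' where "w' = w + dg \<mu> (\<theta> q u) \<times> n"
  have nw: "n \<bullet> w' = 0" using x(6) by (simp add: w'_def inner_add_right dot_cross_self)
  define v0 where "v0 = (0 :: real^2^2, sym_pair n w')"
  have xP: "x \<in> GP" using tangent_space_in[OF assms(1)] .
  have v0T: "v0 \<in> tangent_space GP x"
    unfolding v0_def x(1) by (rule GP_tangentI[OF x(2,3) subspace_0[OF SL.sub[OF x(2)]] nw])
  have \<theta>0: "\<theta> q 0 = 0" by (rule bounded_bilinear.zero_right[OF bounded_bilinear_\<theta>])
  have \<Theta>v0: "\<Theta> x v0 = (0, snd (\<Theta> x \<tau>))"
    unfolding x(1,4) v0_def \<Theta>_eq[OF x(3,6)] \<Theta>_eq[OF x(3) nw] by (simp add: \<theta>0 w'_def linear_0[OF linear_dg])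
  have vert: "v \<in> vertical_space GP fst x \<longleftrightarrow> v \<in> tangent_space GP x \<and> fst v = 0" for v
    unfolding vertical_space_def using dmap_fst[of v x] by auto
  have \<Theta>vert: "fst (\<Theta> x z) = 0" if "z \<in> vertical_space GP fst x" for z
    using that unfolding vert by (simp add: \<Theta>_def x(1) \<theta>0)
  have v0V: "v0 \<in> vertical_space GP fst x" unfolding vert using v0T by (simp add: v0_def)
  have orth: "gG x (\<tau> - v0) z = 0" if "z \<in> vertical_space GP fst x" for z
  proof -
    have "gG x (\<tau> - v0) z = (\<Theta> x \<tau> - \<Theta> x v0) \<bullet> \<Theta> x z"
      using that assms(1) v0T G.sub[OF xP] unfolding vert
      by (simp add: gG_\<Theta> subspace_diff linear_diff[OF \<Theta>_linear])
    then show ?thesis using \<Theta>vert[OF that] by (simp add: \<Theta>v0 inner_prod_def)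
  qed
  have uniq: "v = v0" if v: "v \<in> vertical_space GP fst x" "\<forall>z\<in>vertical_space GP fst x. gG x (\<tau> - v) z = 0" for v
  proof -
    have d: "v0 - v \<in> vertical_space GP fst x"
      using v0V v(1) G.sub[OF xP] unfolding vert by (simp add: subspace_diff)
    have t: "\<tau> - v \<in> tangent_space GP x" "\<tau> - v0 \<in> tangent_space GP x" "v0 - v \<in> tangent_space GP x"
      using subspace_diff[OF G.sub[OF xP]] assms(1) v(1) v0V d unfolding vert by blast+
    have "\<Theta> x (v0 - v) \<bullet> \<Theta> x (v0 - v) = gG x (\<tau> - v) (v0 - v) - gG x (\<tau> - v0) (v0 - v)"
      using t by (simp add: gG_\<Theta> linear_diff[OF \<Theta>_linear] inner_diff_left)
    also have "\<dots> = 0" using v(2) d orth by simp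
    finally show ?thesis using \<Theta>_inj[OF t(3)] by simp
  qed
  have "vertical_part GP gG fst x \<tau> = v0"
    unfolding vertical_part_def by (rule the_equality) (use v0V orth uniq in blast)+
  then have "\<Theta> x v0 = 0" using assms(2) linear_0[OF \<Theta>_linear] by simp
  then show ?thesis by (simp add: \<Theta>v0 zero_prod_def)
qed

end

section \<open>Charts and surfaces\<close>

lemma dmap_frechet:
  assumes "u \<in> tangent_space M x" "open U" "x \<in> U" "smooth_on U F" "\<And>y. y \<in> M \<inter> U \<Longrightarrow> f y = F y"
  shows "dmap M f x u = frechet_derivative F (at x) u"
proof (rule dmap_eq[OF assms(1)], rule has_derivative_eq_on)
  show "(F has_derivative frechet_derivative F (at x)) (at x within M)"
    by (rule has_derivative_at_withinI[OF smooth_on_has_derivative[OF assms(4,3)]])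
  show "x \<in> M" using assms(1) by (rule tangent_space_in)
  show "\<forall>\<^sub>F y in nhds x. y \<in> M \<longrightarrow> f y = F y"
    unfolding eventually_nhds using assms(2,3,5) by blast
qed

text \<open>The second derivatives of an extension of \<open>h\<close> cancel by symmetry and the
  derivative along the bracket is left. Vector values are allowed because \<open>h\<close> will be
  the immersion and its normal.\<close>

lemma second_derivative_bracket:
  fixes h :: "'a::euclidean_space \<Rightarrow> 'b::euclidean_space"
  assumes p: "p \<in> M" and h: "smooth_at M h p" and X: "vec_field_at M p X" and Y: "vec_field_at M p Y"
    and br: "lie_bracket M X Y p \<in> tangent_space M p"
  shows "dmap M (\<lambda>z. dmap M h z (Y z)) p (X p) - dmap M (\<lambda>z. dmap M h z (X z)) p (Y p) = dmap M h p (lie_bracket M X Y p)"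
proof -
  obtain U F where U: "open U" "p \<in> U" "smooth_on U F" "\<forall>x\<in>M \<inter> U. h x = F x"
    using h unfolding smooth_at_def by blast
  have hF: "\<And>y. y \<in> M \<inter> U \<Longrightarrow> h y = F y" using U(4) by blast
  have d: "dmap M (\<lambda>z. dmap M h z (Z z)) p u = D2 F p u (Z p) + frechet_derivative F (at p) (dmap M Z p u)"
    if Z: "vec_field_at M p Z" and u: "u \<in> tangent_space M p" for Z u
  proof (rule dmap_eq[OF u], rule has_derivative_eq_on[OF _ p])
    show "((\<lambda>z. frechet_derivative F (at z) (Z z)) has_derivative
       (\<lambda>u. D2 F p u (Z p) + frechet_derivative F (at p) (dmap M Z p u))) (at p within M)"
      by (rule has_derivative_frechet[OF U(1,3,2) dmap_has_derivative[OF _ p]]) (use Z in \<open>simp add: vec_field_at_def\<close>)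
    have "\<forall>\<^sub>F x in nhds p. x \<in> U" using U by (intro eventually_nhds_in_open)
    moreover have "\<forall>\<^sub>F x in nhds p. x \<in> M \<longrightarrow> Z x \<in> tangent_space M x" using Z by (simp add: vec_field_at_def)
    ultimately show "\<forall>\<^sub>F z in nhds p. z \<in> M \<longrightarrow> dmap M h z (Z z) = frechet_derivative F (at z) (Z z)"
      by eventually_elim (auto intro: dmap_frechet[OF _ U(1) _ U(3) hF])
  qed
  have lin: "linear (frechet_derivative F (at p))"
    using smooth_on_has_derivative[OF U(3,2)] has_derivative_linear by blast
  have "dmap M h p (lie_bracket M X Y p) = frechet_derivative F (at p) (lie_bracket M X Y p)"
    by (rule dmap_frechet[OF br U(1,2,3) hF])
  then show ?thesis
    unfolding d[OF Y vec_field_at_tangent[OF X p]] d[OF X vec_field_at_tangent[OF Y p]] lie_bracket_def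
    using D2_symmetric[OF U(1,3,2), of "X p" "Y p"] by (simp add: linear_diff[OF lin])
qed

text \<open>The fields are the constant fields of the model subspace carried over by the inverse
  chart. They commute because the second derivative of the inverse chart is symmetric.\<close>

lemma chart_fields:
  fixes M :: "'a::euclidean_space set"
  assumes "submanifold d M" "p \<in> M"
  obtains \<Phi> :: "'a \<Rightarrow> 'a" and S U X where "regular_at M p \<Phi> S U" "dim S = d" "\<And>x. linear (\<lambda>s. X s x)"
    "\<And>s x. s \<in> S \<Longrightarrow> x \<in> M \<inter> U \<Longrightarrow> vec_field_at M x (X s)"
    "\<And>r s x. r \<in> S \<Longrightarrow> s \<in> S \<Longrightarrow> x \<in> M \<inter> U \<Longrightarrow> lie_bracket M (X r) (X s) x = 0"
    "\<And>s x. x \<in> M \<inter> U \<Longrightarrow> frechet_derivative \<Phi> (at x) (X s x) = s"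
    "\<And>x u. x \<in> M \<inter> U \<Longrightarrow> u \<in> tangent_space M x \<Longrightarrow> \<exists>s\<in>S. X s x = u"
proof -
  obtain U V \<Phi> \<Psi> and S :: "'a set" where c: "open U" "p \<in> U" "open V" "homeomorphism U V \<Phi> \<Psi>"
    "smooth_on U \<Phi>" "smooth_on V \<Psi>" "subspace S" "dim S = d" "\<Phi> ` (M \<inter> U) = V \<inter> S"
    using assms(1)[unfolded submanifold_def, rule_format, OF assms(2)] by (elim exE conjE) (rule that)
  have \<Psi>\<Phi>: "\<Psi> (\<Phi> x) = x" "\<Phi> x \<in> V" if "x \<in> U" for x using c(4) that unfolding homeomorphism_def by auto
  have \<Phi>\<Psi>: "\<Phi> (\<Psi> y) = y" "\<Psi> y \<in> U" if "y \<in> V" for y using c(4) that unfolding homeomorphism_def by auto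
  have dPhi: "(\<Phi> has_derivative frechet_derivative \<Phi> (at x)) (at x)" if "x \<in> U" for x
    by (rule smooth_on_has_derivative[OF c(5) that])
  have dPsi: "(\<Psi> has_derivative frechet_derivative \<Psi> (at y)) (at y)" if "y \<in> V" for y
    by (rule smooth_on_has_derivative[OF c(6) that])
  have inv1: "frechet_derivative \<Psi> (at (\<Phi> x)) (frechet_derivative \<Phi> (at x) u) = u" if x: "x \<in> U" for x u
  proof -
    have "((\<lambda>x. \<Psi> (\<Phi> x)) has_derivative (\<lambda>u. frechet_derivative \<Psi> (at (\<Phi> x)) (frechet_derivative \<Phi> (at x) u))) (at x)"
      by (rule has_derivative_compose[OF dPhi[OF x] dPsi[OF \<Psi>\<Phi>(2)[OF x]]])
    moreover have "((\<lambda>x. \<Psi> (\<Phi> x)) has_derivative (\<lambda>u. u)) (at x)"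
      by (rule has_derivative_transform_within_open[OF has_derivative_ident c(1) x]) (simp add: \<Psi>\<Phi>)
    ultimately show ?thesis using has_derivative_unique fun_cong by metis
  qed
  have inv2: "frechet_derivative \<Phi> (at x) (frechet_derivative \<Psi> (at (\<Phi> x)) s) = s" if x: "x \<in> U" for x s
  proof -
    have "(\<Phi> has_derivative frechet_derivative \<Phi> (at x)) (at (\<Psi> (\<Phi> x)))" using dPhi[OF x] \<Psi>\<Phi>[OF x] by simp
    from has_derivative_compose[OF dPsi[OF \<Psi>\<Phi>(2)[OF x]] this]
    have "((\<lambda>y. \<Phi> (\<Psi> y)) has_derivative (\<lambda>s. frechet_derivative \<Phi> (at x) (frechet_derivative \<Psi> (at (\<Phi> x)) s))) (at (\<Phi> x))" .
    moreover have "((\<lambda>y. \<Phi> (\<Psi> y)) has_derivative (\<lambda>u. u)) (at (\<Phi> x))"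
      by (rule has_derivative_transform_within_open[OF has_derivative_ident c(3) \<Psi>\<Phi>(2)[OF x]]) (simp add: \<Phi>\<Psi>)
    ultimately show ?thesis using has_derivative_unique fun_cong by metis
  qed
  have linPhi: "linear (frechet_derivative \<Phi> (at x))" if "x \<in> U" for x using dPhi[OF that] has_derivative_linear by blast
  \<comment> \<open>The value 0 outside the chart domain keeps \<open>X s x\<close> linear in
    \<open>s\<close> for every \<open>x\<close>.\<close>
  define X where "X s x = (if x \<in> U then frechet_derivative \<Psi> (at (\<Phi> x)) s else 0)" for s x
  have Xlin: "linear (\<lambda>s. X s x)" for x
    unfolding X_def using dPsi[OF \<Psi>\<Phi>(2)] has_derivative_linear by (cases "x \<in> U") (auto intro: linearI)
  have sX: "smooth_on U (X s)" for s
  proof (rule smooth_on_cong[OF c(1)])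
    show "smooth_on U (\<lambda>x. frechet_derivative \<Psi> (at (\<Phi> x)) s)"
      by (rule smooth_on_compose[OF c(1,3) _ c(5) smooth_on_frechet_const[OF c(6)]]) (use \<Psi>\<Phi> in auto)
  qed (simp add: X_def)
  have T: "tangent_space M x = {u. frechet_derivative \<Phi> (at x) u \<in> S}" if x: "x \<in> M \<inter> U" for x
  proof (intro set_eqI iffI)
    fix u assume u: "u \<in> tangent_space M x"
    have "frechet_derivative \<Phi> (at x) u \<in> S"
    proof (rule derivative_in_subspace[OF has_derivative_at_withinI[OF dPhi] u _ c(7)])
      have "\<forall>\<^sub>F x in nhds x. x \<in> U" using c(1) x by (intro eventually_nhds_in_open) auto
      then show "\<forall>\<^sub>F y in nhds x. y \<in> M \<longrightarrow> \<Phi> y \<in> S" by eventually_elim (use c(9) in auto)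
    qed (use x in simp)
    then show "u \<in> {u. frechet_derivative \<Phi> (at x) u \<in> S}" by simp
  next
    fix u assume "u \<in> {u. frechet_derivative \<Phi> (at x) u \<in> S}"
    then have sS: "frechet_derivative \<Phi> (at x) u \<in> S" by simp
    define s where "s = frechet_derivative \<Phi> (at x) u"
    have us: "frechet_derivative \<Psi> (at (\<Phi> x)) s = u" using inv1 x by (simp add: s_def)
    have \<Phi>x: "\<Phi> x \<in> V \<inter> S" using c(9) x by blast
    \<comment> \<open>The curve with velocity \<open>u\<close> is the image of a straight line in
      the model subspace under the inverse chart.\<close>
    let ?l = "\<lambda>t::real. \<Phi> x + t *\<^sub>R s"
    have "continuous_on UNIV ?l" by (intro continuous_intros)
    then have "open (?l -` V)" using c(3) continuous_on_open_vimage[of UNIV ?l] by auto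
    moreover have "0 \<in> ?l -` V" using \<Phi>x by simp
    ultimately obtain \<epsilon> where \<epsilon>: "\<epsilon> > 0" "ball 0 \<epsilon> \<subseteq> ?l -` V" using openE by blast
    have sub: "?l t \<in> V" if "t \<in> {-\<epsilon><..<\<epsilon>}" for t
    proof -
      have "t \<in> ball 0 \<epsilon>" using that by (simp add: dist_real_def abs_less_iff)
      then show ?thesis using \<epsilon>(2) by blast
    qed
    have dl: "(?l has_derivative (\<lambda>t. t *\<^sub>R s)) (at 0)" by (auto intro!: derivative_eq_intros)
    show "u \<in> tangent_space M x"
    proof (rule tangent_spaceI[OF \<epsilon>(1), of "\<lambda>t. \<Psi> (?l t)"])
      show "smooth_on {-\<epsilon><..<\<epsilon>} (\<lambda>t. \<Psi> (?l t))"
      proof (rule smooth_on_compose[OF _ c(3) _ _ c(6)])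
        show "smooth_on {-\<epsilon><..<\<epsilon>} ?l"
          by (intro smooth_on_add smooth_on_const smooth_on_bounded_linear[OF _ bounded_linear_scaleR_left]) simp_all
      qed (use sub in auto)
      show "(\<lambda>t. \<Psi> (?l t)) ` {-\<epsilon><..<\<epsilon>} \<subseteq> M"
      proof
        fix y assume "y \<in> (\<lambda>t. \<Psi> (?l t)) ` {-\<epsilon><..<\<epsilon>}"
        then obtain t where t: "t \<in> {-\<epsilon><..<\<epsilon>}" "y = \<Psi> (?l t)" by blast
        have "?l t \<in> V \<inter> S" using sub[OF t(1)] \<Phi>x sS c(7) by (auto simp: s_def intro: subspace_add subspace_scale)
        then obtain m where "m \<in> M \<inter> U" "?l t = \<Phi> m" using c(9) by blast
        then show "y \<in> M" using t(2) \<Psi>\<Phi>(1) by simp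
      qed
      show "\<Psi> (?l 0) = x" using \<Psi>\<Phi>(1) x by simp
      have "(\<Psi> has_derivative frechet_derivative \<Psi> (at (\<Phi> x))) (at (?l 0))" using dPsi \<Phi>x by simp
      from has_derivative_compose[OF dl this]
      have "((\<lambda>t. \<Psi> (?l t)) has_derivative (\<lambda>t. frechet_derivative \<Psi> (at (\<Phi> x)) (t *\<^sub>R s))) (at 0)" .
      moreover have "frechet_derivative \<Psi> (at (\<Phi> x)) (t *\<^sub>R s) = t *\<^sub>R u" for t
        using linear_scale[OF has_derivative_linear[OF dPsi]] \<Phi>x us by auto
      ultimately show "((\<lambda>t. \<Psi> (?l t)) has_vector_derivative u) (at 0)"
        by (simp add: has_vector_derivative_def)
    qed
  qed
  have reg: "regular_at M p \<Phi> S U" unfolding regular_at_def using c T by blast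
  have vf: "vec_field_at M x (X s)" if s: "s \<in> S" and x: "x \<in> M \<inter> U" for s x
    unfolding vec_field_at_def
  proof
    show "smooth_at M (X s) x" by (rule smooth_at_smooth_on[OF c(1) _ sX]) (use x in simp)
    have "\<forall>\<^sub>F x in nhds x. x \<in> U" using c(1) x by (intro eventually_nhds_in_open) auto
    then show "\<forall>\<^sub>F y in nhds x. y \<in> M \<longrightarrow> X s y \<in> tangent_space M y"
      by eventually_elim (use T s inv2 in \<open>auto simp: X_def\<close>)
  qed
  have dX: "dmap M (X s) x (X r x) = D2 \<Psi> (\<Phi> x) r s" if "r \<in> S" and x: "x \<in> M \<inter> U" for r s x
  proof -
    have t: "X r x \<in> tangent_space M x" using vec_field_at_tangent[OF vf[OF that]] x by blast
    have xU: "x \<in> U" "\<Phi> x \<in> V" using x \<Psi>\<Phi> by auto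
    have "((\<lambda>y. frechet_derivative \<Psi> (at y) s) has_derivative (\<lambda>v. D2 \<Psi> (\<Phi> x) v s)) (at (\<Phi> x))"
      unfolding D2_def by (rule smooth_on_has_derivative[OF smooth_on_frechet_const[OF c(6)] xU(2)])
    from has_derivative_compose[OF dPhi[OF xU(1)] this]
    have "((\<lambda>z. frechet_derivative \<Psi> (at (\<Phi> z)) s) has_derivative (\<lambda>u. D2 \<Psi> (\<Phi> x) (frechet_derivative \<Phi> (at x) u) s)) (at x)" .
    then have "(X s has_derivative (\<lambda>u. D2 \<Psi> (\<Phi> x) (frechet_derivative \<Phi> (at x) u) s)) (at x)"
      by (rule has_derivative_transform_within_open[OF _ c(1) xU(1)]) (simp add: X_def)
    from dmap_eq[OF t has_derivative_at_withinI[OF this]] show ?thesis using xU inv2 by (simp add: X_def)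
  qed
  show ?thesis
  proof (rule that)
    show "regular_at M p \<Phi> S U" "dim S = d" by (fact reg c(8))+
    show "linear (\<lambda>s. X s x)" for x by (rule Xlin)
    show "vec_field_at M x (X s)" if "s \<in> S" "x \<in> M \<inter> U" for s x by (rule vf[OF that])
    show "lie_bracket M (X r) (X s) x = 0" if "r \<in> S" "s \<in> S" "x \<in> M \<inter> U" for r s x
      unfolding lie_bracket_def using dX that D2_symmetric[OF c(3,6) \<Psi>\<Phi>(2), of x r s] by simp
    show "frechet_derivative \<Phi> (at x) (X s x) = s" if "x \<in> M \<inter> U" for s x using inv2 that by (simp add: X_def)
    show "\<exists>s\<in>S. X s x = u" if "x \<in> M \<inter> U" "u \<in> tangent_space M x" for x u
      using T[OF that(1)] that inv1 by (intro bexI[of _ "frechet_derivative \<Phi> (at x) u"]) (auto simp: X_def)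
  qed
qed

text \<open>Applied to \<open>F\<close> after \<open>fst\<close> on the product space, with the
  moving vector \<open>(snd y, 0)\<close>, the rule \<open>has_derivative_frechet\<close> yields the
  derivative in point and vector jointly.\<close>

lemma has_derivative_frechet_joint:
  fixes F :: "'a::euclidean_space \<Rightarrow> 'b::real_normed_vector"
  assumes U: "open U" "smooth_on U F" "p \<in> U"
  shows "((\<lambda>y. frechet_derivative F (at (fst y)) (snd y)) has_derivative
     (\<lambda>h. D2 F p (fst h) v + frechet_derivative F (at p) (snd h))) (at (p, v))"
proof -
  let ?F = "\<lambda>y::'a \<times> 'a. F (fst y)"
  have o: "open (fst -` U :: ('a \<times> 'a) set)" using U(1) by (rule open_vimage_fst)
  have sf: "smooth_on (fst -` U :: ('a \<times> 'a) set) ?F"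
    by (rule smooth_on_compose[OF o U(1) _ smooth_on_bounded_linear[OF o bounded_linear_fst] U(2)]) auto
  have fd: "frechet_derivative ?F (at y) w = frechet_derivative F (at (fst y)) (fst w)" if "fst y \<in> U" for y w
  proof -
    have "(?F has_derivative (\<lambda>w. frechet_derivative F (at (fst y)) (fst w))) (at y)"
      by (rule has_derivative_compose[OF bounded_linear_imp_has_derivative[OF bounded_linear_fst] smooth_on_has_derivative[OF U(2) that]])
    from fun_cong[OF frechet_derivative_at[OF this], of w] show ?thesis by simp
  qed
  have pU: "(p, v) \<in> fst -` U" using U by simp
  have Y: "((\<lambda>y::'a \<times> 'a. (snd y, 0::'a)) has_derivative (\<lambda>h. (snd h, 0))) (at (p, v))"
    by (intro bounded_linear_imp_has_derivative bounded_linear_Pair bounded_linear_snd bounded_linear_zero)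
  have D: "D2 ?F (p, v) h (v, 0) = D2 F p (fst h) v" for h
  proof -
    have "((\<lambda>y. frechet_derivative F (at (fst y)) v) has_derivative (\<lambda>h. D2 F p (fst h) v)) (at (p, v))"
      unfolding D2_def
      by (rule has_derivative_compose[OF bounded_linear_imp_has_derivative[OF bounded_linear_fst]])
        (use smooth_on_has_derivative[OF smooth_on_frechet_const[OF U(2)] U(3)] in simp)
    then have "((\<lambda>y. frechet_derivative ?F (at y) (v, 0)) has_derivative (\<lambda>h. D2 F p (fst h) v)) (at (p, v))"
      by (rule has_derivative_transform_within_open[OF _ o pU]) (auto simp: fd)
    from fun_cong[OF frechet_derivative_at[OF this], of h] show ?thesis by (simp add: D2_def)
  qed
  have "((\<lambda>y. frechet_derivative ?F (at y) (snd y, 0)) has_derivative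
     (\<lambda>h. D2 ?F (p, v) h (snd (p, v), 0) + frechet_derivative ?F (at (p, v)) (snd h, 0))) (at (p, v))"
    by (rule has_derivative_frechet[OF o sf pU Y])
  then have "((\<lambda>y. frechet_derivative ?F (at y) (snd y, 0)) has_derivative
     (\<lambda>h. D2 F p (fst h) v + frechet_derivative F (at p) (snd h))) (at (p, v))"
    using U(3) by (simp add: D fd)
  then show ?thesis
    by (rule has_derivative_transform_within_open[OF _ o pU]) (auto simp: fd)
qed

section \<open>The surface in frame coordinates\<close>

locale surface = sl2_gr +
  fixes M :: "'m::euclidean_space set" and f :: "'m \<Rightarrow> real^2^2" and N :: "'m \<Rightarrow> real^2^2"
  assumes immersed: "immersed_surface M SL2R g f N"
begin

lemma M_submanifold: "submanifold 2 M" and f_image: "f ` M \<subseteq> SL2R" and f_smooth: "p \<in> M \<Longrightarrow> smooth_at M f p"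
  and df_inj: "p \<in> M \<Longrightarrow> inj_on (dmap M f p) (tangent_space M p)"
  and N_smooth: "p \<in> M \<Longrightarrow> smooth_at M N p" and N_tangent: "p \<in> M \<Longrightarrow> N p \<in> tangent_space SL2R (f p)"
  and N_unit: "p \<in> M \<Longrightarrow> g (f p) (N p) (N p) = 1"
  and N_orth: "u \<in> tangent_space M p \<Longrightarrow> g (f p) (N p) (dmap M f p u) = 0"
  and M_nonempty: "M \<noteq> {}"
  using immersed[unfolded immersed_surface_def smooth_map_def] tangent_space_in[of u M p] by simp_all

abbreviation "TM \<equiv> tangent_space M"
definition gM where "gM = induced_metric M g f"
definition \<alpha> :: "'m \<Rightarrow> 'm \<Rightarrow> real^3" where "\<alpha> x u = \<theta> (f x) (dmap M f x u)"
definition \<nu> :: "'m \<Rightarrow> real^3" where "\<nu> x = \<theta> (f x) (N x)"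

lemma f_in: "p \<in> M \<Longrightarrow> f p \<in> SL2R" using f_image by blast

lemma df_tangent: "u \<in> TM p \<Longrightarrow> dmap M f p u \<in> tangent_space SL2R (f p)"
  by (rule tangent_map[OF f_smooth f_image]) (auto dest: tangent_space_in)

lemma linear_\<theta>: "linear (\<theta> q)" "linear (\<lambda>q. \<theta> q u)"
  using bounded_bilinear.bounded_linear_right[OF bounded_bilinear_\<theta>] bounded_bilinear.bounded_linear_left[OF bounded_bilinear_\<theta>]
    linear_conv_bounded_linear by blast+

lemma \<alpha>_linear: "p \<in> M \<Longrightarrow> linear_on_sub (TM p) (\<alpha> p)"
  using linear_compose[OF has_derivative_linear[OF dmap_has_derivative[OF f_smooth]] linear_\<theta>(1)]
  by (intro linear_imp_linear_on_sub) (simp add: \<alpha>_def[abs_def] comp_def)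

lemma \<nu>_unit: "p \<in> M \<Longrightarrow> \<nu> p \<bullet> \<nu> p = 1"
  using N_unit N_tangent by (simp add: \<nu>_def g_\<theta>)

lemma \<nu>_orth: "u \<in> TM p \<Longrightarrow> \<nu> p \<bullet> \<alpha> p u = 0"
  using N_orth[of u p] N_tangent tangent_space_in[of u M p] df_tangent by (simp add: \<nu>_def \<alpha>_def g_\<theta>)

lemma \<nu>_smooth: "p \<in> M \<Longrightarrow> smooth_at M \<nu> p"
  unfolding \<nu>_def[abs_def] by (intro smooth_at_bilinear[OF bounded_bilinear_\<theta>] f_smooth N_smooth)

lemma \<alpha>_field_smooth: "p \<in> M \<Longrightarrow> vec_field_at M p Y \<Longrightarrow> smooth_at M (\<lambda>z. \<alpha> z (Y z)) p"
  unfolding \<alpha>_def by (intro smooth_at_bilinear[OF bounded_bilinear_\<theta>] f_smooth smooth_at_dmap)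

lemma M_regular: "p \<in> M \<Longrightarrow> \<exists>\<Phi> S U. regular_at M p \<Phi> S (U :: 'm set) \<and> subspace (S :: 'm set)"
  by (rule chart_fields[OF M_submanifold], assumption) (auto simp: regular_at_def)

lemma M_subspace: "p \<in> M \<Longrightarrow> subspace (TM p)"
  using M_regular regular_at_subspace by blast

lemma M_bracket: "p \<in> M \<Longrightarrow> vec_field_at M p X \<Longrightarrow> vec_field_at M p Y \<Longrightarrow> lie_bracket M X Y p \<in> TM p"
  using M_regular regular_at_bracket by blast

lemma M_ext:
  assumes "v \<in> TM p"
  shows "\<exists>Y. vec_field_at M p Y \<and> Y p = v"
proof -
  have p: "p \<in> M" using assms tangent_space_in by blast
  obtain \<Phi> :: "'m \<Rightarrow> 'm" and S U X where c:
    "regular_at M p \<Phi> S U" "dim S = 2" "\<And>x. linear (\<lambda>s. X s x)"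
    "\<And>s x. s \<in> S \<Longrightarrow> x \<in> M \<inter> U \<Longrightarrow> vec_field_at M x (X s)"
    "\<And>r s x. r \<in> S \<Longrightarrow> s \<in> S \<Longrightarrow> x \<in> M \<inter> U \<Longrightarrow> lie_bracket M (X r) (X s) x = 0"
    "\<And>s x. x \<in> M \<inter> U \<Longrightarrow> frechet_derivative \<Phi> (at x) (X s x) = s"
    "\<And>x u. x \<in> M \<inter> U \<Longrightarrow> u \<in> TM x \<Longrightarrow> \<exists>s\<in>S. X s x = u"
    by (rule chart_fields[OF M_submanifold p]) (rule that)
  have "p \<in> M \<inter> U" using c(1) p by (simp add: regular_at_def)
  then show ?thesis using c(4,7) assms by blast
qed

text \<open>The surface inherits coframe and connection form from the ambient space, so its
  Levi-Civita connection is the tangential part of the ambient one: this is the Gauss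
  formula.\<close>

sublocale S: framed M gM \<alpha> \<Omega>
proof
  show "gM p u v = \<alpha> p u \<bullet> \<alpha> p v" if "u \<in> TM p" "v \<in> TM p" for p u v
    using that by (simp add: gM_def induced_metric_def \<alpha>_def g_\<theta> df_tangent)
  show "u = 0" if u: "u \<in> TM p" "\<alpha> p u = 0" for p u
  proof -
    have p: "p \<in> M" using u(1) tangent_space_in by blast
    have "dmap M f p u = 0" using SL.inj[OF df_tangent[OF u(1)]] u(2) by (simp add: \<alpha>_def)
    also have "0 = dmap M f p 0" using linear_0[OF has_derivative_linear[OF dmap_has_derivative[OF f_smooth p]]] p by simp
    finally show ?thesis using df_inj[OF p] u(1) subspace_0[OF M_subspace[OF p]] by (meson inj_onD)
  qed
  show "subspace (TM p)" if "p \<in> M" for p by (rule M_subspace[OF that])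
  show "\<exists>Y. vec_field_at M p Y \<and> Y p = v" if "v \<in> TM p" for p v by (rule M_ext[OF that])
  show "lie_bracket M X Y p \<in> TM p" if "p \<in> M" "vec_field_at M p X" "vec_field_at M p Y" for p X Y
    by (rule M_bracket[OF that])
  show "bilinear \<Omega>" by (rule bilinear_\<Omega>)
  show "\<Omega> x y \<bullet> z = - (y \<bullet> \<Omega> x z)" for x y z by (rule \<Omega>_skew)
  show "\<exists>H \<Theta>'. (\<forall>\<^sub>F x in nhds p. x \<in> M \<longrightarrow> (\<forall>u\<in>TM x. \<alpha> x u = H x u)) \<and>
      linear (H p) \<and> (\<forall>u. \<Theta>' u 0 = 0) \<and>
      (\<forall>v. ((\<lambda>(x, v). H x v) has_derivative (\<lambda>(u, w). \<Theta>' u v + H p w)) (at (p, v))) \<and>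
      (\<forall>u\<in>TM p. \<forall>v\<in>TM p. \<forall>z\<in>TM p.
        (\<Theta>' u v - \<Theta>' v u + \<Omega> (\<alpha> p u) (\<alpha> p v) - \<Omega> (\<alpha> p v) (\<alpha> p u)) \<bullet> \<alpha> p z = 0)"
    if p: "p \<in> M" for p
  proof -
    obtain U F where U: "open U" "p \<in> U" "smooth_on U F" "\<forall>x\<in>M \<inter> U. f x = F x"
      using f_smooth[OF p] unfolding smooth_at_def by blast
    have fF: "\<And>y. y \<in> M \<inter> U \<Longrightarrow> f y = F y" using U(4) by blast
    have lF: "linear (frechet_derivative F (at p))"
      using smooth_on_has_derivative[OF U(3,2)] has_derivative_linear by blast
    let ?H = "\<lambda>x u. \<theta> (F x) (frechet_derivative F (at x) u)"
    \<comment> \<open>Product rule for \<theta> along the extension of \<open>f\<close>; the summand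
      with the second derivative is symmetric and drops out of the torsion.\<close>
    let ?T = "\<lambda>u v. \<theta> (frechet_derivative F (at p) u) (frechet_derivative F (at p) v) + \<theta> (F p) (D2 F p u v)"
    show ?thesis
    proof (rule exI[of _ ?H], rule exI[of _ ?T], intro conjI allI ballI)
      have "\<forall>\<^sub>F x in nhds p. x \<in> U" using U by (intro eventually_nhds_in_open)
      then show "\<forall>\<^sub>F x in nhds p. x \<in> M \<longrightarrow> (\<forall>u\<in>TM x. \<alpha> x u = ?H x u)"
      proof eventually_elim
        case (elim x)
        then show ?case using dmap_frechet[OF _ U(1) elim U(3) fF] fF by (simp add: \<alpha>_def)
      qed
      show "linear (?H p)" using linear_compose[OF lF linear_\<theta>(1)] by (simp add: comp_def)
      show "?T u 0 = 0" for u by (simp add: linear_0[OF lF] linear_0[OF linear_\<theta>(1)] D2_zero_right[OF U(1,3,2)])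
      show "((\<lambda>(x, v). ?H x v) has_derivative (\<lambda>(u, w). ?T u v + ?H p w)) (at (p, v))" for v
      proof -
        have "((\<lambda>y. F (fst y)) has_derivative (\<lambda>h. frechet_derivative F (at p) (fst h))) (at (p, v))"
          by (rule has_derivative_compose[OF bounded_linear_imp_has_derivative[OF bounded_linear_fst]])
            (use smooth_on_has_derivative[OF U(3,2)] in simp)
        from bounded_bilinear.FDERIV[OF bounded_bilinear_\<theta> this has_derivative_frechet_joint[OF U(1,3,2)]]
        show ?thesis by (simp add: case_prod_unfold linear_add[OF linear_\<theta>(1)] algebra_simps)
      qed
      show "(?T u v - ?T v u + \<Omega> (\<alpha> p u) (\<alpha> p v) - \<Omega> (\<alpha> p v) (\<alpha> p u)) \<bullet> \<alpha> p z = 0"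
        if "u \<in> TM p" "v \<in> TM p" for u v z
      proof -
        have e: "frechet_derivative F (at p) u = dmap M f p u" "frechet_derivative F (at p) v = dmap M f p v"
          using dmap_frechet[OF _ U(1,2,3) fF] that by simp_all
        have "?T u v - ?T v u = \<theta> (dmap M f p u) (dmap M f p v) - \<theta> (dmap M f p v) (dmap M f p u)"
          using D2_symmetric[OF U(1,3,2), of u v] by (simp add: e)
        also have "\<dots> = - dg c (\<alpha> p u \<times> \<alpha> p v)"
          unfolding \<alpha>_def by (rule \<theta>_structure[OF df_tangent[OF that(1)] df_tangent[OF that(2)]])
        finally show ?thesis
          by (simp only: \<Omega>_def add_diff_eq[symmetric] dg_\<mu>_cross) simp
      qed
    qed
  qed
qed

text \<open>The Maurer-Cartan equation pulled back by \<open>f\<close>; of the second derivatives of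
  \<open>f\<close> only the bracket survives.\<close>

lemma \<alpha>_structure:
  assumes p: "p \<in> M" and X: "vec_field_at M p X" and Y: "vec_field_at M p Y"
  shows "dmap M (\<lambda>z. \<alpha> z (Y z)) p (X p) - dmap M (\<lambda>z. \<alpha> z (X z)) p (Y p) =
     \<alpha> p (lie_bracket M X Y p) - dg c (\<alpha> p (X p) \<times> \<alpha> p (Y p))"
proof -
  have d: "dmap M (\<lambda>z. \<alpha> z (Z z)) p u = \<theta> (f p) (dmap M (\<lambda>z. dmap M f z (Z z)) p u) + \<theta> (dmap M f p u) (dmap M f p (Z p))"
    if Z: "vec_field_at M p Z" and u: "u \<in> TM p" for Z u
    unfolding \<alpha>_def
    by (rule dmap_eq[OF u], rule bounded_bilinear.FDERIV[OF bounded_bilinear_\<theta>])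
      (intro dmap_has_derivative f_smooth smooth_at_dmap p Z)+
  note t = vec_field_at_tangent[OF X p] vec_field_at_tangent[OF Y p]
  have "dmap M (\<lambda>z. \<alpha> z (Y z)) p (X p) - dmap M (\<lambda>z. \<alpha> z (X z)) p (Y p) =
     \<theta> (f p) (dmap M (\<lambda>z. dmap M f z (Y z)) p (X p) - dmap M (\<lambda>z. dmap M f z (X z)) p (Y p))
      + (\<theta> (dmap M f p (X p)) (dmap M f p (Y p)) - \<theta> (dmap M f p (Y p)) (dmap M f p (X p)))"
    by (simp add: d X Y t linear_diff[OF linear_\<theta>(1)])
  also have "\<dots> = \<alpha> p (lie_bracket M X Y p) - dg c (\<alpha> p (X p) \<times> \<alpha> p (Y p))"
    using second_derivative_bracket[OF p f_smooth[OF p] X Y M_bracket[OF p X Y]] \<theta>_structure[OF df_tangent[OF t(1)] df_tangent[OF t(2)]]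
    by (simp add: \<alpha>_def)
  finally show ?thesis .
qed

text \<open>Dimension count: an injective image of the model space of dimension 2 lies in the plane
  orthogonal to the normal.\<close>

lemma \<alpha>_onto:
  assumes p: "p \<in> M" and y: "\<nu> p \<bullet> y = 0"
  shows "\<exists>u\<in>TM p. \<alpha> p u = y"
proof -
  obtain \<Phi> :: "'m \<Rightarrow> 'm" and S U X where c:
    "regular_at M p \<Phi> S U" "dim S = 2" "\<And>x. linear (\<lambda>s. X s x)"
    "\<And>s x. s \<in> S \<Longrightarrow> x \<in> M \<inter> U \<Longrightarrow> vec_field_at M x (X s)"
    "\<And>r s x. r \<in> S \<Longrightarrow> s \<in> S \<Longrightarrow> x \<in> M \<inter> U \<Longrightarrow> lie_bracket M (X r) (X s) x = 0"
    "\<And>s x. x \<in> M \<inter> U \<Longrightarrow> frechet_derivative \<Phi> (at x) (X s x) = s"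
    "\<And>x u. x \<in> M \<inter> U \<Longrightarrow> u \<in> TM x \<Longrightarrow> \<exists>s\<in>S. X s x = u"
    by (rule chart_fields[OF M_submanifold p]) (rule that)
  have pU: "p \<in> M \<inter> U" and subS: "subspace S" and "linear (frechet_derivative \<Phi> (at p))"
    using c(1) p smooth_on_has_derivative has_derivative_linear unfolding regular_at_def by blast+
  have XT: "X s p \<in> TM p" if "s \<in> S" for s using vec_field_at_tangent[OF c(4)[OF that pU] p] .
  have lin: "linear (\<lambda>s. \<alpha> p (X s p))"
    using linear_compose[OF c(3) linear_compose[OF has_derivative_linear[OF dmap_has_derivative[OF f_smooth[OF p] p]] linear_\<theta>(1)]]
    by (simp add: \<alpha>_def comp_def)
  have inj: "inj_on (\<lambda>s. \<alpha> p (X s p)) S"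
  proof (rule inj_onI)
    fix r s assume rs: "r \<in> S" "s \<in> S" "\<alpha> p (X r p) = \<alpha> p (X s p)"
    have d: "r - s \<in> S" using rs subS by (simp add: subspace_diff)
    have "\<alpha> p (X (r - s) p) = 0" using rs(3) linear_diff[OF lin, of r s] by simp
    then have "X (r - s) p = 0" using S.inj[OF XT[OF d]] by blast
    then have "r - s = 0" using c(6)[OF pU, of "r - s"] linear_0[OF \<open>linear (frechet_derivative \<Phi> (at p))\<close>] by simp
    then show "r = s" by simp
  qed
  have "dim ((\<lambda>s. \<alpha> p (X s p)) ` S) = 2"
    using dim_image_eq[OF lin, of S] inj c(2) span_eq_iff[THEN iffD2, OF subS] by simp
  moreover have "dim {y. \<nu> p \<bullet> y = 0} = 2"
  proof -
    have "\<nu> p \<noteq> 0" using \<nu>_unit[OF p] by auto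
    then show ?thesis using dim_hyperplane[of "\<nu> p"] by simp
  qed
  moreover have "(\<lambda>s. \<alpha> p (X s p)) ` S \<subseteq> {y. \<nu> p \<bullet> y = 0}" using \<nu>_orth XT by auto
  moreover have "subspace ((\<lambda>s. \<alpha> p (X s p)) ` S)" by (rule linear_subspace_image[OF lin subS])
  ultimately have "(\<lambda>s. \<alpha> p (X s p)) ` S = {y. \<nu> p \<bullet> y = 0}"
    by (intro subspace_dim_equal) (auto simp: subspace_hyperplane)
  then have "y \<in> (\<lambda>s. \<alpha> p (X s p)) ` S" using y by simp
  then show ?thesis using XT by auto
qed

lemma \<alpha>_image: "p \<in> M \<Longrightarrow> \<alpha> p ` TM p = {y. \<nu> p \<bullet> y = 0}"
  using \<nu>_orth \<alpha>_onto by force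

lemma adapted_basis:
  assumes p: "p \<in> M" and y: "y \<bullet> y = 1" "\<nu> p \<bullet> y = 0" and u: "u \<in> TM p" "v \<in> TM p" "\<alpha> p u = y" "\<alpha> p v = \<nu> p \<times> y"
  shows "orthonormal_basis M gM p {u, v}" "u \<noteq> v"
proof -
  have yy: "(\<nu> p \<times> y) \<bullet> (\<nu> p \<times> y) = 1" "y \<bullet> (\<nu> p \<times> y) = 0"
    using \<nu>_unit[OF p] y by (simp_all add: cross_inner_cross dot_cross_self)
  show ne: "u \<noteq> v" using u(3,4) yy y(1) by auto
  have "span {u, v} = TM p"
  proof (rule antisym)
    show "span {u, v} \<subseteq> TM p" using u M_subspace[OF p] by (intro span_minimal) auto
    show "TM p \<subseteq> span {u, v}"
    proof
      fix w assume w: "w \<in> TM p"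
      let ?w = "(\<alpha> p w \<bullet> y) *\<^sub>R u + (\<alpha> p w \<bullet> (\<nu> p \<times> y)) *\<^sub>R v"
      have wT: "?w \<in> TM p" using u M_subspace[OF p] by (simp add: subspace_add subspace_scale)
      have "\<alpha> p ?w = \<alpha> p w"
        using orthonormal_expand_R3[OF \<nu>_unit[OF p] y \<nu>_orth[OF w]] u linear_on_subD[OF \<alpha>_linear[OF p] u(1,2)] by simp
      then have "w = ?w" by (intro S.eq_of_inner[OF w wT]) simp
      also have "\<dots> \<in> span {u, v}" by (intro span_add span_scale span_base) auto
      finally show "w \<in> span {u, v}" .
    qed
  qed
  then show "orthonormal_basis M gM p {u, v}"
    unfolding orthonormal_basis_def using u y(1) yy ne by (auto simp: S.metric inner_commute)
qed

sublocale fm: framed_map M gM \<alpha> \<Omega> SL2R g \<theta> \<Omega> f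
  by unfold_locales (use f_image f_smooth in auto)

section \<open>Shape operator and mean curvature\<close>

text \<open>Ambient Levi-Civita connection along \<open>f\<close>, acting on a field given by its
  frame coordinates.\<close>

definition cov :: "('m \<Rightarrow> real^3) \<Rightarrow> 'm \<Rightarrow> 'm \<Rightarrow> real^3" where
  "cov w p u = dmap M w p u + dg \<mu> (\<alpha> p u) \<times> w p"

text \<open>The connection form acts by cross products; these are skew, so its two contributions
  cancel.\<close>

lemma cov_inner:
  assumes "u \<in> TM p" "smooth_at M v p" "smooth_at M w p"
  shows "dmap M (\<lambda>z. v z \<bullet> w z) p u = cov v p u \<bullet> w p + v p \<bullet> cov w p u"
proof -
  have p: "p \<in> M" using assms(1) tangent_space_in by blast
  have "dmap M (\<lambda>z. v z \<bullet> w z) p u = v p \<bullet> dmap M w p u + dmap M v p u \<bullet> w p"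
    by (rule dmap_eq[OF assms(1)]) (intro has_derivative_inner dmap_has_derivative assms p)
  moreover have "(a \<times> b) \<bullet> d + b \<bullet> (a \<times> d) = 0" for a b d :: "real^3"
    by (simp add: inner3 cross_components algebra_simps)
  ultimately show ?thesis by (simp add: cov_def inner_add_left inner_add_right algebra_simps)
qed

text \<open>By the Jacobi identity the cross product with a fixed vector is a derivation of the
  cross product.\<close>

lemma cov_cross:
  assumes "u \<in> TM p" "smooth_at M v p" "smooth_at M w p"
  shows "cov (\<lambda>z. v z \<times> w z) p u = cov v p u \<times> w p + v p \<times> cov w p u"
proof -
  have p: "p \<in> M" using assms(1) tangent_space_in by blast
  have d: "dmap M (\<lambda>z. v z \<times> w z) p u = v p \<times> dmap M w p u + dmap M v p u \<times> w p"
    by (rule dmap_eq[OF assms(1)]) (intro bounded_bilinear.FDERIV[OF bounded_bilinear_cross3] dmap_has_derivative assms p)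
  have "a \<times> (b \<times> d) = (a \<times> b) \<times> d + b \<times> (a \<times> d)" for a b d :: "real^3"
    by (simp add: eq3_iff cross_components algebra_simps)
  from d this[of "dg \<mu> (\<alpha> p u)" "v p" "w p"] show ?thesis by (simp add: cov_def cross_add_left cross_add_right)
qed

lemma cov_linear:
  assumes p: "p \<in> M" and w: "smooth_at M w p"
  shows "linear_on_sub (TM p) (cov w p)"
  unfolding linear_on_sub_def
proof (intro ballI allI)
  fix u v a b assume uv: "u \<in> TM p" "v \<in> TM p"
  show "cov w p (a *\<^sub>R u + b *\<^sub>R v) = a *\<^sub>R cov w p u + b *\<^sub>R cov w p v"
    by (simp add: cov_def linear_on_subD[OF dmap_linear_on[OF w p] uv] linear_on_subD[OF \<alpha>_linear[OF p] uv]
        linear_add[OF linear_dg] linear_scale[OF linear_dg] cross_add_left cross_mult_left scaleR_add_right)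
qed

lemma cov_\<nu>_smooth:
  assumes "p \<in> M" "vec_field_at M p X"
  shows "smooth_at M (\<lambda>z. cov \<nu> z (X z)) p"
  unfolding cov_def
  using assms by (intro smooth_at_add smooth_at_dmap \<nu>_smooth smooth_at_bilinear[OF bounded_bilinear_cross3]
      smooth_at_linear[OF linear_dg[unfolded linear_conv_bounded_linear]] \<alpha>_field_smooth)

lemma cov_\<nu>_orth:
  assumes "u \<in> TM p" shows "\<nu> p \<bullet> cov \<nu> p u = 0"
proof -
  have p: "p \<in> M" using assms(1) tangent_space_in by blast
  have "((\<lambda>z. \<nu> z \<bullet> \<nu> z) has_derivative (\<lambda>u. 0)) (at p within M)"
    by (rule has_derivative_eq_on[OF has_derivative_const[of 1] p]) (simp add: \<nu>_unit)
  from dmap_eq[OF assms this] show ?thesis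
    using cov_inner[OF assms \<nu>_smooth[OF p] \<nu>_smooth[OF p]] by (simp add: inner_commute)
qed

text \<open>Weingarten equation, from differentiating the orthogonality of \<nu> and
  \<open>\<alpha> z (Y z)\<close>.\<close>

lemma \<nu>_cov_field:
  assumes "u \<in> TM p" "vec_field_at M p Y"
  shows "\<nu> p \<bullet> cov (\<lambda>z. \<alpha> z (Y z)) p u = - (cov \<nu> p u \<bullet> \<alpha> p (Y p))"
proof -
  have p: "p \<in> M" using assms(1) tangent_space_in by blast
  have "((\<lambda>z. \<nu> z \<bullet> \<alpha> z (Y z)) has_derivative (\<lambda>u. 0)) (at p within M)"
  proof (rule has_derivative_eq_on[OF has_derivative_const[of 0] p])
    show "\<forall>\<^sub>F z in nhds p. z \<in> M \<longrightarrow> \<nu> z \<bullet> \<alpha> z (Y z) = 0"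
      using S.vec_field_tangent_near[OF assms(2)] by eventually_elim (auto simp: \<nu>_orth)
  qed
  from dmap_eq[OF assms(1) this] show ?thesis
    using cov_inner[OF assms(1) \<nu>_smooth[OF p] \<alpha>_field_smooth[OF p assms(2)]] by simp
qed

lemma cov_field_symmetric:
  assumes "p \<in> M" "vec_field_at M p X" "vec_field_at M p Y"
  shows "cov (\<lambda>z. \<alpha> z (Y z)) p (X p) - cov (\<lambda>z. \<alpha> z (X z)) p (Y p) = \<alpha> p (lie_bracket M X Y p)"
  using \<alpha>_structure[OF assms] dg_\<mu>_cross[of "\<alpha> p (X p)" "\<alpha> p (Y p)"] by (simp add: cov_def algebra_simps)

text \<open>Antisymmetrised covariant derivatives of tangent fields give the bracket, which has no
  normal component.\<close>

lemma shape_symmetric: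
  assumes "u \<in> TM p" "v \<in> TM p"
  shows "cov \<nu> p u \<bullet> \<alpha> p v = cov \<nu> p v \<bullet> \<alpha> p u"
proof -
  have p: "p \<in> M" using assms(1) tangent_space_in by blast
  obtain X where X: "vec_field_at M p X" "X p = u" using M_ext[OF assms(1)] by blast
  obtain Y where Y: "vec_field_at M p Y" "Y p = v" using M_ext[OF assms(2)] by blast
  have "\<nu> p \<bullet> (cov (\<lambda>z. \<alpha> z (Y z)) p (X p) - cov (\<lambda>z. \<alpha> z (X z)) p (Y p)) = 0"
    unfolding cov_field_symmetric[OF p X(1) Y(1)] by (rule \<nu>_orth[OF M_bracket[OF p X(1) Y(1)]])
  then show ?thesis
    using \<nu>_cov_field[OF assms(1) Y(1)] \<nu>_cov_field[OF assms(2) X(1)] X(2) Y(2) by (simp add: inner_diff_right)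
qed

text \<open>The tangential part of the ambient derivative cancels against the Levi-Civita term of
  the surface, so a multiple of the normal remains. The Weingarten equation identifies the multiple
  and is the source of the sign.\<close>

lemma second_fundamental_form_eq:
  assumes "u \<in> TM p" "v \<in> TM p"
  shows "second_fundamental_form M SL2R g f N p u v = - (cov \<nu> p u \<bullet> \<alpha> p v)"
proof -
  have p: "p \<in> M" using assms(1) tangent_space_in by blast
  obtain Y where Y: "vec_field_at M p Y" "Y p = v" using M_ext[OF assms(2)] by blast
  let ?w = "nabla_d M gM SL2R g f p u v"
  let ?c = "cov (\<lambda>z. \<alpha> z (Y z)) p u"
  let ?L = "levi_civita M gM p u Y"
  have LT: "?L \<in> TM p" by (rule S.levi_civita_tangent[OF assms(1) Y(1)])
  have wT: "?w \<in> tangent_space SL2R (f p)" by (rule fm.nabla_d_tangent[OF assms])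
  have \<theta>w: "\<theta> (f p) ?w = ?c - \<alpha> p ?L"
  proof -
    have "\<theta> (f p) ?w \<bullet> y = (?c - \<alpha> p ?L) \<bullet> y" for y
      using fm.nabla_d(2)[OF assms(1) Y(1) E_tangent[OF f_in[OF p]], of y]
      by (simp add: \<theta>_E[OF f_in[OF p]] Y(2) fm.second_part_def \<alpha>_def cov_def \<Omega>_def algebra_simps inner_add_left inner_diff_left)
    then show ?thesis by (metis vector_eq_rdot)
  qed
  have tang: "(?c - \<alpha> p ?L) \<bullet> y = 0" if y: "\<nu> p \<bullet> y = 0" for y
  proof -
    obtain z where z: "z \<in> TM p" "\<alpha> p z = y" using \<alpha>_onto[OF p y] by blast
    have "\<alpha> p ?L \<bullet> \<alpha> p z = ?c \<bullet> \<alpha> p z"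
      using S.levi_civita_inner[OF assms(1) Y(1) z(1)] by (simp add: cov_def \<Omega>_def)
    then show ?thesis using z by (simp add: inner_diff_left)
  qed
  have n1: "\<nu> p \<bullet> \<nu> p = 1" by (rule \<nu>_unit[OF p])
  define h where "h = \<nu> p \<bullet> ?c"
  have "?c - \<alpha> p ?L = h *\<^sub>R \<nu> p"
  proof -
    let ?d = "?c - \<alpha> p ?L - h *\<^sub>R \<nu> p"
    have d: "\<nu> p \<bullet> ?d = 0" using n1 \<nu>_orth[OF LT] by (simp add: h_def inner_diff_right)
    have "?d \<bullet> ?d = (?c - \<alpha> p ?L) \<bullet> ?d - h * (\<nu> p \<bullet> ?d)" by (simp add: inner_diff_left)
    also have "\<dots> = 0" using d tang[OF d] by simp
    finally show ?thesis by simp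
  qed
  then have "\<theta> (f p) ?w = \<theta> (f p) (h *\<^sub>R N p)" by (simp add: \<theta>w linear_scale[OF linear_\<theta>(1)] \<nu>_def)
  then have w: "?w = h *\<^sub>R N p"
    using SL.eq_of_inner[OF wT] N_tangent[OF p] SL.sub[OF f_in[OF p]] by (simp add: subspace_scale)
  have N0: "N p \<noteq> 0" using n1 linear_0[OF linear_\<theta>(1)] by (auto simp: \<nu>_def)
  have "second_fundamental_form M SL2R g f N p u v = h"
    unfolding second_fundamental_form_def gM_def[symmetric]
    by (rule the_equality) (use w N0 in auto)
  then show ?thesis using \<nu>_cov_field[OF assms(1) Y(1)] Y(2) by (simp add: h_def)
qed

lemma mean_curvature_eq:
  assumes p: "p \<in> M" and y: "y \<bullet> y = 1" "\<nu> p \<bullet> y = 0"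
    and u: "u \<in> TM p" "v \<in> TM p" "\<alpha> p u = y" "\<alpha> p v = \<nu> p \<times> y"
  shows "mean_curvature M SL2R g f N p = - (cov \<nu> p u \<bullet> \<alpha> p u) - (cov \<nu> p v \<bullet> \<alpha> p v)"
proof -
  have l: "linear_on_sub (TM p) (second_fundamental_form M SL2R g f N p a)" if "a \<in> TM p" for a
    using that M_subspace[OF p] linear_on_subD[OF \<alpha>_linear[OF p]]
    by (auto simp: linear_on_sub_def second_fundamental_form_eq subspace_add subspace_scale inner_add_right)
  have r: "linear_on_sub (TM p) (\<lambda>v. second_fundamental_form M SL2R g f N p v a)" if "a \<in> TM p" for a
    using that M_subspace[OF p] linear_on_subD[OF cov_linear[OF p \<nu>_smooth[OF p]]]
    by (auto simp: linear_on_sub_def second_fundamental_form_eq subspace_add subspace_scale inner_add_left)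
  note b = adapted_basis[OF p y u]
  have "mean_curvature M SL2R g f N p = (\<Sum>b\<in>{u, v}. second_fundamental_form M SL2R g f N p b b)"
    unfolding mean_curvature_def gM_def[symmetric] by (rule S.metric_trace_eq[OF p b(1) l r])
  then show ?thesis using b(2) u by (simp add: second_fundamental_form_eq)
qed

lemma adapted_vectors:
  assumes p: "p \<in> M" and y: "y \<bullet> y = 1" "\<nu> p \<bullet> y = 0"
  obtains u v where "u \<in> TM p" "v \<in> TM p" "\<alpha> p u = y" "\<alpha> p v = \<nu> p \<times> y"
  using \<alpha>_onto[OF p y(2)] \<alpha>_onto[OF p, of "\<nu> p \<times> y"] by (auto simp: dot_cross_self)

lemma unit_orthogonal_exists:
  assumes "p \<in> M" obtains y where "y \<bullet> y = 1" "\<nu> p \<bullet> y = 0"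
proof -
  have "\<nu> p \<noteq> 0" using \<nu>_unit[OF assms] by auto
  then obtain i where i: "\<nu> p \<times> axis i 1 \<noteq> 0" using cross_basis_nonzero by blast
  let ?a = "\<nu> p \<times> axis i 1"
  have "(?a /\<^sub>R norm ?a) \<bullet> (?a /\<^sub>R norm ?a) = 1"
    using i by (simp add: power2_norm_eq_inner[symmetric] power2_eq_square)
  moreover have "\<nu> p \<bullet> (?a /\<^sub>R norm ?a) = 0" by (simp add: dot_cross_self)
  ultimately show ?thesis using that by blast
qed

lemma tangent_expand:
  assumes p: "p \<in> M" and y: "y \<bullet> y = 1" "\<nu> p \<bullet> y = 0"
    and u: "u \<in> TM p" "v \<in> TM p" "\<alpha> p u = y" "\<alpha> p v = \<nu> p \<times> y" and w: "w \<in> TM p"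
  shows "w = (\<alpha> p w \<bullet> \<alpha> p u) *\<^sub>R u + (\<alpha> p w \<bullet> \<alpha> p v) *\<^sub>R v"
  using S.orthonormal_expand[OF adapted_basis(1)[OF p y u] w p] adapted_basis(2)[OF p y u] by simp

text \<open>Trace of the second fundamental form over arbitrary \<open>a\<close> and
  \<open>b\<close>, multiplied by their Gram determinant. The commuting fields of the Codazzi
  equation are orthonormal at one point only, whereas differentiating the mean curvature there
  requires a formula valid nearby.\<close>

lemma mean_curvature_relation:
  assumes p: "p \<in> M" and ab: "a \<in> TM p" "b \<in> TM p"
  shows "(\<alpha> p b \<bullet> \<alpha> p b) * (cov \<nu> p a \<bullet> \<alpha> p a) - 2 * (\<alpha> p a \<bullet> \<alpha> p b) * (cov \<nu> p a \<bullet> \<alpha> p b)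
     + (\<alpha> p a \<bullet> \<alpha> p a) * (cov \<nu> p b \<bullet> \<alpha> p b)
    = - mean_curvature M SL2R g f N p * ((\<alpha> p a \<bullet> \<alpha> p a) * (\<alpha> p b \<bullet> \<alpha> p b) - (\<alpha> p a \<bullet> \<alpha> p b) * (\<alpha> p a \<bullet> \<alpha> p b))"
proof -
  obtain y where y: "y \<bullet> y = 1" "\<nu> p \<bullet> y = 0" using unit_orthogonal_exists[OF p] .
  obtain u v where u: "u \<in> TM p" "v \<in> TM p" "\<alpha> p u = y" "\<alpha> p v = \<nu> p \<times> y" using adapted_vectors[OF p y] .
  have o: "\<alpha> p u \<bullet> \<alpha> p u = 1" "\<alpha> p v \<bullet> \<alpha> p v = 1" "\<alpha> p u \<bullet> \<alpha> p v = 0" "\<alpha> p v \<bullet> \<alpha> p u = 0"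
    using u(3,4) y \<nu>_unit[OF p] by (simp_all add: cross_inner_cross dot_cross_self)
  define a1 a2 b1 b2 where "a1 = \<alpha> p a \<bullet> \<alpha> p u" and "a2 = \<alpha> p a \<bullet> \<alpha> p v" and "b1 = \<alpha> p b \<bullet> \<alpha> p u" and "b2 = \<alpha> p b \<bullet> \<alpha> p v"
  have a: "a = a1 *\<^sub>R u + a2 *\<^sub>R v" and b: "b = b1 *\<^sub>R u + b2 *\<^sub>R v"
    unfolding a1_def a2_def b1_def b2_def using tangent_expand[OF p y u] ab by blast+
  note la = linear_on_subD[OF \<alpha>_linear[OF p] u(1,2)] and lc = linear_on_subD[OF cov_linear[OF p \<nu>_smooth[OF p]] u(1,2)]
  define S where "S i j = cov \<nu> p i \<bullet> \<alpha> p j" for i j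
  have sy: "S v u = S u v" unfolding S_def by (rule shape_symmetric[OF u(2,1)])
  have H: "mean_curvature M SL2R g f N p = - S u u - S v v"
    unfolding S_def by (rule mean_curvature_eq[OF p y u])
  have \<alpha>ab: "\<alpha> p a = a1 *\<^sub>R \<alpha> p u + a2 *\<^sub>R \<alpha> p v" "\<alpha> p b = b1 *\<^sub>R \<alpha> p u + b2 *\<^sub>R \<alpha> p v"
    unfolding a b by (rule la)+
  have cab: "cov \<nu> p a = a1 *\<^sub>R cov \<nu> p u + a2 *\<^sub>R cov \<nu> p v" "cov \<nu> p b = b1 *\<^sub>R cov \<nu> p u + b2 *\<^sub>R cov \<nu> p v"
    unfolding a b by (rule lc)+
  have G: "\<alpha> p a \<bullet> \<alpha> p a = a1 * a1 + a2 * a2" "\<alpha> p b \<bullet> \<alpha> p b = b1 * b1 + b2 * b2" "\<alpha> p a \<bullet> \<alpha> p b = a1 * b1 + a2 * b2"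
    unfolding \<alpha>ab by (simp_all add: inner_add_left inner_add_right o)
  have h: "cov \<nu> p a \<bullet> \<alpha> p a = a1 * a1 * S u u + 2 * (a1 * a2) * S u v + a2 * a2 * S v v"
    "cov \<nu> p b \<bullet> \<alpha> p b = b1 * b1 * S u u + 2 * (b1 * b2) * S u v + b2 * b2 * S v v"
    "cov \<nu> p a \<bullet> \<alpha> p b = a1 * b1 * S u u + (a1 * b2 + a2 * b1) * S u v + a2 * b2 * S v v"
    unfolding \<alpha>ab cab by (simp_all add: inner_add_left inner_add_right S_def[symmetric] sy algebra_simps)
  show ?thesis unfolding G h H by algebra
qed

section \<open>The Gauss map in the coframe of the bundle\<close>

text \<open>The tangent plane fixes its unit normal up to sign, and \<open>normal_proj\<close> does
  not see the sign.\<close>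

lemma gauss_map_eq:
  assumes p: "p \<in> M"
  shows "gauss_map M SL2R e f p = (f p, normal_proj (\<nu> p))"
proof -
  have q: "f p \<in> SL2R" by (rule f_in[OF p])
  have pl: "plane_of e (f p, normal_proj n) = (\<lambda>v. E v (f p)) ` {v. n \<bullet> v = 0}" if "n \<bullet> n = 1" for n
    unfolding plane_of_def by (auto simp: rank_normal_proj(1)[OF that] E_sum)
  have im: "dmap M f p ` TM p = (\<lambda>v. E v (f p)) ` {v. \<nu> p \<bullet> v = 0}"
  proof -
    have "dmap M f p ` TM p = (\<lambda>u. E (\<alpha> p u) (f p)) ` TM p"
      using E_\<theta>[OF df_tangent] by (intro image_cong) (simp_all add: \<alpha>_def)
    also have "\<dots> = (\<lambda>v. E v (f p)) ` (\<alpha> p ` TM p)" by (simp add: image_image)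
    finally show ?thesis by (simp add: \<alpha>_image[OF p])
  qed
  have Einj: "inj (\<lambda>v. E v (f p))" using \<theta>_E[OF q] by (rule inj_on_inverseI)
  show ?thesis
    unfolding gauss_map_def
  proof (rule the_equality)
    show "(f p, normal_proj (\<nu> p)) \<in> Gr2 SL2R \<and> fst (f p, normal_proj (\<nu> p)) = f p \<and>
      plane_of e (f p, normal_proj (\<nu> p)) = dmap M f p ` TM p"
      using q \<nu>_unit[OF p] im by (auto simp: Gr2_iff pl)
    fix x assume x: "x \<in> Gr2 SL2R \<and> fst x = f p \<and> plane_of e x = dmap M f p ` TM p"
    then obtain m where m: "m \<bullet> m = 1" "x = (f p, normal_proj m)" by (metis Gr2_iff prod.collapse)
    have "(\<lambda>v. E v (f p)) ` {v. m \<bullet> v = 0} = (\<lambda>v. E v (f p)) ` {v. \<nu> p \<bullet> v = 0}"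
      using x m pl im by simp
    then have eq: "{v. m \<bullet> v = 0} = {v. \<nu> p \<bullet> v = 0}" using Einj by (simp add: inj_image_eq_iff)
    let ?v = "m - (\<nu> p \<bullet> m) *\<^sub>R \<nu> p"
    have "\<nu> p \<bullet> ?v = 0" using \<nu>_unit[OF p] by (simp add: inner_diff_right)
    then have "m \<bullet> ?v = 0" using eq by blast
    then have "?v \<bullet> ?v = 0" using \<open>\<nu> p \<bullet> ?v = 0\<close> by (simp add: inner_diff_left)
    then have mv: "m = (\<nu> p \<bullet> m) *\<^sub>R \<nu> p" by simp
    then have "(\<nu> p \<bullet> m) * (\<nu> p \<bullet> m) = 1"
      using m(1) \<nu>_unit[OF p] by (metis inner_scaleR_left inner_scaleR_right mult.right_neutral)
    moreover have "outer m m = ((\<nu> p \<bullet> m) * (\<nu> p \<bullet> m)) *\<^sub>R outer (\<nu> p) (\<nu> p)"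
      using mv by (metis bilinear_lmul[OF bilinear_outer] bilinear_rmul[OF bilinear_outer] scaleR_scaleR)
    ultimately show "x = (f p, normal_proj (\<nu> p))" using m(2) by (simp add: normal_proj_def)
  qed
qed

abbreviation "\<phi> \<equiv> gauss_map M SL2R e f"

lemma \<phi>_has_derivative:
  assumes p: "p \<in> M"
  shows "(\<phi> has_derivative (\<lambda>u. (dmap M f p u, sym_pair (\<nu> p) (dmap M \<nu> p u)))) (at p within M)"
proof -
  have o: "((\<lambda>z. outer (\<nu> z) (\<nu> z)) has_derivative (\<lambda>u. outer (\<nu> p) (dmap M \<nu> p u) + outer (dmap M \<nu> p u) (\<nu> p))) (at p within M)"
    by (intro bounded_bilinear.FDERIV[OF bounded_bilinear_outer] dmap_has_derivative \<nu>_smooth p)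
  have "((\<lambda>z. (f z, mat 1 - outer (\<nu> z) (\<nu> z))) has_derivative
      (\<lambda>u. (dmap M f p u, 0 - (outer (\<nu> p) (dmap M \<nu> p u) + outer (dmap M \<nu> p u) (\<nu> p))))) (at p within M)"
    by (intro has_derivative_Pair has_derivative_diff has_derivative_const dmap_has_derivative f_smooth p o)
  then have "((\<lambda>z. (f z, mat 1 - outer (\<nu> z) (\<nu> z))) has_derivative
      (\<lambda>u. (dmap M f p u, sym_pair (\<nu> p) (dmap M \<nu> p u)))) (at p within M)"
    by (simp add: sym_pair_def add.commute)
  then show ?thesis
    by (rule has_derivative_eq_on[OF _ p]) (simp add: gauss_map_eq normal_proj_def)
qed

lemma \<phi>_smooth:
  assumes p: "p \<in> M" shows "smooth_at M \<phi> p"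
proof -
  have "smooth_at M (\<lambda>z. (f z, 0) + (0, mat 1 + - outer (\<nu> z) (\<nu> z))) p"
    by (intro smooth_at_add smooth_at_linear[of "\<lambda>y. (y, 0)"] smooth_at_linear[of "\<lambda>y. (0, y)"] smooth_at_const
        smooth_at_linear[OF bounded_linear_minus[OF bounded_linear_ident]] smooth_at_bilinear[OF bounded_bilinear_outer]
        bounded_linear_Pair bounded_linear_ident bounded_linear_zero f_smooth \<nu>_smooth p)
  then show ?thesis by (rule smooth_at_cong) (simp add: gauss_map_eq normal_proj_def)
qed

lemma \<phi>_image: "\<phi> ` M \<subseteq> GP"
proof
  fix x assume "x \<in> \<phi> ` M"
  then obtain p where "p \<in> M" "x = (f p, normal_proj (\<nu> p))" using gauss_map_eq by auto
  moreover have "\<exists>n. n \<bullet> n = 1 \<and> normal_proj (\<nu> p) = normal_proj n" using \<nu>_unit[OF \<open>p \<in> M\<close>] by blast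
  ultimately show "x \<in> GP" using f_in[of p] by (simp add: Gr2_iff)
qed

sublocale gm: framed_map M gM \<alpha> \<Omega> GP gG \<Theta> \<Omega>G \<phi>
  by unfold_locales (use \<phi>_image \<phi>_smooth in auto)

lemma d\<phi>:
  assumes u: "u \<in> TM p"
  shows "\<Theta> (\<phi> p) (dmap M \<phi> p u) = (\<alpha> p u, s *\<^sub>R (\<nu> p \<times> cov \<nu> p u))"
proof -
  have p: "p \<in> M" using u tangent_space_in by blast
  have "\<nu> p \<bullet> dmap M \<nu> p u = 0"
    using cov_\<nu>_orth[OF u] by (simp add: cov_def inner_add_right dot_cross_self)
  then show ?thesis
    using \<Theta>_eq[OF \<nu>_unit[OF p], of "dmap M \<nu> p u" "f p" "dmap M f p u"] dmap_eq[OF u \<phi>_has_derivative[OF p]]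
    by (simp add: gauss_map_eq[OF p] \<alpha>_def cov_def)
qed

text \<open>In the second component derivative and connection form combine to a covariant
  derivative; the product rule adds no term, as \<open>cov \<nu>\<close> would be crossed with
  itself. In the first component the two O'Neill terms of \<open>\<Omega>G\<close> coincide, which
  turns \<open>s / 2\<close> into \<open>s\<close>; the other factor \<open>s\<close> stems from the
  differential of \<phi>.\<close>

lemma gauss_nabla:
  assumes p: "p \<in> M" and X: "vec_field_at M p X" and \<zeta>: "\<zeta> \<in> tangent_space GP (\<phi> p)"
  shows "\<Theta> (\<phi> p) (nabla_d M gM GP gG \<phi> p (X p) (X p)) \<bullet> \<Theta> (\<phi> p) \<zeta> =
    (cov (\<lambda>z. \<alpha> z (X z)) p (X p) - \<alpha> p (levi_civita M gM p (X p) X)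
        - (s * s) *\<^sub>R (dg k (\<nu> p \<times> cov \<nu> p (X p)) \<times> \<alpha> p (X p)),
     s *\<^sub>R (\<nu> p \<times> (cov (\<lambda>z. cov \<nu> z (X z)) p (X p) - cov \<nu> p (levi_civita M gM p (X p) X)))) \<bullet> \<Theta> (\<phi> p) \<zeta>"
proof -
  note u = vec_field_at_tangent[OF X p]
  note L = S.levi_civita_tangent[OF u X]
  let ?c = "\<lambda>z. \<nu> z \<times> cov \<nu> z (X z)"
  have sc: "smooth_at M ?c p"
    by (intro smooth_at_bilinear[OF bounded_bilinear_cross3] \<nu>_smooth p cov_\<nu>_smooth X)
  have "((\<lambda>z. (\<alpha> z (X z), s *\<^sub>R ?c z)) has_derivative (\<lambda>u. (dmap M (\<lambda>z. \<alpha> z (X z)) p u, s *\<^sub>R dmap M ?c p u))) (at p within M)"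
    by (intro has_derivative_Pair has_derivative_scaleR_right dmap_has_derivative sc \<alpha>_field_smooth p X)
  then have "((\<lambda>z. \<Theta> (\<phi> z) (dmap M \<phi> z (X z))) has_derivative
      (\<lambda>u. (dmap M (\<lambda>z. \<alpha> z (X z)) p u, s *\<^sub>R dmap M ?c p u))) (at p within M)"
  proof (rule has_derivative_eq_on[OF _ p])
    show "\<forall>\<^sub>F z in nhds p. z \<in> M \<longrightarrow> \<Theta> (\<phi> z) (dmap M \<phi> z (X z)) = (\<alpha> z (X z), s *\<^sub>R ?c z)"
      using S.vec_field_tangent_near[OF X] by eventually_elim (auto simp: d\<phi>)
  qed
  from dmap_eq[OF u this]
  have sp: "gm.second_part p (X p) X = (dmap M (\<lambda>z. \<alpha> z (X z)) p (X p) - \<alpha> p (levi_civita M gM p (X p) X),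
     s *\<^sub>R (dmap M ?c p (X p) - \<nu> p \<times> cov \<nu> p (levi_civita M gM p (X p) X)))"
    by (simp add: gm.second_part_def d\<phi>[OF L] scaleR_diff_right)
  have cc: "dmap M ?c p (X p) + dg \<mu> (\<alpha> p (X p)) \<times> ?c p = \<nu> p \<times> cov (\<lambda>z. cov \<nu> z (X z)) p (X p)"
    using cov_cross[OF u \<nu>_smooth[OF p] cov_\<nu>_smooth[OF p X]] unfolding cov_def[of ?c] by simp
  have half: "(s / 2) *\<^sub>R (a + a) = s *\<^sub>R a" for a :: "real^3"
    by (simp add: scaleR_2[symmetric])
  have Om: "\<Omega>G (\<alpha> p (X p), s *\<^sub>R ?c p) (\<alpha> p (X p), s *\<^sub>R ?c p) =
     (dg \<mu> (\<alpha> p (X p)) \<times> \<alpha> p (X p) - (s * s) *\<^sub>R (dg k (?c p) \<times> \<alpha> p (X p)), s *\<^sub>R (dg \<mu> (\<alpha> p (X p)) \<times> ?c p))"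
    unfolding \<Omega>G_def fst_conv snd_conv half
    by (simp add: linear_scale[OF linear_dg] cross_mult_left cross_mult_right linear_0[OF linear_dg])
  have "gm.second_part p (X p) X + \<Omega>G (\<Theta> (\<phi> p) (dmap M \<phi> p (X p))) (\<Theta> (\<phi> p) (dmap M \<phi> p (X p))) =
    (cov (\<lambda>z. \<alpha> z (X z)) p (X p) - \<alpha> p (levi_civita M gM p (X p) X)
        - (s * s) *\<^sub>R (dg k (\<nu> p \<times> cov \<nu> p (X p)) \<times> \<alpha> p (X p)),
     s *\<^sub>R (\<nu> p \<times> (cov (\<lambda>z. cov \<nu> z (X z)) p (X p) - cov \<nu> p (levi_civita M gM p (X p) X))))"
    unfolding d\<phi>[OF u] Om sp Cross3.right_diff_distrib cc[symmetric]
    by (simp add: cov_def[of "\<lambda>z. \<alpha> z (X z)"] scaleR_add_right scaleR_diff_right algebra_simps)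
  then show ?thesis using gm.nabla_d(2)[OF u X \<zeta>] by simp
qed

section \<open>Commuting fields, the Ricci identity and the Codazzi equation\<close>

text \<open>Commuting chart fields can be made orthonormal at one point, but in general not on a
  neighbourhood.\<close>

lemma adapted_fields:
  assumes p: "p \<in> M" and y: "y \<bullet> y = 1" "\<nu> p \<bullet> y = 0"
  obtains U X Y where "open U" "p \<in> U" "\<And>z. z \<in> M \<inter> U \<Longrightarrow> vec_field_at M z X" "\<And>z. z \<in> M \<inter> U \<Longrightarrow> vec_field_at M z Y"
    "\<And>z. z \<in> M \<inter> U \<Longrightarrow> lie_bracket M X Y z = 0" "\<alpha> p (X p) = y" "\<alpha> p (Y p) = \<nu> p \<times> y"
proof -
  obtain \<Phi> :: "'m \<Rightarrow> 'm" and S U X where c: "regular_at M p \<Phi> S U" "dim S = 2" "\<And>x. linear (\<lambda>s. X s x)"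
    "\<And>s x. s \<in> S \<Longrightarrow> x \<in> M \<inter> U \<Longrightarrow> vec_field_at M x (X s)"
    "\<And>r s x. r \<in> S \<Longrightarrow> s \<in> S \<Longrightarrow> x \<in> M \<inter> U \<Longrightarrow> lie_bracket M (X r) (X s) x = 0"
    "\<And>s x. x \<in> M \<inter> U \<Longrightarrow> frechet_derivative \<Phi> (at x) (X s x) = s"
    "\<And>x u. x \<in> M \<inter> U \<Longrightarrow> u \<in> TM x \<Longrightarrow> \<exists>s\<in>S. X s x = u"
    by (rule chart_fields[OF M_submanifold p]) (rule that)
  have U: "open U" "p \<in> U" using c(1) by (auto simp: regular_at_def)
  obtain u v where u: "u \<in> TM p" "v \<in> TM p" "\<alpha> p u = y" "\<alpha> p v = \<nu> p \<times> y" using adapted_vectors[OF p y] .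
  obtain a b where ab: "a \<in> S" "X a p = u" "b \<in> S" "X b p = v" using c(7)[of p] u(1,2) p U(2) by blast
  show ?thesis
    by (rule that[OF U c(4)[OF ab(1)] c(4)[OF ab(3)] c(5)[OF ab(1,3)]]) (use u ab in auto)
qed

text \<open>Ricci identity. The mixed second derivatives of \<nu> agree, the structure equation
  contributes the bracket term of the curvature, and \<open>curvature_operator\<close> collects the
  rest.\<close>

lemma cov_commute:
  assumes p: "p \<in> M" and X: "vec_field_at M p X" and Y: "vec_field_at M p Y" and br: "lie_bracket M X Y p = 0"
  shows "cov (\<lambda>z. cov \<nu> z (Y z)) p (X p) - cov (\<lambda>z. cov \<nu> z (X z)) p (Y p) =
    - (dg k (\<alpha> p (X p) \<times> \<alpha> p (Y p)) \<times> \<nu> p)"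
proof -
  note t = vec_field_at_tangent[OF X p] vec_field_at_tangent[OF Y p]
  have d: "dmap M (\<lambda>z. cov \<nu> z (Z z)) p u = dmap M (\<lambda>z. dmap M \<nu> z (Z z)) p u
      + (\<Omega> (\<alpha> p (Z p)) (dmap M \<nu> p u) + \<Omega> (dmap M (\<lambda>z. \<alpha> z (Z z)) p u) (\<nu> p))"
    if Z: "vec_field_at M p Z" and u: "u \<in> TM p" for Z u
    unfolding cov_def \<Omega>_def
    by (rule dmap_eq[OF u])
      (intro has_derivative_add dmap_has_derivative smooth_at_dmap \<nu>_smooth p Z
        bounded_bilinear.FDERIV[OF bounded_bilinear_cross3]
        bounded_linear.has_derivative[OF linear_dg[unfolded linear_conv_bounded_linear]] \<alpha>_field_smooth)
  have c: "cov (\<lambda>z. cov \<nu> z (Z z)) p u = dmap M (\<lambda>z. dmap M \<nu> z (Z z)) p u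
      + (\<Omega> (\<alpha> p (Z p)) (dmap M \<nu> p u) + \<Omega> (dmap M (\<lambda>z. \<alpha> z (Z z)) p u) (\<nu> p))
      + (\<Omega> (\<alpha> p u) (dmap M \<nu> p (Z p)) + \<Omega> (\<alpha> p u) (\<Omega> (\<alpha> p (Z p)) (\<nu> p)))"
    if Z: "vec_field_at M p Z" and u: "u \<in> TM p" for Z u
    using d[OF that] bilinear_radd[OF bilinear_\<Omega>]
    by (simp add: cov_def[of "\<lambda>z. cov \<nu> z (Z z)"] \<Omega>_def[symmetric]) (simp add: cov_def \<Omega>_def[symmetric])
  have z: "dmap M w p 0 = 0" if "smooth_at M w p" for w :: "'m \<Rightarrow> real^3"
    by (rule linear_0[OF has_derivative_linear[OF dmap_has_derivative[OF that p]]])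
  have s: "dmap M (\<lambda>z. dmap M \<nu> z (Y z)) p (X p) = dmap M (\<lambda>z. dmap M \<nu> z (X z)) p (Y p)"
    using second_derivative_bracket[OF p \<nu>_smooth[OF p] X Y] br M_bracket[OF p X Y] z[OF \<nu>_smooth[OF p]] by simp
  have a: "dmap M (\<lambda>z. \<alpha> z (Y z)) p (X p) = dmap M (\<lambda>z. \<alpha> z (X z)) p (Y p) - dg c (\<alpha> p (X p) \<times> \<alpha> p (Y p))"
    using \<alpha>_structure[OF p X Y] br linear_on_sub_0[OF \<alpha>_linear[OF p] M_subspace[OF p]] by (simp add: algebra_simps)
  show ?thesis
    unfolding c[OF Y t(1)] c[OF X t(2)] s a bilinear_lsub[OF bilinear_\<Omega>] curvature_operator[symmetric]
    by simp
qed

lemma levi_civita_expand: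
  assumes p: "p \<in> M" and y: "y \<bullet> y = 1" "\<nu> p \<bullet> y = 0"
    and u: "u \<in> TM p" "v \<in> TM p" "\<alpha> p u = y" "\<alpha> p v = \<nu> p \<times> y" and w: "w \<in> TM p" and Z: "vec_field_at M p Z"
  shows "levi_civita M gM p w Z = (cov (\<lambda>z. \<alpha> z (Z z)) p w \<bullet> \<alpha> p u) *\<^sub>R u + (cov (\<lambda>z. \<alpha> z (Z z)) p w \<bullet> \<alpha> p v) *\<^sub>R v"
proof -
  have i: "\<alpha> p (levi_civita M gM p w Z) \<bullet> \<alpha> p a = cov (\<lambda>z. \<alpha> z (Z z)) p w \<bullet> \<alpha> p a" if "a \<in> TM p" for a
    using S.levi_civita_inner[OF w Z that] by (simp add: cov_def \<Omega>_def)
  show ?thesis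
    using tangent_expand[OF p y u S.levi_civita_tangent[OF w Z]] by (simp add: i u(1,2))
qed

text \<open>The Codazzi equation, traced: the derivative of the mean curvature vanishes, so the tangential
  part of the rough Laplacian of the normal is the Ricci term.\<close>

lemma codazzi:
  assumes p: "p \<in> M" and H: "\<And>z. z \<in> M \<Longrightarrow> mean_curvature M SL2R g f N z = H"
    and y: "y \<bullet> y = 1" "\<nu> p \<bullet> y = 0"
    and U: "open U" "p \<in> U" and X: "\<And>z. z \<in> M \<inter> U \<Longrightarrow> vec_field_at M z X" and Y: "\<And>z. z \<in> M \<inter> U \<Longrightarrow> vec_field_at M z Y"
    and br: "\<And>z. z \<in> M \<inter> U \<Longrightarrow> lie_bracket M X Y z = 0" and xy: "\<alpha> p (X p) = y" "\<alpha> p (Y p) = \<nu> p \<times> y"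
  shows "(cov (\<lambda>z. cov \<nu> z (X z)) p (X p) + cov (\<lambda>z. cov \<nu> z (Y z)) p (Y p)
      - cov \<nu> p (levi_civita M gM p (X p) X) - cov \<nu> p (levi_civita M gM p (Y p) Y)) \<bullet> y = - (dg k (\<nu> p) \<bullet> y)"
proof -
  have pU: "p \<in> M \<inter> U" using p U by simp
  note Xp = X[OF pU] and Yp = Y[OF pU]
  note t = vec_field_at_tangent[OF Xp p] vec_field_at_tangent[OF Yp p]
  define n where "n = \<nu> p"
  define x2 where "x2 = n \<times> y"
  have n1: "n \<bullet> n = 1" unfolding n_def by (rule \<nu>_unit[OF p])
  have x: "\<alpha> p (X p) = y" "\<alpha> p (Y p) = x2" using xy by (simp_all add: x2_def n_def)
  have o: "y \<bullet> y = 1" "x2 \<bullet> x2 = 1" "y \<bullet> x2 = 0" "x2 \<bullet> y = 0"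
    using y n1 by (simp_all add: x2_def n_def cross_inner_cross dot_cross_self)
  define A11 A12 A22 where "A11 = cov (\<lambda>z. \<alpha> z (X z)) p (X p)" and "A12 = cov (\<lambda>z. \<alpha> z (Y z)) p (X p)"
    and "A22 = cov (\<lambda>z. \<alpha> z (Y z)) p (Y p)"
  have A21: "cov (\<lambda>z. \<alpha> z (X z)) p (Y p) = A12"
    using cov_field_symmetric[OF p Xp Yp] br[OF pU] linear_on_sub_0[OF \<alpha>_linear[OF p] M_subspace[OF p]] by (simp add: A12_def)
  define E11 E12 E21 E22 where "E11 = cov (\<lambda>z. cov \<nu> z (X z)) p (X p)" and "E12 = cov (\<lambda>z. cov \<nu> z (Y z)) p (X p)"
    and "E21 = cov (\<lambda>z. cov \<nu> z (X z)) p (Y p)" and "E22 = cov (\<lambda>z. cov \<nu> z (Y z)) p (Y p)"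
  define N1 N2 where "N1 = cov \<nu> p (X p)" and "N2 = cov \<nu> p (Y p)"
  have nN: "n \<bullet> N1 = 0" "n \<bullet> N2 = 0" unfolding n_def N1_def N2_def using cov_\<nu>_orth t by blast+
  have Nsym: "N1 \<bullet> x2 = N2 \<bullet> y" using shape_symmetric[OF t] by (simp add: N1_def N2_def x)
  have N: "N1 \<bullet> a = (N1 \<bullet> y) * (a \<bullet> y) + (N2 \<bullet> y) * (a \<bullet> x2)" "N2 \<bullet> a = (N2 \<bullet> y) * (a \<bullet> y) + (N2 \<bullet> x2) * (a \<bullet> x2)" for a
  proof -
    have e: "v \<bullet> a = (v \<bullet> y) * (a \<bullet> y) + (v \<bullet> x2) * (a \<bullet> x2)" if "n \<bullet> v = 0" for v
      using arg_cong[OF orthonormal_expand_R3[OF n1 o(1) _ that], of "\<lambda>v. v \<bullet> a"] y(2)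
      by (simp add: inner_add_left inner_add_right x2_def[symmetric] n_def[symmetric] inner_commute)
    show "N1 \<bullet> a = (N1 \<bullet> y) * (a \<bullet> y) + (N2 \<bullet> y) * (a \<bullet> x2)" "N2 \<bullet> a = (N2 \<bullet> y) * (a \<bullet> y) + (N2 \<bullet> x2) * (a \<bullet> x2)"
      using e[OF nN(1)] e[OF nN(2)] Nsym by simp_all
  qed
  note smX = \<alpha>_field_smooth[OF p Xp] and smY = \<alpha>_field_smooth[OF p Yp] and scX = cov_\<nu>_smooth[OF p Xp] and scY = cov_\<nu>_smooth[OF p Yp]
  have evU: "\<forall>\<^sub>F z in nhds p. z \<in> U" using U by (intro eventually_nhds_in_open)
  \<comment> \<open>Symmetry of the shape operator holds on a neighbourhood; this is its derivative
    along \<open>Y\<close>.\<close>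
  have C: "E21 \<bullet> x2 + N1 \<bullet> A22 = E22 \<bullet> y + N2 \<bullet> A12"
  proof -
    have sm: "smooth_at M (\<lambda>z. cov \<nu> z (Y z) \<bullet> \<alpha> z (X z)) p"
      by (intro smooth_at_bilinear[OF bounded_bilinear_inner] scY smX)
    have "((\<lambda>z. cov \<nu> z (X z) \<bullet> \<alpha> z (Y z)) has_derivative dmap M (\<lambda>z. cov \<nu> z (Y z) \<bullet> \<alpha> z (X z)) p) (at p within M)"
    proof (rule has_derivative_eq_on[OF dmap_has_derivative[OF sm p] p])
      show "\<forall>\<^sub>F z in nhds p. z \<in> M \<longrightarrow> cov \<nu> z (X z) \<bullet> \<alpha> z (Y z) = cov \<nu> z (Y z) \<bullet> \<alpha> z (X z)"
        using evU
      proof eventually_elim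
        case (elim z)
        show ?case
          using shape_symmetric[OF vec_field_at_tangent[OF X] vec_field_at_tangent[OF Y], of z] elim by blast
      qed
    qed
    from dmap_eq[OF t(2) this] show ?thesis
      unfolding cov_inner[OF t(2) scX smY] cov_inner[OF t(2) scY smX]
      by (simp add: x N1_def[symmetric] N2_def[symmetric] A21 A22_def[symmetric] E21_def[symmetric] E22_def[symmetric])
  qed
  \<comment> \<open>The Ricci identity exchanges the order of the second derivatives; the curvature
    enters here.\<close>
  have R: "E12 \<bullet> x2 = E21 \<bullet> x2 + dg k n \<bullet> y"
  proof -
    have xx: "y \<times> x2 = n" using cross_double[OF o(1), of n] y(2) by (simp add: x2_def n_def inner_commute)
    have "E12 - E21 = - (dg k n \<times> n)"
      using cov_commute[OF p Xp Yp br[OF pU]] by (simp add: E12_def E21_def x xx n_def)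
    then have "E12 \<bullet> x2 - E21 \<bullet> x2 = - ((dg k n \<times> n) \<bullet> x2)" by (metis inner_diff_left inner_minus_left)
    also have "(dg k n \<times> n) \<bullet> x2 = (dg k n \<bullet> n) * (n \<bullet> y) - (dg k n \<bullet> y) * (n \<bullet> n)"
      unfolding x2_def by (simp add: inner3 cross_components algebra_simps)
    finally show ?thesis using n1 y(2) by (simp add: n_def)
  qed
  \<comment> \<open>Derivative along \<open>X\<close> of \<open>mean_curvature_relation\<close> with
    constant \<open>H\<close>. The entries \<open>a\<close>, \<open>b\<close>, \<open>d\<close> of
    the Gram matrix vary away from \<open>p\<close> and contribute as well.\<close>
  have D: "2 * (A12 \<bullet> x2) * (N1 \<bullet> y) + (E11 \<bullet> y + N1 \<bullet> A11) - 2 * (A11 \<bullet> x2 + y \<bullet> A12) * (N1 \<bullet> x2)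
      + 2 * (A11 \<bullet> y) * (N2 \<bullet> x2) + (E12 \<bullet> x2 + N2 \<bullet> A12) = - H * (2 * (A11 \<bullet> y) + 2 * (A12 \<bullet> x2))"
  proof -
    define a b d where "a z = \<alpha> z (X z) \<bullet> \<alpha> z (X z)" and "b z = \<alpha> z (X z) \<bullet> \<alpha> z (Y z)" and "d z = \<alpha> z (Y z) \<bullet> \<alpha> z (Y z)" for z
    define a' b' d' where "a' z = cov \<nu> z (X z) \<bullet> \<alpha> z (X z)" and "b' z = cov \<nu> z (X z) \<bullet> \<alpha> z (Y z)" and "d' z = cov \<nu> z (Y z) \<bullet> \<alpha> z (Y z)" for z
    have sm: "smooth_at M a p" "smooth_at M b p" "smooth_at M d p" "smooth_at M a' p" "smooth_at M b' p" "smooth_at M d' p"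
      unfolding a_def b_def d_def a'_def b'_def d'_def
      by (intro smooth_at_bilinear[OF bounded_bilinear_inner] smX smY scX scY)+
    note h = sm[THEN dmap_has_derivative, OF p]
    have zero: "((\<lambda>z. d z * a' z - 2 * (b z * b' z) + a z * d' z + H * (a z * d z - b z * b z)) has_derivative (\<lambda>u. 0)) (at p within M)"
    proof (rule has_derivative_eq_on[OF has_derivative_const[of 0] p])
      show "\<forall>\<^sub>F z in nhds p. z \<in> M \<longrightarrow> d z * a' z - 2 * (b z * b' z) + a z * d' z + H * (a z * d z - b z * b z) = 0"
        using evU
      proof eventually_elim
        case (elim z)
        show ?case
        proof
          assume z: "z \<in> M"
          then have zU: "z \<in> M \<inter> U" using elim by simp
          show "d z * a' z - 2 * (b z * b' z) + a z * d' z + H * (a z * d z - b z * b z) = 0"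
            using mean_curvature_relation[OF z vec_field_at_tangent[OF X[OF zU] z] vec_field_at_tangent[OF Y[OF zU] z]]
            unfolding a_def b_def d_def a'_def b'_def d'_def H[OF z] by (simp add: algebra_simps)
        qed
      qed
    qed
    have "((\<lambda>z. d z * a' z - 2 * (b z * b' z) + a z * d' z + H * (a z * d z - b z * b z)) has_derivative
      (\<lambda>u. (d p * dmap M a' p u + dmap M d p u * a' p) - 2 * (b p * dmap M b' p u + dmap M b p u * b' p)
        + (a p * dmap M d' p u + dmap M a p u * d' p)
        + H * ((a p * dmap M d p u + dmap M a p u * d p) - (b p * dmap M b p u + dmap M b p u * b p)))) (at p within M)"
      by (intro has_derivative_add has_derivative_diff has_derivative_mult_right has_derivative_mult h)
    from tangent_derivative_unique[OF t(1) this zero]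
    have e: "(d p * dmap M a' p (X p) + dmap M d p (X p) * a' p) - 2 * (b p * dmap M b' p (X p) + dmap M b p (X p) * b' p)
        + (a p * dmap M d' p (X p) + dmap M a p (X p) * d' p)
        + H * ((a p * dmap M d p (X p) + dmap M a p (X p) * d p) - (b p * dmap M b p (X p) + dmap M b p (X p) * b p)) = 0" .
    have v: "a p = 1" "b p = 0" "d p = 1" "a' p = N1 \<bullet> y" "b' p = N1 \<bullet> x2" "d' p = N2 \<bullet> x2"
      by (simp_all add: a_def b_def d_def a'_def b'_def d'_def x o N1_def N2_def)
    have w: "dmap M a p (X p) = 2 * (A11 \<bullet> y)" "dmap M b p (X p) = A11 \<bullet> x2 + y \<bullet> A12" "dmap M d p (X p) = 2 * (A12 \<bullet> x2)"
      "dmap M a' p (X p) = E11 \<bullet> y + N1 \<bullet> A11" "dmap M d' p (X p) = E12 \<bullet> x2 + N2 \<bullet> A12"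
      using cov_inner[OF t(1) smX smX] cov_inner[OF t(1) smX smY] cov_inner[OF t(1) smY smY] cov_inner[OF t(1) scX smX] cov_inner[OF t(1) scY smY]
      by (simp_all add: a_def[abs_def] b_def[abs_def] d_def[abs_def] a'_def[abs_def] d'_def[abs_def] x
          A11_def A12_def E11_def E12_def N1_def N2_def inner_commute)
    show ?thesis using e unfolding v w by (simp add: algebra_simps)
  qed
  have Hp: "H = - (N1 \<bullet> y) - N2 \<bullet> x2"
    using mean_curvature_eq[OF p y t x(1) xy(2)] H[OF p] by (simp add: N1_def N2_def x)
  have cl: "cov \<nu> p (a *\<^sub>R X p + b *\<^sub>R Y p) = a *\<^sub>R N1 + b *\<^sub>R N2" for a b
    unfolding N1_def N2_def by (rule linear_on_subD[OF cov_linear[OF p \<nu>_smooth[OF p]] t])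
  have L: "cov \<nu> p (levi_civita M gM p (X p) X) = (A11 \<bullet> y) *\<^sub>R N1 + (A11 \<bullet> x2) *\<^sub>R N2"
    "cov \<nu> p (levi_civita M gM p (Y p) Y) = (A22 \<bullet> y) *\<^sub>R N1 + (A22 \<bullet> x2) *\<^sub>R N2"
    unfolding levi_civita_expand[OF p y t xy t(1) Xp] levi_civita_expand[OF p y t xy t(2) Yp] cl
    by (simp_all add: A11_def A22_def x)
  \<comment> \<open>\<open>E12\<close> and \<open>E21\<close> are eliminated from \<open>C\<close>,
    \<open>R\<close> and \<open>D\<close>. With the trace put in place of \<open>H\<close>, all
    connection coefficients cancel except those of the two Levi-Civita terms.\<close>
  have "E11 \<bullet> y + E22 \<bullet> y - ((A11 \<bullet> y) * (N1 \<bullet> y) + (A11 \<bullet> x2) * (N2 \<bullet> y)) - ((A22 \<bullet> y) * (N1 \<bullet> y) + (A22 \<bullet> x2) * (N2 \<bullet> y)) = - (dg k n \<bullet> y)"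
    using C D R Nsym unfolding Hp N(1)[of A11] N(1)[of A22] N(2)[of A12] inner_commute[of y A12]
    by (simp add: algebra_simps)
  then show ?thesis
    unfolding E11_def[symmetric] E22_def[symmetric] L n_def[symmetric] by (simp add: inner_add_left inner_diff_left)
qed

lemma tension_split:
  assumes p: "p \<in> M" and y: "y \<bullet> y = 1" "\<nu> p \<bullet> y = 0"
    and u: "u \<in> TM p" "v \<in> TM p" "\<alpha> p u = y" "\<alpha> p v = \<nu> p \<times> y"
  shows "tension_field M gM GP gG \<phi> p = nabla_d M gM GP gG \<phi> p u u + nabla_d M gM GP gG \<phi> p v v"
    "tension_field M gM GP gG \<phi> p \<in> tangent_space GP (\<phi> p)"
proof -
  show e: "tension_field M gM GP gG \<phi> p = nabla_d M gM GP gG \<phi> p u u + nabla_d M gM GP gG \<phi> p v v"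
    using gm.tension_field_eq[OF p adapted_basis(1)[OF p y u]] adapted_basis(2)[OF p y u] by simp
  show "tension_field M gM GP gG \<phi> p \<in> tangent_space GP (\<phi> p)"
    unfolding e using gm.nabla_d_tangent u G.sub[OF gm.in_P[OF p]] by (simp add: subspace_add)
qed

end

section \<open>Constant mean curvature and vertically harmonic Gauss map\<close>

locale vh_cmc_surface = surface l1 l2 l3 \<kappa> M f N
  for l1 l2 l3 \<kappa> and M :: "'m::euclidean_space set" and f N +
  fixes H :: real
  assumes order: "c $ 1 > c $ 2" "c $ 2 > 0" "0 > c $ 3"
    and cmc: "\<And>z. z \<in> M \<Longrightarrow> mean_curvature M SL2R g f N z = H"
    and vh: "vertically_harmonic_map M gM GP gG fst \<phi>"
begin

lemma vertical_tension:
  assumes p: "p \<in> M" shows "snd (\<Theta> (\<phi> p) (tension_field M gM GP gG \<phi> p)) = 0"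
proof -
  obtain y where y: "y \<bullet> y = 1" "\<nu> p \<bullet> y = 0" using unit_orthogonal_exists[OF p] .
  obtain u v where u: "u \<in> TM p" "v \<in> TM p" "\<alpha> p u = y" "\<alpha> p v = \<nu> p \<times> y" using adapted_vectors[OF p y] .
  show ?thesis
    using vertical_part_zero[OF tension_split(2)[OF p y u]] vh p unfolding vertically_harmonic_map_def by blast
qed

text \<open>Paired with the vertical vector \<zeta>, only the second component of
  \<open>gauss_nabla\<close> counts. Crossing with \<nu> is an isometry of the tangent plane, so the
  pairing is a multiple of the rough Laplacian of \<nu> against \<open>y\<close>, which
  \<open>codazzi\<close> evaluates.\<close>

lemma ricci_normal:
  assumes p: "p \<in> M" and y: "y \<bullet> y = 1" "\<nu> p \<bullet> y = 0"
  shows "dg k (\<nu> p) \<bullet> y = 0"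
proof -
  obtain U X Y where F: "open U" "p \<in> U" "\<And>z. z \<in> M \<inter> U \<Longrightarrow> vec_field_at M z X" "\<And>z. z \<in> M \<inter> U \<Longrightarrow> vec_field_at M z Y"
    "\<And>z. z \<in> M \<inter> U \<Longrightarrow> lie_bracket M X Y z = 0" "\<alpha> p (X p) = y" "\<alpha> p (Y p) = \<nu> p \<times> y"
    by (rule adapted_fields[OF p y]) (rule that)
  have pU: "p \<in> M \<inter> U" using p F(2) by simp
  note Xp = F(3)[OF pU] and Yp = F(4)[OF pU]
  note t = vec_field_at_tangent[OF Xp p] vec_field_at_tangent[OF Yp p]
  let ?E = "\<lambda>X. cov (\<lambda>z. cov \<nu> z (X z)) p (X p) - cov \<nu> p (levi_civita M gM p (X p) X)"
  define \<zeta> where "\<zeta> = (0 :: real^2^2, sym_pair (\<nu> p) y)"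
  have q: "f p \<in> SL2R" by (rule f_in[OF p])
  have n1: "\<nu> p \<bullet> \<nu> p = 1" by (rule \<nu>_unit[OF p])
  have \<phi>p: "\<phi> p = (f p, normal_proj (\<nu> p))" by (rule gauss_map_eq[OF p])
  have \<zeta>T: "\<zeta> \<in> tangent_space GP (\<phi> p)"
    unfolding \<zeta>_def \<phi>p by (rule GP_tangentI[OF q n1 subspace_0[OF SL.sub[OF q]] y(2)])
  have \<Theta>\<zeta>: "\<Theta> (\<phi> p) \<zeta> = (0, s *\<^sub>R (\<nu> p \<times> y))"
    unfolding \<zeta>_def \<phi>p \<Theta>_eq[OF n1 y(2)] by (simp add: linear_0[OF linear_\<theta>(1)] linear_0[OF linear_dg])
  have "\<Theta> (\<phi> p) (tension_field M gM GP gG \<phi> p) \<bullet> \<Theta> (\<phi> p) \<zeta> = 0"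
    using vertical_tension[OF p] by (simp add: \<Theta>\<zeta> inner_prod_def)
  then have "(s *\<^sub>R (\<nu> p \<times> ?E X)) \<bullet> (s *\<^sub>R (\<nu> p \<times> y)) + (s *\<^sub>R (\<nu> p \<times> ?E Y)) \<bullet> (s *\<^sub>R (\<nu> p \<times> y)) = 0"
    unfolding tension_split(1)[OF p y t F(6,7)] linear_add[OF \<Theta>_linear] inner_add_left
      gauss_nabla[OF p Xp \<zeta>T] gauss_nabla[OF p Yp \<zeta>T]
    by (simp add: \<Theta>\<zeta> inner_prod_def)
  then have "(s * s) * ((?E X + ?E Y) \<bullet> y) = 0"
    using n1 y(2) by (simp add: cross_inner_cross inner_add_left algebra_simps)
  then have "(?E X + ?E Y) \<bullet> y = 0" using s_pos by simp
  moreover have "?E X + ?E Y = cov (\<lambda>z. cov \<nu> z (X z)) p (X p) + cov (\<lambda>z. cov \<nu> z (Y z)) p (Y p)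
      - cov \<nu> p (levi_civita M gM p (X p) X) - cov \<nu> p (levi_civita M gM p (Y p) Y)" by simp
  ultimately show ?thesis using codazzi[OF p cmc y F] by simp
qed

lemma ricci_normal_any:
  assumes p: "p \<in> M" and y: "\<nu> p \<bullet> y = 0"
  shows "dg k (\<nu> p) \<bullet> y = 0"
proof (cases "y = 0")
  case False
  have "(y /\<^sub>R norm y) \<bullet> (y /\<^sub>R norm y) = 1" using False by (simp add: power2_norm_eq_inner[symmetric] power2_eq_square)
  from ricci_normal[OF p this] show ?thesis using y False by simp
qed simp

text \<open>The test vectors are the cross products of \<nu> with the coordinate axes.\<close>

lemma eigen_products:
  assumes p: "p \<in> M"
  shows "(k$1 - k$2) * (\<nu> p $ 1 * \<nu> p $ 2) = 0" "(k$2 - k$3) * (\<nu> p $ 2 * \<nu> p $ 3) = 0" "(k$3 - k$1) * (\<nu> p $ 1 * \<nu> p $ 3) = 0"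
  using ricci_normal_any[OF p, of "vector [\<nu> p $ 2, - \<nu> p $ 1, 0]"] ricci_normal_any[OF p, of "vector [0, \<nu> p $ 3, - \<nu> p $ 2]"]
    ricci_normal_any[OF p, of "vector [- \<nu> p $ 3, 0, \<nu> p $ 1]"]
  by (simp_all add: inner3 algebra_simps)

text \<open>Each entry of \<open>c\<close> is the sum of two entries of \<mu>, and after this
  substitution the differences factor.\<close>

lemma k_differences: "k$1 - k$2 = 2 * \<mu>$3 * (\<mu>$1 - \<mu>$2)" "k$2 - k$3 = 2 * \<mu>$1 * (\<mu>$2 - \<mu>$3)" "k$3 - k$1 = 2 * \<mu>$2 * (\<mu>$3 - \<mu>$1)"
  by (simp_all add: k_def \<mu>_def field_simps)

lemma \<nu>_products: "p \<in> M \<Longrightarrow> \<nu> p $ 1 * \<nu> p $ 2 = 0" "p \<in> M \<Longrightarrow> \<nu> p $ 2 * \<nu> p $ 3 = 0"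
proof -
  have "k$1 - k$2 \<noteq> 0" "k$2 - k$3 \<noteq> 0" unfolding k_differences using order by (auto simp: \<mu>_def)
  then show "p \<in> M \<Longrightarrow> \<nu> p $ 1 * \<nu> p $ 2 = 0" "p \<in> M \<Longrightarrow> \<nu> p $ 2 * \<nu> p $ 3 = 0"
    using eigen_products(1,2) by auto
qed

lemma c_nonzero: "c $ i \<noteq> 0"
  using order exhaust_3[of i] by auto

text \<open>The normal cannot be a constant frame vector on an open set: its orthogonal distribution is
  not integrable, because every \<open>c $ i\<close> is nonzero.\<close>

lemma normal_not_axis:
  assumes p: "p \<in> M" and ev: "\<forall>\<^sub>F z in nhds p. z \<in> M \<longrightarrow> (\<forall>j. j \<noteq> i \<longrightarrow> \<nu> z $ j = 0)"
  shows False
proof -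
  obtain y where y: "y \<bullet> y = 1" "\<nu> p \<bullet> y = 0" using unit_orthogonal_exists[OF p] .
  obtain u v where u: "u \<in> TM p" "v \<in> TM p" "\<alpha> p u = y" "\<alpha> p v = \<nu> p \<times> y" using adapted_vectors[OF p y] .
  have \<nu>j: "\<nu> p $ j = 0" if "j \<noteq> i" for j using eventually_nhds_x_imp_x[OF ev] p that by blast
  have n1: "\<nu> p \<bullet> \<nu> p = 1" by (rule \<nu>_unit[OF p])
  have \<nu>i: "\<nu> p $ i * \<nu> p $ i = 1"
    using n1 \<nu>j exhaust_3[of i] by (auto simp: inner3)
  have d0: "dmap M \<nu> p w = 0" if w: "w \<in> TM p" for w
  proof -
    have j: "dmap M \<nu> p w $ j = 0" if "j \<noteq> i" for j
    proof -
      have "((\<lambda>z. \<nu> z $ j) has_derivative (\<lambda>w. dmap M \<nu> p w $ j)) (at p within M)"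
        by (intro bounded_linear.has_derivative[OF bounded_linear_vec_nth] dmap_has_derivative \<nu>_smooth p)
      moreover have "((\<lambda>z. \<nu> z $ j) has_derivative (\<lambda>w. 0)) (at p within M)"
      proof (rule has_derivative_eq_on[OF has_derivative_const p])
        show "\<forall>\<^sub>F z in nhds p. z \<in> M \<longrightarrow> \<nu> z $ j = 0" using ev by eventually_elim (use that in blast)
      qed
      ultimately show ?thesis by (rule tangent_derivative_unique[OF w])
    qed
    have "\<nu> p \<bullet> dmap M \<nu> p w = 0" using cov_\<nu>_orth[OF w] by (simp add: cov_def inner_add_right dot_cross_self)
    then have "\<nu> p $ i * dmap M \<nu> p w $ i = 0"
      using \<nu>j j exhaust_3[of i] by (auto simp: inner3)
    then have "dmap M \<nu> p w $ i = 0" using \<nu>i by auto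
    then show ?thesis using j by (metis vec_eq_iff zero_index)
  qed
  \<comment> \<open>As the derivative of \<nu> vanishes at \<open>p\<close>, the covariant
    derivative is the connection term alone, and symmetry of the shape operator forces
    \<open>c $ i\<close> to be zero.\<close>
  have "cov \<nu> p u \<bullet> \<alpha> p v - cov \<nu> p v \<bullet> \<alpha> p u = 0" using shape_symmetric[OF u(1,2)] by simp
  then have "(dg \<mu> y \<times> \<nu> p) \<bullet> (\<nu> p \<times> y) - (dg \<mu> (\<nu> p \<times> y) \<times> \<nu> p) \<bullet> y = 0"
    by (simp add: cov_def d0 u)
  moreover have "(a \<times> n) \<bullet> b - (d \<times> n) \<bullet> e = - ((a \<times> b - d \<times> e) \<bullet> n)" for a b d e n :: "real^3"
    by (simp add: inner3 cross_components algebra_simps)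
  ultimately have "dg c (y \<times> (\<nu> p \<times> y)) \<bullet> \<nu> p = 0" by (simp add: dg_\<mu>_cross)
  moreover have "y \<times> (\<nu> p \<times> y) = \<nu> p" using cross_double[OF y(1), of "\<nu> p"] y(2) by (simp add: inner_commute)
  ultimately have "c $ i * (\<nu> p $ i * \<nu> p $ i) = 0"
    using \<nu>j exhaust_3[of i] by (auto simp: inner3)
  then show False using \<nu>i c_nonzero[of i] by simp
qed

lemma \<nu>_nonzero_near:
  assumes p: "p \<in> M" and "\<nu> p $ i \<noteq> 0"
  shows "\<forall>\<^sub>F z in nhds p. z \<in> M \<longrightarrow> \<nu> z $ i \<noteq> 0"
proof (rule eventually_pullback[OF \<nu>_smooth[OF p] p, of UNIV])
  have "open {y::real^3. y $ i \<noteq> 0}"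
    by (intro open_Collect_neq continuous_intros)
  then have "\<forall>\<^sub>F y in nhds (\<nu> p). y \<in> {y. y $ i \<noteq> 0}" using assms(2) by (intro eventually_nhds_in_open) auto
  then show "\<forall>\<^sub>F y in nhds (\<nu> p). y \<in> UNIV \<longrightarrow> y $ i \<noteq> 0" by simp
qed simp

text \<open>A nonzero second component persists nearby, where the products force the other two
  components to vanish; the normal would then be a frame vector on an open set.\<close>

lemma \<nu>2: assumes p: "p \<in> M" shows "\<nu> p $ 2 = 0"
proof (rule ccontr)
  assume "\<nu> p $ 2 \<noteq> 0"
  from \<nu>_nonzero_near[OF p this]
  have "\<forall>\<^sub>F z in nhds p. z \<in> M \<longrightarrow> (\<forall>j. j \<noteq> 2 \<longrightarrow> \<nu> z $ j = 0)"
  proof eventually_elim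
    case (elim z)
    show ?case using elim \<nu>_products[of z] by (auto simp: forall_3)
  qed
  then show False by (rule normal_not_axis[OF p])
qed

lemma \<nu>13_exists: "\<exists>p\<in>M. \<nu> p $ 1 * \<nu> p $ 3 \<noteq> 0"
proof (rule ccontr)
  assume "\<not> ?thesis"
  then have z: "\<nu> z $ 1 * \<nu> z $ 3 = 0" if "z \<in> M" for z using that by blast
  obtain p where p: "p \<in> M" using M_nonempty by blast
  have "\<nu> p $ 1 \<noteq> 0 \<or> \<nu> p $ 3 \<noteq> 0" using \<nu>_unit[OF p] \<nu>2[OF p] by (auto simp: inner3)
  then show False
  proof
    assume "\<nu> p $ 1 \<noteq> 0"
    from \<nu>_nonzero_near[OF p this] have "\<forall>\<^sub>F z in nhds p. z \<in> M \<longrightarrow> (\<forall>j. j \<noteq> 1 \<longrightarrow> \<nu> z $ j = 0)"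
      by eventually_elim (use z \<nu>2 in \<open>auto simp: forall_3\<close>)
    then show False by (rule normal_not_axis[OF p])
  next
    assume "\<nu> p $ 3 \<noteq> 0"
    from \<nu>_nonzero_near[OF p this] have "\<forall>\<^sub>F z in nhds p. z \<in> M \<longrightarrow> (\<forall>j. j \<noteq> 3 \<longrightarrow> \<nu> z $ j = 0)"
      by eventually_elim (use z \<nu>2 in \<open>auto simp: forall_3\<close>)
    then show False by (rule normal_not_axis[OF p])
  qed
qed

text \<open>A point where the first and third components of \<nu> are both nonzero makes the
  corresponding eigenvalues equal, and \<open>\<mu>$2\<close> is the factor of their difference that
  can vanish.\<close>

lemma \<mu>2: "\<mu> $ 2 = 0"
proof -
  have "k$3 - k$1 = 0" using \<nu>13_exists eigen_products(3) by auto
  moreover have "\<mu>$3 - \<mu>$1 \<noteq> 0" using order by (simp add: \<mu>_def)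
  ultimately show ?thesis unfolding k_differences by simp
qed

lemma c_relation: "c $ 2 = c $ 1 + c $ 3"
  using \<mu>2 by (simp add: \<mu>_def)

lemma e2_tangent:
  assumes p: "p \<in> M" shows "e 2 (f p) \<in> dmap M f p ` TM p"
proof -
  have "\<nu> p \<bullet> axis 2 1 = 0" using \<nu>2[OF p] by (simp add: inner_axis)
  then obtain u where u: "u \<in> TM p" "\<alpha> p u = axis 2 1" using \<alpha>_onto[OF p] by blast
  have "e 2 (f p) = dmap M f p u"
    using E_\<theta>[OF df_tangent[OF u(1)]] u(2) by (simp add: e_E \<alpha>_def)
  then show ?thesis using u(1) by blast
qed

section \<open>The angle of the normal\<close>

text \<open>Unit tangent vector orthogonal to \<open>e 2\<close>, in frame coordinates; it is the
  direction in which \<nu> turns.\<close>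

definition J :: "'m \<Rightarrow> real^3" where "J p = \<nu> p \<times> axis 2 1"
text \<open>Rate at which the connection along \<open>J\<close> tilts \<nu> towards
  \<open>e 2\<close>, see \<open>cov_\<nu>_twist\<close>.\<close>

definition q :: "'m \<Rightarrow> real" where "q p = \<mu>$1 * (\<nu> p $ 3 * \<nu> p $ 3) + \<mu>$3 * (\<nu> p $ 1 * \<nu> p $ 1)"

lemma J_nth: "J p $ 1 = - \<nu> p $ 3" "J p $ 2 = 0" "J p $ 3 = \<nu> p $ 1"
  by (simp_all add: J_def cross_components axis_def)

lemma e2: "axis 2 1 \<bullet> (axis 2 1 :: real^3) = 1" "p \<in> M \<Longrightarrow> \<nu> p \<bullet> axis 2 1 = 0"
  using \<nu>2 by (simp_all add: inner_axis)

lemma \<nu>13_unit: "p \<in> M \<Longrightarrow> \<nu> p $ 1 * \<nu> p $ 1 + \<nu> p $ 3 * \<nu> p $ 3 = 1"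
  using \<nu>_unit[of p] \<nu>2[of p] by (simp add: inner3)

lemma tangent_J:
  assumes p: "p \<in> M" and v: "\<nu> p \<bullet> v = 0"
  shows "v = v $ 2 *\<^sub>R axis 2 1 + (v \<bullet> J p) *\<^sub>R J p"
  using orthonormal_expand_R3[OF \<nu>_unit[OF p] e2(1) e2(2)[OF p] v] by (simp add: J_def inner_axis)

text \<open>The component of \<open>\<alpha> p u\<close> along the second axis is killed by \<mu>,
  whose second entry is 0; the component along \<open>J\<close> produces the multiple
  \<open>q p\<close> of that axis.\<close>

lemma cov_\<nu>_twist:
  assumes u: "u \<in> TM p"
  shows "cov \<nu> p u = dmap M \<nu> p u + (q p * (\<alpha> p u \<bullet> J p)) *\<^sub>R axis 2 1"
proof -
  have p: "p \<in> M" using u tangent_space_in by blast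
  define a b where "a = \<alpha> p u $ 2" and "b = \<alpha> p u \<bullet> J p"
  have "\<alpha> p u = a *\<^sub>R axis 2 1 + b *\<^sub>R J p" unfolding a_def b_def by (rule tangent_J[OF p \<nu>_orth[OF u]])
  then have c: "\<alpha> p u $ 1 = - b * \<nu> p $ 3" "\<alpha> p u $ 3 = b * \<nu> p $ 1" by (simp_all add: axis_def J_nth)
  have "dg \<mu> (\<alpha> p u) \<times> \<nu> p = (q p * b) *\<^sub>R axis 2 1"
    by (simp add: eq3_iff cross_components c \<mu>2 \<nu>2[OF p] axis_def q_def algebra_simps)
  then show ?thesis by (simp add: cov_def b_def)
qed

text \<open>\<nu> remains a unit vector orthogonal to the second axis, so it can turn only along
  \<open>J\<close>.\<close>

lemma d\<nu>_J:
  assumes u: "u \<in> TM p"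
  shows "dmap M \<nu> p u = (dmap M \<nu> p u \<bullet> J p) *\<^sub>R J p"
proof -
  have p: "p \<in> M" using u tangent_space_in by blast
  have o: "\<nu> p \<bullet> dmap M \<nu> p u = 0"
    using cov_\<nu>_orth[OF u] by (simp add: cov_def inner_add_right dot_cross_self)
  have "((\<lambda>z. \<nu> z $ 2) has_derivative (\<lambda>w. dmap M \<nu> p w $ 2)) (at p within M)"
    by (intro bounded_linear.has_derivative[OF bounded_linear_vec_nth] dmap_has_derivative \<nu>_smooth p)
  moreover have "((\<lambda>z. \<nu> z $ 2) has_derivative (\<lambda>w. 0)) (at p within M)"
    by (rule has_derivative_eq_on[OF has_derivative_const[of 0] p]) (simp add: \<nu>2)
  ultimately have "dmap M \<nu> p u $ 2 = 0" by (rule tangent_derivative_unique[OF u])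
  then show ?thesis using tangent_J[OF p o] by simp
qed

lemma JJ: "p \<in> M \<Longrightarrow> J p \<bullet> J p = 1"
  using \<nu>13_unit[of p] by (simp add: inner3 J_nth)

text \<open>In the basis \<open>axis 2 1\<close>, \<open>J p\<close> the map
  \<open>cov \<nu> p\<close> has first diagonal entry 0 and, by symmetry, both off-diagonal entries
  \<open>q p\<close>; the trace then makes the last entry \<open>- H\<close>. These entries give the
  coefficients of the angle form.\<close>

lemma d\<nu>:
  assumes u: "u \<in> TM p"
  shows "dmap M \<nu> p u = (q p * \<alpha> p u $ 2 - H * (\<alpha> p u \<bullet> J p)) *\<^sub>R J p"
proof -
  have p: "p \<in> M" using u tangent_space_in by blast
  obtain b1 b2 where b: "b1 \<in> TM p" "b2 \<in> TM p" "\<alpha> p b1 = axis 2 1" "\<alpha> p b2 = \<nu> p \<times> axis 2 1"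
    using adapted_vectors[OF p e2(1) e2(2)[OF p]] .
  have bJ: "\<alpha> p b2 = J p" by (simp add: b(4) J_def)
  have J2: "axis 2 1 \<bullet> J p = 0" "J p \<bullet> axis 2 1 = 0" by (simp_all add: inner_axis inner_axis' J_nth)
  define \<psi> where "\<psi> w = dmap M \<nu> p w \<bullet> J p" for w
  have dn: "dmap M \<nu> p w = \<psi> w *\<^sub>R J p" if "w \<in> TM p" for w unfolding \<psi>_def by (rule d\<nu>_J[OF that])
  have c1: "cov \<nu> p b1 = \<psi> b1 *\<^sub>R J p" and c2: "cov \<nu> p b2 = \<psi> b2 *\<^sub>R J p + q p *\<^sub>R axis 2 1"
    unfolding cov_\<nu>_twist[OF b(1)] cov_\<nu>_twist[OF b(2)] dn[OF b(1)] dn[OF b(2)] b(3) bJ by (simp_all add: J2 JJ[OF p])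
  have "\<psi> b1 = q p"
    using shape_symmetric[OF b(1,2)] unfolding c1 c2 b(3) bJ by (simp add: J2 JJ[OF p] e2 inner_add_left)
  moreover have "\<psi> b2 = - H"
    using mean_curvature_eq[OF p e2(1) e2(2)[OF p] b] cmc[OF p] unfolding c1 c2 b(3) bJ
    by (simp add: J2 JJ[OF p] inner_add_left)
  moreover have "\<psi> u = (\<alpha> p u $ 2) * \<psi> b1 + (\<alpha> p u \<bullet> J p) * \<psi> b2"
  proof -
    have "u = (\<alpha> p u \<bullet> \<alpha> p b1) *\<^sub>R b1 + (\<alpha> p u \<bullet> \<alpha> p b2) *\<^sub>R b2"
      by (rule tangent_expand[OF p e2(1) e2(2)[OF p] b u])
    then have "dmap M \<nu> p u = dmap M \<nu> p ((\<alpha> p u \<bullet> \<alpha> p b1) *\<^sub>R b1 + (\<alpha> p u \<bullet> \<alpha> p b2) *\<^sub>R b2)" by simp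
    also have "\<dots> = (\<alpha> p u \<bullet> \<alpha> p b1) *\<^sub>R dmap M \<nu> p b1 + (\<alpha> p u \<bullet> \<alpha> p b2) *\<^sub>R dmap M \<nu> p b2"
      by (rule linear_on_subD[OF dmap_linear_on[OF \<nu>_smooth[OF p] p] b(1,2)])
    finally show ?thesis unfolding \<psi>_def by (simp add: inner_add_left b(3) bJ inner_axis)
  qed
  ultimately have "\<psi> u = q p * \<alpha> p u $ 2 - H * (\<alpha> p u \<bullet> J p)" by simp
  then show ?thesis using dn[OF u] by simp
qed

text \<open>Closedness of the angle form of the normal forces the mean curvature to vanish.\<close>

lemma H_zero: "H = 0"
proof -
  obtain p where p: "p \<in> M" and n13: "\<nu> p $ 1 * \<nu> p $ 3 \<noteq> 0" using \<nu>13_exists by blast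
  obtain U X Y where F: "open U" "p \<in> U" "\<And>z. z \<in> M \<inter> U \<Longrightarrow> vec_field_at M z X" "\<And>z. z \<in> M \<inter> U \<Longrightarrow> vec_field_at M z Y"
    "\<And>z. z \<in> M \<inter> U \<Longrightarrow> lie_bracket M X Y z = 0" "\<alpha> p (X p) = axis 2 1" "\<alpha> p (Y p) = \<nu> p \<times> axis 2 1"
    by (rule adapted_fields[OF p e2(1) e2(2)[OF p]]) (rule that)
  have pU: "p \<in> M \<inter> U" using p F(2) by simp
  note Xp = F(3)[OF pU] and Yp = F(4)[OF pU]
  note t = vec_field_at_tangent[OF Xp p] vec_field_at_tangent[OF Yp p]
  have Y: "\<alpha> p (Y p) = J p" by (simp add: F(7) J_def)
  \<comment> \<open>Value of the angle form on the field \<open>Z\<close>: by \<open>d\<nu>\<close>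
    the derivative of \<nu> along \<open>Z\<close> is \<open>\<psi> Z z\<close> times
    \<open>J z\<close>.\<close>
  define \<psi> where "\<psi> Z z = q z * \<alpha> z (Z z) $ 2 - H * (\<alpha> z (Z z) \<bullet> J z)" for Z z
  define dq where "dq u = \<mu>$1 * (\<nu> p $ 3 * dmap M \<nu> p u $ 3 + dmap M \<nu> p u $ 3 * \<nu> p $ 3)
     + \<mu>$3 * (\<nu> p $ 1 * dmap M \<nu> p u $ 1 + dmap M \<nu> p u $ 1 * \<nu> p $ 1)" for u
  have hn: "((\<lambda>z. \<nu> z $ i) has_derivative (\<lambda>u. dmap M \<nu> p u $ i)) (at p within M)" for i
    by (intro bounded_linear.has_derivative[OF bounded_linear_vec_nth] dmap_has_derivative \<nu>_smooth p)
  have hq: "(q has_derivative dq) (at p within M)"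
    unfolding q_def[abs_def] dq_def[abs_def] by (intro has_derivative_add has_derivative_mult_right has_derivative_mult hn)
  have hJ: "(J has_derivative (\<lambda>u. dmap M \<nu> p u \<times> axis 2 1)) (at p within M)"
    unfolding J_def[abs_def]
    by (intro bounded_linear.has_derivative[OF bounded_bilinear.bounded_linear_left[OF bounded_bilinear_cross3]]
        dmap_has_derivative \<nu>_smooth p)
  define P where "P Z u = dmap M (\<lambda>z. \<alpha> z (Z z)) p u" for Z u
  have ha: "((\<lambda>z. \<alpha> z (Z z)) has_derivative P Z) (at p within M)" if "vec_field_at M p Z" for Z
    unfolding P_def by (intro dmap_has_derivative \<alpha>_field_smooth p that)
  define d\<psi> where "d\<psi> Z u = (q p * P Z u $ 2 + dq u * \<alpha> p (Z p) $ 2)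
       - H * (\<alpha> p (Z p) \<bullet> (dmap M \<nu> p u \<times> axis 2 1) + P Z u \<bullet> J p)" for Z u
  have h\<psi>: "(\<psi> Z has_derivative d\<psi> Z) (at p within M)" if "vec_field_at M p Z" for Z
    unfolding \<psi>_def[abs_def] d\<psi>_def[abs_def]
    by (intro has_derivative_diff has_derivative_mult has_derivative_mult_right has_derivative_inner hq hJ ha that
        bounded_linear.has_derivative[OF bounded_linear_vec_nth])
  \<comment> \<open>\<open>J\<close> turns towards the normal, so its derivative has no component
    along \<open>J\<close> and only \<psi> is differentiated.\<close>
  have dd: "dmap M (\<lambda>z. dmap M \<nu> z (Z z)) p u \<bullet> J p = d\<psi> Z u" if Z: "vec_field_at M p Z" and u: "u \<in> TM p" for Z u
  proof -
    have "((\<lambda>z. \<psi> Z z *\<^sub>R J z) has_derivative (\<lambda>u. \<psi> Z p *\<^sub>R (dmap M \<nu> p u \<times> axis 2 1) + d\<psi> Z u *\<^sub>R J p)) (at p within M)"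
      by (intro has_derivative_scaleR h\<psi> hJ Z)
    then have "((\<lambda>z. dmap M \<nu> z (Z z)) has_derivative (\<lambda>u. \<psi> Z p *\<^sub>R (dmap M \<nu> p u \<times> axis 2 1) + d\<psi> Z u *\<^sub>R J p)) (at p within M)"
    proof (rule has_derivative_eq_on[OF _ p])
      show "\<forall>\<^sub>F z in nhds p. z \<in> M \<longrightarrow> dmap M \<nu> z (Z z) = \<psi> Z z *\<^sub>R J z"
        using S.vec_field_tangent_near[OF Z] unfolding \<psi>_def by eventually_elim (auto intro: d\<nu>)
    qed
    from dmap_eq[OF u this] have "dmap M (\<lambda>z. dmap M \<nu> z (Z z)) p u = \<psi> Z p *\<^sub>R (dmap M \<nu> p u \<times> axis 2 1) + d\<psi> Z u *\<^sub>R J p" .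
    moreover have "(dmap M \<nu> p u \<times> axis 2 1) \<bullet> J p = 0"
      unfolding d\<nu>[OF u] using \<nu>2[OF p] by (simp add: inner3 cross_components J_nth axis_def)
    ultimately show ?thesis by (simp add: inner_add_left JJ[OF p])
  qed
  \<comment> \<open>Closedness of the angle form: along commuting fields the mixed second
    derivatives of \<nu> agree.\<close>
  have "dmap M (\<lambda>z. dmap M \<nu> z (Y z)) p (X p) = dmap M (\<lambda>z. dmap M \<nu> z (X z)) p (Y p)"
    using second_derivative_bracket[OF p \<nu>_smooth[OF p] Xp Yp M_bracket[OF p Xp Yp]] F(5)[OF pU]
      linear_0[OF has_derivative_linear[OF dmap_has_derivative[OF \<nu>_smooth[OF p] p]]] by simp
  then have eq: "d\<psi> Y (X p) = d\<psi> X (Y p)" using dd[OF Yp t(1)] dd[OF Xp t(2)] by simp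
  have PP: "P Y (X p) = P X (Y p) - dg c (\<nu> p)"
  proof -
    have "axis 2 1 \<times> J p = \<nu> p" using \<nu>2[OF p] by (simp add: eq3_iff cross_components J_nth axis_def)
    then show ?thesis
      using \<alpha>_structure[OF p Xp Yp] F(5)[OF pU] F(6) Y linear_on_sub_0[OF \<alpha>_linear[OF p] M_subspace[OF p]]
      unfolding P_def by (simp add: algebra_simps)
  qed
  have dY: "dmap M \<nu> p (Y p) = (- H) *\<^sub>R J p" unfolding d\<nu>[OF t(2)] Y by (simp add: J_nth JJ[OF p])
  have dX: "dmap M \<nu> p (X p) = q p *\<^sub>R J p" unfolding d\<nu>[OF t(1)] F(6) by (simp add: axis_def inner3 J_nth)
  have "d\<psi> Y (X p) = q p * P X (Y p) $ 2 - H * (P X (Y p) \<bullet> J p - dg c (\<nu> p) \<bullet> J p)"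
    unfolding d\<psi>_def PP Y dX using \<nu>2[OF p] by (simp add: J_nth inner_diff_left dot_cross_self cross_mult_left)
  moreover have "d\<psi> X (Y p) = q p * P X (Y p) $ 2 + dq (Y p) - H * (P X (Y p) \<bullet> J p)"
    unfolding d\<psi>_def F(6) dY by (simp add: axis_def inner3 cross_components)
  ultimately have "H * (dg c (\<nu> p) \<bullet> J p) = dq (Y p)" using eq by (simp add: algebra_simps)
  moreover have "dq (Y p) = 2 * H * (\<mu>$3 - \<mu>$1) * (\<nu> p $ 1 * \<nu> p $ 3)"
    unfolding dq_def dY by (simp add: J_nth algebra_simps)
  moreover have "dg c (\<nu> p) \<bullet> J p = - (c$1 - c$3) * (\<nu> p $ 1 * \<nu> p $ 3)"
    by (simp add: inner3 J_nth algebra_simps)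
  moreover have "\<mu>$3 - \<mu>$1 = c$1 - c$3" by (simp add: \<mu>_def field_simps)
  \<comment> \<open>The factor 3 collects one term from the structure equation \<open>PP\<close> and
    two from the derivative of the squares in \<open>q\<close>.\<close>
  ultimately have "3 * H * (c$1 - c$3) * (\<nu> p $ 1 * \<nu> p $ 3) = 0" by algebra
  moreover have "c$1 - c$3 \<noteq> 0" using order by simp
  ultimately show "H = 0" using n13 by simp
qed

text \<open>Horizontal lift of \<open>E y\<close>: the velocity \<open>w\<close> of the normal
  offsets the connection term, so the plane is parallel.\<close>

lemma horizontal_test:
  assumes p: "p \<in> M"
  obtains \<zeta> where "\<zeta> \<in> tangent_space GP (\<phi> p)" "\<Theta> (\<phi> p) \<zeta> = (y, 0)"
proof -
  have n1: "\<nu> p \<bullet> \<nu> p = 1" by (rule \<nu>_unit[OF p])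
  have q: "f p \<in> SL2R" by (rule f_in[OF p])
  define w where "w = - (dg \<mu> y \<times> \<nu> p)"
  have nw: "\<nu> p \<bullet> w = 0" by (simp add: w_def dot_cross_self)
  show ?thesis
  proof (rule that[of "(E y (f p), sym_pair (\<nu> p) w)"])
    show "(E y (f p), sym_pair (\<nu> p) w) \<in> tangent_space GP (\<phi> p)"
      unfolding gauss_map_eq[OF p] by (rule GP_tangentI[OF q n1 E_tangent[OF q] nw])
    show "\<Theta> (\<phi> p) (E y (f p), sym_pair (\<nu> p) w) = (y, 0)"
      unfolding gauss_map_eq[OF p] \<Theta>_eq[OF n1 nw] \<theta>_E[OF q] by (simp add: w_def)
  qed
qed

text \<open>With \<open>H = 0\<close> the shape operator exchanges the directions \<open>e 2\<close>
  and \<open>J\<close> up to a factor. Both O'Neill terms are then cross products of parallel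
  vectors, and the normal contributions of the two directions have zero sum.\<close>

lemma harmonic:
  assumes p: "p \<in> M"
  shows "tension_field M gM GP gG \<phi> p = 0"
proof -
  let ?\<tau> = "tension_field M gM GP gG \<phi> p"
  obtain U X Y where F: "open U" "p \<in> U" "\<And>z. z \<in> M \<inter> U \<Longrightarrow> vec_field_at M z X" "\<And>z. z \<in> M \<inter> U \<Longrightarrow> vec_field_at M z Y"
    "\<And>z. z \<in> M \<inter> U \<Longrightarrow> lie_bracket M X Y z = 0" "\<alpha> p (X p) = axis 2 1" "\<alpha> p (Y p) = \<nu> p \<times> axis 2 1"
    by (rule adapted_fields[OF p e2(1) e2(2)[OF p]]) (rule that)
  have pU: "p \<in> M \<inter> U" using p F(2) by simp
  note Xp = F(3)[OF pU] and Yp = F(4)[OF pU]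
  note t = vec_field_at_tangent[OF Xp p] vec_field_at_tangent[OF Yp p]
  have YJ: "\<alpha> p (Y p) = J p" by (simp add: F(7) J_def)
  have n1: "\<nu> p \<bullet> \<nu> p = 1" by (rule \<nu>_unit[OF p])
  have a2: "(axis 2 1 :: real^3) $ 2 = 1" by (simp add: axis_def)
  have cX: "cov \<nu> p (X p) = q p *\<^sub>R J p" and cY: "cov \<nu> p (Y p) = q p *\<^sub>R axis 2 1"
    unfolding cov_\<nu>_twist[OF t(1)] cov_\<nu>_twist[OF t(2)] d\<nu>[OF t(1)] d\<nu>[OF t(2)] F(6) YJ H_zero
    by (simp_all add: J_nth JJ[OF p] inner_axis' a2)
  \<comment> \<open>\<open>\<nu> p \<times> J p\<close> is minus the second axis, which every
    diagonal matrix maps to a multiple of itself.\<close>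
  have kX: "dg k (\<nu> p \<times> cov \<nu> p (X p)) \<times> \<alpha> p (X p) = 0"
    unfolding cX F(6) using \<nu>2[OF p] by (simp add: eq3_iff cross_components J_nth axis_def)
  \<comment> \<open>\<open>J p\<close> has components along the first and third axes only, so it is
    an eigenvector of \<open>dg k\<close> once these two eigenvalues agree.\<close>
  have "k$1 = k$3" using k_differences(3) \<mu>2 by simp
  then have kY: "dg k (\<nu> p \<times> cov \<nu> p (Y p)) \<times> \<alpha> p (Y p) = 0"
    unfolding cY YJ using \<nu>2[OF p] by (simp add: eq3_iff cross_components J_nth axis_def)
  \<comment> \<open>Gauss formula in frame coordinates, with the coefficient given by the Weingarten
    equation.\<close>
  have normal: "cov (\<lambda>z. \<alpha> z (Z z)) p u - \<alpha> p (levi_civita M gM p u Z) = (- (cov \<nu> p u \<bullet> \<alpha> p (Z p))) *\<^sub>R \<nu> p"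
    if Z: "vec_field_at M p Z" and u: "u \<in> TM p" for Z u
  proof -
    let ?a = "cov (\<lambda>z. \<alpha> z (Z z)) p u" and ?L = "levi_civita M gM p u Z"
    have LT: "?L \<in> TM p" by (rule S.levi_civita_tangent[OF u Z])
    let ?d = "?a - \<alpha> p ?L - (\<nu> p \<bullet> ?a) *\<^sub>R \<nu> p"
    have d: "\<nu> p \<bullet> ?d = 0" using n1 \<nu>_orth[OF LT] by (simp add: inner_diff_right)
    then obtain z where z: "z \<in> TM p" "\<alpha> p z = ?d" using \<alpha>_onto[OF p] by blast
    have "\<alpha> p ?L \<bullet> ?d = ?a \<bullet> ?d"
      using S.levi_civita_inner[OF u Z z(1)] by (simp add: cov_def \<Omega>_def z(2))
    moreover have "?d \<bullet> ?d = ?a \<bullet> ?d - \<alpha> p ?L \<bullet> ?d - (\<nu> p \<bullet> ?a) * (\<nu> p \<bullet> ?d)"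
      by (simp only: inner_diff_left inner_scaleR_left)
    ultimately have "?d \<bullet> ?d = 0" using d by simp
    then have "?d = 0" by (simp only: inner_eq_zero_iff)
    then show ?thesis using \<nu>_cov_field[OF u Z] by (simp add: eq_neg_iff_add_eq_0)
  qed
  have "- (cov \<nu> p (X p) \<bullet> \<alpha> p (X p)) - (cov \<nu> p (Y p) \<bullet> \<alpha> p (Y p)) = 0"
    unfolding cX cY F(6) YJ by (simp add: inner_axis inner_axis' J_nth)
  then have sum0: "(- (cov \<nu> p (X p) \<bullet> \<alpha> p (X p))) *\<^sub>R \<nu> p + (- (cov \<nu> p (Y p) \<bullet> \<alpha> p (Y p))) *\<^sub>R \<nu> p = 0"
    unfolding scaleR_left.add[symmetric] by simp
  note \<tau> = tension_split[OF p e2(1) e2(2)[OF p] t F(6,7)]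
  have "fst (\<Theta> (\<phi> p) ?\<tau>) \<bullet> y = 0" for y
  proof -
    obtain \<zeta> where \<zeta>: "\<zeta> \<in> tangent_space GP (\<phi> p)" "\<Theta> (\<phi> p) \<zeta> = (y, 0)" using horizontal_test[OF p] .
    have "fst (\<Theta> (\<phi> p) ?\<tau>) \<bullet> y = \<Theta> (\<phi> p) ?\<tau> \<bullet> \<Theta> (\<phi> p) \<zeta>" by (simp add: \<zeta>(2) inner_prod_def)
    also have "\<dots> = ((- (cov \<nu> p (X p) \<bullet> \<alpha> p (X p))) *\<^sub>R \<nu> p + (- (cov \<nu> p (Y p) \<bullet> \<alpha> p (Y p))) *\<^sub>R \<nu> p) \<bullet> y"
      unfolding \<tau>(1) linear_add[OF \<Theta>_linear] inner_add_left gauss_nabla[OF p Xp \<zeta>(1)] gauss_nabla[OF p Yp \<zeta>(1)]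
        normal[OF Xp t(1)] normal[OF Yp t(2)] kX kY
      by (simp add: \<zeta>(2) inner_prod_def)
    finally show ?thesis unfolding sum0 by simp
  qed
  then have "fst (\<Theta> (\<phi> p) ?\<tau>) = 0" by (metis inner_eq_zero_iff)
  then have "\<Theta> (\<phi> p) ?\<tau> = 0" using vertical_tension[OF p] by (simp add: prod_eq_iff)
  then show ?thesis using \<Theta>_inj[OF \<tau>(2)] by blast
qed

end

theorem theorem3:
  fixes l1 l2 l3 c1 c2 c3 \<kappa> :: real
    and e :: "3 \<Rightarrow> real^2^2 \<Rightarrow> real^2^2" and g :: "(real^2^2) metric"
  assumes "l1 > 0" and "l2 > 0" and "l3 > 0"
    and "c1 = 2 / l1\<^sup>2" and "c2 = 2 / l2\<^sup>2" and "c3 = - 2 / l3\<^sup>2"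
    and "e = sl2_frame l1 l2 l3" and "g = frame_metric e"
    and "\<kappa> > 0"
    and "locally_Euclidean_dim 3 (isometry_group_topology SL2R g)"
    and "c1 > c2" and "c2 > 0" and "0 > c3"
  shows "(\<forall>q\<in>SL2R. c2 = c1 + c3 \<longleftrightarrow>
            sectional_curvature SL2R g (e 1) (e 2) q = sectional_curvature SL2R g (e 2) (e 3) q) \<and>
         (\<forall>(M :: 'a::euclidean_space set) f N.
            immersed_surface M SL2R g f N \<and> cmc M SL2R g f N \<and>
            vertically_harmonic_map M (induced_metric M g f) (Gr2 SL2R) (Gr2_metric \<kappa> SL2R e) fst
              (gauss_map M SL2R e f)
            \<longrightarrow> c2 = c1 + c3 \<and>
                (\<forall>p\<in>M. e 2 (f p) \<in> dmap M f p ` tangent_space M p) \<and>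
                minimal M SL2R g f N \<and>
                harmonic_map M (induced_metric M g f) (Gr2 SL2R) (Gr2_metric \<kappa> SL2R e)
                  (gauss_map M SL2R e f))"
proof -
  interpret L: sl2_gr l1 l2 l3 \<kappa> by unfold_locales (use assms in auto)
  have e: "e = L.e" and g: "g = L.g" by (simp_all add: assms(7,8) L.e_def L.g_def)
  have c: "L.c $ 1 = c1" "L.c $ 2 = c2" "L.c $ 3 = c3" by (simp_all add: L.c_def assms(4-6))
  show ?thesis
  proof (intro conjI ballI allI impI; (elim conjE)?)
    fix q :: "real^2^2" assume q: "q \<in> SL2R"
    \<comment> \<open>The factorisation of K12 - K23 through \<mu>, expressed by the structure
      constants; the first factor is twice the second entry of \<mu>.\<close>
    have "L.k $ 3 - L.k $ 1 = (c1 + c3 - c2) * (c1 - c3)"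
      by (simp add: L.k_def L.\<mu>_def c field_simps)
    moreover have "c1 - c3 \<noteq> 0" using assms(11-13) by simp
    ultimately show "(c2 = c1 + c3) = (sectional_curvature SL2R g (e 1) (e 2) q = sectional_curvature SL2R g (e 2) (e 3) q)"
      unfolding e g L.sectional_curvature_frame[OF q] by auto
  next
    fix M :: "'a set" and f N
    assume i: "immersed_surface M SL2R g f N" and cm: "cmc M SL2R g f N" and
      v: "vertically_harmonic_map M (induced_metric M g f) (Gr2 SL2R) (Gr2_metric \<kappa> SL2R e) fst (gauss_map M SL2R e f)"
    interpret S: surface l1 l2 l3 \<kappa> M f N by unfold_locales (use i g in simp)
    obtain H where H: "\<And>p. p \<in> M \<Longrightarrow> mean_curvature M SL2R g f N p = H" using cm unfolding cmc_def by blast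
    interpret V: vh_cmc_surface l1 l2 l3 \<kappa> M f N H
      by unfold_locales (use assms(11-13) c H v in \<open>simp_all add: e g S.gM_def L.gG_def\<close>)
    show "c2 = c1 + c3" using V.c_relation by (simp add: c)
    show "e 2 (f p) \<in> dmap M f p ` tangent_space M p" if "p \<in> M" for p using V.e2_tangent[OF that] by (simp add: e)
    show "minimal M SL2R g f N" using H V.H_zero by (simp add: minimal_def)
    show "harmonic_map M (induced_metric M g f) (Gr2 SL2R) (Gr2_metric \<kappa> SL2R e) (gauss_map M SL2R e f)"
      using V.harmonic by (simp add: harmonic_map_def e g S.gM_def L.gG_def)
  qed
qed

end
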